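(* Let $k$ be a field with separable closure $\overline{k}$, and let $C:\ F_{\overline{C}}(X,Y,Z)=0$, $F_{\overline{C}}\in k[X,Y,Z]$, be a smooth plane curve over $k$. Assume that $\mathrm{Aut}(F_{\overline{C}})\subseteq\mathrm{PGL}_3(\overline{k})$ is a non-trivial cyclic group of order $n$, with $n$ coprime to the characteristic of $k$, generated by $\alpha=\mathrm{diag}(1,\zeta_n^a,\zeta_n^b)$ for some $a,b\in\mathbb{N}$. Then every twist of $C$ over $k$ is $k$-isomorphic to a curve $F_{D^{-1}\overline{C}}(X,Y,Z):=F_{\overline{C}}(D(X,Y,Z))=0$ with $F_{D^{-1}\overline{C}}\in k[X,Y,Z]$ and $D\in\mathrm{PGL}_3(\overline{k})$ diagonal. In particular, the map $\Sigma:\mathrm{H}^1(k,\mathrm{Aut}(F_{\overline{C}}))\to\mathrm{H}^1(k,\mathrm{PGL}_3(\overline{k}))$ induced by the inclusion $\mathrm{Aut}(F_{\overline{C}})\subseteq\mathrm{PGL}_3(\overline{k})$ is trivial.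
   Context: A smooth plane curve over $k$ is a projective, non-singular, geometrically irreducible curve of genus $\ge2$ given by a non-singular plane equation of degree $\ge4$ with coefficients in $k$. $\zeta_n$ is a primitive $n$-th root of unity in $\overline{k}$. A twist of $C$ over $k$ is a smooth curve $C'$ over $k$ with a $\overline{k}$-isomorphism to $C$; twists up to $k$-isomorphism correspond to $\mathrm{H}^1(k,\mathrm{Aut}(F_{\overline{C}}))$. "$\Sigma$ is trivial" means that it maps every class to the trivial class. *)

theory Defs
  imports
    "HOL-Analysis.Analysis"
    "HOL-Algebra.Bij"
    "HOL-Algebra.Coset"
    "HOL-Algebra.Generated_Groups"
    "HOL-Algebra.Algebraic_Closure_Type"
    "HOL-Library.Poly_Mapping"
begin

section \<open>Polynomials in finitely many variables\<close>

text \<open>Variables are indexed by a finite type; a polynomial is a finitely supported map from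
  exponent vectors to coefficients, with the ring structure of \<^theory>\<open>HOL-Library.Poly_Mapping\<close>.\<close>

type_synonym ('i, 'a) mpoly = "('i \<Rightarrow>\<^sub>0 nat) \<Rightarrow>\<^sub>0 'a"

definition Const :: "'a::comm_ring_1 \<Rightarrow> ('i, 'a) mpoly" where
  "Const c = Poly_Mapping.single 0 c"

definition Var :: "'i \<Rightarrow> ('i, 'a::comm_ring_1) mpoly" where
  "Var i = Poly_Mapping.single (Poly_Mapping.single i 1) 1"

definition coeffs_in :: "'a::zero set \<Rightarrow> ('i, 'a) mpoly \<Rightarrow> bool" where
  "coeffs_in L p \<longleftrightarrow> (\<forall>m. Poly_Mapping.lookup p m \<in> L)"

definition homogeneous :: "nat \<Rightarrow> ('i::finite, 'a::zero) mpoly \<Rightarrow> bool" where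
  "homogeneous d p \<longleftrightarrow> (\<forall>m\<in>Poly_Mapping.keys p. (\<Sum>i\<in>UNIV. Poly_Mapping.lookup m i) = d)"

definition mp_eval_hom :: "('a::zero \<Rightarrow> 'b::comm_ring_1) \<Rightarrow> ('i::finite \<Rightarrow> 'b) \<Rightarrow> ('i, 'a) mpoly \<Rightarrow> 'b" where
  "mp_eval_hom h x p =
     (\<Sum>m\<in>Poly_Mapping.keys p. h (Poly_Mapping.lookup p m) * (\<Prod>i\<in>UNIV. x i ^ Poly_Mapping.lookup m i))"

definition mp_eval :: "('i::finite, 'a::comm_ring_1) mpoly \<Rightarrow> 'a ^ 'i \<Rightarrow> 'a" where
  "mp_eval p x = mp_eval_hom (\<lambda>c. c) (\<lambda>i. x $ i) p"

text \<open>\<open>lin_subst F A\<close> is the polynomial \<open>F(A(X\<^sub>1, \<dots>, X\<^sub>n))\<close>, with \<open>A\<close> acting on column vectors.\<close>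

definition lin_subst :: "('i::finite, 'a::comm_ring_1) mpoly \<Rightarrow> 'a ^ 'i ^ 'i \<Rightarrow> ('i, 'a) mpoly" where
  "lin_subst F A = mp_eval_hom Const (\<lambda>i. \<Sum>j\<in>UNIV. Const (A $ i $ j) * Var j) F"

definition mp_deriv :: "'i \<Rightarrow> ('i, 'a::comm_ring_1) mpoly \<Rightarrow> ('i, 'a) mpoly" where
  "mp_deriv i p = (\<Sum>m\<in>Poly_Mapping.keys p.
     Poly_Mapping.single (m - Poly_Mapping.single i 1)
       (of_nat (Poly_Mapping.lookup m i) * Poly_Mapping.lookup p m))"

definition gradient :: "('i::finite, 'a::comm_ring_1) mpoly \<Rightarrow> 'a ^ 'i \<Rightarrow> 'a ^ 'i" where
  "gradient p x = (\<chi> i. mp_eval (mp_deriv i p) x)"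


section \<open>Projective varieties and their morphisms\<close>

text \<open>Throughout, \<open>'K\<close> is an algebraically closed field. A point of projective space is the set
  of nonzero multiples of a nonzero vector; the dimension of the space is
  \<open>CARD('m) - 1\<close>.\<close>

definition pt :: "'K::field ^ 'm \<Rightarrow> ('K ^ 'm) set" where
  "pt x = {c *s x | c. c \<noteq> 0}"

definition proj_zeros :: "('m::finite, 'K::field) mpoly set \<Rightarrow> ('K ^ 'm) set set" where
  "proj_zeros S = {pt x | x. x \<noteq> 0 \<and> (\<forall>f\<in>S. mp_eval f x = 0)}"

definition zariski_closed :: "('K::field ^ 'm::finite) set set \<Rightarrow> bool" where
  "zariski_closed Z \<longleftrightarrow> (\<exists>S. (\<forall>f\<in>S. \<exists>d. homogeneous d f) \<and> Z = proj_zeros S)"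

definition irreducible_closed :: "('K::field ^ 'm::finite) set set \<Rightarrow> bool" where
  "irreducible_closed Z \<longleftrightarrow> zariski_closed Z \<and> Z \<noteq> {} \<and>
     (\<forall>A B. zariski_closed A \<longrightarrow> zariski_closed B \<longrightarrow> Z \<subseteq> A \<union> B \<longrightarrow> Z \<subseteq> A \<or> Z \<subseteq> B)"

definition krull_dim :: "('K::field ^ 'm::finite) set set \<Rightarrow> enat" where
  "krull_dim V = (SUP n\<in>{n. \<exists>Z :: nat \<Rightarrow> ('K ^ 'm) set set.
       (\<forall>i\<le>n. irreducible_closed (Z i) \<and> Z i \<subseteq> V) \<and> (\<forall>i<n. Z i \<subset> Z (Suc i))}. enat n)"

text \<open>\<open>smooth_curve k S\<close>: the homogeneous equations \<open>S\<close> over the subfield \<open>k\<close> define a smooth,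
  geometrically irreducible projective curve over \<open>k\<close>. Irreducibility and dimension are those of
  the set of \<open>'K\<close>-points; smoothness is the Jacobian criterion at every \<open>'K\<close>-point, the rank
  being the codimension \<open>(CARD('m) - 1) - 1\<close>. As the criterion is applied to \<open>S\<close> itself, the scheme
  defined by \<open>S\<close> is smooth, hence geometrically reduced, and morphisms may be described
  by their action on \<open>'K\<close>-points.\<close>

definition smooth_curve :: "'K::alg_closed_field set \<Rightarrow> ('m::finite, 'K) mpoly set \<Rightarrow> bool" where
  "smooth_curve k S \<longleftrightarrow>
     (\<forall>f\<in>S. coeffs_in k f \<and> (\<exists>d. homogeneous d f)) \<and>
     irreducible_closed (proj_zeros S) \<and>
     krull_dim (proj_zeros S) = 1 \<and>
     (\<forall>x. x \<noteq> 0 \<and> pt x \<in> proj_zeros S \<longrightarrow> vec.dim {gradient f x | f. f \<in> S} + 2 = CARD('m))"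

text \<open>A smooth plane curve. Genus at least 2 is no separate condition: the genus is
  \<open>(d - 1) (d - 2) / 2 \<ge> 3\<close>.\<close>

definition smooth_plane_curve :: "'K::alg_closed_field set \<Rightarrow> (3, 'K) mpoly \<Rightarrow> bool" where
  "smooth_plane_curve k F \<longleftrightarrow> (\<exists>d\<ge>4. homogeneous d F) \<and> smooth_curve k {F}"

text \<open>Morphisms over the subfield \<open>L\<close>: maps that are, near every point, given by
  homogeneous polynomials of equal degree with coefficients in \<open>L\<close>.\<close>

definition proj_morphism ::
  "'K::alg_closed_field set \<Rightarrow> ('K ^ 'm::finite) set set \<Rightarrow> ('K ^ 'n::finite) set set \<Rightarrow>
     (('K ^ 'm) set \<Rightarrow> ('K ^ 'n) set) \<Rightarrow> bool" where
  "proj_morphism L V W \<phi> \<longleftrightarrow> \<phi> \<in> V \<rightarrow> W \<and>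
     (\<forall>x. x \<noteq> 0 \<and> pt x \<in> V \<longrightarrow>
       (\<exists>(g :: 'n \<Rightarrow> ('m, 'K) mpoly) e.
          (\<forall>j. homogeneous e (g j) \<and> coeffs_in L (g j)) \<and>
          (\<chi> j. mp_eval (g j) x) \<noteq> 0 \<and>
          (\<forall>y. y \<noteq> 0 \<and> pt y \<in> V \<and> (\<chi> j. mp_eval (g j) y) \<noteq> 0 \<longrightarrow>
             \<phi> (pt y) = pt (\<chi> j. mp_eval (g j) y))))"

definition isomorphic_over ::
  "'K::alg_closed_field set \<Rightarrow> ('m::finite, 'K) mpoly set \<Rightarrow> ('n::finite, 'K) mpoly set \<Rightarrow> bool" where
  "isomorphic_over L S T \<longleftrightarrow>
     (\<exists>\<phi>. bij_betw \<phi> (proj_zeros S) (proj_zeros T) \<and>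
          proj_morphism L (proj_zeros S) (proj_zeros T) \<phi> \<and>
          proj_morphism L (proj_zeros T) (proj_zeros S) (inv_into (proj_zeros S) \<phi>))"

text \<open>Twists need not be plane curves: \<open>S\<close> lives in a projective space of any dimension.
  The parameter \<open>ks\<close> is the separable closure of \<open>k\<close>.\<close>

definition is_twist ::
  "'K::alg_closed_field set \<Rightarrow> 'K set \<Rightarrow> ('m::finite, 'K) mpoly set \<Rightarrow> ('n::finite, 'K) mpoly set \<Rightarrow> bool" where
  "is_twist k ks S T \<longleftrightarrow> smooth_curve k S \<and> isomorphic_over ks S T"


section \<open>Projective linear group and automorphisms of a plane curve\<close>

definition GL3 :: "'K::field set \<Rightarrow> ('K ^ 3 ^ 3) monoid" where
  "GL3 L = \<lparr>carrier = {A. (\<forall>i j. A $ i $ j \<in> L) \<and> det A \<noteq> 0}, mult = (**), one = mat 1\<rparr>"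

definition scalars3 :: "'K::field set \<Rightarrow> ('K ^ 3 ^ 3) set" where
  "scalars3 L = {mat c | c. c \<in> L \<and> c \<noteq> 0}"

definition PGL3 :: "'K::field set \<Rightarrow> ('K ^ 3 ^ 3) set monoid" where
  "PGL3 L = GL3 L Mod scalars3 L"

definition pgl_class :: "'K::field set \<Rightarrow> 'K ^ 3 ^ 3 \<Rightarrow> ('K ^ 3 ^ 3) set" where
  "pgl_class L A = scalars3 L #>\<^bsub>GL3 L\<^esub> A"

definition diag :: "'K::zero ^ 'n \<Rightarrow> 'K ^ 'n ^ 'n" where
  "diag v = (\<chi> i j. if i = j then v $ i else 0)"

definition is_diagonal :: "'K::zero ^ 'n ^ 'n \<Rightarrow> bool" where
  "is_diagonal A \<longleftrightarrow> (\<forall>i j. i \<noteq> j \<longrightarrow> A $ i $ j = 0)"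

definition plane_aut :: "'K::field set \<Rightarrow> (3, 'K) mpoly \<Rightarrow> ('K ^ 3 ^ 3) set monoid" where
  "plane_aut L F = (PGL3 L)\<lparr>carrier :=
     {g \<in> carrier (PGL3 L). \<exists>A\<in>g. \<exists>c. c \<noteq> 0 \<and> lin_subst F A = Const c * F}\<rparr>"


section \<open>The separable closure and its Galois group\<close>

definition base_field :: "'k::field alg_closure set" where
  "base_field = range to_ac"

definition sep_closure :: "'k::field alg_closure set" where
  "sep_closure = {x. \<exists>p :: 'k poly. coprime p (pderiv p) \<and> poly (map_poly to_ac p) x = 0}"

definition galois_group :: "'K::field set \<Rightarrow> 'K set \<Rightarrow> ('K \<Rightarrow> 'K) monoid" where
  "galois_group k L = (BijGroup L)\<lparr>carrier :=
     {\<sigma> \<in> Bij L. (\<forall>x\<in>L. \<forall>y\<in>L. \<sigma> (x + y) = \<sigma> x + \<sigma> y \<and> \<sigma> (x * y) = \<sigma> x * \<sigma> y) \<and>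
                  (\<forall>x\<in>k. \<sigma> x = x)}\<rparr>"

text \<open>The Krull topology is the topology of pointwise convergence, \<open>L\<close> being discrete.\<close>

definition krull_topology :: "'K::field set \<Rightarrow> 'K set \<Rightarrow> ('K \<Rightarrow> 'K) topology" where
  "krull_topology k L =
     subtopology (product_topology (\<lambda>_. discrete_topology L) L) (carrier (galois_group k L))"

text \<open>Entrywise action on classes of matrices.\<close>

definition pgl_act :: "('K \<Rightarrow> 'K) \<Rightarrow> ('K ^ 3 ^ 3) set \<Rightarrow> ('K ^ 3 ^ 3) set" where
  "pgl_act \<sigma> g = (\<lambda>A. \<chi> i j. \<sigma> (A $ i $ j)) ` g"


section \<open>Nonabelian cohomology in degree 1\<close>

text \<open>\<open>G\<close> is a group with topology \<open>T\<close>, acting through \<open>act\<close> on the discrete group \<open>A\<close>.\<close>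

definition cocycles ::
  "'g monoid \<Rightarrow> 'g topology \<Rightarrow> ('g \<Rightarrow> 'a \<Rightarrow> 'a) \<Rightarrow> 'a monoid \<Rightarrow> ('g \<Rightarrow> 'a) set" where
  "cocycles G T act A = {\<xi> \<in> carrier G \<rightarrow>\<^sub>E carrier A.
     continuous_map T (discrete_topology (carrier A)) \<xi> \<and>
     (\<forall>\<sigma>\<in>carrier G. \<forall>\<tau>\<in>carrier G. \<xi> (\<sigma> \<otimes>\<^bsub>G\<^esub> \<tau>) = \<xi> \<sigma> \<otimes>\<^bsub>A\<^esub> act \<sigma> (\<xi> \<tau>))}"

definition cohomologous ::
  "'g monoid \<Rightarrow> 'g topology \<Rightarrow> ('g \<Rightarrow> 'a \<Rightarrow> 'a) \<Rightarrow> 'a monoid \<Rightarrow> (('g \<Rightarrow> 'a) \<times> ('g \<Rightarrow> 'a)) set" where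
  "cohomologous G T act A = {(\<xi>, \<eta>). \<xi> \<in> cocycles G T act A \<and> \<eta> \<in> cocycles G T act A \<and>
     (\<exists>a\<in>carrier A. \<forall>\<sigma>\<in>carrier G. \<eta> \<sigma> = inv\<^bsub>A\<^esub> a \<otimes>\<^bsub>A\<^esub> \<xi> \<sigma> \<otimes>\<^bsub>A\<^esub> act \<sigma> a)}"

definition H1 ::
  "'g monoid \<Rightarrow> 'g topology \<Rightarrow> ('g \<Rightarrow> 'a \<Rightarrow> 'a) \<Rightarrow> 'a monoid \<Rightarrow> ('g \<Rightarrow> 'a) set set" where
  "H1 G T act A = cocycles G T act A // cohomologous G T act A"

definition H1_trivial ::
  "'g monoid \<Rightarrow> 'g topology \<Rightarrow> ('g \<Rightarrow> 'a \<Rightarrow> 'a) \<Rightarrow> 'a monoid \<Rightarrow> ('g \<Rightarrow> 'a) set" where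
  "H1_trivial G T act A = cohomologous G T act A `` {\<lambda>\<sigma>\<in>carrier G. \<one>\<^bsub>A\<^esub>}"

text \<open>The map into \<open>H1 G T act B\<close> induced by the inclusion of a \<open>G\<close>-stable subgroup: a class
  is sent to the class in \<open>B\<close> of any of its cocycles.\<close>

definition H1_incl ::
  "'g monoid \<Rightarrow> 'g topology \<Rightarrow> ('g \<Rightarrow> 'a \<Rightarrow> 'a) \<Rightarrow> 'a monoid \<Rightarrow> ('g \<Rightarrow> 'a) set \<Rightarrow> ('g \<Rightarrow> 'a) set" where
  "H1_incl G T act B c = cohomologous G T act B `` c"

abbreviation gal_sep :: "('k::field alg_closure \<Rightarrow> 'k alg_closure) monoid" where
  "gal_sep \<equiv> galois_group base_field sep_closure"

abbreviation gal_sep_top :: "('k::field alg_closure \<Rightarrow> 'k alg_closure) topology" where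
  "gal_sep_top \<equiv> krull_topology base_field sep_closure"

text \<open>The map \<open>\<Sigma>\<close> from the cohomology of the automorphism group of a plane curve
  to that of \<open>PGL\<^sub>3\<close>.\<close>

definition Sigma_map ::
  "(('k::field alg_closure \<Rightarrow> 'k alg_closure) \<Rightarrow> ('k alg_closure ^ 3 ^ 3) set) set \<Rightarrow>
   (('k alg_closure \<Rightarrow> 'k alg_closure) \<Rightarrow> ('k alg_closure ^ 3 ^ 3) set) set" where
  "Sigma_map = H1_incl gal_sep gal_sep_top pgl_act (PGL3 sep_closure)"

end

theory Submission
  imports Defs
begin

hide_const (open) UnivPoly.up_ring.monom UnivPoly.up_ring.coeff Polynomials.degree Module.module.smult Coset.order
  Polynomials.lead_coeff
unbundle no fps_syntax

text \<open>Let \<open>\<phi>\<close> be an isomorphism over the separable closure from a twist to the plane curve. Comparing \<open>\<phi>\<close> with its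
  conjugates gives automorphisms \<open>\<phi> \<circ> \<sigma>(\<phi>)\<^sup>-\<^sup>1\<close> of the plane curve. They are linear: by a residue-free form of
  Noether's reduction argument the preimage of a line section is a line section, and smooth plane curves are
  projectively normal. By hypothesis they are then \<open>diag(1, u\<^sub>\<sigma>, v\<^sub>\<sigma>)\<close> with roots of unity \<open>u\<close>, \<open>v\<close>. These are
  cocycles with values in the multiplicative group, hence \<open>u\<^sub>\<sigma> = \<sigma>(b\<^sub>1) / b\<^sub>1\<close> and \<open>v\<^sub>\<sigma> = \<sigma>(b\<^sub>2) / b\<^sub>2\<close> by
  Hilbert 90, and composing \<open>\<phi>\<close> with \<open>diag(1, b\<^sub>1, b\<^sub>2)\<close> makes it Galois equivariant, so that it descends to \<open>k\<close>.
  The polynomial \<open>F(X, Y / b\<^sub>1, Z / b\<^sub>2)\<close> has rational coefficients up to a common factor; as \<open>n\<close> is prime to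
  the characteristic, this factor can be absorbed into a scalar multiple of the diagonal matrix.
  The same coboundary trivialises the class in the cohomology of \<open>PGL\<^sub>3\<close>.\<close>


section \<open>Polynomial functions\<close>

text \<open>Everything is done with points and polynomials, without divisors, differentials or a
  canonical series whose lines an automorphism would have to permute. What replaces them is the
  projection of the curve from a point \<open>P\<close> off it. F is then monic in one coordinate,
  the coordinate ring is free of rank d over the binary forms in the other two, and finiteness of
  zeros, generation of the ideal by F and projective normality become statements on univariate
  polynomials. Degree at least 4 enters where a form of degree d - 3 has to contain a line; smooth
  cubics do have automorphisms that are not linear. Two features of positive characteristic shape
  the rest. Centres of projection must avoid strange points, through which every tangent passes.
  Automorphisms of the algebraic closure fix the perfect closure of k, so each descent is carried
  out on separable elements. Diagonality matters because diag(1, u, v) is the only matrix in its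
  class with first entry 1 on the diagonal that is diagonal: the cocycle in PGL_3 lifts to a torus,
  where Hilbert 90 applies.\<close>

lemma infinite_alg_closed: "infinite (UNIV :: 'a::alg_closed_field set)"
proof
  assume fin: "finite (UNIV :: 'a set)"
  define p :: "'a poly" where "p = (\<Prod>a\<in>UNIV. [:-a, 1:]) + 1"
  have deg: "degree (\<Prod>a\<in>(UNIV::'a set). [:-a, 1:]) = card (UNIV :: 'a set)"
    by (subst degree_prod_sum_eq) auto
  have "degree p = card (UNIV :: 'a set)"
    unfolding p_def using deg fin by (subst degree_add_eq_left) (auto simp: card_gt_0_iff)
  hence "degree p > 0" using fin by (simp add: card_gt_0_iff)
  then obtain x where "poly p x = 0" using alg_closed_imp_poly_has_root by blast
  moreover have "poly (\<Prod>a\<in>UNIV. [:-a, 1:]) x = 0"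
    using fin by (simp add: poly_prod prod_zero_iff)
  ultimately show False by (simp add: p_def)
qed

lemma poly_zero_fun: "(\<And>t. poly q t = 0) \<Longrightarrow> q = (0 :: 'a::alg_closed_field poly)"
  using poly_roots_finite[of q] infinite_alg_closed by auto

definition is_subring :: "'a::comm_ring_1 set \<Rightarrow> bool" where
  "is_subring L \<longleftrightarrow> 0 \<in> L \<and> 1 \<in> L \<and> (\<forall>x\<in>L. \<forall>y\<in>L. x + y \<in> L \<and> x * y \<in> L) \<and> (\<forall>x\<in>L. - x \<in> L)"

lemma is_subringD:
  assumes "is_subring L"
  shows "0 \<in> L" "1 \<in> L" "x \<in> L \<Longrightarrow> y \<in> L \<Longrightarrow> x + y \<in> L" "x \<in> L \<Longrightarrow> y \<in> L \<Longrightarrow> x * y \<in> L"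
    "x \<in> L \<Longrightarrow> - x \<in> L" "x \<in> L \<Longrightarrow> y \<in> L \<Longrightarrow> x - y \<in> L"
  using assms unfolding is_subring_def diff_conv_add_uminus by blast+

lemma is_subring_sum: "is_subring L \<Longrightarrow> (\<And>i. i \<in> I \<Longrightarrow> f i \<in> L) \<Longrightarrow> sum f I \<in> L"
  by (induction I rule: infinite_finite_induct) (auto intro: is_subringD)

lemma is_subring_power: "is_subring L \<Longrightarrow> x \<in> L \<Longrightarrow> x ^ n \<in> L"
  by (induction n) (auto intro: is_subringD)

lemma is_subring_UNIV [simp]: "is_subring UNIV"
  by (simp add: is_subring_def)

section \<open>Evaluation of polynomials at vectors\<close>

definition monom_at :: "('i::finite \<Rightarrow>\<^sub>0 nat) \<Rightarrow> 'a::comm_ring_1 ^ 'i \<Rightarrow> 'a" where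
  "monom_at m x = (\<Prod>i\<in>UNIV. x $ i ^ Poly_Mapping.lookup m i)"

lemma monom_at_add: "monom_at (m + m') x = monom_at m x * monom_at m' x"
  by (simp add: monom_at_def lookup_add power_add prod.distrib)

text \<open>A common finite index set lets polynomials with different supports be compared term by
  term.\<close>

lemma mp_eval_superset:
  assumes "finite A" "Poly_Mapping.keys p \<subseteq> A"
  shows "mp_eval p x = (\<Sum>m\<in>A. Poly_Mapping.lookup p m * monom_at m x)"
  unfolding mp_eval_def mp_eval_hom_def monom_at_def
  by (rule sum.mono_neutral_left) (use assms in \<open>auto simp: in_keys_iff\<close>)

lemma mp_eval_eq: "mp_eval p x = (\<Sum>m\<in>Poly_Mapping.keys p. Poly_Mapping.lookup p m * monom_at m x)"
  by (rule mp_eval_superset) auto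

lemma mp_eval_0 [simp]: "mp_eval 0 x = 0"
  by (simp add: mp_eval_eq)

lemma mp_eval_single [simp]: "mp_eval (Poly_Mapping.single m c) x = c * monom_at m x"
  by (subst mp_eval_superset[of "{m}"]) auto

lemma mp_eval_add [simp]: "mp_eval (p + q) x = mp_eval p x + mp_eval q x"
proof -
  let ?A = "Poly_Mapping.keys p \<union> Poly_Mapping.keys q"
  have "Poly_Mapping.keys (p + q) \<subseteq> ?A" by (rule Poly_Mapping.keys_add)
  then show ?thesis
    by (simp add: mp_eval_superset[of ?A] lookup_add distrib_right sum.distrib)
qed

lemma mp_eval_sum [simp]: "mp_eval (sum f I) x = (\<Sum>i\<in>I. mp_eval (f i) x)"
  by (induction I rule: infinite_finite_induct) auto

lemma poly_mapping_expand: "p = (\<Sum>m\<in>Poly_Mapping.keys p. Poly_Mapping.single m (Poly_Mapping.lookup p m))"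
proof (rule poly_mapping_eqI)
  fix k
  show "Poly_Mapping.lookup p k =
    Poly_Mapping.lookup (\<Sum>m\<in>Poly_Mapping.keys p. Poly_Mapping.single m (Poly_Mapping.lookup p m)) k"
    by (cases "k \<in> Poly_Mapping.keys p")
      (auto simp: lookup_sum lookup_single when_def in_keys_iff)
qed

lemma mp_eval_mult [simp]: "mp_eval (p * q) x = mp_eval p x * mp_eval q x"
proof -
  let ?s = "\<lambda>p m. Poly_Mapping.single m (Poly_Mapping.lookup p m)"
  have "p * q = (\<Sum>m\<in>Poly_Mapping.keys p. \<Sum>m'\<in>Poly_Mapping.keys q. ?s p m * ?s q m')"
    by (subst poly_mapping_expand[of p], subst poly_mapping_expand[of q]) (simp add: sum_product)
  then show ?thesis
    by (simp add: mult_single monom_at_add mp_eval_eq[of p] mp_eval_eq[of q] sum_product algebra_simps)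
qed

lemma mp_eval_Const [simp]: "mp_eval (Const c) x = c"
  by (simp add: Const_def monom_at_def)

lemma monom_at_single: "monom_at (Poly_Mapping.single i n) x = x $ i ^ n"
proof -
  have "monom_at (Poly_Mapping.single i n) x = (\<Prod>j\<in>UNIV. if j = i then x $ i ^ n else 1)"
    unfolding monom_at_def by (rule prod.cong) (auto simp: lookup_single when_def)
  then show ?thesis by simp
qed

lemma mp_eval_Var [simp]: "mp_eval (Var i) x = x $ i"
  by (simp add: Var_def monom_at_single)

lemma mp_eval_1 [simp]: "mp_eval 1 x = 1"
  using mp_eval_Const[of 1 x] by (simp add: Const_def)

lemma mp_eval_uminus [simp]: "mp_eval (- p) x = - mp_eval p x"
proof -
  have "mp_eval (- p) x + mp_eval p x = mp_eval (- p + p) x" by (rule mp_eval_add[symmetric])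
  then show ?thesis by (simp add: eq_neg_iff_add_eq_0)
qed

lemma mp_eval_diff [simp]: "mp_eval (p - q) x = mp_eval p x - mp_eval q x"
  using mp_eval_add[of p "- q" x] by simp

lemma mp_eval_power [simp]: "mp_eval (p ^ n) x = mp_eval p x ^ n"
  by (induction n) auto

lemma mp_eval_prod [simp]: "mp_eval (prod f I) x = (\<Prod>i\<in>I. mp_eval (f i) x)"
  by (induction I rule: infinite_finite_induct) auto

lemma mp_eval_lin_subst: "mp_eval (lin_subst F A) x = mp_eval F (A *v x)"
  by (simp add: lin_subst_def mp_eval_hom_def mp_eval_eq[of F] monom_at_def matrix_vector_mult_def)

text \<open>Induction over the variables that still separate the monomials in \<open>M\<close>. With
  the others fixed, the sum is a polynomial in variable \<open>j\<close> over an infinite field, so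
  each of its coefficients vanishes; the monomials contributing to one coefficient agree at
  \<open>j\<close> and are therefore separated by the remaining variables.\<close>

lemma monomials_independent:
  fixes c :: "('i::finite \<Rightarrow>\<^sub>0 nat) \<Rightarrow> 'a::alg_closed_field"
  assumes "finite I" "finite M"
    and "\<And>m m'. m \<in> M \<Longrightarrow> m' \<in> M \<Longrightarrow> (\<And>i. i \<in> I \<Longrightarrow> Poly_Mapping.lookup m i = Poly_Mapping.lookup m' i) \<Longrightarrow> m = m'"
    and "\<And>x :: 'a ^ 'i. (\<Sum>m\<in>M. c m * (\<Prod>i\<in>I. x $ i ^ Poly_Mapping.lookup m i)) = 0"
    and "m \<in> M"
  shows "c m = 0"
  using assms
proof (induction I arbitrary: M m rule: finite_induct)
  case empty
  have "M = {m}" using empty.prems by blast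
  then show ?case using empty.prems(3) by simp
next
  case (insert j I)
  define M' where "M' = {m' \<in> M. Poly_Mapping.lookup m' j = Poly_Mapping.lookup m j}"
  have fin: "finite M'" using insert.prems by (simp add: M'_def)
  have "(\<Sum>m\<in>M'. c m * (\<Prod>i\<in>I. x $ i ^ Poly_Mapping.lookup m i)) = 0" for x :: "'a ^ 'i"
  proof -
    let ?e = "\<lambda>m. c m * (\<Prod>i\<in>I. x $ i ^ Poly_Mapping.lookup m i)"
    define q where "q = (\<Sum>m\<in>M. monom (?e m) (Poly_Mapping.lookup m j))"
    have "poly q t = 0" for t
    proof -
      define y :: "'a ^ 'i" where "y = (\<chi> i. if i = j then t else x $ i)"
      have "(\<Prod>i\<in>I. y $ i ^ Poly_Mapping.lookup m i) = (\<Prod>i\<in>I. x $ i ^ Poly_Mapping.lookup m i)" for m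
        using insert.hyps by (intro prod.cong) (auto simp: y_def)
      then have "poly q t = (\<Sum>m\<in>M. c m * (\<Prod>i\<in>insert j I. y $ i ^ Poly_Mapping.lookup m i))"
        using insert.hyps by (simp add: q_def poly_sum poly_monom y_def algebra_simps)
      then show ?thesis using insert.prems(3) by simp
    qed
    then have "q = 0" by (rule poly_zero_fun)
    then have "coeff q (Poly_Mapping.lookup m j) = 0" by simp
    then have "(\<Sum>m'\<in>M. if Poly_Mapping.lookup m' j = Poly_Mapping.lookup m j then ?e m' else 0) = 0"
      by (simp add: q_def coeff_sum)
    then show ?thesis using insert.prems(1) by (simp add: M'_def sum.inter_filter)
  qed
  then show ?case
    using insert.IH[OF fin, of m] insert.prems fin by (force simp: M'_def)
qed

text \<open>Over an infinite field a polynomial is its function. The geometric part can thus work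
  with functions and return to polynomials only when rationality of coefficients matters.\<close>

lemma mp_eval_inj:
  fixes p q :: "('i::finite, 'a::alg_closed_field) mpoly"
  assumes "\<And>x. mp_eval p x = mp_eval q x"
  shows "p = q"
proof -
  have "Poly_Mapping.lookup (p - q) m = 0" for m
  proof (cases "m \<in> Poly_Mapping.keys (p - q)")
    case True
    show ?thesis
    proof (rule monomials_independent[where I = UNIV and M = "Poly_Mapping.keys (p - q)"])
      fix x :: "'a ^ 'i"
      show "(\<Sum>m\<in>Poly_Mapping.keys (p - q). Poly_Mapping.lookup (p - q) m *
          (\<Prod>i\<in>UNIV. x $ i ^ Poly_Mapping.lookup m i)) = 0"
        using mp_eval_eq[of "p - q" x] assms by (simp add: monom_at_def)
    qed (use True in \<open>auto intro: poly_mapping_eqI\<close>)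
  qed (simp add: in_keys_iff)
  then show ?thesis by (metis eq_iff_diff_eq_0 lookup_zero poly_mapping_eqI)
qed

text \<open>Homogeneous polynomial functions. Degrees are integers, so that forms of
  negative degree vanish identically and no case distinctions arise when degrees are subtracted.\<close>

definition form :: "'a::comm_ring_1 set \<Rightarrow> int \<Rightarrow> ('a ^ 'i::finite \<Rightarrow> 'a) \<Rightarrow> bool" where
  "form L e f \<longleftrightarrow> (\<exists>p. (\<forall>m\<in>Poly_Mapping.keys p. int (\<Sum>i\<in>UNIV. Poly_Mapping.lookup m i) = e) \<and>
      coeffs_in L p \<and> f = mp_eval p)"

lemma form_mp_eval: "homogeneous d p \<Longrightarrow> coeffs_in L p \<Longrightarrow> form L (int d) (mp_eval p)"
  unfolding form_def homogeneous_def by (intro exI[of _ p]) auto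

lemma formE:
  assumes "form L (int d) f"
  obtains p where "homogeneous d p" "coeffs_in L p" "f = mp_eval p"
  using assms unfolding form_def homogeneous_def of_nat_eq_iff by blast

lemma form_mono: "form L e f \<Longrightarrow> L \<subseteq> L' \<Longrightarrow> form L' e f"
  unfolding form_def coeffs_in_def by blast

lemma form_neg: "form L e f \<Longrightarrow> e < 0 \<Longrightarrow> f x = 0"
proof -
  assume "form L e f" "e < 0"
  then obtain p where p: "\<forall>m\<in>Poly_Mapping.keys p. int (\<Sum>i\<in>UNIV. Poly_Mapping.lookup m i) = e" "f = mp_eval p"
    unfolding form_def by auto
  have "Poly_Mapping.keys p = {}"
  proof (rule ccontr)
    assume "Poly_Mapping.keys p \<noteq> {}"
    then obtain m where "m \<in> Poly_Mapping.keys p" unfolding ex_in_conv[symmetric] by (elim exE)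
    then have "int (\<Sum>i\<in>UNIV. Poly_Mapping.lookup m i) = e" using p(1) by blast
    with \<open>e < 0\<close> show False by linarith
  qed
  then show "f x = 0" using p by (simp add: mp_eval_eq)
qed

lemma form_zero: "is_subring L \<Longrightarrow> form L e (\<lambda>x. 0)"
  unfolding form_def by (rule exI[of _ 0]) (auto simp: coeffs_in_def is_subringD(1))

lemma form_single:
  assumes "is_subring L" "c \<in> L" "c \<noteq> 0 \<Longrightarrow> int (\<Sum>i\<in>UNIV. Poly_Mapping.lookup m i) = e"
  shows "form L e (\<lambda>x. c * monom_at m x)"
  unfolding form_def
  by (rule exI[of _ "Poly_Mapping.single m c"])
    (use assms in \<open>auto simp: coeffs_in_def is_subringD(1) lookup_single when_def split: if_splits\<close>)

lemma form_const: "is_subring L \<Longrightarrow> c \<in> L \<Longrightarrow> form L 0 (\<lambda>x. c)"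
  using form_single[of L c 0 0] by (simp add: monom_at_def)

lemma form_add:
  assumes "is_subring L" "form L e f" "form L e g"
  shows "form L e (\<lambda>x. f x + g x)"
proof -
  obtain p q where p: "\<forall>m\<in>Poly_Mapping.keys p. int (\<Sum>i\<in>UNIV. Poly_Mapping.lookup m i) = e" "coeffs_in L p" "f = mp_eval p"
    and q: "\<forall>m\<in>Poly_Mapping.keys q. int (\<Sum>i\<in>UNIV. Poly_Mapping.lookup m i) = e" "coeffs_in L q" "g = mp_eval q"
    using assms(2,3) unfolding form_def by blast
  show ?thesis unfolding form_def
  proof (intro exI[of _ "p + q"] conjI ballI)
    fix m assume "m \<in> Poly_Mapping.keys (p + q)"
    then have "m \<in> Poly_Mapping.keys p \<union> Poly_Mapping.keys q" by (rule subsetD[OF Poly_Mapping.keys_add])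
    then show "int (\<Sum>i\<in>UNIV. Poly_Mapping.lookup m i) = e" using p(1) q(1) by blast
  qed (use p q is_subringD(3)[OF assms(1)] in \<open>auto simp: coeffs_in_def lookup_add\<close>)
qed

lemma form_sum:
  assumes "is_subring L" "\<And>i. i \<in> I \<Longrightarrow> form L e (f i)"
  shows "form L e (\<lambda>x. \<Sum>i\<in>I. f i x)"
  using assms(2)
  by (induction I rule: infinite_finite_induct) (auto intro: form_zero form_add assms(1))

lemma form_mult:
  assumes "is_subring L" "form L e f" "form L e' g"
  shows "form L (e + e') (\<lambda>x. f x * g x)"
proof -
  obtain p q where p: "\<forall>m\<in>Poly_Mapping.keys p. int (\<Sum>i\<in>UNIV. Poly_Mapping.lookup m i) = e" "coeffs_in L p" "f = mp_eval p"
    and q: "\<forall>m\<in>Poly_Mapping.keys q. int (\<Sum>i\<in>UNIV. Poly_Mapping.lookup m i) = e'" "coeffs_in L q" "g = mp_eval q"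
    using assms unfolding form_def by auto
  have eq: "(\<lambda>x. f x * g x) = (\<lambda>x. \<Sum>m\<in>Poly_Mapping.keys p. \<Sum>m'\<in>Poly_Mapping.keys q.
       (Poly_Mapping.lookup p m * Poly_Mapping.lookup q m') * monom_at (m + m') x)"
    by (rule ext) (simp add: p q mp_eval_eq sum_product monom_at_add algebra_simps)
  show ?thesis unfolding eq
  proof (intro form_sum form_single assms(1))
    fix m m' assume "m \<in> Poly_Mapping.keys p" "m' \<in> Poly_Mapping.keys q"
    then show "int (\<Sum>i\<in>UNIV. Poly_Mapping.lookup (m + m') i) = e + e'"
      using p(1) q(1) by (simp add: lookup_add sum.distrib)
    show "Poly_Mapping.lookup p m * Poly_Mapping.lookup q m' \<in> L"
      using p(2) q(2) is_subringD(4)[OF assms(1)] by (simp add: coeffs_in_def)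
  qed
qed

lemma form_var: "is_subring L \<Longrightarrow> form L 1 (\<lambda>x. x $ i)"
proof -
  assume L: "is_subring L"
  have "(\<Sum>j\<in>UNIV. Poly_Mapping.lookup (Poly_Mapping.single i 1) j) = (\<Sum>j\<in>UNIV. if j = i then 1 else (0::nat))"
    by (rule sum.cong) (auto simp: lookup_single when_def)
  then show ?thesis
    using form_single[OF L is_subringD(2)[OF L], of "Poly_Mapping.single i 1" 1]
    by (simp add: monom_at_single)
qed

lemma form_cmult: "is_subring L \<Longrightarrow> c \<in> L \<Longrightarrow> form L e f \<Longrightarrow> form L e (\<lambda>x. c * f x)"
  using form_mult[OF _ form_const, of L c e f] by simp

lemma form_uminus: "is_subring L \<Longrightarrow> form L e f \<Longrightarrow> form L e (\<lambda>x. - f x)"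
  using form_cmult[of L "- 1" e f] by (simp add: is_subringD(2,5))

lemma form_diff: "is_subring L \<Longrightarrow> form L e f \<Longrightarrow> form L e g \<Longrightarrow> form L e (\<lambda>x. f x - g x)"
  using form_add[OF _ _ form_uminus, of L e f g] by simp

lemma form_power: "is_subring L \<Longrightarrow> form L e f \<Longrightarrow> form L (int n * e) (\<lambda>x. f x ^ n)"
proof (induction n)
  case 0
  then show ?case using form_const[of L 1] by (simp add: is_subringD(2))
next
  case (Suc n)
  then show ?case using form_mult[of L e f "int n * e" "\<lambda>x. f x ^ n"] by (simp add: algebra_simps)
qed

lemma form_prod:
  assumes "is_subring L" "\<And>i. i \<in> I \<Longrightarrow> form L (e i) (f i)"
  shows "form L (\<Sum>i\<in>I. e i) (\<lambda>x. \<Prod>i\<in>I. f i x)"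
  using assms(2)
proof (induction I rule: infinite_finite_induct)
  case (insert x F)
  then show ?case by (simp add: form_mult[OF assms(1)])
qed (auto intro: form_const assms(1) is_subringD(2))

lemma form_linear: "is_subring L \<Longrightarrow> (\<And>i. a i \<in> L) \<Longrightarrow> form L 1 (\<lambda>x. \<Sum>i\<in>UNIV. a i * x $ i)"
  by (intro form_sum form_cmult form_var) auto

text \<open>A monomial of positive degree is a coordinate times a monomial of degree one less, so
  later inductions need no exponent vectors. The zero function is a case of its own, in every
  degree, because the empty sum carries no degree.\<close>

lemma form_induct [consumes 2, case_names zero const var add]:
  fixes P :: "int \<Rightarrow> ('a::comm_ring_1 ^ 'i::finite \<Rightarrow> 'a) \<Rightarrow> bool"
  assumes L: "is_subring L" and f: "form L e f"
    and zero: "\<And>e. P e (\<lambda>x. 0)"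
    and const: "\<And>c. c \<in> L \<Longrightarrow> P 0 (\<lambda>x. c)"
    and var: "\<And>e f i. form L e f \<Longrightarrow> P e f \<Longrightarrow> P (e + 1) (\<lambda>x. x $ i * f x)"
    and add: "\<And>e f g. form L e f \<Longrightarrow> form L e g \<Longrightarrow> P e f \<Longrightarrow> P e g \<Longrightarrow> P e (\<lambda>x. f x + g x)"
  shows "P e f"
proof -
  obtain p where p: "\<forall>m\<in>Poly_Mapping.keys p. int (\<Sum>i\<in>UNIV. Poly_Mapping.lookup m i) = e" "coeffs_in L p" "f = mp_eval p"
    using f unfolding form_def by auto
  have mono: "P (int (\<Sum>i\<in>UNIV. Poly_Mapping.lookup m i)) (\<lambda>x. c * monom_at m x)" if "c \<in> L" for c and m :: "'i \<Rightarrow>\<^sub>0 nat"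
  proof (induction "\<Sum>i\<in>UNIV. Poly_Mapping.lookup m i" arbitrary: m)
    case 0
    then have m: "m = 0" by (intro poly_mapping_eqI) auto
    show ?case using const[OF that] unfolding m by (simp add: monom_at_def)
  next
    case (Suc n)
    have "(\<Sum>i\<in>UNIV. Poly_Mapping.lookup m i) \<noteq> 0" using Suc.hyps(2) by linarith
    then obtain i where i: "Poly_Mapping.lookup m i \<noteq> 0" by (metis sum.neutral)
    define m' where "m' = m - Poly_Mapping.single i 1"
    have m: "m = Poly_Mapping.single i 1 + m'"
      using i by (intro poly_mapping_eqI) (auto simp: m'_def lookup_add lookup_minus lookup_single when_def)
    have one: "(\<Sum>j\<in>UNIV. Poly_Mapping.lookup (Poly_Mapping.single i 1) j) = (1::nat)"
    proof -
      have "(\<Sum>j\<in>UNIV. Poly_Mapping.lookup (Poly_Mapping.single i 1) j) = (\<Sum>j\<in>UNIV. if j = i then 1 else (0::nat))"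
        by (rule sum.cong) (auto simp: lookup_single when_def)
      then show ?thesis by simp
    qed
    have deg: "(\<Sum>i\<in>UNIV. Poly_Mapping.lookup m i) = 1 + (\<Sum>i\<in>UNIV. Poly_Mapping.lookup m' i)"
      using m by (metis (no_types, lifting) lookup_add one sum.cong sum.distrib)
    then have "n = (\<Sum>i\<in>UNIV. Poly_Mapping.lookup m' i)" using Suc by simp
    from var[OF form_single[OF L that refl] Suc.hyps(1)[OF this], of i]
    show ?case unfolding deg
      by (subst m) (simp add: monom_at_add monom_at_single algebra_simps)
  qed
  have "P e (\<lambda>x. \<Sum>m\<in>M. Poly_Mapping.lookup p m * monom_at m x) \<and> form L e (\<lambda>x. \<Sum>m\<in>M. Poly_Mapping.lookup p m * monom_at m x)"
    if "M \<subseteq> Poly_Mapping.keys p" for M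
    using finite_subset[OF that finite_keys] that
  proof (induction M rule: finite_induct)
    case empty
    then show ?case using zero form_zero[OF L] by simp
  next
    case (insert m M)
    have m: "int (\<Sum>i\<in>UNIV. Poly_Mapping.lookup m i) = e" "Poly_Mapping.lookup p m \<in> L"
      using insert.prems p by (auto simp: coeffs_in_def)
    have "form L e (\<lambda>x. Poly_Mapping.lookup p m * monom_at m x)" by (rule form_single[OF L]) (use m in auto)
    moreover have "P e (\<lambda>x. Poly_Mapping.lookup p m * monom_at m x)" using mono[OF m(2), of m] m(1) by simp
    moreover have IH: "P e (\<lambda>x. \<Sum>m\<in>M. Poly_Mapping.lookup p m * monom_at m x)"
      "form L e (\<lambda>x. \<Sum>m\<in>M. Poly_Mapping.lookup p m * monom_at m x)" using insert by auto
    ultimately show ?case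
      using add[OF _ IH(2) _ IH(1)] form_add[OF L _ IH(2)] insert.hyps by simp
  qed
  from this[of "Poly_Mapping.keys p"] show ?thesis
    using p(3) by (simp add: mp_eval_eq[abs_def])
qed

lemmas form_UNIV_induct = form_induct[OF is_subring_UNIV, consumes 1, case_names zero const var add]

lemma form_comp:
  assumes L: "is_subring L" and "form L e f" "\<And>j. form L e' (g j)"
  shows "form L (e * e') (\<lambda>x. f (\<chi> j. g j x))"
  using assms(1,2)
proof (induction rule: form_induct)
  case (var e f i)
  show ?case using form_mult[OF L assms(3) var(2), of i] by (simp add: algebra_simps)
qed (auto intro: form_zero form_const form_add L)

lemma form_scale:
  assumes "form L e f" "e \<ge> 0"
  shows "f (c *s x) = c ^ nat e * f x"
proof -
  have "form UNIV e f" using assms by (auto intro: form_mono)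
  then have "e \<ge> 0 \<longrightarrow> f (c *s x) = c ^ nat e * f x"
  proof (induction rule: form_UNIV_induct)
    case (var e f i)
    show ?case
    proof (cases "e \<ge> 0")
      case True
      then show ?thesis using var by (simp add: nat_add_distrib algebra_simps)
    next
      case False
      then show ?thesis using form_neg[OF var(1)] by simp
    qed
  qed (auto simp: algebra_simps)
  then show ?thesis using assms by simp
qed

lemma form_scale_eq_0:
  fixes f :: "'a::field ^ 'i::finite \<Rightarrow> 'a"
  assumes "form L e f" "c \<noteq> 0"
  shows "f (c *s x) = 0 \<longleftrightarrow> f x = 0"
  using form_scale[OF assms(1), of c x] form_neg[OF assms(1)] assms(2) by (cases "e \<ge> 0") auto

lemma form_at_0: "form L e f \<Longrightarrow> e \<noteq> 0 \<Longrightarrow> f 0 = 0"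
  using form_scale[of L e f 0 0] form_neg[of L e f 0] by (cases "e \<ge> 0") (auto simp: zero_power)

lemma form_0_const: "form L 0 f \<Longrightarrow> f x = f 0"
  using form_scale[of L 0 f 0 x] by simp

lemma form_line:
  fixes f :: "'a::comm_ring_1 ^ 'i::finite \<Rightarrow> 'a"
  assumes "form L e f"
  shows "\<exists>p. \<forall>t. f (u + t *s v) = poly p t"
proof -
  have "form UNIV e f" using assms by (auto intro: form_mono)
  then show ?thesis
  proof (induction rule: form_UNIV_induct)
    case (zero e)
    show ?case by (rule exI[of _ 0]) simp
  next
    case (const c)
    show ?case by (rule exI[of _ "[:c:]"]) simp
  next
    case (var e f i)
    then obtain p where "\<forall>t. f (u + t *s v) = poly p t" by blast
    then show ?case by (intro exI[of _ "[:u $ i, v $ i:] * p"]) (simp add: algebra_simps)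
  next
    case (add e f g)
    then obtain p q where "\<forall>t. f (u + t *s v) = poly p t" "\<forall>t. g (u + t *s v) = poly q t" by blast
    then show ?case by (intro exI[of _ "p + q"]) simp
  qed
qed

text \<open>Taylor expansion of first order along a vector \<open>v\<close> with the linear form \<open>l\<close> as parameter.\<close>

lemma form_shift:
  fixes f :: "'a::comm_ring_1 ^ 'i::finite \<Rightarrow> 'a"
  assumes "form UNIV e f" "form UNIV 1 l"
  shows "\<exists>g. form UNIV (e - 1) g \<and> (\<forall>u. f u - f (u - l u *s v) = l u * g u)"
  using is_subring_UNIV assms(1)
proof (induction rule: form_induct)
  case (zero e)
  show ?case using form_zero[OF is_subring_UNIV] by (intro exI[of _ "\<lambda>x. 0"]) simp
next
  case (const c)
  show ?case using form_zero[OF is_subring_UNIV] by (intro exI[of _ "\<lambda>x. 0"]) simp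
next
  case (var e f i)
  then obtain g where g: "form UNIV (e - 1) g" "\<And>u. f u - f (u - l u *s v) = l u * g u" by blast
  have lin: "form UNIV 1 (\<lambda>u. u $ i - v $ i * l u)"
    by (intro form_diff form_cmult form_var assms) auto
  have "form UNIV e (\<lambda>u. v $ i * f u + (u $ i - v $ i * l u) * g u)"
    using form_mult[OF is_subring_UNIV lin g(1)]
    by (intro form_add form_cmult var) auto
  moreover have "u $ i * f u - (u - l u *s v) $ i * f (u - l u *s v)
     = l u * (v $ i * f u + (u $ i - v $ i * l u) * g u)" for u
  proof -
    have f': "f (u - l u *s v) = f u - l u * g u" using g(2)[of u] by (simp add: algebra_simps)
    show ?thesis unfolding f' by (simp add: algebra_simps)
  qed
  ultimately show ?case by (intro exI[of _ "\<lambda>u. v $ i * f u + (u $ i - v $ i * l u) * g u"]) simp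
next
  case (add e f g)
  obtain f' where f': "form UNIV (e - 1) f'" "\<And>u. f u - f (u - l u *s v) = l u * f' u" using add(3) by blast
  obtain g' where g': "form UNIV (e - 1) g'" "\<And>u. g u - g (u - l u *s v) = l u * g' u" using add(4) by blast
  have "f u + g u - (f (u - l u *s v) + g (u - l u *s v)) = l u * (f' u + g' u)" for u
    using f'(2)[of u] g'(2)[of u] by (simp add: algebra_simps)
  then show ?case using form_add[OF is_subring_UNIV f'(1) g'(1)] by blast
qed

text \<open>In the induction only degree 1 counts: the factor beside a coordinate then has degree 0
  and is constant.\<close>

lemma form_one_linear:
  fixes l :: "'a::comm_ring_1 ^ 'i::finite \<Rightarrow> 'a"
  assumes "form UNIV 1 l"
  shows "l (u + v) = l u + l v" "l (c *s u) = c * l u"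
proof -
  have "form UNIV e g \<Longrightarrow> e = 1 \<longrightarrow> (\<forall>u v. g (u + v) = g u + g v)" for e and g :: "'a ^ 'i \<Rightarrow> 'a"
  proof (induction rule: form_UNIV_induct)
    case (var e f i)
    show ?case
    proof (intro impI allI)
      fix u v :: "'a ^ 'i" assume "e + 1 = 1"
      then have "f x = f 0" for x using form_0_const[of UNIV f x] var(1) by simp
      then show "(u + v) $ i * f (u + v) = u $ i * f u + v $ i * f v"
        by (metis distrib_right vector_add_component)
    qed
  qed auto
  then show "l (u + v) = l u + l v" using assms by blast
  show "l (c *s u) = c * l u" using form_scale[OF assms, of c u] by simp
qed

lemma form_one_eq:
  fixes l :: "'a::comm_ring_1 ^ 'i::finite \<Rightarrow> 'a"
  assumes "form UNIV 1 l"
  shows "l u = (\<Sum>i\<in>UNIV. l (axis i 1) * u $ i)"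
proof -
  have sum: "l (\<Sum>i\<in>I. h i) = (\<Sum>i\<in>I. l (h i))" for I and h :: "'b \<Rightarrow> _"
    by (induction I rule: infinite_finite_induct) (auto simp: form_one_linear[OF assms] form_at_0[OF assms])
  have "u = (\<Sum>i\<in>UNIV. u $ i *s axis i 1)"
    by (simp add: vec_eq_iff axis_def if_distrib sum.delta' cong: if_cong)
  then have "l u = l (\<Sum>i\<in>UNIV. u $ i *s axis i 1)" by simp
  then show ?thesis by (simp add: sum form_one_linear[OF assms] mult.commute)
qed

section \<open>Partial derivatives\<close>

lemma form_deriv:
  assumes "homogeneous d p"
  shows "form UNIV (int d - 1) (mp_eval (mp_deriv i p))"
proof -
  have eq: "mp_eval (mp_deriv i p) = (\<lambda>x. \<Sum>m\<in>Poly_Mapping.keys p.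
     (of_nat (Poly_Mapping.lookup m i) * Poly_Mapping.lookup p m) * monom_at (m - Poly_Mapping.single i 1) x)"
    by (rule ext) (simp add: mp_deriv_def)
  show ?thesis unfolding eq
  proof (intro form_sum form_single)
    fix m assume m: "m \<in> Poly_Mapping.keys p"
      and "of_nat (Poly_Mapping.lookup m i) * Poly_Mapping.lookup p m \<noteq> 0"
    then have mi: "Poly_Mapping.lookup m i > 0" by (cases "Poly_Mapping.lookup m i") auto
    have "(\<Sum>j\<in>UNIV. Poly_Mapping.lookup (m - Poly_Mapping.single i 1) j) + 1
       = (\<Sum>j\<in>UNIV. Poly_Mapping.lookup (m - Poly_Mapping.single i 1) j + (if j = i then 1 else 0))"
      by (simp add: sum.distrib)
    also have "\<dots> = (\<Sum>j\<in>UNIV. Poly_Mapping.lookup m j)"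
      by (rule sum.cong) (use mi in \<open>auto simp: lookup_minus lookup_single when_def\<close>)
    also have "\<dots> = d" using assms m by (auto simp: homogeneous_def)
    finally show "int (\<Sum>j\<in>UNIV. Poly_Mapping.lookup (m - Poly_Mapping.single i 1) j) = int d - 1" by linarith
  qed auto
qed

text \<open>The chain rule along a line. Besides degrees and smoothness, this is the only
  information on partial derivatives that passes to the locale \<open>plane_curve\<close>.\<close>

lemma mp_eval_line_deriv:
  fixes p :: "('i::finite, 'a::idom) mpoly"
  shows "\<exists>q. (\<forall>t. mp_eval p (x + t *s v) = poly q t) \<and>
    (\<forall>t. poly (pderiv q) t = (\<Sum>i\<in>UNIV. v $ i * mp_eval (mp_deriv i p) (x + t *s v)))"
proof -
  let ?l = "\<lambda>i. [:x $ i, v $ i:]"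
  define q where "q = (\<Sum>m\<in>Poly_Mapping.keys p. smult (Poly_Mapping.lookup p m)
      (\<Prod>i\<in>UNIV. ?l i ^ Poly_Mapping.lookup m i))"
  have 1: "mp_eval p (x + t *s v) = poly q t" for t
    by (simp add: q_def mp_eval_eq monom_at_def poly_sum poly_prod)
  have 2: "poly (pderiv q) t = (\<Sum>i\<in>UNIV. v $ i * mp_eval (mp_deriv i p) (x + t *s v))" for t
  proof -
    let ?y = "x + t *s v"
    have mon: "of_nat (Poly_Mapping.lookup m i) * monom_at (m - Poly_Mapping.single i 1) ?y
      = (\<Prod>j\<in>UNIV - {i}. ?y $ j ^ Poly_Mapping.lookup m j) * (of_nat (Poly_Mapping.lookup m i) * ?y $ i ^ (Poly_Mapping.lookup m i - 1))" for m i
    proof -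
      have "monom_at (m - Poly_Mapping.single i 1) ?y
         = ?y $ i ^ (Poly_Mapping.lookup m i - 1) * (\<Prod>j\<in>UNIV - {i}. ?y $ j ^ Poly_Mapping.lookup (m - Poly_Mapping.single i 1) j)"
        unfolding monom_at_def by (subst prod.remove[of _ i]) (auto simp: lookup_minus)
      also have "(\<Prod>j\<in>UNIV - {i}. ?y $ j ^ Poly_Mapping.lookup (m - Poly_Mapping.single i 1) j) = (\<Prod>j\<in>UNIV - {i}. ?y $ j ^ Poly_Mapping.lookup m j)"
        by (rule prod.cong) (auto simp: lookup_minus lookup_single when_def)
      finally show ?thesis by (simp add: algebra_simps)
    qed
    have pd: "pderiv (?l i ^ n) = smult (of_nat n * v $ i) (?l i ^ (n - 1))" for i n
      by (cases n) (simp_all add: pderiv_power_Suc pderiv_pCons mult.commute del: power_Suc)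
    have pd_sum: "pderiv (sum h I) = (\<Sum>i\<in>I. pderiv (h i))" for h :: "_ \<Rightarrow> 'a poly" and I
      by (induction I rule: infinite_finite_induct) (auto simp: pderiv_add)
    have "poly (pderiv q) t = (\<Sum>m\<in>Poly_Mapping.keys p. Poly_Mapping.lookup p m *
        (\<Sum>i\<in>UNIV. (\<Prod>j\<in>UNIV - {i}. ?y $ j ^ Poly_Mapping.lookup m j) *
           (of_nat (Poly_Mapping.lookup m i) * v $ i * ?y $ i ^ (Poly_Mapping.lookup m i - 1))))"
      by (simp add: q_def pd_sum pderiv_smult pderiv_prod pd poly_sum poly_prod mult_ac)
    also have "\<dots> = (\<Sum>m\<in>Poly_Mapping.keys p. \<Sum>i\<in>UNIV. v $ i *
        (of_nat (Poly_Mapping.lookup m i) * Poly_Mapping.lookup p m * monom_at (m - Poly_Mapping.single i 1) ?y))"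
      unfolding sum_distrib_left
    proof (intro sum.cong refl, goal_cases)
      case (1 m i)
      have "v $ i * (of_nat (Poly_Mapping.lookup m i) * Poly_Mapping.lookup p m * monom_at (m - Poly_Mapping.single i 1) ?y)
        = Poly_Mapping.lookup p m * v $ i * (of_nat (Poly_Mapping.lookup m i) * monom_at (m - Poly_Mapping.single i 1) ?y)"
        by (simp only: mult_ac)
      then show ?case unfolding mon by (simp only: mult_ac)
    qed
    also have "\<dots> = (\<Sum>i\<in>UNIV. v $ i * mp_eval (mp_deriv i p) ?y)"
      by (subst sum.swap) (simp add: mp_deriv_def sum_distrib_left)
    finally show ?thesis .
  qed
  show ?thesis using 1 2 by blast
qed


section \<open>Binary forms\<close>

text \<open>The homogenisation of \<open>p\<close> in degree \<open>n\<close>. The degree is a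
  separate argument because that of a nonzero \<open>p\<close> may be smaller; the difference is the
  order of the zero at the point \<open>s = 0\<close>.\<close>

definition binary :: "nat \<Rightarrow> 'a::comm_ring_1 poly \<Rightarrow> 'a \<Rightarrow> 'a \<Rightarrow> 'a" where
  "binary n p s t = (\<Sum>i\<le>n. coeff p i * s ^ (n - i) * t ^ i)"

lemma binary_one: "degree p \<le> n \<Longrightarrow> binary n p 1 t = poly p t"
  unfolding binary_def poly_altdef
  by (rule sum.mono_neutral_cong_right) (auto simp: coeff_eq_0)

lemma binary_zero_one: "binary n p 0 1 = coeff p n"
proof -
  have "binary n p 0 1 = (\<Sum>i\<le>n. if i = n then coeff p n else 0)"
    unfolding binary_def by (rule sum.cong) (auto simp: zero_power)
  then show ?thesis by simp
qed

lemma binary_0 [simp]: "binary n 0 s t = 0"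
  by (simp add: binary_def)

lemma binary_add: "binary n (p + q) s t = binary n p s t + binary n q s t"
  by (simp add: binary_def distrib_right sum.distrib)

lemma binary_smult: "binary n (smult c p) s t = c * binary n p s t"
  by (simp add: binary_def sum_distrib_left mult.assoc)

lemma binary_Suc: "degree p \<le> n \<Longrightarrow> binary (Suc n) p s t = s * binary n p s t"
proof -
  assume "degree p \<le> n"
  then have "binary (Suc n) p s t = (\<Sum>i\<le>n. coeff p i * s ^ (Suc n - i) * t ^ i)"
    by (simp add: binary_def coeff_eq_0)
  also have "\<dots> = (\<Sum>i\<le>n. s * (coeff p i * s ^ (n - i) * t ^ i))"
    by (rule sum.cong) (auto simp: Suc_diff_le)
  finally show ?thesis by (simp add: binary_def sum_distrib_left)
qed

lemma binary_pCons: "binary (Suc n) (pCons 0 p) s t = t * binary n p s t"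
  unfolding binary_def by (subst sum.atMost_Suc_shift) (simp add: sum_distrib_left algebra_simps)

lemma binary_linear_mult:
  assumes "degree p \<le> n"
  shows "binary (Suc n) ([:a, b:] * p) s t = (a * s + b * t) * binary n p s t"
proof -
  have "[:a, b:] * p = smult a p + pCons 0 (smult b p)" by simp
  then show ?thesis
    by (simp add: binary_add binary_smult binary_Suc[OF assms] binary_pCons distrib_right mult.assoc mult.left_commute del: mult_pCons_left)
qed

lemma form_binary:
  assumes "form UNIV 1 a" "form UNIV 1 b"
  shows "form UNIV (int n) (\<lambda>u. binary n p (a u) (b u))"
  unfolding binary_def
proof (rule form_sum[OF is_subring_UNIV])
  fix i assume "i \<in> {..n}"
  then have n: "int (n - i) * 1 + int i * 1 = int n" by auto
  have 1: "form UNIV (int (n - i) * 1) (\<lambda>u. coeff p i * a u ^ (n - i))"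
    by (rule form_cmult[OF is_subring_UNIV UNIV_I form_power[OF is_subring_UNIV assms(1)]])
  have 2: "form UNIV (int i * 1) (\<lambda>u. b u ^ i)"
    by (rule form_power[OF is_subring_UNIV assms(2)])
  show "form UNIV (int n) (\<lambda>u. coeff p i * a u ^ (n - i) * b u ^ i)"
    using form_mult[OF is_subring_UNIV 1 2] unfolding n .
qed

lemma form_binary_line:
  fixes f :: "'a::comm_ring_1 ^ 'i::finite \<Rightarrow> 'a"
  assumes "form UNIV e f"
  shows "\<exists>p. degree p \<le> nat e \<and> (\<forall>s t. f (s *s u + t *s v) = binary (nat e) p s t)"
  using assms
proof (induction rule: form_UNIV_induct)
  case (zero e)
  show ?case by (rule exI[of _ 0]) simp
next
  case (const c)
  show ?case by (rule exI[of _ "[:c:]"]) (simp add: binary_def)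
next
  case (var e f i)
  show ?case
  proof (cases "e \<ge> 0")
    case True
    from var obtain p where p: "degree p \<le> nat e" "\<And>s t. f (s *s u + t *s v) = binary (nat e) p s t" by blast
    have n: "nat (e + 1) = Suc (nat e)" using True by simp
    have "degree ([:u $ i, v $ i:] * p) \<le> degree [:u $ i, v $ i:] + degree p" by (rule degree_mult_le)
    also have "\<dots> \<le> nat (e + 1)" using p(1) n by (auto simp: degree_pCons_eq_if)
    finally have "degree ([:u $ i, v $ i:] * p) \<le> nat (e + 1)" .
    moreover have "(s *s u + t *s v) $ i * f (s *s u + t *s v) = binary (nat (e + 1)) ([:u $ i, v $ i:] * p) s t" for s t
      unfolding n p(2) binary_linear_mult[OF p(1)] by (simp add: algebra_simps)
    ultimately show ?thesis by blast
  next
    case False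
    then have "f x = 0" for x using form_neg[OF var(1)] by simp
    then show ?thesis by (intro exI[of _ 0]) simp
  qed
next
  case (add e f g)
  then obtain p q where "degree p \<le> nat e" "\<And>s t. f (s *s u + t *s v) = binary (nat e) p s t"
     "degree q \<le> nat e" "\<And>s t. g (s *s u + t *s v) = binary (nat e) q s t" by blast
  then show ?case by (intro exI[of _ "p + q"]) (auto simp: binary_add intro: degree_add_le)
qed

text \<open>A root of \<open>p\<close> gives the factor. A nonzero constant \<open>p\<close> has
  none, but then its homogenisation vanishes at infinity and \<open>s\<close> splits off.\<close>

lemma binary_factor:
  fixes p :: "'a::alg_closed_field poly"
  assumes "p \<noteq> 0" "degree p \<le> Suc n"
  obtains \<alpha> \<beta> q where "\<alpha> \<noteq> 0 \<or> \<beta> \<noteq> 0" "q \<noteq> 0" "degree q \<le> n"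
    "\<And>s t. binary (Suc n) p s t = (\<alpha> * s + \<beta> * t) * binary n q s t"
proof (cases "degree p = 0")
  case True
  then show ?thesis using that[of 1 0 p] assms binary_Suc[of p n] by simp
next
  case False
  then obtain r where "poly p r = 0" using alg_closed_imp_poly_has_root by blast
  then obtain q where q: "p = [:- r, 1:] * q" by (auto simp: poly_eq_0_iff_dvd dvd_def)
  with assms have q0: "q \<noteq> 0" by auto
  have "degree p = 1 + degree q" unfolding q by (subst degree_mult_eq) (use q0 in auto)
  then have "degree q \<le> n" using assms by simp
  then show ?thesis using that[of "- r" 1 q] q0 binary_linear_mult[of q n "- r" 1] q by simp
qed


section \<open>Univariate lemmas\<close>

text \<open>Simplicity of the roots is what allows fibres to be counted in any
  characteristic.\<close>

lemma card_roots_eq_degree: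
  fixes q :: "'a::alg_closed_field poly"
  assumes "q \<noteq> 0" "\<And>z. poly q z = 0 \<Longrightarrow> poly (pderiv q) z \<noteq> 0"
  shows "card {z. poly q z = 0} = degree q"
  using assms
proof (induction "degree q" arbitrary: q)
  case 0
  then obtain c where "q = [:c:]" by (metis degree_eq_zeroE)
  then show ?case using 0 by simp
next
  case (Suc n)
  then obtain a where a: "poly q a = 0" using alg_closed_imp_poly_has_root[of q] by auto
  then obtain r where r: "q = [:- a, 1:] * r" by (auto simp: poly_eq_0_iff_dvd dvd_def)
  have r0: "r \<noteq> 0" using Suc r by auto
  have pd: "poly (pderiv q) z = poly r z + (z - a) * poly (pderiv r) z" for z
    unfolding r pderiv_mult by (simp add: pderiv_pCons algebra_simps)
  have ra: "poly r a \<noteq> 0" using Suc(4)[OF a] pd[of a] by simp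
  have deg: "degree q = Suc (degree r)" unfolding r by (subst degree_mult_eq) (use r0 in auto)
  have "card {z. poly r z = 0} = degree r"
  proof (rule Suc(1)[OF _ r0])
    show "n = degree r" using deg Suc(2) by simp
    fix z assume "poly r z = 0"
    then show "poly (pderiv r) z \<noteq> 0" using Suc(4)[of z] pd[of z] r by auto
  qed
  moreover have "{z. poly q z = 0} = insert a {z. poly r z = 0}" using r by auto
  moreover have "finite {z. poly r z = 0}" using r0 by (rule poly_roots_finite)
  ultimately show ?case using ra deg by simp
qed

text \<open>Only the zeros of \<open>f\<close> matter, and at each of them the equation
  \<open>v * g = f * q\<close> forces \<open>g\<close> to vanish. Cancelling the common root from
  \<open>f\<close> and \<open>g\<close> keeps all local equations.\<close>

lemma poly_dvd_if_locally:
  fixes f g :: "'a::alg_closed_field poly"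
  assumes "f \<noteq> 0" "\<And>z. poly f z = 0 \<Longrightarrow> \<exists>v q. poly v z \<noteq> 0 \<and> v * g = f * q"
  shows "f dvd g"
  using assms
proof (induction "degree f" arbitrary: f g)
  case 0
  then have "f dvd 1" by (simp add: is_unit_iff_degree)
  then show ?case by (rule unit_imp_dvd)
next
  case (Suc n)
  then obtain z where z: "poly f z = 0" using alg_closed_imp_poly_has_root[of f] by auto
  then obtain f' where f': "f = [:- z, 1:] * f'" by (auto simp: poly_eq_0_iff_dvd dvd_def)
  have f0: "f' \<noteq> 0" using Suc f' by auto
  have deg: "degree f = Suc (degree f')" unfolding f' by (subst degree_mult_eq) (use f0 in auto)
  obtain v q where vq: "poly v z \<noteq> 0" "v * g = f * q" using Suc(4)[OF z] by blast
  have "poly v z * poly g z = 0" using arg_cong[OF vq(2), of "\<lambda>p. poly p z"] z by simp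
  then have "poly g z = 0" using vq(1) by simp
  then obtain g' where g': "g = [:- z, 1:] * g'" by (auto simp: poly_eq_0_iff_dvd dvd_def)
  have "f' dvd g'"
  proof (rule Suc(1)[OF _ f0])
    show "n = degree f'" using deg Suc(2) by simp
    fix y assume "poly f' y = 0"
    then have "poly f y = 0" using f' by simp
    then obtain v q where v: "poly v y \<noteq> 0" and "v * g = f * q" using Suc(4) by blast
    then have "[:- z, 1:] * (v * g') = [:- z, 1:] * (f' * q)" unfolding f' g' by (simp only: mult_ac)
    then have "v * g' = f' * q" by (simp only: mult_cancel_left) simp
    with v show "\<exists>v q. poly v y \<noteq> 0 \<and> v * g' = f' * q" by blast
  qed
  then show ?case unfolding f' g' by (rule mult_dvd_mono[OF dvd_refl])
qed

text \<open>Gaussian elimination: an unknown \<open>k\<close> occurring in equation \<open>j\<close>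
  is solved for, and the corrected coefficients form a system with one unknown and one equation
  less.\<close>

lemma homogeneous_system:
  fixes a :: "'i \<Rightarrow> 'j \<Rightarrow> 'a::field"
  assumes "finite J" "finite I" "card J < card I"
  shows "\<exists>c. (\<exists>i\<in>I. c i \<noteq> 0) \<and> (\<forall>j\<in>J. (\<Sum>i\<in>I. c i * a i j) = 0)"
  using assms
proof (induction J arbitrary: I a rule: finite_induct)
  case empty
  then have "I \<noteq> {}" by auto
  then show ?case by (intro exI[of _ "\<lambda>_. 1"]) auto
next
  case (insert j J)
  show ?case
  proof (cases "\<forall>i\<in>I. a i j = 0")
    case True
    obtain c where "\<exists>i\<in>I. c i \<noteq> 0" "\<forall>j\<in>J. (\<Sum>i\<in>I. c i * a i j) = 0"
      using insert.IH[of I a] insert.prems insert.hyps by auto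
    then show ?thesis using True by (intro exI[of _ c]) auto
  next
    case False
    then obtain k where k: "k \<in> I" "a k j \<noteq> 0" by blast
    let ?I = "I - {k}"
    have "card J < card ?I" using insert.prems insert.hyps k by simp
    then obtain c where c: "\<exists>i\<in>?I. c i \<noteq> 0" "\<forall>l\<in>J. (\<Sum>i\<in>?I. c i * (a i l - a i j / a k j * a k l)) = 0"
      using insert.IH[of ?I "\<lambda>i l. a i l - a i j / a k j * a k l"] insert.prems by auto
    define c' where "c' = c(k := - (\<Sum>i\<in>?I. c i * a i j) / a k j)"
    have split: "(\<Sum>i\<in>I. c' i * a i l) = - (\<Sum>i\<in>?I. c i * a i j) / a k j * a k l + (\<Sum>i\<in>?I. c i * a i l)" for l
      using k insert.prems by (subst sum.remove[of I k]) (auto simp: c'_def intro!: sum.cong)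
    have "(\<Sum>i\<in>I. c' i * a i l) = 0" if "l \<in> J" for l
    proof -
      have "0 = (\<Sum>i\<in>?I. c i * (a i l - a i j / a k j * a k l))" using c(2) that by simp
      also have "\<dots> = (\<Sum>i\<in>?I. c i * a i l - (c i * a i j) * (a k l / a k j))"
        by (rule sum.cong) (auto simp: algebra_simps)
      also have "\<dots> = (\<Sum>i\<in>?I. c i * a i l) - (\<Sum>i\<in>?I. c i * a i j) * (a k l / a k j)"
        by (simp only: sum_subtractf sum_distrib_right)
      finally show ?thesis unfolding split by (simp add: algebra_simps)
    qed
    moreover have "(\<Sum>i\<in>I. c' i * a i j) = 0" unfolding split using k by simp
    moreover have "\<exists>i\<in>I. c' i \<noteq> 0" using c(1) by (auto simp: c'_def)
    ultimately show ?thesis by (intro exI[of _ c']) auto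
  qed
qed

lemma form_deg_cong: "form L e f \<Longrightarrow> e = e' \<Longrightarrow> form L e' f"
  by simp

lemmas formU = form_add[OF is_subring_UNIV] form_sum[OF is_subring_UNIV] form_mult[OF is_subring_UNIV]
  form_cmult[OF is_subring_UNIV UNIV_I] form_diff[OF is_subring_UNIV] form_zero[OF is_subring_UNIV]
  form_power[OF is_subring_UNIV] form_uminus[OF is_subring_UNIV] form_var[OF is_subring_UNIV]

lemma form_mult_deg: "form UNIV e f \<Longrightarrow> form UNIV e' g \<Longrightarrow> e + e' = e'' \<Longrightarrow> form UNIV e'' (\<lambda>x. f x * g x)"
  using form_mult[OF is_subring_UNIV] by blast


section \<open>Functions on a smooth plane curve\<close>

text \<open>Irreducibility enters as primality for forms on the points of the curve. That F
  generates the ideal of forms vanishing there is not assumed but derived from smoothness and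
  primality in \<open>van_multiple\<close>. The \<open>D i\<close> are partial derivatives, known
  through the chain rule \<open>line_D\<close>.\<close>

locale plane_curve =
  fixes F :: "'K::alg_closed_field ^ 3 \<Rightarrow> 'K" and d :: nat and D :: "3 \<Rightarrow> 'K ^ 3 \<Rightarrow> 'K"
  assumes form_F: "form UNIV (int d) F" and d_ge: "d \<ge> 4"
    and form_D: "form UNIV (int d - 1) (D i)"
    and line_D: "\<exists>q. (\<forall>t. F (x + t *s v) = poly q t) \<and>
      (\<forall>t. poly (pderiv q) t = (\<Sum>i\<in>UNIV. v $ i * D i (x + t *s v)))"
    and smooth: "x \<noteq> 0 \<Longrightarrow> F x = 0 \<Longrightarrow> \<exists>i. D i x \<noteq> 0"
    and prime: "form UNIV e f \<Longrightarrow> form UNIV e' g \<Longrightarrow> (\<And>x. x \<noteq> 0 \<Longrightarrow> F x = 0 \<Longrightarrow> f x * g x = 0) \<Longrightarrow>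
      (\<forall>x. x \<noteq> 0 \<longrightarrow> F x = 0 \<longrightarrow> f x = 0) \<or> (\<forall>x. x \<noteq> 0 \<longrightarrow> F x = 0 \<longrightarrow> g x = 0)"
    and nonempty: "\<exists>x. x \<noteq> 0 \<and> F x = 0"
begin

definition C :: "('K ^ 3) set" where "C = {x. x \<noteq> 0 \<and> F x = 0}"

definition van :: "('K ^ 3 \<Rightarrow> 'K) \<Rightarrow> bool" where "van f \<longleftrightarrow> (\<forall>x\<in>C. f x = 0)"

lemma vanD: "van f \<Longrightarrow> x \<in> C \<Longrightarrow> f x = 0"
  by (simp add: van_def)

lemma van_prime:
  assumes "form UNIV e f" "form UNIV e' g" "\<And>x. x \<in> C \<Longrightarrow> f x * g x = 0" "\<not> van f"
  shows "van g"
  using prime[OF assms(1,2)] assms(3,4) unfolding van_def C_def by auto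

text \<open>Holds at the zeros of \<open>f\<close> too, since primality is applied to
  \<open>g - h\<close> on the whole curve. It takes the place of calculating in the function
  field.\<close>

lemma van_cancel:
  assumes "form UNIV e f" "\<not> van f" "form UNIV e' g" "form UNIV e' h"
    "\<And>x. x \<in> C \<Longrightarrow> f x * g x = f x * h x" "x \<in> C"
  shows "g x = h x"
  using vanD[OF van_prime[OF assms(1) formU(5)[OF assms(3,4)] _ assms(2)] assms(6)] assms(5)
  by (auto simp: algebra_simps)

lemma van_power:
  assumes "form UNIV e f" "\<not> van f"
  shows "\<not> van (\<lambda>x. f x ^ n)"
proof (induction n)
  case 0
  then show ?case using assms by (auto simp: van_def)
next
  case (Suc n)
  show ?case
  proof
    assume v: "van (\<lambda>x. f x ^ Suc n)"
    have "van (\<lambda>x. f x ^ n)"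
      by (rule van_prime[OF assms(1) formU(7)[OF assms(1)] _ assms(2)]) (use vanD[OF v] in simp)
    with Suc show False by simp
  qed
qed

text \<open>The derivative of F at \<open>x\<close> in direction \<open>v\<close>. For fixed
  \<open>x\<close> on the curve its zeros in \<open>v\<close> form the tangent line, for fixed
  \<open>v\<close> its zeros in \<open>x\<close> are the polar of \<open>v\<close>. So
  \<open>van (DV v)\<close> says that every tangent passes through \<open>v\<close>.\<close>

definition DV :: "'K ^ 3 \<Rightarrow> 'K ^ 3 \<Rightarrow> 'K" where "DV v x = (\<Sum>i\<in>UNIV. v $ i * D i x)"

lemma form_DV: "form UNIV (int d - 1) (DV v)"
  unfolding DV_def by (intro formU form_D)

lemma form_DV_vec: "form UNIV 1 (\<lambda>v. DV v x)"
  using form_linear[OF is_subring_UNIV, of "\<lambda>i. D i x"] by (simp add: DV_def mult.commute)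

lemma line_DV: "\<exists>q. (\<forall>t. F (x + t *s v) = poly q t) \<and> (\<forall>t. poly (pderiv q) t = DV v (x + t *s v))"
  using line_D unfolding DV_def .

lemma DV_nonzero: "x \<in> C \<Longrightarrow> \<exists>v. DV v x \<noteq> 0"
proof -
  assume "x \<in> C"
  then obtain i where i: "D i x \<noteq> 0" using smooth by (auto simp: C_def)
  have "DV (axis i 1) x = (\<Sum>j\<in>UNIV. if j = i then D i x else 0)"
    unfolding DV_def by (rule sum.cong) (auto simp: axis_def)
  then show ?thesis using i by (intro exI[of _ "axis i 1"]) simp
qed

lemma C_scale: "x \<in> C \<Longrightarrow> c \<noteq> 0 \<Longrightarrow> c *s x \<in> C"
  using form_scale_eq_0[OF form_F] by (auto simp: C_def)

text \<open>Such a \<open>P\<close> serves as centre of projection: it lies off the curve and is not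
  strange, so that the projection is separable. On a line through a curve point \<open>x\<close>
  that is not tangent there, F and the tangent form of \<open>x\<close> restrict to nonzero
  polynomials in the parameter, so some point avoids the zeros of both.\<close>

lemma good_point: "\<exists>P. F P \<noteq> 0 \<and> \<not> van (DV P)"
proof -
  obtain x where x: "x \<in> C" using nonempty by (auto simp: C_def)
  obtain v where v: "DV v x \<noteq> 0" using DV_nonzero[OF x] by blast
  obtain q where q: "\<And>t. F (x + t *s v) = poly q t" "\<And>t. poly (pderiv q) t = DV v (x + t *s v)"
    using line_DV[of x v] by blast
  have "q \<noteq> 0" using q(2)[of 0] v by auto
  moreover have "[:DV x x, DV v x:] \<noteq> 0" using v by simp
  ultimately have "q * [:DV x x, DV v x:] \<noteq> 0" by (simp only: mult_eq_0_iff) simp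
  then obtain t where t: "poly (q * [:DV x x, DV v x:]) t \<noteq> 0" using poly_zero_fun by blast
  have "poly q t * (DV x x + t * DV v x) \<noteq> 0" using t unfolding poly_mult by simp
  then have "F (x + t *s v) \<noteq> 0" "DV (x + t *s v) x \<noteq> 0"
    using form_one_linear[OF form_DV_vec[of x]] by (auto simp: q(1))
  then show ?thesis using x by (auto simp: van_def)
qed

end

text \<open>Two standard basis vectors complete \<open>P\<close> to a basis, and \<open>cX\<close>,
  \<open>cY\<close>, \<open>cZ\<close> are the dual coordinates; \<open>cX\<close> and
  \<open>cY\<close> then describe the projection from \<open>P\<close>.\<close>

lemma adapted_basis:
  fixes P :: "'a::field ^ 3"
  assumes "P \<noteq> 0"
  obtains cX cY cZ b1 b2 where "form UNIV 1 cX" "form UNIV 1 cY" "form UNIV 1 cZ"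
    "\<And>u. u = cX u *s b1 + cY u *s b2 + cZ u *s P"
    "cX P = 0" "cY P = 0" "cZ P = 1" "cX b1 = 1" "cY b1 = 0" "cZ b1 = 0" "cX b2 = 0" "cY b2 = 1" "cZ b2 = 0"
proof -
  obtain k where k: "P $ k \<noteq> 0" using assms by (auto simp: vec_eq_iff)
  have "\<exists>i j. i \<noteq> j \<and> i \<noteq> k \<and> j \<noteq> k \<and> (\<forall>m. m = i \<or> m = j \<or> m = k)"
    using exhaust_3[of k]
  proof (elim disjE)
    assume "k = 1"
    then show ?thesis using exhaust_3 by (intro exI[of _ 2] exI[of _ 3]) auto
  next
    assume "k = 2"
    then show ?thesis using exhaust_3 by (intro exI[of _ 1] exI[of _ 3]) auto
  next
    assume "k = 3"
    then show ?thesis using exhaust_3 by (intro exI[of _ 1] exI[of _ 2]) auto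
  qed
  then obtain i j where ij: "i \<noteq> j" "i \<noteq> k" "j \<noteq> k" "\<And>m. m = i \<or> m = j \<or> m = k" by blast
  define cZ where "cZ = (\<lambda>u::'a^3. inverse (P $ k) * u $ k)"
  define cX where "cX = (\<lambda>u::'a^3. u $ i - P $ i * cZ u)"
  define cY where "cY = (\<lambda>u::'a^3. u $ j - P $ j * cZ u)"
  have cZ: "form UNIV 1 cZ" unfolding cZ_def by (intro formU)
  have cX: "form UNIV 1 cX" unfolding cX_def by (intro formU cZ)
  have cY: "form UNIV 1 cY" unfolding cY_def by (intro formU cZ)
  have *: "u = cX u *s axis i 1 + cY u *s axis j 1 + cZ u *s P" for u
  proof (subst vec_eq_iff, rule allI)
    fix m
    show "u $ m = (cX u *s axis i 1 + cY u *s axis j 1 + cZ u *s P) $ m"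
      using ij(4)[of m] ij(1-3) k by (auto simp: cX_def cY_def cZ_def axis_def)
  qed
  show ?thesis
    by (rule that[OF cX cY cZ *]) (use ij k in \<open>auto simp: cX_def cY_def cZ_def axis_def\<close>)
qed

section \<open>Projection of the curve from a point off it\<close>

locale plane_curve_pt = plane_curve F d D
  for F :: "'K::alg_closed_field ^ 3 \<Rightarrow> 'K" and d :: nat and D :: "3 \<Rightarrow> 'K ^ 3 \<Rightarrow> 'K" +
  fixes P b1 b2 :: "'K ^ 3" and cX cY cZ :: "'K ^ 3 \<Rightarrow> 'K"
  assumes FP: "F P \<noteq> 0" and DP: "\<not> van (DV P)"
    and fX: "form UNIV 1 cX" and fY: "form UNIV 1 cY" and fZ: "form UNIV 1 cZ"
    and basis: "\<And>u. u = cX u *s b1 + cY u *s b2 + cZ u *s P"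
    and XP [simp]: "cX P = 0" and YP [simp]: "cY P = 0" and ZP [simp]: "cZ P = 1"
    and Xb1 [simp]: "cX b1 = 1" and Yb1 [simp]: "cY b1 = 0" and Zb1 [simp]: "cZ b1 = 0"
    and Xb2 [simp]: "cX b2 = 0" and Yb2 [simp]: "cY b2 = 1" and Zb2 [simp]: "cZ b2 = 0"
begin

lemmas linX [simp] = form_one_linear[OF fX]
lemmas linY [simp] = form_one_linear[OF fY]
lemmas linZ [simp] = form_one_linear[OF fZ]

text \<open>Forms on the base of the projection: invariance under translation by multiples of
  \<open>P\<close> means that only \<open>cX\<close> and \<open>cY\<close> occur
  (\<open>bform_binary\<close>).\<close>

definition bform :: "int \<Rightarrow> ('K ^ 3 \<Rightarrow> 'K) \<Rightarrow> bool" where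
  "bform n c \<longleftrightarrow> form UNIV n c \<and> (\<forall>u t. c (u + t *s P) = c u)"

lemma bform_zero: "bform n (\<lambda>u. 0)" by (simp add: bform_def formU)
lemma bform_const: "bform 0 (\<lambda>u. c)" by (simp add: bform_def form_const)
lemma bform_add: "bform n a \<Longrightarrow> bform n b \<Longrightarrow> bform n (\<lambda>u. a u + b u)" by (simp add: bform_def formU)
lemma bform_diff: "bform n a \<Longrightarrow> bform n b \<Longrightarrow> bform n (\<lambda>u. a u - b u)" by (simp add: bform_def formU)
lemma bform_cmult: "bform n a \<Longrightarrow> bform n (\<lambda>u. c * a u)" by (simp add: bform_def formU)
lemma bform_mult: "bform n a \<Longrightarrow> bform m b \<Longrightarrow> n + m = l \<Longrightarrow> bform l (\<lambda>u. a u * b u)"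
  by (auto simp: bform_def intro: form_mult_deg)
lemma bform_neg: "bform n a \<Longrightarrow> n < 0 \<Longrightarrow> a u = 0" by (auto simp: bform_def form_neg)
lemma bform_X: "bform 1 cX" and bform_Y: "bform 1 cY" by (simp_all add: bform_def fX fY)

lemma coord: "u $ i = (b1 $ i * cX u + b2 $ i * cY u) + P $ i * cZ u"
proof -
  have "u $ i = (cX u *s b1 + cY u *s b2 + cZ u *s P) $ i" using basis[of u] by simp
  then show ?thesis by (simp add: mult.commute)
qed

lemma form_expand:
  assumes "form UNIV e f"
  shows "\<exists>c. (\<forall>i. bform (e - int i) (c i)) \<and> (\<forall>u. f u = (\<Sum>i<nat (e + 1). c i u * cZ u ^ i))"
  using assms
proof (induction rule: form_UNIV_induct)
  case (zero e)
  show ?case by (rule exI[of _ "\<lambda>i u. 0"]) (simp add: bform_zero)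
next
  case (const c)
  show ?case by (rule exI[of _ "\<lambda>i. if i = 0 then (\<lambda>u. c) else (\<lambda>u. 0)"]) (simp add: bform_zero bform_const)
next
  case (var e f j)
  show ?case
  proof (cases "e \<ge> 0")
    case False
    then have "f x = 0" for x using form_neg[OF var(1)] by simp
    then show ?thesis by (intro exI[of _ "\<lambda>i u. 0"]) (simp add: bform_zero)
  next
    case True
    obtain c where c: "\<And>i. bform (e - int i) (c i)" "\<And>u. f u = (\<Sum>i<nat (e + 1). c i u * cZ u ^ i)"
      using var(2) by blast
    define N where "N = nat (e + 1)"
    have N: "nat (e + 1 + 1) = Suc N" "int N = e + 1" using True by (auto simp: N_def)
    \<comment> \<open>Coordinate \<open>j\<close> equals a linear form in \<open>cX\<close> and
      \<open>cY\<close> plus \<open>P $ j * cZ\<close>; the second part shifts the coefficients by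
      one power of \<open>cZ\<close>.\<close>
    define c' where "c' = (\<lambda>i u. (b1 $ j * cX u + b2 $ j * cY u) * c i u + P $ j * (case i of 0 \<Rightarrow> 0 | Suc k \<Rightarrow> c k u))"
    have "bform (e + 1 - int i) (c' i)" for i
    proof -
      have "bform (e + 1 - int i) (\<lambda>u. case i of 0 \<Rightarrow> 0 | Suc k \<Rightarrow> c k u)"
        using c(1)[of "i - 1"] by (cases i) (auto simp: bform_zero)
      moreover have "bform (e + 1 - int i) (\<lambda>u. (b1 $ j * cX u + b2 $ j * cY u) * c i u)"
        by (rule bform_mult[OF bform_add[OF bform_cmult[OF bform_X] bform_cmult[OF bform_Y]] c(1)[of i]]) simp
      ultimately show ?thesis unfolding c'_def by (intro bform_add bform_cmult)
    qed
    moreover have "u $ j * f u = (\<Sum>i<Suc N. c' i u * cZ u ^ i)" for u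
    proof -
      have z: "c N u = 0" using bform_neg[OF c(1)[of N]] N(2) by simp
      have "(\<Sum>i<Suc N. c' i u * cZ u ^ i) = (b1 $ j * cX u + b2 $ j * cY u) * (\<Sum>i<Suc N. c i u * cZ u ^ i)
         + P $ j * (\<Sum>i<Suc N. (case i of 0 \<Rightarrow> 0 | Suc k \<Rightarrow> c k u) * cZ u ^ i)"
        unfolding c'_def sum_distrib_left sum.distrib[symmetric] by (rule sum.cong) (simp_all only: algebra_simps)
      also have "(\<Sum>i<Suc N. c i u * cZ u ^ i) = f u" using z c(2) by (simp add: N_def)
      also have "(\<Sum>i<Suc N. (case i of 0 \<Rightarrow> 0 | Suc k \<Rightarrow> c k u) * cZ u ^ i) = cZ u * f u"
        by (subst sum.lessThan_Suc_shift) (simp add: c(2) N_def sum_distrib_left algebra_simps)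
      finally show ?thesis unfolding coord[of u j] by (simp add: algebra_simps)
    qed
    ultimately show ?thesis unfolding N(1) by blast
  qed
next
  case (add e f g)
  obtain c where c: "\<And>i. bform (e - int i) (c i)" "\<And>u. f u = (\<Sum>i<nat (e + 1). c i u * cZ u ^ i)" using add(3) by blast
  obtain c' where c': "\<And>i. bform (e - int i) (c' i)" "\<And>u. g u = (\<Sum>i<nat (e + 1). c' i u * cZ u ^ i)" using add(4) by blast
  show ?case
    by (rule exI[of _ "\<lambda>i u. c i u + c' i u"]) (simp add: bform_add c c' sum.distrib distrib_right)
qed

lemma F_monic:
  obtains b where "\<And>i. bform (int d - int i) (b i)" "\<And>u. F u = F P * cZ u ^ d + (\<Sum>i<d. b i u * cZ u ^ i)"
proof -
  obtain c where c: "\<And>i. bform (int d - int i) (c i)" "\<And>u. F u = (\<Sum>i<nat (int d + 1). c i u * cZ u ^ i)"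
    using form_expand[OF form_F] by blast
  have n: "nat (int d + 1) = Suc d" by simp
  have eq: "F u = (\<Sum>i<d. c i u * cZ u ^ i) + c d u * cZ u ^ d" for u unfolding c(2) n by simp
  have const: "c d u = c d 0" for u using form_0_const[of UNIV "c d" u] c(1)[of d] by (simp add: bform_def)
  \<comment> \<open>Evaluation at \<open>P\<close> isolates the top coefficient: the others have
    positive degree, and being invariant along \<open>P\<close> they take there their value at
    0.\<close>
  have "c i P = 0" if "i < d" for i
  proof -
    have "c i (0 + 1 *s P) = c i 0" using c(1)[of i] unfolding bform_def by blast
    also have "\<dots> = 0" using form_at_0[of UNIV "int d - int i" "c i"] c(1)[of i] that by (simp add: bform_def)
    finally show ?thesis by simp
  qed
  then have "F P = c d P" by (simp add: eq[of P])
  then have cd: "c d u = F P" for u using const[of u] const[of P] by simp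
  show ?thesis
  proof (rule that[of c])
    show "F u = F P * cZ u ^ d + (\<Sum>i<d. c i u * cZ u ^ i)" for u
      using eq[of u] cd[of u] by (simp only: add.commute)
  qed (rule c(1))
qed

text \<open>Division by F, which is monic in \<open>cZ\<close> up to the constant
  \<open>F P\<close>. Multiplying by a coordinate raises the remainder to degree at most d in
  \<open>cZ\<close>, and its top term is removed by a multiple of F.\<close>

lemma form_reduce:
  assumes "form UNIV e f"
  shows "\<exists>Q c. form UNIV (e - int d) Q \<and> (\<forall>i. bform (e - int i) (c i)) \<and> (\<forall>u. f u = F u * Q u + (\<Sum>i<d. c i u * cZ u ^ i))"
  using assms
proof (induction rule: form_UNIV_induct)
  case (zero e)
  show ?case by (rule exI[of _ "\<lambda>u. 0"], rule exI[of _ "\<lambda>i u. 0"]) (simp add: bform_zero formU)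
next
  case (const c)
  obtain d' where d': "d = Suc d'" using d_ge by (cases d) auto
  have "(\<Sum>i<d. (if i = 0 then (\<lambda>u. c) else (\<lambda>u. 0)) u * cZ u ^ i) = c" for u
    unfolding d' by (subst sum.lessThan_Suc_shift) simp
  then show ?case
    by (intro exI[of _ "\<lambda>u. 0"], intro exI[of _ "\<lambda>i. if i = 0 then (\<lambda>u. c) else (\<lambda>u. 0)"])
      (simp add: bform_zero bform_const formU)
next
  case (var e f j)
  obtain Q c where Q: "form UNIV (e - int d) Q" and c: "\<And>i. bform (e - int i) (c i)"
    and f: "\<And>u. f u = F u * Q u + (\<Sum>i<d. c i u * cZ u ^ i)" using var(2) by blast
  obtain b where b: "\<And>i. bform (int d - int i) (b i)" "\<And>u. F u = F P * cZ u ^ d + (\<Sum>i<d. b i u * cZ u ^ i)"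
    using F_monic by blast
  obtain d' where d': "d = Suc d'" using d_ge by (cases d) auto
  define l where "l = (\<lambda>u. b1 $ j * cX u + b2 $ j * cY u)"
  \<comment> \<open>Chosen such that \<open>k * F P = P $ j\<close>; then
    \<open>k * c d' u * F u\<close> accounts for the term of degree d in \<open>cZ\<close>.\<close>
  define k where "k = P $ j * inverse (F P)"
  define Q' where "Q' = (\<lambda>u. u $ j * Q u + k * c d' u)"
  define c' where "c' = (\<lambda>i u. l u * c i u + (P $ j * (case i of 0 \<Rightarrow> 0 | Suc m \<Rightarrow> c m u) - k * (c d' u * b i u)))"
  have "form UNIV (e + 1 - int d) Q'"
    unfolding Q'_def
  proof (rule formU(1))
    show "form UNIV (e + 1 - int d) (\<lambda>x. x $ j * Q x)" by (rule form_mult_deg[OF formU(9) Q]) simp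
    show "form UNIV (e + 1 - int d) (\<lambda>x. k * c d' x)"
      by (rule formU(4), rule form_deg_cong[of _ "e - int d'"]) (use c[of d'] d' in \<open>auto simp: bform_def\<close>)
  qed
  moreover have "bform (e + 1 - int i) (c' i)" for i
  proof -
    have "bform (e + 1 - int i) (\<lambda>u. case i of 0 \<Rightarrow> 0 | Suc m \<Rightarrow> c m u)"
      using c[of "i - 1"] by (cases i) (auto simp: bform_zero)
    moreover have "bform (e + 1 - int i) (\<lambda>u. l u * c i u)"
      unfolding l_def by (rule bform_mult[OF bform_add[OF bform_cmult[OF bform_X] bform_cmult[OF bform_Y]] c[of i]]) simp
    moreover have "bform (e + 1 - int i) (\<lambda>u. c d' u * b i u)"
      by (rule bform_mult[OF c[of d'] b(1)[of i]]) (use d' in simp)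
    ultimately show ?thesis unfolding c'_def by (intro bform_add bform_diff bform_cmult)
  qed
  moreover have "u $ j * f u = F u * Q' u + (\<Sum>i<d. c' i u * cZ u ^ i)" for u
  proof -
    have s1: "(\<Sum>i<d. c' i u * cZ u ^ i) = l u * (\<Sum>i<d. c i u * cZ u ^ i)
        + P $ j * (\<Sum>i<d. (case i of 0 \<Rightarrow> 0 | Suc m \<Rightarrow> c m u) * cZ u ^ i) - k * c d' u * (\<Sum>i<d. b i u * cZ u ^ i)"
      unfolding c'_def sum_distrib_left sum.distrib[symmetric] sum_subtractf[symmetric]
      by (rule sum.cong) (simp_all only: algebra_simps)
    have s2: "(\<Sum>i<d. (case i of 0 \<Rightarrow> 0 | Suc m \<Rightarrow> c m u) * cZ u ^ i) = cZ u * (\<Sum>i<d'. c i u * cZ u ^ i)"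
      unfolding d' by (subst sum.lessThan_Suc_shift) (simp add: sum_distrib_left algebra_simps)
    have s3: "(\<Sum>i<d. c i u * cZ u ^ i) = (\<Sum>i<d'. c i u * cZ u ^ i) + c d' u * cZ u ^ d'" unfolding d' by simp
    have s4: "(\<Sum>i<d. b i u * cZ u ^ i) = F u - F P * cZ u ^ d" using b(2)[of u] by simp
    have s5: "cZ u ^ d = cZ u * cZ u ^ d'" unfolding d' by simp
    have kF: "k * F P = P $ j" using FP by (simp add: k_def)
    have "F u * Q' u + (\<Sum>i<d. c' i u * cZ u ^ i) = F u * (u $ j) * Q u + l u * (\<Sum>i<d. c i u * cZ u ^ i)
       + P $ j * cZ u * (\<Sum>i<d'. c i u * cZ u ^ i) + (k * F P) * c d' u * (cZ u * cZ u ^ d')"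
      unfolding s1 s2 s4 s5 Q'_def by (simp add: algebra_simps)
    also have "\<dots> = F u * (u $ j) * Q u + (l u + P $ j * cZ u) * (\<Sum>i<d. c i u * cZ u ^ i)"
      unfolding kF s3 by (simp add: algebra_simps)
    also have "l u + P $ j * cZ u = u $ j" unfolding coord[of u j] l_def by simp
    finally show ?thesis unfolding f by (simp add: algebra_simps)
  qed
  ultimately show ?case by blast
next
  case (add e f g)
  obtain Q c where 1: "form UNIV (e - int d) Q" "\<And>i. bform (e - int i) (c i)"
    "\<And>u. f u = F u * Q u + (\<Sum>i<d. c i u * cZ u ^ i)" using add(3) by blast
  obtain Q' c' where 2: "form UNIV (e - int d) Q'" "\<And>i. bform (e - int i) (c' i)"
    "\<And>u. g u = F u * Q' u + (\<Sum>i<d. c' i u * cZ u ^ i)" using add(4) by blast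
  show ?case
    by (rule exI[of _ "\<lambda>u. Q u + Q' u"], rule exI[of _ "\<lambda>i u. c i u + c' i u"])
      (auto simp: bform_add 1 2 sum.distrib algebra_simps intro: formU)
qed

lemma bform_binary:
  assumes "bform n c"
  obtains p where "degree p \<le> nat n" "\<And>u. c u = binary (nat n) p (cX u) (cY u)"
proof -
  obtain p where p: "degree p \<le> nat n" "\<And>s t. c (s *s b1 + t *s b2) = binary (nat n) p s t"
    using form_binary_line[of n c b1 b2] assms by (auto simp: bform_def)
  have "c u = binary (nat n) p (cX u) (cY u)" for u
  proof -
    have "c u = c (cX u *s b1 + cY u *s b2 + cZ u *s P)" using basis[of u] by simp
    then show ?thesis using assms p(2) by (simp add: bform_def)
  qed
  then show ?thesis using that p(1) by blast
qed

lemma fiber: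
  obtains q where "degree q = d" "\<And>z. F (w + z *s P) = poly q z"
proof -
  obtain q where q: "degree q \<le> d" "\<And>s t. F (s *s w + t *s P) = binary d q s t"
    using form_binary_line[OF form_F, of w P] by auto
  have "F P = coeff q d" using q(2)[of 0 1] by (simp add: binary_zero_one)
  then have "degree q = d" using q(1) FP le_degree[of q d] by auto
  moreover have "F (w + z *s P) = poly q z" for z using q(2)[of 1 z] binary_one[OF q(1)] by simp
  ultimately show ?thesis using that by blast
qed

lemma C_XY: "u \<in> C \<Longrightarrow> cX u \<noteq> 0 \<or> cY u \<noteq> 0"
proof (rule ccontr)
  assume u: "u \<in> C" "\<not> (cX u \<noteq> 0 \<or> cY u \<noteq> 0)"
  then have eq: "u = cZ u *s P" using basis[of u] by simp
  have "F (cZ u *s P) = 0" using u(1) eq by (simp add: C_def)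
  then have "cZ u = 0" using form_scale_eq_0[OF form_F, of "cZ u" P] FP by auto
  then show False using u(1) eq by (auto simp: C_def)
qed

lemma fiber_in_C: "cX w \<noteq> 0 \<or> cY w \<noteq> 0 \<Longrightarrow> F (w + z *s P) = 0 \<Longrightarrow> w + z *s P \<in> C"
proof -
  assume a: "cX w \<noteq> 0 \<or> cY w \<noteq> 0" "F (w + z *s P) = 0"
  have "cX (w + z *s P) \<noteq> 0 \<or> cY (w + z *s P) \<noteq> 0" using a(1) by simp
  then have "w + z *s P \<noteq> 0" by (metis form_at_0[OF fX, simplified] form_at_0[OF fY, simplified])
  then show ?thesis using a(2) by (simp add: C_def)
qed

text \<open>Every line through \<open>P\<close> meets the curve, since F restricted to it has degree
  d. A binary form vanishing on the curve therefore vanishes on the whole base.\<close>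

lemma binary_not_van:
  assumes "p \<noteq> 0" "degree p \<le> n"
  shows "\<not> van (\<lambda>u. binary n p (cX u) (cY u))"
proof -
  obtain t where t: "poly p t \<noteq> 0" using assms(1) poly_zero_fun by blast
  define w where "w = b1 + t *s b2"
  obtain q where q: "degree q = d" "\<And>z. F (w + z *s P) = poly q z" using fiber[of w] by blast
  then obtain z where z: "poly q z = 0" using alg_closed_imp_poly_has_root[of q] d_ge by auto
  have "w + z *s P \<in> C" using fiber_in_C[of w z] q(2) z by (simp add: w_def)
  moreover have "binary n p (cX (w + z *s P)) (cY (w + z *s P)) \<noteq> 0"
    using t binary_one[OF assms(2)] by (simp add: w_def)
  ultimately show ?thesis unfolding van_def by blast
qed

end

section \<open>Binary multiples, the ideal of the curve, and division\<close>

context plane_curve_pt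
begin

text \<open>A dimension count: modulo \<open>F\<close> there are about \<open>d N\<close> independent forms of degree \<open>N\<close>, while the
  monomials in \<open>X\<close>, \<open>Y\<close>, \<open>H\<close> of degree \<open>N\<close> grow quadratically in number. The relation obtained makes a
  multiple of \<open>H\<close> a binary form.\<close>

lemma multiple_binary:
  assumes H: "form UNIV (int h) H" and nv: "\<not> van H"
  obtains p n V where "p \<noteq> 0" "degree p \<le> n" "form UNIV (int n - int h) V"
    "\<And>u. u \<in> C \<Longrightarrow> H u * V u = binary n p (cX u) (cY u)"
proof -
  \<comment> \<open>With l at most 2d and k at most 2hd, the monomials
    \<open>cX ^ e * cY ^ k * H ^ l\<close> fit into degree \<open>N\<close>. There are (2d + 1)(2hd
    + 1) of them, more than the d(4hd + 1) coefficients of a reduced form.\<close>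
  define N where "N = 4 * h * d"
  define I where "I = {..2 * d} \<times> {..2 * h * d}"
  define J where "J = {..<d} \<times> {..N}"
  define e where "e = (\<lambda>(l::nat, k::nat). N - h * l - k)"
  have le: "h * l + k \<le> N" if "(l, k) \<in> I" for l k
  proof -
    have "h * l \<le> h * (2 * d)" using that by (intro mult_left_mono) (auto simp: I_def)
    moreover have "k \<le> 2 * h * d" using that by (auto simp: I_def)
    moreover have "h * (2 * d) + 2 * h * d = N" by (simp add: N_def)
    ultimately show ?thesis by linarith
  qed
  define f where "f = (\<lambda>(l, k) u. cX u ^ e (l, k) * cY u ^ k * H u ^ l)"
  have formf: "form UNIV (int N) (f i)" if iI: "i \<in> I" for i
  proof -
    obtain l k where i: "i = (l, k)" by (cases i)
    have "int (e (l, k)) * 1 + int k * 1 + int l * int h = int N"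
      using le[of l k] iI by (simp add: i e_def of_nat_diff algebra_simps flip: of_nat_mult of_nat_add)
    then show ?thesis
      using form_mult[OF is_subring_UNIV form_mult[OF is_subring_UNIV form_power[OF is_subring_UNIV fX, of "e (l, k)"]
        form_power[OF is_subring_UNIV fY, of k]] form_power[OF is_subring_UNIV H, of l]]
      by (simp add: f_def i)
  qed
  have ex: "\<exists>a. \<forall>u\<in>C. f i u = (\<Sum>(j, m)\<in>J. a j m * (cX u ^ (nat (int N - int j) - m) * cY u ^ m * cZ u ^ j))"
    if iI: "i \<in> I" for i
  proof -
    obtain Q c where c: "\<And>j. bform (int N - int j) (c j)" "\<And>u. f i u = F u * Q u + (\<Sum>j<d. c j u * cZ u ^ j)"
      using form_reduce[OF formf[OF iI]] by blast
    have "\<forall>j. \<exists>p. degree p \<le> nat (int N - int j) \<and> (\<forall>u. c j u = binary (nat (int N - int j)) p (cX u) (cY u))"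
      using bform_binary[OF c(1)] by metis
    then obtain p where p: "\<And>j. degree (p j) \<le> nat (int N - int j)"
      "\<And>j u. c j u = binary (nat (int N - int j)) (p j) (cX u) (cY u)" by metis
    have p': "c j u = (\<Sum>m\<le>N. coeff (p j) m * cX u ^ (nat (int N - int j) - m) * cY u ^ m)" for j u
      unfolding p(2) binary_def
      by (rule sum.mono_neutral_left) (use p(1)[of j] in \<open>auto intro!: coeff_eq_0\<close>)
    have "f i u = (\<Sum>(j, m)\<in>J. coeff (p j) m * (cX u ^ (nat (int N - int j) - m) * cY u ^ m * cZ u ^ j))" if "u \<in> C" for u
    proof -
      have "f i u = (\<Sum>j<d. c j u * cZ u ^ j)" using c(2)[of u] that by (simp add: C_def)
      then show ?thesis
        unfolding J_def by (simp add: p' sum.cartesian_product[symmetric] sum_distrib_left sum_distrib_right mult_ac)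
    qed
    then show ?thesis by (intro exI[of _ "\<lambda>j m. coeff (p j) m"]) blast
  qed
  define a where "a = (\<lambda>i. SOME a. \<forall>u\<in>C. f i u = (\<Sum>(j, m)\<in>J. a j m * (cX u ^ (nat (int N - int j) - m) * cY u ^ m * cZ u ^ j)))"
  have a: "f i u = (\<Sum>(j, m)\<in>J. a i j m * (cX u ^ (nat (int N - int j) - m) * cY u ^ m * cZ u ^ j))" if "i \<in> I" "u \<in> C" for i u
    using someI_ex[OF ex[OF that(1)]] that(2) unfolding a_def by blast
  have fin: "finite I" "finite J" by (auto simp: I_def J_def)
  have "card J < card I"
  proof -
    have "d * (4 * h * d + 1) < (2 * d + 1) * (2 * h * d + 1)" using d_ge by (simp add: algebra_simps)
    then show ?thesis unfolding I_def J_def N_def by (simp add: card_cartesian_product)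
  qed
  from homogeneous_system[OF fin(2) fin(1) this, of "\<lambda>i (j, m). a i j m"]
  obtain c where c: "\<exists>i\<in>I. c i \<noteq> 0" "\<And>j m. (j, m) \<in> J \<Longrightarrow> (\<Sum>i\<in>I. c i * a i j m) = 0" by fastforce
  have rel: "(\<Sum>i\<in>I. c i * f i u) = 0" if "u \<in> C" for u
  proof -
    have "(\<Sum>i\<in>I. c i * f i u) = (\<Sum>i\<in>I. \<Sum>(j, m)\<in>J. c i * a i j m * (cX u ^ (nat (int N - int j) - m) * cY u ^ m * cZ u ^ j))"
      by (rule sum.cong) (auto simp: a that sum_distrib_left mult.assoc case_prod_unfold)
    also have "\<dots> = (\<Sum>(j, m)\<in>J. (\<Sum>i\<in>I. c i * a i j m) * (cX u ^ (nat (int N - int j) - m) * cY u ^ m * cZ u ^ j))"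
      by (subst sum.swap) (simp add: case_prod_unfold sum_distrib_right)
    also have "\<dots> = 0" by (rule sum.neutral) (auto simp: c(2))
    finally show ?thesis .
  qed
  define p where "p = (\<lambda>l. \<Sum>k\<le>2 * h * d. monom (c (l, k)) k)"
  have coeffp: "coeff (p l) k = (if k \<le> 2 * h * d then c (l, k) else 0)" for l k
    by (simp add: p_def coeff_sum)
  have degp: "degree (p l) \<le> 2 * h * d" for l
    by (rule degree_le) (simp add: coeffp)
  have degp': "degree (p l) \<le> N - h * l" if "l \<le> 2 * d" for l
  proof -
    have "h * l + 2 * h * d \<le> N" using le[of l "2 * h * d"] that by (simp add: I_def)
    then show ?thesis using degp[of l] by linarith
  qed
  define A where "A = (\<lambda>l u. binary (N - h * l) (p l) (cX u) (cY u))"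
  have A: "A l u = (\<Sum>k\<le>2 * h * d. c (l, k) * (cX u ^ e (l, k) * cY u ^ k))" if "l \<le> 2 * d" for l u
  proof -
    have "2 * h * d \<le> N - h * l" using le[of l "2 * h * d"] that by (simp add: I_def)
    then have "A l u = (\<Sum>k\<le>2 * h * d. coeff (p l) k * cX u ^ (N - h * l - k) * cY u ^ k)"
      unfolding A_def binary_def by (intro sum.mono_neutral_right) (auto simp: coeffp)
    then show ?thesis by (simp add: coeffp e_def mult.assoc)
  qed
  have formA: "form UNIV (int (N - h * l)) (A l)" for l
    unfolding A_def by (rule form_binary[OF fX fY])
  have rel': "(\<Sum>l\<le>2 * d. A l u * H u ^ l) = 0" if "u \<in> C" for u
  proof -
    have "(\<Sum>l\<le>2 * d. A l u * H u ^ l) = (\<Sum>l\<le>2 * d. \<Sum>k\<le>2 * h * d. c (l, k) * f (l, k) u)"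
      by (rule sum.cong) (simp_all add: A f_def sum_distrib_right mult.assoc)
    also have "\<dots> = (\<Sum>i\<in>I. c i * f i u)" unfolding I_def by (simp add: sum.cartesian_product)
    finally show ?thesis using rel[OF that] by simp
  qed
  \<comment> \<open>The lowest power of \<open>H\<close> with nonzero coefficient is divided out of
    the relation. Its coefficient \<open>A l0\<close> is a binary form, and the remaining terms, all
    divisible by \<open>H\<close>, make up \<open>- H u * V u\<close>.\<close>
  obtain l0 where l0: "l0 \<le> 2 * d" "p l0 \<noteq> 0" "\<And>l. l < l0 \<Longrightarrow> p l = 0"
  proof -
    obtain l k where "(l, k) \<in> I" "c (l, k) \<noteq> 0" using c(1) by auto
    then have "l \<le> 2 * d" "coeff (p l) k \<noteq> 0" by (auto simp: coeffp I_def)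
    then have l: "l \<le> 2 * d" "p l \<noteq> 0" by auto
    have "(LEAST l. p l \<noteq> 0) \<le> l" using l(2) by (rule Least_le)
    moreover have "p (LEAST l. p l \<noteq> 0) \<noteq> 0" using l(2) by (rule LeastI)
    ultimately show ?thesis using that[of "LEAST l. p l \<noteq> 0"] l(1) not_less_Least by fastforce
  qed
  define V where "V = (\<lambda>u. - (\<Sum>l\<in>{l0<..2 * d}. A l u * H u ^ (l - l0 - 1)))"
  have formV: "form UNIV (int (N - h * l0) - int h) V"
    unfolding V_def
  proof (intro formU(8) formU(2))
    fix l assume l: "l \<in> {l0<..2 * d}"
    have 1: "h * l \<le> N" using le[of l 0] l by (simp add: I_def)
    have 2: "h * l0 \<le> N" using le[of l0 0] l by (simp add: I_def)
    have "int (N - h * l) + int (l - l0 - 1) * int h = int (N - h * l0) - int h"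
      using 1 2 l by (simp add: of_nat_diff algebra_simps)
    then show "form UNIV (int (N - h * l0) - int h) (\<lambda>u. A l u * H u ^ (l - l0 - 1))"
      by (rule form_mult_deg[OF formA form_power[OF is_subring_UNIV H]])
  qed
  have factor: "(\<Sum>l\<le>2 * d. A l u * H u ^ l) = H u ^ l0 * (A l0 u - H u * V u)" for u
  proof -
    have "(\<Sum>l\<le>2 * d. A l u * H u ^ l) = (\<Sum>l\<in>insert l0 {l0<..2 * d}. A l u * H u ^ l)"
      by (rule sum.mono_neutral_right) (use l0 in \<open>auto simp: A_def not_less le_less\<close>)
    also have "\<dots> = A l0 u * H u ^ l0 + (\<Sum>l\<in>{l0<..2 * d}. A l u * H u ^ l)" by simp
    also have "(\<Sum>l\<in>{l0<..2 * d}. A l u * H u ^ l) = (\<Sum>l\<in>{l0<..2 * d}. (H u ^ l0 * H u) * (A l u * H u ^ (l - l0 - 1)))"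
    proof (rule sum.cong)
      fix l assume "l \<in> {l0<..2 * d}"
      then have "l = l0 + 1 + (l - l0 - 1)" by auto
      then have "H u ^ l = H u ^ l0 * H u * H u ^ (l - l0 - 1)"
        by (metis power_add power_one_right)
      then show "A l u * H u ^ l = (H u ^ l0 * H u) * (A l u * H u ^ (l - l0 - 1))" by (simp only: mult_ac)
    qed simp
    finally show ?thesis unfolding V_def sum_distrib_left[symmetric] by (simp add: algebra_simps)
  qed
  show ?thesis
  proof (rule that[OF l0(2) degp'[OF l0(1)] formV])
    fix u assume u: "u \<in> C"
    have fHV: "form UNIV (int (N - h * l0)) (\<lambda>u. H u * V u)"
      by (rule form_mult_deg[OF H formV]) simp
    have "A l0 u = H u * V u"
    proof (rule van_cancel[OF form_power[OF is_subring_UNIV H, of l0] van_power[OF H nv] formA fHV _ u])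
      fix x assume "x \<in> C"
      then show "H x ^ l0 * A l0 x = H x ^ l0 * (H x * V x)"
        using rel'[of x] factor[of x] by (auto simp: algebra_simps)
    qed
    then show "H u * V u = binary (N - h * l0) (p l0) (cX u) (cY u)" by (simp add: A_def)
  qed
qed

text \<open>Zeros of \<open>H\<close> lie over zeros of a binary multiple of \<open>H\<close>; there
  are finitely many of those, and every fibre of the projection is finite.\<close>

lemma finite_zeros_pt:
  assumes H: "form UNIV (int h) H" and nv: "\<not> van H"
  shows "\<exists>S. finite S \<and> S \<subseteq> C \<and> (\<forall>x\<in>C. H x = 0 \<longrightarrow> (\<exists>c z. z \<in> S \<and> c \<noteq> 0 \<and> x = c *s z))"
proof -
  obtain p n V where p: "p \<noteq> 0" "degree p \<le> n" and "form UNIV (int n - int h) V"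
    and p3: "\<And>u. u \<in> C \<Longrightarrow> H u * V u = binary n p (cX u) (cY u)"
    by (rule multiple_binary[OF H nv]) (rule that)
  \<comment> \<open>The vector \<open>b2\<close> stands for the base point at infinity, which the
    roots of \<open>p\<close> do not record.\<close>
  define B where "B = insert b2 ((\<lambda>t. b1 + t *s b2) ` {t. poly p t = 0})"
  define S where "S = (\<Union>w\<in>B. (\<lambda>z. w + z *s P) ` {z. F (w + z *s P) = 0})"
  have finB: "finite B" unfolding B_def using poly_roots_finite[OF p(1)] by simp
  have "finite {z. F (w + z *s P) = 0}" for w
  proof -
    obtain q where q: "degree q = d" "\<And>z. F (w + z *s P) = poly q z" using fiber[of w] by blast
    then have "q \<noteq> 0" using d_ge by auto
    then show ?thesis unfolding q(2) by (rule poly_roots_finite)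
  qed
  then have "finite S" using finB by (auto simp: S_def)
  moreover have "S \<subseteq> C"
  proof
    fix x assume "x \<in> S"
    then obtain w z where "w \<in> B" "F (w + z *s P) = 0" "x = w + z *s P" by (auto simp: S_def)
    moreover have "cX w \<noteq> 0 \<or> cY w \<noteq> 0" using \<open>w \<in> B\<close> by (auto simp: B_def)
    ultimately show "x \<in> C" using fiber_in_C by blast
  qed
  moreover have "\<exists>c z. z \<in> S \<and> c \<noteq> 0 \<and> x = c *s z" if x: "x \<in> C" "H x = 0" for x
  proof -
    have bin: "binary n p (cX x) (cY x) = 0" using p3[OF x(1)] x(2) by simp
    obtain c w where cw: "c \<noteq> 0" "w \<in> B" "cX x *s b1 + cY x *s b2 = c *s w"
    proof (cases "cX x = 0")
      case True
      then have "cY x \<noteq> 0" using C_XY[OF x(1)] by simp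
      then show ?thesis using that[of "cY x" b2] True by (simp add: B_def)
    next
      case False
      let ?t = "cY x / cX x"
      have scale: "binary n p (c * s) (c * t) = c ^ n * binary n p s t" for c s t
        unfolding binary_def sum_distrib_left
        by (rule sum.cong) (auto simp: power_mult_distrib mult_ac simp flip: power_add)
      have "cX x * 1 = cX x" "cX x * ?t = cY x" using False by simp_all
      then have "cX x ^ n * binary n p 1 ?t = 0" using scale[of "cX x" 1 ?t] bin by (simp only:)
      then have "poly p ?t = 0" using False binary_one[OF p(2), of ?t] by simp
      then have "b1 + ?t *s b2 \<in> B" unfolding B_def by blast
      then show ?thesis using that[of "cX x" "b1 + ?t *s b2"] False
        by (simp add: vector_add_ldistrib vector_smult_assoc)
    qed
    define z where "z = w + (cZ x / c) *s P"
    have xz: "x = c *s z"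
      using basis[of x] cw by (simp add: z_def vector_add_ldistrib vector_smult_assoc)
    then have "F z = 0" using form_scale_eq_0[OF form_F cw(1)] x(1) by (auto simp: C_def)
    then have "z \<in> S" using cw(2) by (auto simp: S_def z_def)
    then show ?thesis using xz cw(1) by blast
  qed
  ultimately show ?thesis by blast
qed

text \<open>Reduction modulo F leaves a remainder of degree less than d in \<open>cZ\<close>. Over a
  general base point the fibre consists of d distinct points, at which the remainder vanishes, so
  its coefficients vanish over these base points and then, by primality, identically.\<close>

lemma van_multiple_pt:
  assumes G: "form UNIV e G" and "van G"
  shows "\<exists>Q. form UNIV (e - int d) Q \<and> (\<forall>u. G u = F u * Q u)"
proof -
  obtain Q c where Q: "form UNIV (e - int d) Q" "\<And>i. bform (e - int i) (c i)"
    "\<And>u. G u = F u * Q u + (\<Sum>i<d. c i u * cZ u ^ i)" using form_reduce[OF G] by blast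
  have "form UNIV (int (d - 1)) (DV P)" using form_DV[of P] d_ge by (simp add: of_nat_diff)
  \<comment> \<open>A binary multiple of \<open>DV P\<close> replaces the discriminant: where it is
    nonzero, the fibre has only simple points.\<close>
  then obtain p n V where p: "p \<noteq> 0" "degree p \<le> n" and "form UNIV (int n - int (d - 1)) V"
    and p3: "\<And>u. u \<in> C \<Longrightarrow> DV P u * V u = binary n p (cX u) (cY u)"
    by (rule multiple_binary[OF _ DP]) (rule that)
  have c0: "c i u = 0" if "i < d" for i u
  proof -
    have "van (c i)"
    proof (rule van_prime[OF form_binary[OF fX fY] _ _ binary_not_van[OF p(1,2)]])
      show "form UNIV (e - int i) (c i)" using Q(2) by (simp add: bform_def)
      fix x assume x: "x \<in> C"
      show "binary n p (cX x) (cY x) * c i x = 0"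
      proof (cases "binary n p (cX x) (cY x) = 0")
        case False
        define w where "w = cX x *s b1 + cY x *s b2"
        have w: "cX w = cX x" "cY w = cY x" "cZ w = 0" by (simp_all add: w_def)
        have XY: "cX w \<noteq> 0 \<or> cY w \<noteq> 0" using C_XY[OF x] w by simp
        obtain q where q: "degree q = d" "\<And>z. F (w + z *s P) = poly q z" using fiber[of w] by blast
        obtain q' where q': "\<And>t. F (w + t *s P) = poly q' t" "\<And>t. poly (pderiv q') t = DV P (w + t *s P)"
          using line_DV[of w P] by blast
        have "poly (q - q') t = 0" for t using q(2)[of t] q'(1)[of t] by simp
        then have qq: "q = q'" using poly_zero_fun by (metis eq_iff_diff_eq_0)
        have q0: "q \<noteq> 0" using q(1) d_ge by auto
        have inC: "w + z *s P \<in> C" if "poly q z = 0" for z using fiber_in_C[OF XY] q(2) that by simp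
        have "card {z. poly q z = 0} = d" unfolding q(1)[symmetric]
        proof (rule card_roots_eq_degree[OF q0])
          fix z assume "poly q z = 0"
          from p3[OF inC[OF this]] show "poly (pderiv q) z \<noteq> 0" using False w q'(2) qq by auto
        qed
        moreover define r where "r = (\<Sum>i<d. monom (c i x) i)"
        have rz: "poly r z = 0" if z: "poly q z = 0" for z
        proof -
          have ci: "c i (w + z *s P) = c i x" for i
          proof -
            have "c i x = c i (w + cZ x *s P)" using basis[of x] by (simp add: w_def)
            then show ?thesis using Q(2)[of i] by (simp add: bform_def)
          qed
          have "0 = G (w + z *s P)" using vanD[OF assms(2) inC[OF z]] by simp
          also have "\<dots> = (\<Sum>i<d. c i (w + z *s P) * cZ (w + z *s P) ^ i)"
            using Q(3)[of "w + z *s P"] inC[OF z] by (simp add: C_def)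
          also have "\<dots> = poly r z" by (simp add: r_def poly_sum poly_monom ci w)
          finally show ?thesis by simp
        qed
        have "r = 0"
        proof (rule ccontr)
          assume r0: "r \<noteq> 0"
          have "{z. poly q z = 0} \<subseteq> {z. poly r z = 0}" using rz by auto
          then have "d \<le> card {z. poly r z = 0}"
            using \<open>card {z. poly q z = 0} = d\<close> poly_roots_finite[OF r0] card_mono by metis
          also have "\<dots> \<le> degree r" by (rule card_poly_roots_bound[OF r0])
          also have "degree r \<le> d - 1"
            unfolding r_def by (rule degree_sum_le) (auto intro: order_trans[OF degree_monom_le])
          finally show False using d_ge by simp
        qed
        then have "coeff r i = 0" by simp
        then show ?thesis using that by (simp add: r_def coeff_sum)
      qed simp
    qed
    moreover obtain pi where "degree pi \<le> nat (e - int i)" "\<And>u. c i u = binary (nat (e - int i)) pi (cX u) (cY u)"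
      using bform_binary[OF Q(2)] by metis
    ultimately show ?thesis using binary_not_van[of pi "nat (e - int i)"]
      by (cases "pi = 0") (auto simp: van_def)
  qed
  show ?thesis using Q(1,3) c0 by (intro exI[of _ Q]) simp
qed

text \<open>On the line \<open>\<alpha> * cX + \<beta> * cY = 0\<close> through \<open>P\<close>,
  the local conditions make the restriction of \<open>G\<close> locally divisible by that of F at
  each zero of the latter, hence divisible. Subtracting a multiple of F yields a form that vanishes
  on the line, and such a form is divisible by the linear form.\<close>

lemma divide_linear_pt:
  assumes ab: "\<alpha> \<noteq> 0 \<or> \<beta> \<noteq> 0" and G: "form UNIV e G"
    and loc: "\<And>x. x \<in> C \<Longrightarrow> \<alpha> * cX x + \<beta> * cY x = 0 \<Longrightarrow>
      \<exists>a V U. form UNIV a V \<and> form UNIV (a + e - 1) U \<and> V x \<noteq> 0 \<and> (\<forall>y\<in>C. V y * G y = (\<alpha> * cX y + \<beta> * cY y) * U y)"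
  shows "\<exists>G1. form UNIV (e - 1) G1 \<and> (\<forall>y\<in>C. G y = (\<alpha> * cX y + \<beta> * cY y) * G1 y)"
proof -
  define l where "l = (\<lambda>u. \<alpha> * cX u + \<beta> * cY u)"
  \<comment> \<open>The line is spanned by \<open>w\<close> and \<open>P\<close>, with coordinates
    \<open>\<mu>\<close> and \<open>cZ\<close>; the vector \<open>v\<close> with
    \<open>l v = 1\<close> points out of it.\<close>
  define w where "w = \<beta> *s b1 - \<alpha> *s b2"
  define \<mu> where "\<mu> = (\<lambda>u. if \<beta> \<noteq> 0 then inverse \<beta> * cX u else - inverse \<alpha> * cY u)"
  define v where "v = (if \<beta> \<noteq> 0 then inverse \<beta> *s b2 else inverse \<alpha> *s b1)"
  have sub: "cX (a - b) = cX a - cX b" "cY (a - b) = cY a - cY b" "cZ (a - b) = cZ a - cZ b" for a b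
    using linX(1)[of "a - b" b] linY(1)[of "a - b" b] linZ(1)[of "a - b" b] by simp_all
  have fl: "form UNIV 1 l" unfolding l_def by (intro formU fX fY)
  have fmu: "form UNIV 1 \<mu>" unfolding \<mu>_def by (cases "\<beta> \<noteq> 0") (auto intro!: formU fX fY)
  have wXY: "cX w = \<beta>" "cY w = - \<alpha>" "cZ w = 0" by (simp_all add: w_def sub)
  have lv: "l v = 1" using ab by (auto simp: l_def v_def)
  have muw: "\<mu> w = 1" using ab by (auto simp: \<mu>_def wXY)
  have ker: "u = \<mu> u *s w + cZ u *s P" if "l u = 0" for u
  proof -
    have "cX u = \<mu> u * \<beta>" "cY u = - \<mu> u * \<alpha>"
      using that ab by (auto simp: l_def \<mu>_def field_simps eq_neg_iff_add_eq_0)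
    then have "\<mu> u *s w = cX u *s b1 + cY u *s b2"
      by (simp add: w_def vector_ssub_ldistrib vector_smult_assoc vec_eq_iff)
    then show ?thesis using basis[of u] by simp
  qed
  have lline: "l (s *s w + t *s P) = 0" for s t by (simp add: l_def wXY algebra_simps)
  obtain pF where pF: "degree pF \<le> d" "\<And>s t. F (s *s w + t *s P) = binary d pF s t"
    using form_binary_line[OF form_F, of w P] by auto
  obtain pG where pG: "degree pG \<le> nat e" "\<And>s t. G (s *s w + t *s P) = binary (nat e) pG s t"
    using form_binary_line[OF G, of w P] by auto
  have pF1: "F (w + t *s P) = poly pF t" for t using pF(2)[of 1 t] binary_one[OF pF(1)] by simp
  have pG1: "G (w + t *s P) = poly pG t" for t using pG(2)[of 1 t] binary_one[OF pG(1)] by simp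
  have "coeff pF d \<noteq> 0" using pF(2)[of 0 1] FP by (simp add: binary_zero_one)
  then have degF: "degree pF = d" using pF(1) le_degree[of pF d] by auto
  then have pF0: "pF \<noteq> 0" using d_ge by auto
  have "pF dvd pG"
  proof (rule poly_dvd_if_locally[OF pF0])
    fix z assume z: "poly pF z = 0"
    have "cX w \<noteq> 0 \<or> cY w \<noteq> 0" using ab by (auto simp: wXY)
    then have xC: "w + z *s P \<in> C" using fiber_in_C z pF1 by simp
    have lx: "l (w + z *s P) = 0" using lline[of 1 z] by simp
    obtain a V U where VU: "form UNIV a V" "form UNIV (a + e - 1) U" "V (w + z *s P) \<noteq> 0"
      "\<And>y. y \<in> C \<Longrightarrow> V y * G y = l y * U y"
      using loc[OF xC] lx unfolding l_def by blast
    have "form UNIV (a + e) (\<lambda>y. V y * G y - l y * U y)"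
      by (intro formU(5) form_mult_deg[OF VU(1) G] form_mult_deg[OF fl VU(2)]) auto
    moreover have "van (\<lambda>y. V y * G y - l y * U y)" using VU(4) by (simp add: van_def)
    ultimately obtain Q where Q: "form UNIV (a + e - int d) Q" "\<And>u. V u * G u - l u * U u = F u * Q u"
      using van_multiple_pt by blast
    obtain pV pQ where pV: "\<And>t. V (w + t *s P) = poly pV t" and pQ: "\<And>t. Q (w + t *s P) = poly pQ t"
      using form_line[OF VU(1), of w P] form_line[OF Q(1), of w P] by blast
    have "poly (pV * pG - pF * pQ) t = 0" for t
      using Q(2)[of "w + t *s P"] lline[of 1 t] by (simp add: pV pQ pF1 pG1)
    then have "pV * pG = pF * pQ" using poly_zero_fun by (metis eq_iff_diff_eq_0)
    then show "\<exists>v q. poly v z \<noteq> 0 \<and> v * pG = pF * q" using VU(3) pV by auto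
  qed
  then obtain q where q: "pG = pF * q" by (elim dvdE)
  \<comment> \<open>The quotient on the line is extended to the plane by homogenising in
    \<open>\<mu>\<close> and \<open>cZ\<close>. Since F keeps its full degree d on the line, the
    quotient has degree at most \<open>nat e - d\<close>.\<close>
  obtain Q where Q: "form UNIV (e - int d) Q" "\<And>t. Q (w + t *s P) = poly q t"
  proof (cases "q = 0")
    case True
    then show ?thesis by (intro that[of "\<lambda>u. 0"]) (simp_all add: formU(6))
  next
    case False
    have "degree pG = d + degree q" unfolding q using False pF0 degF by (subst degree_mult_eq) auto
    then have deg: "degree q \<le> nat e - d" "d \<le> nat e" using pG(1) by auto
    have "form UNIV (int (nat e - d)) (\<lambda>u. binary (nat e - d) q (\<mu> u) (cZ u))"
      by (rule form_binary[OF fmu fZ])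
    moreover have "int (nat e - d) = e - int d" using deg d_ge by linarith
    moreover have "\<mu> (w + t *s P) = 1" "cZ (w + t *s P) = t" for t
      using muw ab by (auto simp: \<mu>_def wXY)
    ultimately show ?thesis using that[of "\<lambda>u. binary (nat e - d) q (\<mu> u) (cZ u)"] binary_one[OF deg(1)] by simp
  qed
  define R where "R = (\<lambda>u. G u - F u * Q u)"
  have fR: "form UNIV e R" unfolding R_def by (intro formU(5) G form_mult_deg[OF form_F Q(1)]) simp
  obtain pR where pR: "degree pR \<le> nat e" "\<And>s t. R (s *s w + t *s P) = binary (nat e) pR s t"
    using form_binary_line[OF fR, of w P] by auto
  have "poly pR t = 0" for t
  proof -
    have "poly pR t = R (w + t *s P)" using pR(2)[of 1 t] binary_one[OF pR(1)] by simp
    also have "\<dots> = 0" by (simp add: R_def pF1 pG1 Q(2) q)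
    finally show ?thesis .
  qed
  then have "pR = 0" by (rule poly_zero_fun)
  then have R0: "R (s *s w + t *s P) = 0" for s t using pR(2) by simp
  obtain G1 where G1: "form UNIV (e - 1) G1" "\<And>u. R u - R (u - l u *s v) = l u * G1 u"
    using form_shift[OF fR fl, of v] by blast
  have RG: "R u = l u * G1 u" for u
  proof -
    have "l (u - l u *s v) = 0"
      using form_one_linear(1)[OF fl, of "u - l u *s v" "l u *s v"] form_one_linear(2)[OF fl, of "l u" v] lv by simp
    then have "R (u - l u *s v) = 0" using ker R0 by metis
    then show ?thesis using G1(2)[of u] by simp
  qed
  have "G y = l y * G1 y" if "y \<in> C" for y using that RG[of y] by (simp add: R_def C_def)
  then show ?thesis using G1(1) unfolding l_def by blast
qed

text \<open>One linear factor at a time. The local conditions pass to the quotient because the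
  linear form does not vanish identically on the curve and can be cancelled.\<close>

lemma divide_binary_pt:
  assumes "p \<noteq> 0" "degree p \<le> n" "form UNIV e G"
    and "\<And>x. x \<in> C \<Longrightarrow> \<exists>a V U. form UNIV a V \<and> form UNIV (a + e - int n) U \<and> V x \<noteq> 0 \<and>
      (\<forall>y\<in>C. V y * G y = binary n p (cX y) (cY y) * U y)"
  shows "\<exists>Q. form UNIV (e - int n) Q \<and> (\<forall>y\<in>C. G y = binary n p (cX y) (cY y) * Q y)"
  using assms
proof (induction n arbitrary: p e G)
  case 0
  then obtain c where c: "p = [:c:]" "c \<noteq> 0" by (metis degree_eq_zeroE le_zero_eq pCons_eq_0_iff)
  have "form UNIV e (\<lambda>u. inverse c * G u)" using 0 by (intro formU)
  then show ?case using c by (intro exI[of _ "\<lambda>u. inverse c * G u"]) (simp add: binary_def)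
next
  case (Suc n)
  obtain \<alpha> \<beta> q where q: "\<alpha> \<noteq> 0 \<or> \<beta> \<noteq> 0" "q \<noteq> 0" "degree q \<le> n"
    "\<And>s t. binary (Suc n) p s t = (\<alpha> * s + \<beta> * t) * binary n q s t"
    using binary_factor[OF Suc(2,3)] by metis
  let ?l = "\<lambda>u. \<alpha> * cX u + \<beta> * cY u" and ?N = "\<lambda>u. binary n q (cX u) (cY u)"
  have fl: "form UNIV 1 ?l" by (intro formU fX fY)
  have fN: "form UNIV (int n) ?N" by (rule form_binary[OF fX fY])
  have nl: "\<not> van ?l"
    using binary_not_van[of "[:\<alpha>, \<beta>:]" 1] q(1) by (simp add: binary_def)
  obtain G1 where G1: "form UNIV (e - 1) G1" "\<And>y. y \<in> C \<Longrightarrow> G y = ?l y * G1 y"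
  proof -
    have "\<exists>G1. form UNIV (e - 1) G1 \<and> (\<forall>y\<in>C. G y = ?l y * G1 y)"
    proof (rule divide_linear_pt[OF q(1) Suc(4)])
      fix x assume "x \<in> C"
      then obtain a V U where VU: "form UNIV a V" "form UNIV (a + e - int (Suc n)) U" "V x \<noteq> 0"
        "\<And>y. y \<in> C \<Longrightarrow> V y * G y = binary (Suc n) p (cX y) (cY y) * U y" using Suc(5) by blast
      have "form UNIV (a + e - 1) (\<lambda>u. ?N u * U u)" by (rule form_mult_deg[OF fN VU(2)]) simp
      then show "\<exists>a V U. form UNIV a V \<and> form UNIV (a + e - 1) U \<and> V x \<noteq> 0 \<and> (\<forall>y\<in>C. V y * G y = ?l y * U y)"
        using VU q(4) by (intro exI[of _ a] exI[of _ V] exI[of _ "\<lambda>u. ?N u * U u"]) (simp add: mult.assoc)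
    qed
    then show ?thesis using that by blast
  qed
  have "\<exists>Q. form UNIV (e - 1 - int n) Q \<and> (\<forall>y\<in>C. G1 y = ?N y * Q y)"
  proof (rule Suc(1)[OF q(2,3) G1(1)])
    fix x assume "x \<in> C"
    then obtain a V U where VU: "form UNIV a V" "form UNIV (a + e - int (Suc n)) U" "V x \<noteq> 0"
      "\<And>y. y \<in> C \<Longrightarrow> V y * G y = binary (Suc n) p (cX y) (cY y) * U y" using Suc(5) by blast
    have U: "form UNIV (a + (e - 1) - int n) U" using VU(2) by (simp add: algebra_simps)
    have "V y * G1 y = ?N y * U y" if "y \<in> C" for y
    proof (rule van_cancel[OF fl nl _ _ _ that])
      show "form UNIV (a + (e - 1)) (\<lambda>y. V y * G1 y)" by (rule form_mult_deg[OF VU(1) G1(1)]) simp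
      show "form UNIV (a + (e - 1)) (\<lambda>y. ?N y * U y)" by (rule form_mult_deg[OF fN U]) simp
      fix x assume "x \<in> C"
      then show "?l x * (V x * G1 x) = ?l x * (?N x * U x)"
        using VU(4) G1(2) q(4) by (simp add: mult.assoc mult.left_commute)
    qed
    then show "\<exists>a V U. form UNIV a V \<and> form UNIV (a + (e - 1) - int n) U \<and> V x \<noteq> 0 \<and> (\<forall>y\<in>C. V y * G1 y = ?N y * U y)"
      using VU(1,3) U by blast
  qed
  then obtain Q where "form UNIV (e - 1 - int n) Q" "\<And>y. y \<in> C \<Longrightarrow> G1 y = ?N y * Q y" by blast
  then show ?case using G1(2) q(4) by (intro exI[of _ Q]) (simp add: algebra_simps)
qed

end

section \<open>Consequences independent of the centre of projection\<close>

context plane_curve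
begin

lemma pt_exists:
  obtains P b1 b2 cX cY cZ where "plane_curve_pt F d D P b1 b2 cX cY cZ"
proof -
  obtain P where P: "F P \<noteq> 0" "\<not> van (DV P)" using good_point by blast
  have "P \<noteq> 0" using P form_at_0[OF form_F] d_ge by auto
  then obtain b1 b2 cX cY cZ where "form UNIV 1 cX" "form UNIV 1 cY" "form UNIV 1 cZ"
    "\<And>u. u = cX u *s b1 + cY u *s b2 + cZ u *s P"
    "cX P = 0" "cY P = 0" "cZ P = 1" "cX b1 = 1" "cY b1 = 0" "cZ b1 = 0" "cX b2 = 0" "cY b2 = 1" "cZ b2 = 0"
    by (rule adapted_basis) (rule that)
  then have "plane_curve_pt F d D P b1 b2 cX cY cZ"
    using P by unfold_locales auto
  then show ?thesis by (rule that)
qed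

lemma finite_zeros:
  assumes "form UNIV e H" "\<not> van H"
  shows "\<exists>S. finite S \<and> S \<subseteq> C \<and> (\<forall>x\<in>C. H x = 0 \<longrightarrow> (\<exists>c z. z \<in> S \<and> c \<noteq> 0 \<and> x = c *s z))"
proof -
  obtain P b1 b2 cX cY cZ where "plane_curve_pt F d D P b1 b2 cX cY cZ" using pt_exists .
  then interpret plane_curve_pt F d D P b1 b2 cX cY cZ .
  have "e \<ge> 0" using assms form_neg[OF assms(1)] by (force simp: van_def)
  then show ?thesis using finite_zeros_pt[of "nat e" H] assms by simp
qed

lemma van_multiple:
  assumes "form UNIV e G" "van G"
  obtains Q where "form UNIV (e - int d) Q" "\<And>u. G u = F u * Q u"
proof -
  obtain P b1 b2 cX cY cZ where "plane_curve_pt F d D P b1 b2 cX cY cZ" using pt_exists .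
  then interpret plane_curve_pt F d D P b1 b2 cX cY cZ .
  show ?thesis using van_multiple_pt[OF assms] that by blast
qed

text \<open>Projective normality: a quotient of forms that is regular at every point of the curve is a form.\<close>

lemma regular_quotient:
  assumes G: "form UNIV e G" and H: "form UNIV h H" and nv: "\<not> van H"
    and loc: "\<And>x. x \<in> C \<Longrightarrow> \<exists>a V U. form UNIV a V \<and> form UNIV (a + e - h) U \<and> V x \<noteq> 0 \<and> (\<forall>y\<in>C. V y * G y = H y * U y)"
  obtains Q where "form UNIV (e - h) Q" "\<And>y. y \<in> C \<Longrightarrow> G y = H y * Q y"
proof -
  obtain P b1 b2 cX cY cZ where "plane_curve_pt F d D P b1 b2 cX cY cZ" using pt_exists .
  then interpret plane_curve_pt F d D P b1 b2 cX cY cZ .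
  have "h \<ge> 0" using nv form_neg[OF H] by (force simp: van_def)
  then have H': "form UNIV (int (nat h)) H" using H by simp
  obtain n p W where p: "p \<noteq> 0" "degree p \<le> n" and W0: "form UNIV (int n - int (nat h)) W"
    and HW: "\<And>u. u \<in> C \<Longrightarrow> H u * W u = binary n p (cX u) (cY u)"
    by (rule multiple_binary[OF H' nv]) (rule that)
  have W: "form UNIV (int n - h) W" using W0 \<open>h \<ge> 0\<close> by simp
  \<comment> \<open>Multiplying numerator and denominator by \<open>W\<close> turns the denominator
    into a binary form, which \<open>divide_binary_pt\<close> can split off.\<close>
  have GW: "form UNIV (e + int n - h) (\<lambda>u. G u * W u)" by (rule form_mult_deg[OF G W]) simp
  have "\<exists>Q. form UNIV (e + int n - h - int n) Q \<and> (\<forall>y\<in>C. G y * W y = binary n p (cX y) (cY y) * Q y)"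
  proof (rule divide_binary_pt[OF p GW])
    fix x assume "x \<in> C"
    then obtain a V U where VU: "form UNIV a V" "form UNIV (a + e - h) U" "V x \<noteq> 0" "\<And>y. y \<in> C \<Longrightarrow> V y * G y = H y * U y"
      using loc by blast
    have "V y * (G y * W y) = binary n p (cX y) (cY y) * U y" if "y \<in> C" for y
      using VU(4)[OF that] HW[OF that] by (metis mult.assoc mult.commute)
    moreover have "form UNIV (a + (e + int n - h) - int n) U" using VU(2) by (simp add: algebra_simps)
    ultimately show "\<exists>a V U. form UNIV a V \<and> form UNIV (a + (e + int n - h) - int n) U \<and> V x \<noteq> 0 \<and>
      (\<forall>y\<in>C. V y * (G y * W y) = binary n p (cX y) (cY y) * U y)" using VU by blast
  qed
  then obtain Q where Q: "form UNIV (e - h) Q" "\<And>y. y \<in> C \<Longrightarrow> G y * W y = binary n p (cX y) (cY y) * Q y" by auto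
  have nvW: "\<not> van W"
  proof
    assume "van W"
    then have "van (\<lambda>u. binary n p (cX u) (cY u))" using HW by (force simp: van_def)
    then show False using binary_not_van[OF p] by simp
  qed
  have "G y = H y * Q y" if "y \<in> C" for y
  proof (rule van_cancel[OF W nvW G form_mult_deg[OF H Q(1)] _ that])
    fix x assume "x \<in> C"
    then show "W x * G x = W x * (H x * Q x)" using Q(2) HW by (metis mult.assoc mult.commute)
  qed simp
  then show ?thesis using that Q(1) by blast
qed

end


section \<open>Isomorphisms of smooth plane curves are linear\<close>

definition par :: "'a::field ^ 'i \<Rightarrow> 'a ^ 'i \<Rightarrow> bool" where
  "par x y \<longleftrightarrow> (\<exists>c. c \<noteq> 0 \<and> x = c *s y)"

lemma par_refl [simp]: "par x x"
  unfolding par_def by (rule exI[of _ 1]) simp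

lemma par_sym: "par x y \<Longrightarrow> par y x"
  unfolding par_def by (metis divide_self inverse_eq_divide nonzero_imp_inverse_nonzero vector_smult_assoc vector_smult_lid left_inverse)

lemma par_trans: "par x y \<Longrightarrow> par y z \<Longrightarrow> par x z"
  unfolding par_def by (metis mult_eq_0_iff vector_smult_assoc)

lemma par_scale: "c \<noteq> 0 \<Longrightarrow> par (c *s x) x"
  unfolding par_def by blast

lemma par_form: "par x y \<Longrightarrow> form L e f \<Longrightarrow> f x = 0 \<longleftrightarrow> f y = 0"
  unfolding par_def using form_scale_eq_0 by blast

lemma par_if_cross:
  fixes x y :: "'a::field ^ 'i::finite"
  assumes "x \<noteq> 0" "y \<noteq> 0" "\<And>i j. x $ i * y $ j = x $ j * y $ i"
  shows "par x y"
proof -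
  obtain i where i: "y $ i \<noteq> 0" using assms(2) by (auto simp: vec_eq_iff)
  have eq: "x = (x $ i / y $ i) *s y"
    using assms(3) i by (simp add: vec_eq_iff field_simps)
  then have "x $ i \<noteq> 0" using assms(1) by (metis div_0 vector_smult_lzero)
  then show ?thesis unfolding par_def using eq i by (metis divide_eq_0_iff)
qed

text \<open>Three unknown coefficients, two equations. The points may coincide, and \<open>w\<close>
  certifies that the form is not zero.\<close>

lemma linear_form_through_two:
  fixes a b :: "'a::field ^ 3"
  obtains l w where "form UNIV 1 l" "l w \<noteq> 0" "l a = 0" "l b = 0"
proof -
  have "card {0::nat, 1} < card (UNIV :: 3 set)" by simp
  from homogeneous_system[OF _ _ this, of "\<lambda>i j. if j = 0 then a $ i else b $ i"]
  obtain c where c: "\<exists>i. c i \<noteq> 0" "(\<Sum>i\<in>UNIV. c i * a $ i) = 0" "(\<Sum>i\<in>UNIV. c i * b $ i) = 0" by auto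
  then obtain i where i: "c i \<noteq> 0" by blast
  have "(\<Sum>j\<in>UNIV. c j * axis i 1 $ j) = (\<Sum>j\<in>UNIV. if j = i then c j else 0)"
    by (rule sum.cong) (auto simp: axis_def)
  then have "(\<Sum>j\<in>UNIV. c j * axis i 1 $ j) \<noteq> 0" using i by simp
  then show ?thesis
    using that[of "\<lambda>u. \<Sum>i\<in>UNIV. c i * u $ i" "axis i 1"] c form_linear[OF is_subring_UNIV, of c] by simp
qed

lemma separating_linear_form:
  fixes u v :: "'a::field ^ 3"
  assumes "u \<noteq> 0" "v \<noteq> 0" "\<not> par u v"
  obtains l where "form UNIV 1 l" "l v = 0" "l u \<noteq> 0"
proof -
  obtain cX cY cZ b1 b2 where XYZ: "form UNIV 1 cX" "form UNIV 1 cY" "form UNIV 1 cZ"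
    "\<And>u. u = cX u *s b1 + cY u *s b2 + cZ u *s v" "cX v = 0" "cY v = 0" "cZ v = 1" "cX b1 = 1" "cY b1 = 0" "cZ b1 = 0" "cX b2 = 0" "cY b2 = 1" "cZ b2 = 0"
    by (rule adapted_basis[OF assms(2)]) (rule that)
  have "cX u \<noteq> 0 \<or> cY u \<noteq> 0"
  proof (rule ccontr)
    assume "\<not> ?thesis"
    then have "u = cZ u *s v" using XYZ(4)[of u] by simp
    moreover from this have "cZ u \<noteq> 0" using assms(1) by (metis vector_smult_lzero)
    ultimately show False using assms(3) unfolding par_def by blast
  qed
  then show ?thesis using that XYZ by blast
qed

text \<open>Each pair excludes at most one \<open>t\<close>. This supplies members of a pencil of
  lines that avoid finitely many points other than its base point.\<close>

lemma avoid_finite: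
  fixes S :: "('a::alg_closed_field \<times> 'a) set"
  assumes "finite S" "\<And>\<alpha> \<beta>. (\<alpha>, \<beta>) \<in> S \<Longrightarrow> \<alpha> \<noteq> 0 \<or> \<beta> \<noteq> 0"
  obtains t where "\<And>\<alpha> \<beta>. (\<alpha>, \<beta>) \<in> S \<Longrightarrow> \<alpha> + t * \<beta> \<noteq> 0"
proof -
  have "finite ((\<lambda>(\<alpha>, \<beta>). - \<alpha> / \<beta>) ` S)" using assms(1) by simp
  then obtain t where t: "t \<notin> (\<lambda>(\<alpha>, \<beta>). - \<alpha> / \<beta>) ` S"
    using infinite_alg_closed ex_new_if_finite by metis
  have "\<alpha> + t * \<beta> \<noteq> 0" if "(\<alpha>, \<beta>) \<in> S" for \<alpha> \<beta>
  proof
    assume 0: "\<alpha> + t * \<beta> = 0"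
    then have "\<beta> \<noteq> 0" using assms(2)[OF that] by auto
    then have "t = - \<alpha> / \<beta>" using 0 by (simp add: field_simps eq_neg_iff_add_eq_0)
    then show False using t that by force
  qed
  then show ?thesis using that by blast
qed

definition tuple :: "('i \<Rightarrow> 'b \<Rightarrow> 'a) \<Rightarrow> 'b \<Rightarrow> 'a ^ 'i" where
  "tuple g y = (\<chi> j. g j y)"

lemma tuple_nth [simp]: "tuple g y $ j = g j y"
  by (simp add: tuple_def)

lemma form_tuple: "form UNIV e f \<Longrightarrow> (\<And>j. form UNIV e' (g j)) \<Longrightarrow> form UNIV (e * e') (\<lambda>x. f (tuple g x))"
  unfolding tuple_def by (rule form_comp[OF is_subring_UNIV])

section \<open>Degree bounds, tangents and local parameters\<close>

context plane_curve
begin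

text \<open>F would divide the form with a cofactor of negative degree.\<close>

lemma nondegenerate: "form UNIV e f \<Longrightarrow> van f \<Longrightarrow> e < int d \<Longrightarrow> f u = 0"
proof -
  assume f: "form UNIV e f" "van f" and "e < int d"
  obtain Q where Q: "form UNIV (e - int d) Q" "\<And>u. f u = F u * Q u" by (rule van_multiple[OF f]) (rule that)
  then show ?thesis using form_neg[OF Q(1), of u] \<open>e < int d\<close> by simp
qed

text \<open>F vanishes along the whole line \<open>Q + t *s Q\<close>, hence so does its derivative
  in that direction.\<close>

lemma euler: "Q \<in> C \<Longrightarrow> DV Q Q = 0"
proof -
  assume Q: "Q \<in> C"
  obtain q where q: "\<And>t. F (Q + t *s Q) = poly q t" "\<And>t. poly (pderiv q) t = DV Q (Q + t *s Q)"
    using line_DV[of Q Q] by blast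
  have "F (Q + t *s Q) = 0" for t
  proof -
    have "Q + t *s Q = (1 + t) *s Q" by (simp add: vector_sadd_rdistrib)
    then show ?thesis using form_scale[OF form_F, of "1 + t" Q] Q by (simp add: C_def)
  qed
  then have "q = 0" using q(1) by (intro poly_zero_fun) simp
  then show ?thesis using q(2)[of 0] by simp
qed

lemma DV_linear: "DV (a + b) x = DV a x + DV b x" "DV (c *s a) x = c * DV a x"
  using form_one_linear[OF form_DV_vec[of x]] by simp_all

text \<open>A line through \<open>Q\<close> that is not tangent there gives a local parameter.\<close>

lemma local_parameter:
  assumes Q: "Q \<in> C" and l: "form UNIV 1 l" "l Q = 0" "l w0 \<noteq> 0" and v: "l v = 0" "DV v Q \<noteq> 0"
    and A: "form UNIV a A" "A Q = 0"
  shows "\<exists>b V U. form UNIV b V \<and> form UNIV (b + a - 1) U \<and> V Q \<noteq> 0 \<and> (\<forall>y\<in>C. V y * A y = l y * U y)"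
proof -
  have "Q \<noteq> 0" using Q by (simp add: C_def)
  then obtain cX cY cZ b1 b2 where XYZ: "form UNIV 1 cX" "form UNIV 1 cY" "form UNIV 1 cZ"
    "\<And>u. u = cX u *s b1 + cY u *s b2 + cZ u *s Q"
    "cX Q = 0" "cY Q = 0" "cZ Q = 1" "cX b1 = 1" "cY b1 = 0" "cZ b1 = 0" "cX b2 = 0" "cY b2 = 1" "cZ b2 = 0"
    by (rule adapted_basis) (rule that)
  note lin = form_one_linear[OF l(1)]
  have leq: "l u = l b1 * cX u + l b2 * cY u" for u
  proof -
    have "l u = l (cX u *s b1 + cY u *s b2 + cZ u *s Q)" using XYZ(4)[of u] by simp
    then show ?thesis by (simp add: lin l(2) mult.commute)
  qed
  \<comment> \<open>The forms \<open>l\<close> and \<open>\<tau>\<close> together cut out the point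
    \<open>Q\<close>; \<open>w\<close> and \<open>v'\<close> are the directions of the two Taylor
    shifts that eliminate one of them each.\<close>
  obtain \<tau> w v' where \<tau>: "form UNIV 1 \<tau>" "\<tau> v' = 1" "\<tau> w = 0" "l w = 1" "\<tau> Q = 0"
    and ker: "\<And>u. l u = 0 \<Longrightarrow> \<tau> u = 0 \<Longrightarrow> u = cZ u *s Q"
  proof (cases "l b1 = 0")
    case False
    show ?thesis
    proof (rule that[of cY b2 "inverse (l b1) *s b1"])
      show "cY b2 = 1" "cY (inverse (l b1) *s b1) = 0" "l (inverse (l b1) *s b1) = 1" "form UNIV 1 cY" "cY Q = 0"
        using XYZ False by (simp_all add: lin form_one_linear[OF XYZ(2)])
      fix u assume "l u = 0" "cY u = 0"
      then have "cX u = 0" using leq[of u] False by simp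
      then show "u = cZ u *s Q" using XYZ(4)[of u] \<open>cY u = 0\<close> by simp
    qed
  next
    case True
    then have b2: "l b2 \<noteq> 0" using leq[of w0] l(3) by auto
    show ?thesis
    proof (rule that[of cX b1 "inverse (l b2) *s b2"])
      show "cX b1 = 1" "cX (inverse (l b2) *s b2) = 0" "l (inverse (l b2) *s b2) = 1" "form UNIV 1 cX" "cX Q = 0"
        using XYZ b2 by (simp_all add: lin form_one_linear[OF XYZ(1)])
      fix u assume "l u = 0" "cX u = 0"
      then have "cY u = 0" using leq[of u] b2 by simp
      then show "u = cZ u *s Q" using XYZ(4)[of u] \<open>cX u = 0\<close> by simp
    qed
  qed
  note lint = form_one_linear[OF \<tau>(1)]
  have sub: "l (x - y) = l x - l y" "\<tau> (x - y) = \<tau> x - \<tau> y" for x y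
    using lin(1)[of "x - y" y] lint(1)[of "x - y" y] by simp_all
  have ideal: "\<exists>G G'. form UNIV (e - 1) G \<and> form UNIV (e - 1) G' \<and> (\<forall>u. f u = l u * G u + \<tau> u * G' u)"
    if f: "form UNIV e f" "f Q = 0" for e f
  proof -
    obtain G where G: "form UNIV (e - 1) G" "\<And>u. f u - f (u - l u *s w) = l u * G u"
      using form_shift[OF f(1) l(1), of w] by blast
    define h where "h = (\<lambda>u. f (\<chi> j. u $ j - w $ j * l u))"
    have hf: "h u = f (u - l u *s w)" for u
      unfolding h_def by (rule arg_cong[of _ _ f]) (simp add: vec_eq_iff mult.commute)
    have "form UNIV 1 (\<lambda>u. u $ j - w $ j * l u)" for j by (intro formU l)
    from form_comp[OF is_subring_UNIV f(1) this] have h: "form UNIV e h" by (simp add: h_def)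
    obtain G' where G': "form UNIV (e - 1) G'" "\<And>u. h u - h (u - \<tau> u *s v') = \<tau> u * G' u"
      using form_shift[OF h \<tau>(1), of v'] by blast
    have "h (u - \<tau> u *s v') = 0" for u
    proof -
      define y where "y = (u - \<tau> u *s v') - l (u - \<tau> u *s v') *s w"
      have "l y = 0" "\<tau> y = 0" unfolding y_def by (simp_all add: sub lin lint \<tau>)
      then have "y = cZ y *s Q" by (rule ker)
      moreover have "f (cZ y *s Q) = 0" using f form_scale[OF f(1), of "cZ y" Q] form_neg[OF f(1)] by (cases "e \<ge> 0") auto
      ultimately show ?thesis by (simp add: hf y_def)
    qed
    then have "f u = l u * G u + \<tau> u * G' u" for u
      using G(2)[of u] G'(2)[of u] by (simp add: hf algebra_simps)
    then show ?thesis using G(1) G'(1) by blast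
  qed
  \<comment> \<open>With F and \<open>A\<close> written in terms of \<open>l\<close> and
    \<open>\<tau>\<close>, the equation F = 0 expresses \<open>\<tau> * G'\<close> through
    \<open>l\<close> on the curve, whence \<open>G' * A\<close> is a multiple of \<open>l\<close>.
    That \<open>G' Q\<close> is nonzero follows from
    \<open>DV v Q = \<tau> v * G' Q\<close>.\<close>
  obtain G G' where G: "form UNIV (int d - 1) G" "form UNIV (int d - 1) G'" "\<And>u. F u = l u * G u + \<tau> u * G' u"
    using ideal[OF form_F] Q by (auto simp: C_def)
  obtain H H' where H: "form UNIV (a - 1) H" "form UNIV (a - 1) H'" "\<And>u. A u = l u * H u + \<tau> u * H' u"
    using ideal[OF A] by blast
  obtain q where q: "\<And>t. F (Q + t *s v) = poly q t" "\<And>t. poly (pderiv q) t = DV v (Q + t *s v)"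
    using line_DV[of Q v] by blast
  obtain r where r: "\<And>t. G' (Q + t *s v) = poly r t" using form_line[OF G(2), of Q v] by blast
  have "poly (q - smult (\<tau> v) (pCons 0 r)) t = 0" for t
    using q(1)[of t] r[of t] G(3)[of "Q + t *s v"] by (simp add: lin lint l v \<tau> algebra_simps)
  then have qr: "q = smult (\<tau> v) (pCons 0 r)" using poly_zero_fun by (metis eq_iff_diff_eq_0)
  have "DV v Q = \<tau> v * G' Q"
    using q(2)[of 0] r[of 0] by (simp add: qr pderiv_smult pderiv_pCons)
  then have G'Q: "G' Q \<noteq> 0" using v by auto
  have "form UNIV (int d - 1 + a - 1) (\<lambda>y. H y * G' y - G y * H' y)"
    by (intro formU(5) form_mult_deg[OF H(1) G(2)] form_mult_deg[OF G(1) H(2)]) auto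
  moreover have "G' y * A y = l y * (H y * G' y - G y * H' y)" if "y \<in> C" for y
  proof -
    have "\<tau> y * G' y = - l y * G y" using that G(3)[of y] by (simp add: C_def eq_neg_iff_add_eq_0 add.commute)
    moreover have "G' y * A y = l y * H y * G' y + (\<tau> y * G' y) * H' y" by (simp add: H(3) algebra_simps)
    ultimately show ?thesis by (simp add: algebra_simps)
  qed
  ultimately show ?thesis using G(2) G'Q by blast
qed

end

text \<open>Automorphisms are given on vectors: \<open>\<Psi>\<close> and its inverse \<open>\<Phi>\<close> choose a representative of the image point.\<close>

locale curve_aut = plane_curve F d D
  for F :: "'K::alg_closed_field ^ 3 \<Rightarrow> 'K" and d :: nat and D :: "3 \<Rightarrow> 'K ^ 3 \<Rightarrow> 'K" +
  fixes \<Psi> \<Phi> :: "'K ^ 3 \<Rightarrow> 'K ^ 3"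
  assumes \<Psi>_C: "x \<in> C \<Longrightarrow> \<Psi> x \<in> C" and \<Phi>_C: "x \<in> C \<Longrightarrow> \<Phi> x \<in> C"
    and \<Phi>\<Psi>: "x \<in> C \<Longrightarrow> par (\<Phi> (\<Psi> x)) x" and \<Psi>\<Phi>: "x \<in> C \<Longrightarrow> par (\<Psi> (\<Phi> x)) x"
    and \<Psi>_par: "x \<in> C \<Longrightarrow> y \<in> C \<Longrightarrow> par x y \<Longrightarrow> par (\<Psi> x) (\<Psi> y)"
    and \<Phi>_par: "x \<in> C \<Longrightarrow> y \<in> C \<Longrightarrow> par x y \<Longrightarrow> par (\<Phi> x) (\<Phi> y)"
    and \<Psi>_rep: "x \<in> C \<Longrightarrow> \<exists>e g. (\<forall>j. form UNIV e (g j)) \<and> tuple g x \<noteq> 0 \<and>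
      (\<forall>y\<in>C. tuple g y \<noteq> 0 \<longrightarrow> par (tuple g y) (\<Psi> y))"
    and \<Phi>_rep: "x \<in> C \<Longrightarrow> \<exists>e g. (\<forall>j. form UNIV e (g j)) \<and> tuple g x \<noteq> 0 \<and>
      (\<forall>y\<in>C. tuple g y \<noteq> 0 \<longrightarrow> par (tuple g y) (\<Phi> y))"
begin

text \<open>A tuple may vanish at some points of the curve and says nothing there. Tuples are
  compared through cross products, which hold at these points as well.\<close>

definition rep :: "int \<Rightarrow> (3 \<Rightarrow> 'K ^ 3 \<Rightarrow> 'K) \<Rightarrow> bool" where
  "rep e g \<longleftrightarrow> (\<forall>j. form UNIV e (g j)) \<and> (\<forall>y\<in>C. tuple g y \<noteq> 0 \<longrightarrow> par (tuple g y) (\<Psi> y))"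

lemma rep_ex:
  assumes "x \<in> C"
  obtains e g where "rep e g" "tuple g x \<noteq> 0"
  using \<Psi>_rep[OF assms] unfolding rep_def by blast

lemma rep_form: "rep e g \<Longrightarrow> form UNIV 1 l \<Longrightarrow> form UNIV e (\<lambda>y. l (tuple g y))"
  unfolding rep_def using form_tuple[of 1 l e g] by simp

lemma rep_C: "rep e g \<Longrightarrow> y \<in> C \<Longrightarrow> tuple g y \<noteq> 0 \<Longrightarrow> tuple g y \<in> C"
  unfolding rep_def par_def using \<Psi>_C C_scale by metis

lemma rep_mult:
  assumes "rep e g" "y \<in> C"
  obtains c where "tuple g y = c *s \<Psi> y" "tuple g y \<noteq> 0 \<Longrightarrow> c \<noteq> 0"
proof (cases "tuple g y = 0")
  case True
  then show ?thesis using that[of 0] by simp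
next
  case False
  then show ?thesis using assms that unfolding rep_def par_def by metis
qed

lemma rep_cross:
  assumes "rep e g" "rep e' g'" "y \<in> C" "form UNIV 1 l" "form UNIV 1 l'"
  shows "l (tuple g y) * l' (tuple g' y) = l' (tuple g y) * l (tuple g' y)"
proof -
  obtain c where c: "tuple g y = c *s \<Psi> y" using rep_mult[OF assms(1,3)] by metis
  obtain c' where c': "tuple g' y = c' *s \<Psi> y" using rep_mult[OF assms(2,3)] by metis
  show ?thesis unfolding c c' by (simp add: form_one_linear[OF assms(4)] form_one_linear[OF assms(5)])
qed

lemma rep_zero_iff:
  assumes "rep e g" "y \<in> C" "tuple g y \<noteq> 0" "form UNIV a f"
  shows "f (tuple g y) = 0 \<longleftrightarrow> f (\<Psi> y) = 0"
  using assms par_form unfolding rep_def by blast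

text \<open>If the pullback of \<open>l\<close> by one representation vanished, cross products and
  primality would transfer this to every representation. Then \<open>l\<close> would vanish on the
  image of \<open>\<Psi>\<close>, which up to scalars is the whole curve, against
  \<open>nondegenerate\<close>.\<close>

lemma rep_not_van:
  assumes g: "rep e g" "x \<in> C" "tuple g x \<noteq> 0" and l: "form UNIV 1 l" "l w \<noteq> 0"
  shows "\<not> van (\<lambda>y. l (tuple g y))"
proof
  assume v: "van (\<lambda>y. l (tuple g y))"
  obtain k where k: "tuple g x $ k \<noteq> 0" using g(3) by (auto simp: vec_eq_iff)
  have gk: "form UNIV e (g k)" using g(1) by (simp add: rep_def)
  have nk: "\<not> van (g k)" using k g(2) by (auto simp: van_def)
  have "van l"
    unfolding van_def
  proof
    fix Q assume Q: "Q \<in> C"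
    have PQ: "\<Phi> Q \<in> C" by (rule \<Phi>_C[OF Q])
    obtain e' g' where g': "rep e' g'" "tuple g' (\<Phi> Q) \<noteq> 0" by (rule rep_ex[OF PQ])
    have "van (\<lambda>y. l (tuple g' y))"
    proof (rule van_prime[OF gk rep_form[OF g'(1) l(1)] _ nk])
      fix y assume y: "y \<in> C"
      have "tuple g y $ k * l (tuple g' y) = l (tuple g y) * tuple g' y $ k"
        by (rule rep_cross[OF g(1) g'(1) y formU(9) l(1)])
      then show "g k y * l (tuple g' y) = 0" using vanD[OF v y] by simp
    qed
    then have "l (tuple g' (\<Phi> Q)) = 0" using PQ by (simp add: van_def)
    then have "l (\<Psi> (\<Phi> Q)) = 0" using rep_zero_iff[OF g'(1) PQ g'(2) l(1)] by simp
    then show "l Q = 0" using par_form[OF \<Psi>\<Phi>[OF Q] l(1)] by simp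
  qed
  then show False using nondegenerate[OF l(1)] l(2) d_ge by simp
qed

text \<open>An isomorphism carries parameters to parameters. \<open>B\<close> is moved to
  \<open>\<Psi> x\<close> by a representation \<open>h\<close> of the inverse map,
  \<open>local_parameter\<close> applies there, and \<open>g\<close> pulls the relation
  back.\<close>

lemma pullback_parameter:
  assumes x: "x \<in> C" and g: "rep e g" "tuple g x \<noteq> 0"
    and l: "form UNIV 1 l" "l (\<Psi> x) = 0" "l w0 \<noteq> 0" and v: "l v = 0" "DV v (\<Psi> x) \<noteq> 0"
    and B: "form UNIV b B" "B x = 0"
  shows "\<exists>a V U. form UNIV a V \<and> form UNIV (a + b - e) U \<and> V x \<noteq> 0 \<and> (\<forall>y\<in>C. V y * B y = l (tuple g y) * U y)"
proof (cases "b \<ge> 0")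
  case False
  then have "B y = 0" for y using form_neg[OF B(1)] by simp
  then show ?thesis
    by (intro exI[of _ 0] exI[of _ "\<lambda>y. 1"] exI[of _ "\<lambda>y. 0"]) (simp add: form_const formU(6))
next
  case True
  define Q where "Q = \<Psi> x"
  have Q: "Q \<in> C" using \<Psi>_C[OF x] by (simp add: Q_def)
  obtain e' h where h: "\<And>j. form UNIV e' (h j)" "tuple h Q \<noteq> 0"
    "\<And>y. y \<in> C \<Longrightarrow> tuple h y \<noteq> 0 \<Longrightarrow> par (tuple h y) (\<Phi> y)" using \<Phi>_rep[OF Q] by blast
  have gf: "\<And>j. form UNIV e (g j)" using g(1) by (simp add: rep_def)
  have Bh: "form UNIV (b * e') (\<lambda>y. B (tuple h y))" by (rule form_tuple[OF B(1) h(1)])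
  have BhQ: "B (tuple h Q) = 0"
  proof -
    have "par (tuple h Q) x" using par_trans[OF h(3)[OF Q h(2)]] \<Phi>\<Psi>[OF x] by (simp add: Q_def)
    then show ?thesis using par_form[OF _ B(1)] B(2) by blast
  qed
  obtain a V0 U0 where V0: "form UNIV a V0" "form UNIV (a + b * e' - 1) U0" "V0 Q \<noteq> 0"
    "\<And>y. y \<in> C \<Longrightarrow> V0 y * B (tuple h y) = l y * U0 y"
    using local_parameter[OF Q l(1) _ l(3) v(1) _ Bh BhQ] l(2) v(2) unfolding Q_def by blast
  obtain k where k: "g k x \<noteq> 0" using g(2) by (auto simp: vec_eq_iff)
  obtain j where j: "h j Q \<noteq> 0" using h(2) by (auto simp: vec_eq_iff)
  define n where "n = nat b"
  have n: "int n = b" using True by (simp add: n_def)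
  \<comment> \<open>The composition of \<open>h\<close> with \<open>g\<close> returns
    \<open>y\<close> only up to a scalar \<open>s\<close>. The powers of the \<open>j\<close>-th
    coordinate compensate \<open>s ^ n\<close>, and the factor \<open>g k\<close> makes both sides
    vanish where the tuple \<open>g\<close> does.\<close>
  define V where "V = (\<lambda>y. g k y * (V0 (tuple g y) * h j (tuple g y) ^ n))"
  define U where "U = (\<lambda>y. g k y * (y $ j ^ n * U0 (tuple g y)))"
  have fV: "form UNIV (e + (a * e + b * (e' * e))) V"
    unfolding V_def n[symmetric]
    by (rule form_mult[OF is_subring_UNIV gf form_mult[OF is_subring_UNIV form_tuple[OF V0(1) gf] form_power[OF is_subring_UNIV form_tuple[OF h(1) gf]]]])
  have fU: "form UNIV (e + (b * 1 + (a + b * e' - 1) * e)) U"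
    unfolding U_def n[symmetric]
    by (rule form_mult_deg[OF gf form_mult_deg[OF form_power[OF is_subring_UNIV formU(9)] form_tuple[OF V0(2) gf] refl]]) (simp add: n)
  have fU': "form UNIV ((e + (a * e + b * (e' * e))) + b - e) U"
    by (rule form_deg_cong[OF fU]) (simp add: algebra_simps)
  have gx: "par (tuple g x) Q" using g x unfolding rep_def Q_def by blast
  have "V x \<noteq> 0" unfolding V_def using k V0(3) j par_form[OF gx V0(1)] par_form[OF gx h(1)] by simp
  moreover have "V y * B y = l (tuple g y) * U y" if y: "y \<in> C" for y
  proof (cases "tuple g y = 0")
    case True
    then have "g k y = 0" by (metis tuple_nth zero_index)
    then show ?thesis by (simp add: V_def U_def)
  next
    case False
    let ?z = "tuple g y"
    have z: "?z \<in> C" by (rule rep_C[OF g(1) y False])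
    have "\<exists>s. tuple h ?z = s *s y"
    proof (cases "tuple h ?z = 0")
      case True
      then show ?thesis by (intro exI[of _ 0]) simp
    next
      case nz: False
      have "par ?z (\<Psi> y)" using g(1) y False by (simp add: rep_def)
      then have "par (\<Phi> ?z) (\<Phi> (\<Psi> y))" by (rule \<Phi>_par[OF z \<Psi>_C[OF y]])
      then have "par (tuple h ?z) y" using par_trans[OF h(3)[OF z nz] par_trans[OF _ \<Phi>\<Psi>[OF y]]] by blast
      then show ?thesis unfolding par_def by blast
    qed
    then obtain s where s: "tuple h ?z = s *s y" by blast
    have hj: "h j ?z = s * y $ j" using s by (metis tuple_nth vector_smult_component)
    have "y $ j ^ n * B (tuple h ?z) = h j ?z ^ n * B y"
      using form_scale[OF B(1) True, of s y] unfolding s hj n_def by (simp add: power_mult_distrib)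
    then have "V y * B y = g k y * V0 ?z * (y $ j ^ n * B (tuple h ?z))" by (simp add: V_def mult_ac)
    also have "\<dots> = g k y * (y $ j ^ n) * (V0 ?z * B (tuple h ?z))" by (simp only: mult_ac)
    also have "\<dots> = l ?z * U y" unfolding V0(4)[OF z] by (simp add: U_def mult_ac)
    finally show ?thesis .
  qed
  ultimately show ?thesis using fV fU' by blast
qed

text \<open>At each intersection with the curve the line is not the tangent, which is the situation
  of \<open>local_parameter\<close>.\<close>

definition transversal :: "('K ^ 3 \<Rightarrow> 'K) \<Rightarrow> bool" where
  "transversal l \<longleftrightarrow> form UNIV 1 l \<and> (\<exists>w. l w \<noteq> 0) \<and> (\<forall>Q\<in>C. l Q = 0 \<longrightarrow> (\<exists>v. l v = 0 \<and> DV v Q \<noteq> 0))"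

text \<open>If \<open>B\<close> vanishes on the preimage of the line \<open>l\<close>, except possibly where \<open>l'\<close> vanishes as well, then
  \<open>B l' / l\<close>, pulled back, has no poles.\<close>

lemma pullback_quotient:
  assumes l: "transversal l" and l': "form UNIV 1 l'" and B: "form UNIV b B"
    and van: "\<And>x. x \<in> C \<Longrightarrow> l (\<Psi> x) = 0 \<Longrightarrow> B x = 0 \<or> l' (\<Psi> x) = 0"
  obtains Q where "form UNIV b Q" "\<And>y. y \<in> C \<Longrightarrow> B y * l' (\<Psi> y) = l (\<Psi> y) * Q y"
proof -
  have fl: "form UNIV 1 l" using l by (simp add: transversal_def)
  obtain w where w: "l w \<noteq> 0" using l by (auto simp: transversal_def)
  obtain x0 where x0: "x0 \<in> C" using nonempty by (auto simp: C_def)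
  obtain e g where g: "rep e g" "tuple g x0 \<noteq> 0" by (rule rep_ex[OF x0])
  have nv: "\<not> van (\<lambda>y. l (tuple g y))" by (rule rep_not_van[OF g(1) x0 g(2) fl w])
  have fG: "form UNIV (b + e) (\<lambda>y. B y * l' (tuple g y))" by (rule form_mult[OF is_subring_UNIV B rep_form[OF g(1) l']])
  obtain Q where Q: "form UNIV (b + e - e) Q" "\<And>y. y \<in> C \<Longrightarrow> B y * l' (tuple g y) = l (tuple g y) * Q y"
  proof (rule regular_quotient[OF fG rep_form[OF g(1) fl] nv])
    fix x assume x: "x \<in> C"
    \<comment> \<open>Only the quotient of the two pullbacks matters, and by cross products it may
      be computed with a representation that is nonzero at \<open>x\<close>.\<close>
    obtain e' g' where g': "rep e' g'" "tuple g' x \<noteq> 0" by (rule rep_ex[OF x])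
    have cross: "l (tuple g' y) * l' (tuple g y) = l' (tuple g' y) * l (tuple g y)" if "y \<in> C" for y
      by (rule rep_cross[OF g'(1) g(1) that fl l'])
    show "\<exists>a V U. form UNIV a V \<and> form UNIV (a + (b + e) - e) U \<and> V x \<noteq> 0 \<and>
        (\<forall>y\<in>C. V y * (B y * l' (tuple g y)) = l (tuple g y) * U y)"
    proof (cases "l (\<Psi> x) = 0")
      case False
      have "form UNIV (e' + (b + e) - e) (\<lambda>y. B y * l' (tuple g' y))"
        by (rule form_mult_deg[OF B rep_form[OF g'(1) l']]) simp
      moreover have "l (tuple g' x) \<noteq> 0" using False rep_zero_iff[OF g'(1) x g'(2) fl] by simp
      moreover have "l (tuple g' y) * (B y * l' (tuple g y)) = l (tuple g y) * (B y * l' (tuple g' y))" if "y \<in> C" for y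
        using cross[OF that] by (metis mult.commute mult.left_commute)
      ultimately show ?thesis using rep_form[OF g'(1) fl] by blast
    next
      case True
      then obtain v where v: "l v = 0" "DV v (\<Psi> x) \<noteq> 0" using l \<Psi>_C[OF x] unfolding transversal_def by blast
      from van[OF x True] show ?thesis
      proof
        assume "B x = 0"
        from pullback_parameter[OF x g' fl True w v B this]
        obtain a V U where VU: "form UNIV a V" "form UNIV (a + b - e') U" "V x \<noteq> 0"
          "\<And>y. y \<in> C \<Longrightarrow> V y * B y = l (tuple g' y) * U y" by blast
        have "form UNIV (a + (b + e) - e) (\<lambda>y. U y * l' (tuple g' y))"
          by (rule form_mult_deg[OF VU(2) rep_form[OF g'(1) l']]) simp
        moreover have "V y * (B y * l' (tuple g y)) = l (tuple g y) * (U y * l' (tuple g' y))" if "y \<in> C" for y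
        proof -
          have "V y * (B y * l' (tuple g y)) = (V y * B y) * l' (tuple g y)" by (simp only: mult_ac)
          also have "\<dots> = U y * (l (tuple g' y) * l' (tuple g y))" unfolding VU(4)[OF that] by (simp only: mult_ac)
          also have "\<dots> = l (tuple g y) * (U y * l' (tuple g' y))" unfolding cross[OF that] by (simp only: mult_ac)
          finally show ?thesis .
        qed
        ultimately show ?thesis using VU(1,3) by blast
      next
        assume l'0: "l' (\<Psi> x) = 0"
        obtain a V U where VU: "form UNIV a V" "form UNIV (a + 1 - 1) U" "V (\<Psi> x) \<noteq> 0"
          "\<And>y. y \<in> C \<Longrightarrow> V y * l' y = l y * U y"
          using local_parameter[OF \<Psi>_C[OF x] fl True w v l' l'0] by blast
        obtain k where k: "g' k x \<noteq> 0" using g'(2) by (auto simp: vec_eq_iff)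
        have gf: "\<And>j. form UNIV e' (g' j)" using g'(1) by (simp add: rep_def)
        let ?V = "\<lambda>y. g' k y * V (tuple g' y)" and ?U = "\<lambda>y. B y * (g' k y * U (tuple g' y))"
        have 1: "form UNIV (e' + a * e') ?V" by (rule form_mult[OF is_subring_UNIV gf form_tuple[OF VU(1) gf]])
        have 2: "form UNIV (e' + a * e' + (b + e) - e) ?U"
          by (rule form_mult_deg[OF B form_mult[OF is_subring_UNIV gf form_tuple[OF VU(2) gf]]]) simp
        have 3: "?V x \<noteq> 0" using k VU(3) rep_zero_iff[OF g'(1) x g'(2) VU(1)] by simp
        have 4: "?V y * (B y * l' (tuple g y)) = l (tuple g y) * ?U y" if y: "y \<in> C" for y
        proof (cases "tuple g' y = 0")
          case True
          then have "g' k y = 0" by (metis tuple_nth zero_index)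
          then show ?thesis by simp
        next
          case False
          have z: "tuple g' y \<in> C" by (rule rep_C[OF g'(1) y False])
          have c1: "g' k y * l' (tuple g y) = l' (tuple g' y) * g k y"
            using rep_cross[OF g'(1) g(1) y formU(9)[of k] l'] by simp
          have c2: "g' k y * l (tuple g y) = l (tuple g' y) * g k y"
            using rep_cross[OF g'(1) g(1) y formU(9)[of k] fl] by simp
          have "?V y * (B y * l' (tuple g y)) = B y * V (tuple g' y) * (g' k y * l' (tuple g y))" by (simp only: mult_ac)
          also have "\<dots> = B y * g k y * (V (tuple g' y) * l' (tuple g' y))" unfolding c1 by (simp only: mult_ac)
          also have "\<dots> = B y * U (tuple g' y) * (l (tuple g' y) * g k y)" unfolding VU(4)[OF z] by (simp only: mult_ac)
          also have "\<dots> = l (tuple g y) * ?U y" unfolding c2[symmetric] by (simp only: mult_ac)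
          finally show ?thesis .
        qed
        show ?thesis using 1 2 3 4 by blast
      qed
    qed
  qed (rule that)
  have fQ: "form UNIV b Q" using Q(1) by simp
  have "B y * l' (\<Psi> y) = l (\<Psi> y) * Q y" if y: "y \<in> C" for y
  proof -
    obtain e' g' where g': "rep e' g'" "tuple g' y \<noteq> 0" by (rule rep_ex[OF y])
    have "B y * l' (tuple g' y) = l (tuple g' y) * Q y"
    proof (rule van_cancel[OF rep_form[OF g(1) fl] nv form_mult_deg[OF B rep_form[OF g'(1) l']] form_mult_deg[OF rep_form[OF g'(1) fl] fQ] _ y])
      show "b + e' = b + e'" "e' + b = b + e'" by simp_all
      fix z assume z: "z \<in> C"
      have "l (tuple g z) * (B z * l' (tuple g' z)) = B z * (l (tuple g z) * l' (tuple g' z))" by (simp only: mult_ac)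
      also have "\<dots> = (B z * l' (tuple g z)) * l (tuple g' z)"
        unfolding rep_cross[OF g(1) g'(1) z fl l'] by (simp only: mult_ac)
      also have "\<dots> = l (tuple g z) * (l (tuple g' z) * Q z)" unfolding Q(2)[OF z] by (simp only: mult_ac)
      finally show "l (tuple g z) * (B z * l' (tuple g' z)) = l (tuple g z) * (l (tuple g' z) * Q z)" .
    qed
    moreover obtain c where c: "tuple g' y = c *s \<Psi> y" "c \<noteq> 0" using rep_mult[OF g'(1) y] g'(2) by metis
    ultimately show ?thesis
      by (simp add: form_one_linear[OF fl] form_one_linear[OF l'] mult.left_commute mult.assoc)
  qed
  with fQ show ?thesis by (rule that)
qed

end

section \<open>Preimages of lines under an automorphism\<close>

context curve_aut
begin

lemma \<Psi>_par_iff: "x \<in> C \<Longrightarrow> y \<in> C \<Longrightarrow> par (\<Psi> x) (\<Psi> y) \<longleftrightarrow> par x y"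
  using \<Psi>_par \<Phi>_par[OF \<Psi>_C \<Psi>_C] \<Phi>\<Psi> par_sym par_trans by metis

text \<open>The line is a general member of the pencil through a centre \<open>P\<close>. Avoiding
  the points whose tangent contains \<open>P\<close> makes it transversal, avoiding the images of
  the points on one fixed tangent keeps strange points out of the preimage, and \<open>R\<close>
  consists of the preimages of the at most d points of the fibre.\<close>

lemma good_line:
  obtains l R where "transversal l" "\<And>x. x \<in> C \<Longrightarrow> l (\<Psi> x) = 0 \<Longrightarrow> \<not> van (DV x)"
    "finite R" "card R \<le> d" "R \<subseteq> C" "\<And>r. r \<in> R \<Longrightarrow> l (\<Psi> r) = 0"
    "\<And>x. x \<in> C \<Longrightarrow> l (\<Psi> x) = 0 \<Longrightarrow> \<exists>r\<in>R. par x r"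
    "\<And>r r'. r \<in> R \<Longrightarrow> r' \<in> R \<Longrightarrow> par r r' \<Longrightarrow> r = r'"
proof -
  obtain P b1 b2 cX cY cZ where "plane_curve_pt F d D P b1 b2 cX cY cZ" using pt_exists .
  then interpret plane_curve_pt F d D P b1 b2 cX cY cZ .
  obtain x0 where x0: "x0 \<in> C" using nonempty by (auto simp: C_def)
  obtain v0 where v0: "DV v0 x0 \<noteq> 0" using DV_nonzero[OF x0] by blast
  \<comment> \<open>The zeros of \<open>?s\<close> form the tangent line at \<open>x0\<close>. A
    point \<open>x\<close> outside it satisfies \<open>DV x x0 \<noteq> 0\<close>, so
    \<open>DV x\<close> does not vanish on the curve.\<close>
  let ?s = "\<lambda>v. DV v x0"
  have fs: "form UNIV 1 ?s" by (rule form_DV_vec)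
  have nvs: "\<not> van ?s" using nondegenerate[OF fs] v0 d_ge by force
  obtain S1 where S1: "finite S1" "S1 \<subseteq> C" "\<And>x. x \<in> C \<Longrightarrow> DV P x = 0 \<Longrightarrow> \<exists>z\<in>S1. par x z"
    using finite_zeros[OF form_DV DP] unfolding par_def by metis
  obtain S2 where S2: "finite S2" "S2 \<subseteq> C" "\<And>x. x \<in> C \<Longrightarrow> ?s x = 0 \<Longrightarrow> \<exists>z\<in>S2. par x z"
    using finite_zeros[OF fs nvs] unfolding par_def by metis
  define S where "S = S1 \<union> \<Psi> ` S2"
  have S: "finite S" "S \<subseteq> C" using S1 S2 \<Psi>_C by (auto simp: S_def)
  obtain t where t: "\<And>\<alpha> \<beta>. (\<alpha>, \<beta>) \<in> (\<lambda>b. (cX b, cY b)) ` S \<Longrightarrow> \<alpha> + t * \<beta> \<noteq> 0"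
  proof (rule avoid_finite)
    show "finite ((\<lambda>b. (cX b, cY b)) ` S)" using S by simp
    fix \<alpha> \<beta> assume "(\<alpha>, \<beta>) \<in> (\<lambda>b. (cX b, cY b)) ` S"
    then show "\<alpha> \<noteq> 0 \<or> \<beta> \<noteq> 0" using C_XY S(2) by auto
  qed (rule that)
  define l where "l = (\<lambda>u. cX u + t * cY u)"
  have fl: "form UNIV 1 l" unfolding l_def by (intro formU fX fY)
  have lS: "l b \<noteq> 0" if "b \<in> S" for b using t that unfolding l_def by blast
  have lP: "l P = 0" by (simp add: l_def)
  have lb1: "l b1 \<noteq> 0" by (simp add: l_def)
  have tr: "transversal l"
    unfolding transversal_def
  proof (intro conjI ballI impI)
    fix Q assume Q: "Q \<in> C" "l Q = 0"
    have "DV P Q \<noteq> 0"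
    proof
      assume "DV P Q = 0"
      then obtain z where "z \<in> S1" "par Q z" using S1(3) Q(1) by blast
      then show False using par_form[OF _ fl] Q(2) lS[of z] by (auto simp: S_def)
    qed
    then show "\<exists>v. l v = 0 \<and> DV v Q \<noteq> 0" using lP by blast
  qed (use fl lb1 in blast)+
  have nstr: "\<not> van (DV x)" if x: "x \<in> C" "l (\<Psi> x) = 0" for x
  proof
    assume "van (DV x)"
    then have "?s x = 0" using x0 by (simp add: van_def)
    then obtain z where z: "z \<in> S2" "par x z" using S2(3) x(1) by blast
    then have "par (\<Psi> x) (\<Psi> z)" using \<Psi>_par x(1) S2(2) by blast
    then have "l (\<Psi> z) = 0" using par_form[OF _ fl] x(2) by blast
    then show False using lS[of "\<Psi> z"] z(1) by (auto simp: S_def)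
  qed
  define w where "w = b2 - t *s b1"
  have wX: "cX w = - t" "cY w = 1" "cZ w = 0"
    using linX(1)[of w "t *s b1"] linY(1)[of w "t *s b1"] linZ(1)[of w "t *s b1"] by (simp_all add: w_def eq_neg_iff_add_eq_0)
  obtain q where q: "degree q = d" "\<And>z. F (w + z *s P) = poly q z" using fiber[of w] by blast
  have q0: "q \<noteq> 0" using q(1) d_ge by auto
  define Z where "Z = (\<lambda>z. w + z *s P) ` {z. poly q z = 0}"
  have Z: "finite Z" "card Z \<le> d"
    using poly_roots_finite[OF q0] card_image_le[OF poly_roots_finite[OF q0]] card_poly_roots_bound[OF q0] q(1)
    unfolding Z_def by (auto intro: order_trans)
  have ZC: "Z \<subseteq> C" unfolding Z_def using fiber_in_C[of w] q(2) wX by auto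
  have Zl: "l z = 0" if "z \<in> Z" for z using that by (auto simp: Z_def l_def wX)
  have Zpar: "z = z'" if zz: "z \<in> Z" "z' \<in> Z" "par z z'" for z z'
  proof -
    have "cY z = 1" "cY z' = 1" using zz by (auto simp: Z_def wX)
    moreover obtain c where c: "z = c *s z'" using zz(3) unfolding par_def by blast
    ultimately have "c = 1" using linY(2)[of c z'] by simp
    then show ?thesis using c by simp
  qed
  have Zcov: "\<exists>z\<in>Z. par Q z" if Q: "Q \<in> C" "l Q = 0" for Q
  proof -
    have X: "cX Q = - t * cY Q" using Q(2) by (simp add: l_def eq_neg_iff_add_eq_0)
    then have Y: "cY Q \<noteq> 0" using C_XY[OF Q(1)] by auto
    define z where "z = w + (cZ Q / cY Q) *s P"
    have eq: "Q = cY Q *s z"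
      using basis[of Q] Y by (simp add: z_def w_def X vec_eq_iff algebra_simps)
    then have "F z = 0" using form_scale_eq_0[OF form_F Y, of z] Q(1) by (simp add: C_def)
    then have "z \<in> Z" by (auto simp: Z_def z_def q(2))
    then show ?thesis using eq par_scale[OF Y] by metis
  qed
  define R where "R = \<Phi> ` Z"
  show ?thesis
  proof (rule that[OF tr nstr])
    show "finite R" "R \<subseteq> C" using Z(1) ZC \<Phi>_C by (auto simp: R_def)
    show "card R \<le> d" using card_image_le[OF Z(1), of \<Phi>] Z(2) by (simp add: R_def)
    show "l (\<Psi> r) = 0" if r: "r \<in> R" for r
    proof -
      obtain z where z: "z \<in> Z" "r = \<Phi> z" using r by (auto simp: R_def)
      then show ?thesis using par_form[OF \<Psi>\<Phi>[of z] fl] Zl ZC by auto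
    qed
    show "\<exists>r\<in>R. par x r" if x: "x \<in> C" "l (\<Psi> x) = 0" for x
    proof -
      obtain z where z: "z \<in> Z" "par (\<Psi> x) z" using Zcov[OF \<Psi>_C] x by blast
      have "par (\<Phi> (\<Psi> x)) (\<Phi> z)" by (rule \<Phi>_par[OF \<Psi>_C[OF x(1)] _ z(2)]) (use z ZC in auto)
      then have "par x (\<Phi> z)" using \<Phi>\<Psi>[OF x(1)] par_sym par_trans by blast
      then show ?thesis using z(1) by (auto simp: R_def)
    qed
    show "r = r'" if rr: "r \<in> R" "r' \<in> R" "par r r'" for r r'
    proof -
      obtain z z' where z: "z \<in> Z" "r = \<Phi> z" "z' \<in> Z" "r' = \<Phi> z'" using rr by (auto simp: R_def)
      have zC: "z \<in> C" "z' \<in> C" using z ZC by auto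
      have "par (\<Psi> (\<Phi> z)) (\<Psi> (\<Phi> z'))" using \<Psi>_par[OF \<Phi>_C \<Phi>_C] zC rr(3) z by blast
      then have "par z z'" using \<Psi>\<Phi>[OF zC(1)] \<Psi>\<Phi>[OF zC(2)] par_sym par_trans by blast
      then show ?thesis using Zpar z by blast
    qed
  qed
qed

text \<open>Noether's reduction argument: if a form \<open>A\<close> of degree at most \<open>d - 3\<close> vanishes on all points of
  the divisor except \<open>r\<close> and possibly some points where \<open>l'\<close> vanishes, then it vanishes at \<open>r\<close> too. Multiplying
  by a general line \<open>m\<close> through \<open>r\<close>, the quotient \<open>A m l' / l\<close> is a form of degree at most \<open>d - 2\<close>
  vanishing at the \<open>d - 1\<close> remaining points of \<open>m\<close>, hence divisible by \<open>m\<close>.\<close>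

lemma reduction:
  assumes l: "transversal l" and R: "finite R" "R \<subseteq> C" "\<And>x. x \<in> C \<Longrightarrow> l (\<Psi> x) = 0 \<Longrightarrow> \<exists>r\<in>R. par x r"
    and r: "r \<in> R" "l (\<Psi> r) = 0" "\<not> van (DV r)"
    and A: "form UNIV a A" "a + 3 \<le> int d" and l': "form UNIV 1 l'"
    and van: "\<And>x. x \<in> R \<Longrightarrow> x = r \<or> A x = 0 \<or> l' (\<Psi> x) = 0"
  shows "A r = 0 \<or> l' (\<Psi> r) = 0"
proof -
  have fl: "form UNIV 1 l" using l by (simp add: transversal_def)
  have rC: "r \<in> C" using r R by blast
  then have r0: "r \<noteq> 0" by (simp add: C_def)
  obtain cX cY cZ b1 b2 where B: "form UNIV 1 cX" "form UNIV 1 cY" "form UNIV 1 cZ"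
    "\<And>u. u = cX u *s b1 + cY u *s b2 + cZ u *s r"
    "cX r = 0" "cY r = 0" "cZ r = 1" "cX b1 = 1" "cY b1 = 0" "cZ b1 = 0" "cX b2 = 0" "cY b2 = 1" "cZ b2 = 0"
    by (rule adapted_basis[OF r0]) (rule that)
  note lX = form_one_linear[OF B(1)] and lY = form_one_linear[OF B(2)] and lZ = form_one_linear[OF B(3)]
  obtain S1 where S1: "finite S1" "S1 \<subseteq> C" "\<And>x. x \<in> C \<Longrightarrow> DV r x = 0 \<Longrightarrow> \<exists>z\<in>S1. par x z"
    using finite_zeros[OF form_DV r(3)] unfolding par_def by metis
  define S where "S = {b \<in> S1 \<union> R. cX b \<noteq> 0 \<or> cY b \<noteq> 0}"
  have finS: "finite S" using S1(1) R(1) by (simp add: S_def)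
  have DVr: "DV b2 r \<noteq> 0 \<or> - DV b1 r \<noteq> 0"
  proof (rule ccontr)
    assume n: "\<not> ?thesis"
    obtain v where v: "DV v r \<noteq> 0" using DV_nonzero[OF rC] by blast
    have "DV v r = DV (cX v *s b1 + cY v *s b2 + cZ v *s r) r" using B(4)[of v] by simp
    also have "\<dots> = 0" using n euler[OF rC] by (simp add: DV_linear)
    finally show False using v by simp
  qed
  \<comment> \<open>The line \<open>m = 0\<close> through \<open>r\<close> is chosen general: the
    inserted pair gives \<open>DV w r \<noteq> 0\<close> and keeps it from being the tangent at
    \<open>r\<close>, while \<open>S\<close> keeps it away from the other points of \<open>R\<close>
    and from the others whose tangent passes through \<open>r\<close>.\<close>
  obtain t where t: "\<And>\<alpha> \<beta>. (\<alpha>, \<beta>) \<in> insert (DV b2 r, - DV b1 r) ((\<lambda>b. (cX b, cY b)) ` S) \<Longrightarrow> \<alpha> + t * \<beta> \<noteq> 0"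
  proof (rule avoid_finite)
    show "finite (insert (DV b2 r, - DV b1 r) ((\<lambda>b. (cX b, cY b)) ` S))" using finS by simp
    fix \<alpha> \<beta> assume "(\<alpha>, \<beta>) \<in> insert (DV b2 r, - DV b1 r) ((\<lambda>b. (cX b, cY b)) ` S)"
    then show "\<alpha> \<noteq> 0 \<or> \<beta> \<noteq> 0" using DVr by (auto simp: S_def)
  qed (rule that)
  define m where "m = (\<lambda>u. cX u + t * cY u)"
  define w where "w = b2 - t *s b1"
  have fm: "form UNIV 1 m" unfolding m_def by (intro formU B)
  have wX: "cX w = - t" "cY w = 1" "cZ w = 0"
    using lX(1)[of w "t *s b1"] lY(1)[of w "t *s b1"] lZ(1)[of w "t *s b1"] B lX(2) lY(2) lZ(2)
    by (simp_all add: w_def eq_neg_iff_add_eq_0)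
  have mS: "m b \<noteq> 0" if "b \<in> S" for b using t that unfolding m_def by blast
  have mline: "m (s *s w + z *s r) = 0" for s z by (simp add: m_def lX lY wX B algebra_simps)
  have "w + t *s b1 = b2" by (simp add: w_def)
  then have "DV w r + t * DV b1 r = DV b2 r" using DV_linear(1)[of w "t *s b1" r] DV_linear(2)[of t b1 r] by simp
  then have DVw: "DV w r \<noteq> 0" using t[of "DV b2 r" "- DV b1 r"] by (auto simp: algebra_simps)
  obtain p where p: "degree p \<le> d" "\<And>s z. F (s *s w + z *s r) = binary d p s z"
    using form_binary_line[OF form_F, of w r] by auto
  have Fp: "F (w + z *s r) = poly p z" for z using p(2)[of 1 z] binary_one[OF p(1)] by simp
  \<comment> \<open>On this line \<open>r\<close> is the point at infinity of the parametrisation: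
    the coefficient at d is \<open>F r = 0\<close>, the next one is the derivative at
    \<open>r\<close>. So d - 1 further intersections remain.\<close>
  have "coeff p d = 0" using p(2)[of 0 1] rC by (simp add: binary_zero_one C_def)
  moreover have cd: "coeff p (d - 1) = DV w r"
  proof -
    obtain q where q: "\<And>s. F (r + s *s w) = poly q s" "\<And>s. poly (pderiv q) s = DV w (r + s *s w)"
      using line_DV[of r w] by blast
    define q2 where "q2 = (\<Sum>i\<le>d. monom (coeff p i) (d - i))"
    have "poly (q - q2) s = 0" for s
      using q(1)[of s] p(2)[of s 1] by (simp add: q2_def poly_sum poly_monom binary_def add.commute)
    then have "q = q2" using poly_zero_fun by (metis eq_iff_diff_eq_0)
    moreover have "coeff q2 1 = (\<Sum>i\<le>d. if i = d - 1 then coeff p i else 0)"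
      unfolding q2_def coeff_sum by (rule sum.cong) (use d_ge in auto)
    moreover have "poly (pderiv q) 0 = coeff q 1" by (simp add: poly_0_coeff_0 coeff_pderiv)
    ultimately show ?thesis using q(2)[of 0] by simp
  qed
  ultimately have degp: "degree p = d - 1"
  proof -
    have "degree p \<le> d - 1"
      using p(1) \<open>coeff p d = 0\<close> leading_coeff_0_iff[of p] by (cases "degree p = d") auto
    then show ?thesis using le_degree[of p "d - 1"] cd DVw by simp
  qed
  have p0: "p \<noteq> 0" using cd DVw by auto
  have root: "w + z *s r \<in> C" if "poly p z = 0" for z
  proof -
    have "cY (w + z *s r) \<noteq> 0" by (simp add: lY wX B)
    then have "w + z *s r \<noteq> 0" using form_at_0[OF B(2)] by auto
    then show ?thesis using that Fp by (simp add: C_def)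
  qed
  have noS: "\<not> par (w + z *s r) b" if "b \<in> S1 \<union> R" for b z
  proof
    assume pr: "par (w + z *s r) b"
    have "cY (w + z *s r) \<noteq> 0" by (simp add: lY wX B)
    then have "cY b \<noteq> 0" using par_form[OF pr B(2)] by simp
    then have "b \<in> S" using that by (simp add: S_def)
    moreover have "m b = 0" using par_form[OF pr fm] mline[of 1 z] by simp
    ultimately show False using mS by blast
  qed
  have card: "card {z. poly p z = 0} = d - 1"
    unfolding degp[symmetric]
  proof (rule card_roots_eq_degree[OF p0])
    fix z assume z: "poly p z = 0"
    obtain q where q: "\<And>t. F ((w + z *s r) + t *s r) = poly q t" "\<And>t. poly (pderiv q) t = DV r ((w + z *s r) + t *s r)"
      using line_DV[of "w + z *s r" r] by blast
    have "poly (q - pcompose p [:z, 1:]) t = 0" for t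
      using q(1)[of t] Fp[of "z + t"] by (simp add: poly_pcompose vector_sadd_rdistrib add.assoc algebra_simps)
    then have qp: "q = pcompose p [:z, 1:]" using poly_zero_fun by (metis eq_iff_diff_eq_0)
    have "poly (pderiv q) 0 = poly (pderiv p) z"
      by (simp add: qp pderiv_pcompose poly_pcompose pderiv_pCons)
    moreover have "DV r (w + z *s r) \<noteq> 0" using S1(3)[OF root[OF z]] noS by blast
    ultimately show "poly (pderiv p) z \<noteq> 0" using q(2)[of 0] by simp
  qed
  have fAm: "form UNIV (a + 1) (\<lambda>u. A u * m u)" by (rule form_mult[OF is_subring_UNIV A(1) fm])
  have mr: "m r = 0" using mline[of 0 1] by simp
  obtain Q where Q: "form UNIV (a + 1) Q" "\<And>y. y \<in> C \<Longrightarrow> A y * m y * l' (\<Psi> y) = l (\<Psi> y) * Q y"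
  proof (rule pullback_quotient[OF l l' fAm])
    fix x assume x: "x \<in> C" "l (\<Psi> x) = 0"
    then obtain r' where r': "r' \<in> R" "par x r'" using R(3) by blast
    show "A x * m x = 0 \<or> l' (\<Psi> x) = 0"
      using van[OF r'(1)]
    proof (elim disjE)
      assume "r' = r"
      then have "m x = 0" using par_form[OF r'(2) fm] mr by simp
      then show ?thesis by simp
    next
      assume "A r' = 0"
      then show ?thesis using par_form[OF r'(2) A(1)] by simp
    next
      assume "l' (\<Psi> r') = 0"
      moreover have "par (\<Psi> x) (\<Psi> r')" using \<Psi>_par[OF x(1) _ r'(2)] r'(1) R(2) by blast
      ultimately show ?thesis using par_form[OF _ l'] by blast
    qed
  qed (rule that)
  \<comment> \<open>At these points the left side vanishes through \<open>m\<close>, but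
    \<open>l\<close> composed with \<open>\<Psi>\<close> does not vanish, as they avoid
    \<open>R\<close>. This gives d - 1 zeros of a polynomial of degree at most d - 2.\<close>
  have Qroot: "Q (w + z *s r) = 0" if z: "poly p z = 0" for z
  proof -
    have y: "w + z *s r \<in> C" by (rule root[OF z])
    have "l (\<Psi> (w + z *s r)) \<noteq> 0" using R(3)[OF y] noS by blast
    then show ?thesis using Q(2)[OF y] mline[of 1 z] by simp
  qed
  obtain pQ where pQ: "degree pQ \<le> nat (a + 1)" "\<And>s z. Q (s *s w + z *s r) = binary (nat (a + 1)) pQ s z"
    using form_binary_line[OF Q(1), of w r] by auto
  have "pQ = 0"
  proof (rule ccontr)
    assume n: "pQ \<noteq> 0"
    have "{z. poly p z = 0} \<subseteq> {z. poly pQ z = 0}"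
      using Qroot pQ(2)[of 1] binary_one[OF pQ(1)] by auto
    then have "d - 1 \<le> card {z. poly pQ z = 0}"
      using card card_mono[OF poly_roots_finite[OF n]] by metis
    also have "\<dots> \<le> degree pQ" by (rule card_poly_roots_bound[OF n])
    finally show False using pQ(1) A(2) d_ge by linarith
  qed
  then have Q0: "Q (s *s w + z *s r) = 0" for s z using pQ(2) by simp
  obtain Q1 where Q1: "form UNIV (a + 1 - 1) Q1" "\<And>u. Q u - Q (u - m u *s b1) = m u * Q1 u"
    using form_shift[OF Q(1) fm, of b1] by blast
  have Qm: "Q u = m u * Q1 u" for u
  proof -
    have "u - m u *s b1 = cY u *s w + cZ u *s r"
      using B(4)[of u] by (simp add: m_def w_def vec_eq_iff algebra_simps)
    then show ?thesis using Q1(2)[of u] Q0 by simp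
  qed
  have fQ1: "form UNIV a Q1" using Q1(1) by simp
  obtain e g where g: "rep e g" "tuple g r \<noteq> 0" by (rule rep_ex[OF rC])
  have nvm: "\<not> van m"
  proof
    assume "van m"
    then have "m b1 = 0" using nondegenerate[OF fm] d_ge by simp
    then show False by (simp add: m_def B)
  qed
  \<comment> \<open>After \<open>m\<close> is cancelled the right hand side still contains
    \<open>l\<close>, which vanishes at the image of \<open>r\<close>.\<close>
  have "A r * l' (tuple g r) = Q1 r * l (tuple g r)"
  proof (rule van_cancel[OF fm nvm form_mult[OF is_subring_UNIV A(1) rep_form[OF g(1) l']]
        form_mult[OF is_subring_UNIV fQ1 rep_form[OF g(1) fl]] _ rC])
    fix y assume y: "y \<in> C"
    obtain c where c: "tuple g y = c *s \<Psi> y" using rep_mult[OF g(1) y] by metis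
    have "m y * (A y * l' (tuple g y)) = c * (A y * m y * l' (\<Psi> y))"
      unfolding c form_one_linear(2)[OF l'] by (simp only: mult_ac)
    also have "\<dots> = m y * (Q1 y * l (tuple g y))"
      unfolding c form_one_linear(2)[OF fl] Q(2)[OF y] Qm by (simp only: mult_ac)
    finally show "m y * (A y * l' (tuple g y)) = m y * (Q1 y * l (tuple g y))" .
  qed
  moreover have "l (tuple g r) = 0" using rep_zero_iff[OF g(1) rC g(2) fl] r(2) by simp
  ultimately have "A r = 0 \<or> l' (tuple g r) = 0" by simp
  then show ?thesis using rep_zero_iff[OF g(1) rC g(2) l'] by simp
qed

text \<open>Otherwise some \<open>r3\<close> lies off the line \<open>m\<close> through two of the
  points \<open>r1\<close> and \<open>r2\<close>. The product \<open>A\<close> of \<open>m\<close>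
  and one line for each further point but one vanishes at these points and not at \<open>r3\<close>.
  The point left out is covered by a line \<open>l'\<close> on the target side, which keeps the
  degree of \<open>A\<close> at 1 + (d - 4) = d - 3 at most, and \<open>reduction\<close> gives the
  contradiction.\<close>

lemma preimage_collinear:
  assumes l: "transversal l" and nv: "\<And>x. x \<in> C \<Longrightarrow> l (\<Psi> x) = 0 \<Longrightarrow> \<not> van (DV x)"
    and R: "finite R" "card R \<le> d" "R \<subseteq> C" "\<And>r. r \<in> R \<Longrightarrow> l (\<Psi> r) = 0"
    "\<And>x. x \<in> C \<Longrightarrow> l (\<Psi> x) = 0 \<Longrightarrow> \<exists>r\<in>R. par x r"
    "\<And>r r'. r \<in> R \<Longrightarrow> r' \<in> R \<Longrightarrow> par r r' \<Longrightarrow> r = r'"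
  shows "\<exists>m w. form UNIV 1 m \<and> m w \<noteq> 0 \<and> (\<forall>r\<in>R. m r = 0)"
proof (rule ccontr)
  assume contra: "\<not> ?thesis"
  have nz: "r \<noteq> 0" if "r \<in> R" for r using that R(3) by (auto simp: C_def)
  have two: "\<exists>m w. form UNIV 1 m \<and> m w \<noteq> 0 \<and> m u = 0 \<and> m v = 0" for u v :: "'K ^ 3"
    using linear_form_through_two[of u v] by metis
  have "R \<noteq> {}" using contra two[of 0 0] by auto
  then obtain r1 where r1: "r1 \<in> R" by blast
  obtain r2 where r2: "r2 \<in> R" "r2 \<noteq> r1"
    using contra two[of r1 r1] by metis
  obtain m w where m: "form UNIV 1 m" "m w \<noteq> 0" "m r1 = 0" "m r2 = 0" using two[of r1 r2] by blast
  obtain r3 where r3: "r3 \<in> R" "m r3 \<noteq> 0" using contra m(1,2) by blast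
  have ne: "r3 \<noteq> r1" "r3 \<noteq> r2" using r3 m by auto
  define R' where "R' = R - {r1, r2, r3}"
  have "card R' = card R - card {r1, r2, r3}"
    unfolding R'_def by (rule card_Diff_subset) (use r1 r2 r3 in auto)
  then have cR': "card R' \<le> d - 3" using R(2) ne r2 by simp
  have finR': "finite R'" using R(1) by (simp add: R'_def)
  have sep: "\<exists>k. form UNIV 1 k \<and> k r = 0 \<and> k r3 \<noteq> 0" if "r \<in> R'" for r
  proof -
    have "\<not> par r3 r" using R(6)[OF r3(1), of r] that by (auto simp: R'_def)
    then show ?thesis using separating_linear_form[of r3 r] nz r3(1) that by (metis DiffD1 R'_def)
  qed
  then obtain k where k: "\<And>r. r \<in> R' \<Longrightarrow> form UNIV 1 (k r) \<and> k r r = 0 \<and> k r r3 \<noteq> 0" by metis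
  have r3C: "r3 \<in> C" using r3 R(3) by blast
  have \<Psi>3: "\<Psi> r3 \<noteq> 0" using \<Psi>_C[OF r3C] by (simp add: C_def)
  \<comment> \<open>If there is no further point, any coordinate that is nonzero at
    \<open>\<Psi> r3\<close> serves as \<open>l'\<close>.\<close>
  obtain l' R'' where l': "form UNIV 1 l'" "l' (\<Psi> r3) \<noteq> 0" and R'': "R'' \<subseteq> R'" "card R'' \<le> d - 4"
    "\<And>r. r \<in> R' - R'' \<Longrightarrow> l' (\<Psi> r) = 0"
  proof (cases "R' = {}")
    case True
    obtain i where i: "\<Psi> r3 $ i \<noteq> 0" using \<Psi>3 by (auto simp: vec_eq_iff)
    show ?thesis by (rule that[of "\<lambda>u. u $ i" "{}"]) (use i True formU(9) in auto)
  next
    case False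
    then obtain r4 where r4: "r4 \<in> R'" by blast
    then have r4C: "r4 \<in> C" using R(3) by (auto simp: R'_def)
    have "\<not> par r3 r4" using R(6)[OF r3(1), of r4] r4 by (auto simp: R'_def)
    then have "\<not> par (\<Psi> r3) (\<Psi> r4)" using \<Psi>_par_iff[OF r3C r4C] by simp
    moreover have "\<Psi> r4 \<noteq> 0" using \<Psi>_C[OF r4C] by (simp add: C_def)
    ultimately obtain l' where l': "form UNIV 1 l'" "l' (\<Psi> r4) = 0" "l' (\<Psi> r3) \<noteq> 0"
      using separating_linear_form[OF \<Psi>3] by metis
    show ?thesis
    proof (rule that[of l' "R' - {r4}"])
      show "card (R' - {r4}) \<le> d - 4" using cR' r4 finR' by simp
    qed (use l' in auto)
  qed
  have finR'': "finite R''" using R''(1) finR' finite_subset by blast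
  define A where "A = (\<lambda>u. m u * (\<Prod>r\<in>R''. k r u))"
  have "form UNIV (\<Sum>r\<in>R''. 1) (\<lambda>u. \<Prod>r\<in>R''. k r u)"
    by (rule form_prod[OF is_subring_UNIV]) (use k R''(1) in blast)
  then have fA: "form UNIV (1 + int (card R'')) A"
    unfolding A_def using form_mult[OF is_subring_UNIV m(1)] by simp
  have "A r3 = 0 \<or> l' (\<Psi> r3) = 0"
  proof (rule reduction[OF l R(1,3,5) r3(1) R(4)[OF r3(1)] nv[OF r3C R(4)[OF r3(1)]] fA _ l'(1)])
    show "1 + int (card R'') + 3 \<le> int d" using R''(2) d_ge by linarith
    fix x assume x: "x \<in> R"
    show "x = r3 \<or> A x = 0 \<or> l' (\<Psi> x) = 0"
    proof (cases "x \<in> R''")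
      case True
      then have "k x x = 0" using k R''(1) by blast
      then have "(\<Prod>r\<in>R''. k r x) = 0" using True finR'' by (auto simp: prod_zero_iff)
      then show ?thesis by (simp add: A_def)
    next
      case False
      then show ?thesis using x m(3,4) R''(3)[of x] by (auto simp: A_def R'_def)
    qed
  qed
  moreover have "A r3 \<noteq> 0" using r3(2) k R''(1) finR'' by (auto simp: A_def prod_zero_iff)
  ultimately show False using l'(2) by blast
qed

text \<open>Let \<open>m\<close> vanish on the preimage of the line \<open>l\<close>. Then
  \<open>m y * \<Psi> y $ j / l (\<Psi> y)\<close> has no poles, hence is a form of degree 1 by
  \<open>pullback_quotient\<close>, and these forms are the rows of \<open>M\<close>. Wherever
  \<open>l (\<Psi> y)\<close> is nonzero, \<open>M *v y\<close> is \<open>\<Psi> y\<close> times a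
  scalar that does not depend on \<open>j\<close>.\<close>

theorem linear_ex:
  obtains M :: "'K ^ 3 ^ 3" where "\<exists>y\<in>C. M *v y \<noteq> 0"
    "\<And>y i j. y \<in> C \<Longrightarrow> (M *v y) $ i * \<Psi> y $ j = (M *v y) $ j * \<Psi> y $ i"
proof -
  obtain l R where l: "transversal l" and nv: "\<And>x. x \<in> C \<Longrightarrow> l (\<Psi> x) = 0 \<Longrightarrow> \<not> van (DV x)"
    and R: "finite R" "card R \<le> d" "R \<subseteq> C" "\<And>r. r \<in> R \<Longrightarrow> l (\<Psi> r) = 0"
    "\<And>x. x \<in> C \<Longrightarrow> l (\<Psi> x) = 0 \<Longrightarrow> \<exists>r\<in>R. par x r"
    "\<And>r r'. r \<in> R \<Longrightarrow> r' \<in> R \<Longrightarrow> par r r' \<Longrightarrow> r = r'"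
    by (rule good_line) (rule that)
  obtain m w where m: "form UNIV 1 m" "m w \<noteq> 0" "\<And>r. r \<in> R \<Longrightarrow> m r = 0"
    using preimage_collinear[OF l nv R] by blast
  have fl: "form UNIV 1 l" using l by (simp add: transversal_def)
  have "\<exists>Q. form UNIV 1 Q \<and> (\<forall>y\<in>C. m y * \<Psi> y $ j = l (\<Psi> y) * Q y)" for j
  proof -
    obtain Q where "form UNIV 1 Q" "\<And>y. y \<in> C \<Longrightarrow> m y * \<Psi> y $ j = l (\<Psi> y) * Q y"
    proof (rule pullback_quotient[OF l formU(9)[of j] m(1)])
      fix x assume "x \<in> C" "l (\<Psi> x) = 0"
      then obtain r where "r \<in> R" "par x r" using R(5) by blast
      then show "m x = 0 \<or> \<Psi> x $ j = 0" using par_form[OF _ m(1)] m(3) by blast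
    qed (rule that)
    then show ?thesis by blast
  qed
  then obtain Q where Q: "\<And>j. form UNIV 1 (Q j)" "\<And>j y. y \<in> C \<Longrightarrow> m y * \<Psi> y $ j = l (\<Psi> y) * Q j y" by metis
  define M :: "'K ^ 3 ^ 3" where "M = (\<chi> j k. Q j (axis k 1))"
  have M: "(M *v y) $ j = Q j y" for y j
    by (simp add: M_def matrix_vector_mult_def form_one_eq[OF Q(1), of j y])
  show ?thesis
  proof (rule that[of M])
    show "\<exists>y\<in>C. M *v y \<noteq> 0"
    proof (rule ccontr)
      assume n: "\<not> ?thesis"
      have "m y = 0" if y: "y \<in> C" for y
      proof -
        have "\<Psi> y \<noteq> 0" using \<Psi>_C[OF y] by (simp add: C_def)
        then obtain j where "\<Psi> y $ j \<noteq> 0" by (auto simp: vec_eq_iff)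
        moreover have "Q j y = 0" using n y M[of y j] by auto
        ultimately show ?thesis using Q(2)[OF y, of j] by simp
      qed
      then show False using nondegenerate[OF m(1)] m(2) d_ge by (simp add: van_def)
    qed
    fix y i j assume y: "y \<in> C"
    obtain x0 where x0: "x0 \<in> C" using nonempty by (auto simp: C_def)
    obtain e g where g: "rep e g" "tuple g y \<noteq> 0" by (rule rep_ex[OF y])
    have nvl: "\<not> van (\<lambda>y. l (tuple g y))"
      using rep_not_van[OF g(1) y g(2) fl] l unfolding transversal_def by blast
    have gf: "\<And>j. form UNIV e (g j)" using g(1) by (simp add: rep_def)
    have "Q i y * g j y = Q j y * g i y"
    proof (rule van_cancel[OF rep_form[OF g(1) fl] nvl form_mult[OF is_subring_UNIV Q(1) gf] form_mult[OF is_subring_UNIV Q(1) gf] _ y])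
      fix z assume z: "z \<in> C"
      obtain c where c: "tuple g z = c *s \<Psi> z" using rep_mult[OF g(1) z] by metis
      have gz: "g j z = c * \<Psi> z $ j" for j using c by (metis tuple_nth vector_smult_component)
      have *: "l (tuple g z) * Q i z = m z * g i z" for i
        unfolding c form_one_linear(2)[OF fl] gz using Q(2)[OF z, of i] by (metis mult.assoc mult.left_commute)
      have "l (tuple g z) * (Q i z * g j z) = m z * g i z * g j z" using *[of i] by (metis mult.assoc)
      also have "\<dots> = l (tuple g z) * (Q j z * g i z)" using *[of j] by (metis mult.assoc mult.commute)
      finally show "l (tuple g z) * (Q i z * g j z) = l (tuple g z) * (Q j z * g i z)" .
    qed
    moreover obtain c where c: "tuple g y = c *s \<Psi> y" "c \<noteq> 0" using rep_mult[OF g(1) y] g(2) by metis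
    moreover have "g j y = c * \<Psi> y $ j" for j using c by (metis tuple_nth vector_smult_component)
    ultimately show "(M *v y) $ i * \<Psi> y $ j = (M *v y) $ j * \<Psi> y $ i"
      by (simp add: M mult.left_commute)
  qed
qed

text \<open>Stated for an arbitrary matrix parallel to \<open>\<Psi>\<close>, since it will be
  applied to one with entries in a smaller field. A linear form killing the image of
  \<open>M\<close> would vanish on \<open>\<Psi>\<close> of the curve, hence on the curve; and F
  composed with \<open>M\<close> is a multiple of F of equal degree.\<close>

theorem linear_unique:
  fixes M :: "'K ^ 3 ^ 3"
  assumes nz: "\<exists>y\<in>C. M *v y \<noteq> 0"
    and cr: "\<And>y i j. y \<in> C \<Longrightarrow> (M *v y) $ i * \<Psi> y $ j = (M *v y) $ j * \<Psi> y $ i"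
  shows "det M \<noteq> 0" "\<And>y. y \<in> C \<Longrightarrow> par (M *v y) (\<Psi> y)" "\<exists>c. c \<noteq> 0 \<and> (\<forall>u. F (M *v u) = c * F u)"
proof -
  have fM: "form UNIV 1 (\<lambda>y. (M *v y) $ i)" for i
    unfolding matrix_vector_mult_def by (simp add: form_linear)
  show det: "det M \<noteq> 0"
  proof
    assume "det M = 0"
    then have "det (transpose M) = 0" by (simp add: det_transpose)
    then have "\<not> (\<exists>B. B ** transpose M = mat 1)" using invertible_det_nz invertible_left_inverse by metis
    then obtain r where r: "transpose M *v r = 0" "r \<noteq> 0" using matrix_left_invertible_ker by metis
    define \<rho> where "\<rho> = (\<lambda>u::'K^3. \<Sum>i\<in>UNIV. r $ i * u $ i)"
    have f\<rho>: "form UNIV 1 \<rho>" unfolding \<rho>_def by (rule form_linear) auto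
    have \<rho>M: "\<rho> (M *v y) = 0" for y
    proof -
      have "\<rho> (M *v y) = (\<Sum>j\<in>UNIV. (transpose M *v r) $ j * y $ j)"
        unfolding \<rho>_def matrix_vector_mult_def transpose_def
        by (simp add: sum_distrib_left sum_distrib_right, subst sum.swap) (simp add: mult_ac)
      then show ?thesis using r by simp
    qed
    obtain y0 i where i: "y0 \<in> C" "(M *v y0) $ i \<noteq> 0" using nz by (metis vec_eq_iff zero_index)
    then have nvi: "\<not> van (\<lambda>y. (M *v y) $ i)" by (auto simp: van_def)
    have \<rho>\<Psi>: "\<rho> (\<Psi> y) = 0" if y: "y \<in> C" for y
    proof -
      obtain e g where g: "rep e g" "tuple g y \<noteq> 0" by (rule rep_ex[OF y])
      have "van (\<lambda>y. \<rho> (tuple g y))"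
      proof (rule van_prime[OF fM rep_form[OF g(1) f\<rho>] _ nvi])
        fix z assume z: "z \<in> C"
        obtain c where c: "tuple g z = c *s \<Psi> z" using rep_mult[OF g(1) z] by metis
        have "(M *v z) $ i * \<rho> (tuple g z) = c * (\<Sum>k\<in>UNIV. r $ k * ((M *v z) $ i * \<Psi> z $ k))"
          unfolding c form_one_linear(2)[OF f\<rho>] by (simp add: \<rho>_def sum_distrib_left mult_ac)
        also have "\<dots> = c * (\<Psi> z $ i * \<rho> (M *v z))"
          unfolding cr[OF z, of i] by (simp add: \<rho>_def sum_distrib_left mult_ac)
        finally show "(M *v z) $ i * \<rho> (tuple g z) = 0" using \<rho>M by simp
      qed
      then show ?thesis using rep_zero_iff[OF g(1) y g(2) f\<rho>] y by (simp add: van_def)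
    qed
    have "van \<rho>"
      unfolding van_def using \<rho>\<Psi> \<Phi>_C par_form[OF \<Psi>\<Phi> f\<rho>] by blast
    then have "\<rho> u = 0" for u using nondegenerate[OF f\<rho>] d_ge by simp
    moreover have "\<rho> (axis i 1) = r $ i" for i
    proof -
      have "\<rho> (axis i 1) = (\<Sum>j\<in>UNIV. if j = i then r $ j else 0)"
        unfolding \<rho>_def by (rule sum.cong) (auto simp: axis_def)
      then show ?thesis by simp
    qed
    ultimately show False using r(2) by (simp add: vec_eq_iff)
  qed
  have ker: "M *v u = 0 \<Longrightarrow> u = 0" for u
    using det invertible_det_nz invertible_left_inverse matrix_left_invertible_ker by metis
  show par: "par (M *v y) (\<Psi> y)" if y: "y \<in> C" for y
  proof (rule par_if_cross)
    show "M *v y \<noteq> 0" using ker y by (auto simp: C_def)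
    show "\<Psi> y \<noteq> 0" using \<Psi>_C[OF y] by (simp add: C_def)
  qed (rule cr[OF y])
  have "form UNIV (int d * 1) (\<lambda>u. F (tuple (\<lambda>i u. (M *v u) $ i) u))"
    by (rule form_tuple[OF form_F fM])
  moreover have "tuple (\<lambda>i u. (M *v u) $ i) u = M *v u" for u by (simp add: vec_eq_iff)
  ultimately have fFM: "form UNIV (int d) (\<lambda>u. F (M *v u))" by simp
  have "van (\<lambda>u. F (M *v u))"
    unfolding van_def using par_form[OF par form_F] \<Psi>_C by (auto simp: C_def)
  then obtain Q where Q: "form UNIV (int d - int d) Q" "\<And>u. F (M *v u) = F u * Q u"
    by (rule van_multiple[OF fFM]) (rule that)
  have Qc: "Q u = Q 0" for u using form_0_const[of UNIV Q u] Q(1) by simp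
  have "Q 0 \<noteq> 0"
  proof
    assume z: "Q 0 = 0"
    obtain P where P: "F P \<noteq> 0" using good_point by blast
    obtain B where "M ** B = mat 1" using det invertible_det_nz invertible_right_inverse by metis
    then have "M *v (B *v P) = P" by (simp add: matrix_vector_mul_assoc)
    then show False using Q(2)[of "B *v P"] Qc[of "B *v P"] z P by simp
  qed
  then show "\<exists>c. c \<noteq> 0 \<and> (\<forall>u. F (M *v u) = c * F u)"
    using Q(2) Qc by (intro exI[of _ "Q 0"]) (metis mult.commute)
qed

end


section \<open>Points and forms\<close>

lemma mem_pt: "y \<in> pt x \<longleftrightarrow> par y x"
  by (auto simp: pt_def par_def)

lemma pt_eq_iff: "pt x = pt y \<longleftrightarrow> par x y"
proof
  assume "pt x = pt y"
  then show "par x y" using mem_pt[of x x] mem_pt[of x y] by simp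
next
  assume "par x y"
  then show "pt x = pt y" by (auto simp: set_eq_iff mem_pt intro: par_trans par_sym)
qed

lemma mp_eval_par:
  assumes "homogeneous d f" "par x y"
  shows "mp_eval f x = 0 \<longleftrightarrow> mp_eval f y = 0"
  by (rule par_form[OF assms(2) form_mp_eval[OF assms(1)]]) (auto simp: coeffs_in_def)

lemma pt_in_proj_zeros:
  assumes "\<And>f. f \<in> S \<Longrightarrow> \<exists>d. homogeneous d f" "x \<noteq> 0"
  shows "pt x \<in> proj_zeros S \<longleftrightarrow> (\<forall>f\<in>S. mp_eval f x = 0)"
proof
  assume "pt x \<in> proj_zeros S"
  then obtain y where "par x y" "\<forall>f\<in>S. mp_eval f y = 0" by (auto simp: proj_zeros_def pt_eq_iff)
  then show "\<forall>f\<in>S. mp_eval f x = 0" using mp_eval_par assms(1) by blast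
qed (use assms(2) in \<open>auto simp: proj_zeros_def\<close>)

lemma coeffs_in_UNIV [simp]: "coeffs_in UNIV p"
  by (simp add: coeffs_in_def)

text \<open>A vanishing gradient would contradict the rank condition, and primality is
  irreducibility applied to the zero sets of the two forms.\<close>

lemma smooth_plane_curve_locale:
  fixes F :: "(3, 'K::alg_closed_field) mpoly"
  assumes sm: "smooth_plane_curve k F" and d: "homogeneous d F" "d \<ge> 4"
  shows "plane_curve (mp_eval F) d (\<lambda>i. mp_eval (mp_deriv i F))"
proof
  have mem: "pt x \<in> proj_zeros {F} \<longleftrightarrow> mp_eval F x = 0" if "x \<noteq> 0" for x
    using pt_in_proj_zeros[of "{F}" x] d that by auto
  have irr: "irreducible_closed (proj_zeros {F})" using sm by (simp add: smooth_plane_curve_def smooth_curve_def)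
  show "form UNIV (int d) (mp_eval F)" by (rule form_mp_eval[OF d(1)]) simp
  show "4 \<le> d" by (rule d(2))
  show "form UNIV (int d - 1) (mp_eval (mp_deriv i F))" for i by (rule form_deriv[OF d(1)])
  show "\<exists>q. (\<forall>t. mp_eval F (x + t *s v) = poly q t) \<and> (\<forall>t. poly (pderiv q) t = (\<Sum>i\<in>UNIV. v $ i * mp_eval (mp_deriv i F) (x + t *s v)))" for x v
    by (rule mp_eval_line_deriv)
  show "\<exists>i. mp_eval (mp_deriv i F) x \<noteq> 0" if x: "x \<noteq> 0" "mp_eval F x = 0" for x
  proof (rule ccontr)
    assume "\<not> ?thesis"
    then have g0: "gradient F x = 0" by (simp add: gradient_def vec_eq_iff)
    have "vec.dim {gradient f x | f. f \<in> {F}} + 2 = CARD(3)"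
      using sm mem[OF x(1)] x unfolding smooth_plane_curve_def smooth_curve_def by blast
    moreover have "{gradient f x | f. f \<in> {F}} = {0}" using g0 by auto
    moreover have "vec.dim {0 :: 'K ^ 3} = 0" using vec.dim_span[of "{}"] vec.dim_span[of "{0::'K^3}"] by simp
    ultimately show False by simp
  qed
  show "\<exists>x. x \<noteq> 0 \<and> mp_eval F x = 0"
    using irr by (auto simp: irreducible_closed_def proj_zeros_def)
  show "(\<forall>x. x \<noteq> 0 \<longrightarrow> mp_eval F x = 0 \<longrightarrow> f x = 0) \<or> (\<forall>x. x \<noteq> 0 \<longrightarrow> mp_eval F x = 0 \<longrightarrow> g x = 0)"
    if f: "form UNIV e f" and g: "form UNIV e' g" and fg: "\<And>x. x \<noteq> 0 \<Longrightarrow> mp_eval F x = 0 \<Longrightarrow> f x * g x = 0" for e f e' g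
  proof -
    consider "e < 0" | "e' < 0" | "e \<ge> 0" "e' \<ge> 0" by linarith
    then show ?thesis
    proof cases
      case 1
      then show ?thesis using form_neg[OF f] by simp
    next
      case 2
      then show ?thesis using form_neg[OF g] by simp
    next
      case 3
      obtain p where p: "homogeneous (nat e) p" "f = mp_eval p"
        using formE[of UNIV "nat e" f] f 3 by auto
      obtain q where q: "homogeneous (nat e') q" "g = mp_eval q"
        using formE[of UNIV "nat e'" g] g 3 by auto
      have zp: "zariski_closed (proj_zeros {p})" "zariski_closed (proj_zeros {q})"
        unfolding zariski_closed_def using p(1) q(1) by blast+
      have memp: "pt x \<in> proj_zeros {p} \<longleftrightarrow> f x = 0" if "x \<noteq> 0" for x
        using pt_in_proj_zeros[of "{p}" x] p that by auto
      have memq: "pt x \<in> proj_zeros {q} \<longleftrightarrow> g x = 0" if "x \<noteq> 0" for x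
        using pt_in_proj_zeros[of "{q}" x] q that by auto
      have "proj_zeros {F} \<subseteq> proj_zeros {p} \<union> proj_zeros {q}"
      proof
        fix P assume "P \<in> proj_zeros {F}"
        then obtain x where x: "P = pt x" "x \<noteq> 0" "mp_eval F x = 0" by (auto simp: proj_zeros_def)
        then have "f x = 0 \<or> g x = 0" using fg[of x] by simp
        then show "P \<in> proj_zeros {p} \<union> proj_zeros {q}" using memp memq x by auto
      qed
      then have "proj_zeros {F} \<subseteq> proj_zeros {p} \<or> proj_zeros {F} \<subseteq> proj_zeros {q}"
        using irr zp unfolding irreducible_closed_def by blast
      then show ?thesis using mem memp memq by blast
    qed
  qed
qed


section \<open>Rationality\<close>

definition is_subfield :: "'a::field set \<Rightarrow> bool" where
  "is_subfield L \<longleftrightarrow> is_subring L \<and> (\<forall>x\<in>L. inverse x \<in> L)"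

lemma is_subfieldD:
  assumes "is_subfield L"
  shows "is_subring L" "x \<in> L \<Longrightarrow> inverse x \<in> L" "x \<in> L \<Longrightarrow> y \<in> L \<Longrightarrow> x / y \<in> L"
  using assms is_subringD(4)[of L] by (auto simp: is_subfield_def divide_inverse)

text \<open>The kernel is a subspace maximal among those not containing 1, found by Zorn's lemma;
  maximality makes it a complement of \<open>L\<close>. Applying \<open>\<pi>\<close> to
  coefficients turns a solution of linear equations over \<open>L\<close> into one with entries in
  \<open>L\<close>.\<close>

lemma linear_retraction:
  fixes L :: "'a::field set"
  assumes L: "is_subfield L"
  obtains \<pi> :: "'a \<Rightarrow> 'a" where "\<And>x y. \<pi> (x + y) = \<pi> x + \<pi> y" "\<And>a x. a \<in> L \<Longrightarrow> \<pi> (x * a) = \<pi> x * a"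
    "\<And>x. \<pi> x \<in> L" "\<pi> 1 = 1"
proof -
  note R = is_subringD[OF is_subfieldD(1)[OF L]]
  define \<W> where "\<W> = {W. 0 \<in> W \<and> (\<forall>x\<in>W. \<forall>y\<in>W. x + y \<in> W) \<and> (\<forall>x\<in>W. \<forall>a\<in>L. x * a \<in> W) \<and> 1 \<notin> W}"
  have "\<exists>W\<in>\<W>. \<forall>W2\<in>\<W>. W \<subseteq> W2 \<longrightarrow> W2 = W"
  proof (rule subset_Zorn_nonempty)
    show "\<W> \<noteq> {}" by (auto simp: \<W>_def intro!: exI[of _ "{0}"])
    fix \<C> assume c: "\<C> \<noteq> {}" "subset.chain \<W> \<C>"
    have sub: "\<And>W. W \<in> \<C> \<Longrightarrow> W \<in> \<W>" using c(2) by (auto simp: subset.chain_def)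
    have tot: "\<And>V W. V \<in> \<C> \<Longrightarrow> W \<in> \<C> \<Longrightarrow> V \<subseteq> W \<or> W \<subseteq> V" using c(2) by (auto simp: subset.chain_def)
    show "\<Union>\<C> \<in> \<W>"
      unfolding \<W>_def mem_Collect_eq
    proof (intro conjI ballI)
      show "0 \<in> \<Union>\<C>" using c(1) sub by (auto simp: \<W>_def)
      show "1 \<notin> \<Union>\<C>" using sub by (auto simp: \<W>_def)
      show "x + y \<in> \<Union>\<C>" if xy: "x \<in> \<Union>\<C>" "y \<in> \<Union>\<C>" for x y
      proof -
        obtain V W where VW: "V \<in> \<C>" "x \<in> V" "W \<in> \<C>" "y \<in> W" using xy by blast
        then obtain U where U: "U \<in> \<C>" "x \<in> U" "y \<in> U" using tot by blast
        then have "x + y \<in> U" using sub[OF U(1)] unfolding \<W>_def by blast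
        then show ?thesis using U(1) by blast
      qed
      show "x * a \<in> \<Union>\<C>" if "x \<in> \<Union>\<C>" "a \<in> L" for x a
        using that sub by (auto simp: \<W>_def)
    qed
  qed
  then obtain W where W: "W \<in> \<W>" and max: "\<And>W2. W2 \<in> \<W> \<Longrightarrow> W \<subseteq> W2 \<Longrightarrow> W2 = W" by blast
  have W0: "0 \<in> W" and Wadd: "\<And>x y. x \<in> W \<Longrightarrow> y \<in> W \<Longrightarrow> x + y \<in> W"
    and Wmult: "\<And>x a. x \<in> W \<Longrightarrow> a \<in> L \<Longrightarrow> x * a \<in> W" and W1: "1 \<notin> W"
    using W by (auto simp: \<W>_def)
  have ex: "\<exists>a\<in>L. x - a \<in> W" for x
  proof (cases "x \<in> W")
    case True
    then show ?thesis using R(1) by (intro bexI[of _ 0]) auto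
  next
    case False
    define W2 where "W2 = {w + x * a | w a. w \<in> W \<and> a \<in> L}"
    have "W \<subseteq> W2"
    proof
      fix w assume "w \<in> W"
      then have "w = w + x * 0 \<and> w \<in> W \<and> 0 \<in> L" using R(1) by simp
      then show "w \<in> W2" unfolding W2_def by blast
    qed
    moreover have "x \<in> W2"
    proof -
      have "x = 0 + x * 1 \<and> 0 \<in> W \<and> 1 \<in> L" using W0 R(2) by simp
      then show ?thesis unfolding W2_def by blast
    qed
    ultimately have "W2 \<notin> \<W>" using max False by blast
    moreover have "0 \<in> W2" using \<open>W \<subseteq> W2\<close> W0 by blast
    moreover have "u + v \<in> W2" if uv: "u \<in> W2" "v \<in> W2" for u v
    proof -
      obtain w a w' a' where "w \<in> W" "a \<in> L" "w' \<in> W" "a' \<in> L" "u = w + x * a" "v = w' + x * a'"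
        using uv by (auto simp: W2_def)
      then have "u + v = (w + w') + x * (a + a') \<and> w + w' \<in> W \<and> a + a' \<in> L"
        using Wadd R(3) by (simp add: algebra_simps)
      then show ?thesis unfolding W2_def by blast
    qed
    moreover have "u * b \<in> W2" if ub: "u \<in> W2" "b \<in> L" for u b
    proof -
      obtain w a where w: "w \<in> W" "a \<in> L" "u = w + x * a" using ub by (auto simp: W2_def)
      have "u * b = w * b + x * (a * b)" by (simp add: w algebra_simps)
      then have "u * b = w * b + x * (a * b) \<and> w * b \<in> W \<and> a * b \<in> L"
        using Wmult[OF w(1) ub(2)] R(4)[OF w(2) ub(2)] by simp
      then show ?thesis unfolding W2_def by blast
    qed
    ultimately have "1 \<in> W2" unfolding \<W>_def by blast
    then obtain w a where wa: "w \<in> W" "a \<in> L" "1 = w + x * a" by (auto simp: W2_def)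
    have a0: "a \<noteq> 0" using wa W1 by auto
    have "x * a = 1 - w" using wa(3) by (metis add_diff_cancel_left')
    then have x: "x = (1 - w) * inverse a" using a0 by (simp add: field_simps)
    have "x - inverse a = w * (- inverse a)" by (subst x) (simp add: algebra_simps)
    also have "\<dots> \<in> W" using Wmult[OF wa(1) R(5)[OF is_subfieldD(2)[OF L wa(2)]]] .
    finally show ?thesis using is_subfieldD(2)[OF L wa(2)] by blast
  qed
  have uniq: "a = b" if ab: "a \<in> L" "b \<in> L" "x - a \<in> W" "x - b \<in> W" for x a b
  proof (rule ccontr)
    assume ne: "a \<noteq> b"
    have "a - b = (x - b) + (x - a) * (- 1)" by simp
    also have "\<dots> \<in> W" using Wadd[OF ab(4) Wmult[OF ab(3) R(5)[OF R(2)]]] .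
    finally have "(a - b) * inverse (a - b) \<in> W" using Wmult is_subfieldD(2)[OF L] R(6) ab by blast
    then show False using ne W1 by simp
  qed
  define \<pi> where "\<pi> = (\<lambda>x. SOME a. a \<in> L \<and> x - a \<in> W)"
  have \<pi>: "\<pi> x \<in> L" "x - \<pi> x \<in> W" for x
    using someI_ex[of "\<lambda>a. a \<in> L \<and> x - a \<in> W"] ex[of x] unfolding \<pi>_def by blast+
  show ?thesis
  proof (rule that[of \<pi>])
    show "\<pi> x \<in> L" for x by (rule \<pi>)
    have "(x + y) - (\<pi> x + \<pi> y) = (x - \<pi> x) + (y - \<pi> y)" for x y by simp
    then show "\<pi> (x + y) = \<pi> x + \<pi> y" for x y
      using uniq[OF \<pi>(1) R(3)[OF \<pi>(1) \<pi>(1)] \<pi>(2)] Wadd[OF \<pi>(2) \<pi>(2)] by metis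
    have "x * a - \<pi> x * a = (x - \<pi> x) * a" for x a by (simp add: algebra_simps)
    then show "\<pi> (x * a) = \<pi> x * a" if "a \<in> L" for a x
      using uniq[OF \<pi>(1) R(4)[OF \<pi>(1) that] \<pi>(2)] Wmult[OF \<pi>(2) that] by metis
    show "\<pi> 1 = 1" using uniq[OF \<pi>(1) R(2) \<pi>(2)] W0 by simp
  qed
qed

section \<open>Maps acting on coefficients\<close>

definition map_coeffs :: "('a \<Rightarrow> 'b) \<Rightarrow> ('i, 'a::zero) mpoly \<Rightarrow> ('i, 'b::zero) mpoly" where
  "map_coeffs h p = Poly_Mapping.map h p"

lemma lookup_map_coeffs: "h 0 = 0 \<Longrightarrow> Poly_Mapping.lookup (map_coeffs h p) m = h (Poly_Mapping.lookup p m)"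
  unfolding map_coeffs_def by (simp add: Poly_Mapping.map.rep_eq when_def)

lemma map_coeffs_add:
  assumes "\<And>x y. h (x + y) = h x + h y" "h 0 = 0"
  shows "map_coeffs h (p + q) = map_coeffs h p + map_coeffs h q"
  by (rule poly_mapping_eqI) (simp add: lookup_map_coeffs lookup_add assms)

lemma map_coeffs_sum:
  assumes "\<And>x y. h (x + y) = h x + h y" "h 0 = 0"
  shows "map_coeffs h (sum f I) = (\<Sum>i\<in>I. map_coeffs h (f i))"
proof (induction I rule: infinite_finite_induct)
  case (insert i I)
  then show ?case by (simp add: map_coeffs_add[of h] assms)
qed (auto intro!: poly_mapping_eqI simp: lookup_map_coeffs assms)

lemma map_coeffs_single: "h 0 = 0 \<Longrightarrow> map_coeffs h (Poly_Mapping.single m c) = Poly_Mapping.single m (h c)"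
  by (rule poly_mapping_eqI) (simp add: lookup_map_coeffs lookup_single when_def)

text \<open>The map is only \<open>L\<close>-linear, so it passes through a product when one factor
  has coefficients in \<open>L\<close>.\<close>

lemma map_coeffs_mult:
  fixes p q :: "('i, 'a::comm_ring_1) mpoly"
  assumes h: "\<And>x y. h (x + y) = h x + h y" "h 0 = 0" "\<And>a x. a \<in> L \<Longrightarrow> h (x * a) = h x * a" and q: "coeffs_in L q"
  shows "map_coeffs h (p * q) = map_coeffs h p * q"
proof -
  let ?s = "\<lambda>p m. Poly_Mapping.single m (Poly_Mapping.lookup p m)"
  have pq: "p * q = (\<Sum>m\<in>Poly_Mapping.keys p. \<Sum>m'\<in>Poly_Mapping.keys q. ?s p m * ?s q m')"
    by (subst poly_mapping_expand[of p], subst poly_mapping_expand[of q]) (simp add: sum_product)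
  have p: "map_coeffs h p = (\<Sum>m\<in>Poly_Mapping.keys p. Poly_Mapping.single m (h (Poly_Mapping.lookup p m)))"
    by (subst poly_mapping_expand[of p]) (simp add: map_coeffs_sum[of h, OF h(1,2)] map_coeffs_single h(2))
  have "map_coeffs h p * q = (\<Sum>m\<in>Poly_Mapping.keys p. \<Sum>m'\<in>Poly_Mapping.keys q.
      Poly_Mapping.single m (h (Poly_Mapping.lookup p m)) * ?s q m')"
    unfolding p by (subst poly_mapping_expand[of q]) (simp add: sum_product)
  also have "\<dots> = map_coeffs h (p * q)"
    unfolding pq using q by (simp add: map_coeffs_sum[of h, OF h(1,2)] mult_single map_coeffs_single h coeffs_in_def)
  finally show ?thesis by simp
qed

lemma coeffs_in_Var: "is_subring L \<Longrightarrow> coeffs_in L (Var i)"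
  by (auto simp: coeffs_in_def Var_def lookup_single when_def is_subringD(1,2))

lemma coeffs_in_mult:
  assumes "is_subring L" "coeffs_in L p" "coeffs_in L q"
  shows "coeffs_in L (p * q)"
proof -
  have sum: "coeffs_in L (sum f I)" if "\<And>i. i \<in> I \<Longrightarrow> coeffs_in L (f i)" for f :: "_ \<Rightarrow> ('b, 'a) mpoly" and I
    using that by (auto simp: coeffs_in_def lookup_sum intro!: is_subring_sum[OF assms(1)])
  have "p * q = (\<Sum>m\<in>Poly_Mapping.keys p. \<Sum>m'\<in>Poly_Mapping.keys q.
     Poly_Mapping.single m (Poly_Mapping.lookup p m) * Poly_Mapping.single m' (Poly_Mapping.lookup q m'))"
    by (subst poly_mapping_expand[of p], subst poly_mapping_expand[of q]) (simp add: sum_product)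
  moreover have "coeffs_in L (Poly_Mapping.single m (Poly_Mapping.lookup p m) * Poly_Mapping.single m' (Poly_Mapping.lookup q m'))" for m m'
    using assms by (auto simp: mult_single coeffs_in_def lookup_single when_def is_subringD(1,4)[OF assms(1)])
  ultimately show ?thesis by (simp only:) (intro sum)
qed


section \<open>Automorphisms over a subfield\<close>

text \<open>The matrix from \<open>linear_ex\<close> has entries in the algebraically closed field.
  Being parallel to the representing forms, which are defined over \<open>L\<close>, is a linear
  condition on it modulo F with coefficients in \<open>L\<close>; the retraction therefore produces
  a solution over \<open>L\<close>.\<close>

theorem automorphism_linear:
  fixes F :: "(3, 'K::alg_closed_field) mpoly"
  assumes sm: "smooth_plane_curve k F" and L: "is_subfield L" and FL: "coeffs_in L F"
    and bij: "bij_betw \<psi> (proj_zeros {F}) (proj_zeros {F})"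
    and mor: "proj_morphism L (proj_zeros {F}) (proj_zeros {F}) \<psi>"
    and mor': "proj_morphism L (proj_zeros {F}) (proj_zeros {F}) (inv_into (proj_zeros {F}) \<psi>)"
  obtains M :: "'K ^ 3 ^ 3" where "\<And>i j. M $ i $ j \<in> L" "det M \<noteq> 0" "\<exists>c. c \<noteq> 0 \<and> lin_subst F M = Const c * F"
    "\<And>y. y \<noteq> 0 \<Longrightarrow> mp_eval F y = 0 \<Longrightarrow> \<psi> (pt y) = pt (M *v y)"
proof -
  obtain d where d: "d \<ge> 4" "homogeneous d F" using sm by (auto simp: smooth_plane_curve_def)
  interpret plane_curve "mp_eval F" d "\<lambda>i. mp_eval (mp_deriv i F)"
    by (rule smooth_plane_curve_locale[OF sm d(2,1)])
  let ?Z = "proj_zeros {F}"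
  have mem: "pt x \<in> ?Z" if "x \<in> C" for x using that by (auto simp: proj_zeros_def C_def)
  have Cpar: "y \<in> C" if "x \<in> C" "par y x" for x y
    using that C_scale unfolding par_def by blast
  define rp where "rp = (\<lambda>\<phi> (x :: 'K ^ 3). SOME y :: 'K ^ 3. y \<in> C \<and> \<phi> (pt x) = pt y)"
  have rp: "rp \<phi> x \<in> C \<and> \<phi> (pt x) = pt (rp \<phi> x)" if "\<phi> \<in> ?Z \<rightarrow> ?Z" "x \<in> C" for \<phi> x
  proof -
    have "\<phi> (pt x) \<in> ?Z" using that mem by blast
    then have "\<exists>y. y \<in> C \<and> \<phi> (pt x) = pt y" unfolding proj_zeros_def C_def by blast
    then show ?thesis unfolding rp_def by (rule someI_ex)
  qed
  let ?\<phi> = "inv_into ?Z \<psi>"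
  have fun1: "\<psi> \<in> ?Z \<rightarrow> ?Z" and fun2: "?\<phi> \<in> ?Z \<rightarrow> ?Z" using mor mor' by (auto simp: proj_morphism_def)
  have inv1: "?\<phi> (\<psi> P) = P" if "P \<in> ?Z" for P using bij that by (simp add: bij_betw_def inv_into_f_f)
  have inv2: "\<psi> (?\<phi> P) = P" if "P \<in> ?Z" for P
    using bij that by (metis bij_betw_def f_inv_into_f)
  have reps: "\<exists>e g. (\<forall>j. form UNIV (int e) (mp_eval (g j)) \<and> coeffs_in L (g j) \<and> homogeneous e (g j)) \<and> tuple (\<lambda>j. mp_eval (g j)) x \<noteq> 0 \<and>
      (\<forall>y\<in>C. tuple (\<lambda>j. mp_eval (g j)) y \<noteq> 0 \<longrightarrow> par (tuple (\<lambda>j. mp_eval (g j)) y) (rp \<phi> y))"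
    if m: "proj_morphism L ?Z ?Z \<phi>" and x: "x \<in> C" for \<phi> x
  proof -
    obtain g :: "3 \<Rightarrow> (3, 'K) mpoly" and e where g: "\<And>j. homogeneous e (g j) \<and> coeffs_in L (g j)"
      "(\<chi> j. mp_eval (g j) x) \<noteq> 0"
      "\<And>y. y \<noteq> 0 \<Longrightarrow> pt y \<in> ?Z \<Longrightarrow> (\<chi> j. mp_eval (g j) y) \<noteq> 0 \<Longrightarrow> \<phi> (pt y) = pt (\<chi> j. mp_eval (g j) y)"
    proof -
      have "x \<noteq> 0 \<and> pt x \<in> ?Z" using x mem[OF x] by (simp add: C_def)
      with m[unfolded proj_morphism_def] obtain g :: "3 \<Rightarrow> (3, 'K) mpoly" and e where g:
        "\<forall>j. homogeneous e (g j) \<and> coeffs_in L (g j)" "(\<chi> j. mp_eval (g j) x) \<noteq> 0"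
        "\<forall>y. y \<noteq> 0 \<and> pt y \<in> ?Z \<and> (\<chi> j. mp_eval (g j) y) \<noteq> 0 \<longrightarrow> \<phi> (pt y) = pt (\<chi> j. mp_eval (g j) y)"
        by metis
      show ?thesis by (rule that[of e g]) (use g in auto)
    qed
    have "par (tuple (\<lambda>j. mp_eval (g j)) y) (rp \<phi> y)" if y: "y \<in> C" "tuple (\<lambda>j. mp_eval (g j)) y \<noteq> 0" for y
    proof -
      have "\<phi> (pt y) = pt (tuple (\<lambda>j. mp_eval (g j)) y)"
        using g(3)[of y] y mem[OF y(1)] by (simp add: tuple_def C_def)
      moreover have "\<phi> (pt y) = pt (rp \<phi> y)" using rp[OF _ y(1)] m by (simp add: proj_morphism_def)
      ultimately show ?thesis by (simp add: pt_eq_iff[symmetric])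
    qed
    moreover have "form UNIV (int e) (mp_eval (g j))" for j by (rule form_mp_eval) (use g(1) in auto)
    ultimately show ?thesis using g(1,2) by (intro exI[of _ e] exI[of _ g]) (simp add: tuple_def)
  qed
  interpret curve_aut "mp_eval F" d "\<lambda>i. mp_eval (mp_deriv i F)" "rp \<psi>" "rp ?\<phi>"
  proof
    show "rp \<psi> x \<in> C" "rp ?\<phi> x \<in> C" if "x \<in> C" for x using rp fun1 fun2 that by blast+
    show "par (rp ?\<phi> (rp \<psi> x)) x" if x: "x \<in> C" for x
    proof -
      have "pt (rp ?\<phi> (rp \<psi> x)) = ?\<phi> (\<psi> (pt x))" using rp[OF fun1 x] rp[OF fun2, of "rp \<psi> x"] by simp
      then show ?thesis using inv1[OF mem[OF x]] by (simp add: pt_eq_iff)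
    qed
    show "par (rp \<psi> (rp ?\<phi> x)) x" if x: "x \<in> C" for x
    proof -
      have "pt (rp \<psi> (rp ?\<phi> x)) = \<psi> (?\<phi> (pt x))" using rp[OF fun2 x] rp[OF fun1, of "rp ?\<phi> x"] by simp
      then show ?thesis using inv2[OF mem[OF x]] by (simp add: pt_eq_iff)
    qed
    show "par (rp \<psi> x) (rp \<psi> y)" if "x \<in> C" "y \<in> C" "par x y" for x y
      using rp[OF fun1] that pt_eq_iff by metis
    show "par (rp ?\<phi> x) (rp ?\<phi> y)" if "x \<in> C" "y \<in> C" "par x y" for x y
      using rp[OF fun2] that pt_eq_iff by metis
    show "\<exists>e g. (\<forall>j. form UNIV e (g j)) \<and> tuple g x \<noteq> 0 \<and> (\<forall>y\<in>C. tuple g y \<noteq> 0 \<longrightarrow> par (tuple g y) (rp \<psi> y))" if x: "x \<in> C" for x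
    proof -
      obtain e g where "(\<forall>j. form UNIV (int e) (mp_eval (g j)) \<and> coeffs_in L (g j) \<and> homogeneous e (g j)) \<and> tuple (\<lambda>j. mp_eval (g j)) x \<noteq> 0 \<and>
        (\<forall>y\<in>C. tuple (\<lambda>j. mp_eval (g j)) y \<noteq> 0 \<longrightarrow> par (tuple (\<lambda>j. mp_eval (g j)) y) (rp (\<psi>) y))"
        using reps[OF mor x] by (elim exE)
      then show ?thesis by (intro exI[of _ "int e"] exI[of _ "\<lambda>j. mp_eval (g j)"]) blast
    qed
    show "\<exists>e g. (\<forall>j. form UNIV e (g j)) \<and> tuple g x \<noteq> 0 \<and> (\<forall>y\<in>C. tuple g y \<noteq> 0 \<longrightarrow> par (tuple g y) (rp ?\<phi> y))" if x: "x \<in> C" for x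
    proof -
      obtain e g where "(\<forall>j. form UNIV (int e) (mp_eval (g j)) \<and> coeffs_in L (g j) \<and> homogeneous e (g j)) \<and> tuple (\<lambda>j. mp_eval (g j)) x \<noteq> 0 \<and>
        (\<forall>y\<in>C. tuple (\<lambda>j. mp_eval (g j)) y \<noteq> 0 \<longrightarrow> par (tuple (\<lambda>j. mp_eval (g j)) y) (rp (?\<phi>) y))"
        using reps[OF mor' x] by (elim exE)
      then show ?thesis by (intro exI[of _ "int e"] exI[of _ "\<lambda>j. mp_eval (g j)"]) blast
    qed
  qed
  obtain M0 :: "'K ^ 3 ^ 3" where M0: "\<exists>y\<in>C. M0 *v y \<noteq> 0"
    "\<And>y i j. y \<in> C \<Longrightarrow> (M0 *v y) $ i * rp \<psi> y $ j = (M0 *v y) $ j * rp \<psi> y $ i"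
    by (rule linear_ex) (rule that)
  obtain x0 where x0: "x0 \<in> C" using nonempty by (auto simp: C_def)
  obtain e g where g: "\<And>j. form UNIV (int e) (mp_eval (g j))" "\<And>j. coeffs_in L (g j)" "tuple (\<lambda>j. mp_eval (g j)) x0 \<noteq> 0"
    "\<And>y. y \<in> C \<Longrightarrow> tuple (\<lambda>j. mp_eval (g j)) y \<noteq> 0 \<Longrightarrow> par (tuple (\<lambda>j. mp_eval (g j)) y) (rp \<psi> y)"
    using reps[OF mor x0] by blast
  have gr: "rep (int e) (\<lambda>j. mp_eval (g j))" using g by (simp add: rep_def)
  have "M0 \<noteq> 0" using M0(1) by auto
  then obtain i0 j0 where ij0: "M0 $ i0 $ j0 \<noteq> 0" by (auto simp: vec_eq_iff)
  \<comment> \<open>One entry is scaled to 1, which \<open>\<pi>\<close> preserves, so that the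
    matrix does not become zero.\<close>
  define N where "N = (\<lambda>i k. M0 $ i $ k / M0 $ i0 $ j0)"
  obtain \<pi> :: "'K \<Rightarrow> 'K" where \<pi>: "\<And>x y. \<pi> (x + y) = \<pi> x + \<pi> y" "\<And>a x. a \<in> L \<Longrightarrow> \<pi> (x * a) = \<pi> x * a"
    "\<And>x. \<pi> x \<in> L" "\<pi> 1 = 1" using linear_retraction[OF L] by metis
  have "\<pi> 0 + 0 = \<pi> 0 + \<pi> 0" using \<pi>(1)[of 0 0] by simp
  then have \<pi>0: "\<pi> 0 = 0" by (simp only: add_left_cancel)
  note Lr = is_subfieldD(1)[OF L]
  define M :: "'K ^ 3 ^ 3" where "M = (\<chi> i k. \<pi> (N i k))"
  have cross: "(M *v y) $ i * mp_eval (g j) y = (M *v y) $ j * mp_eval (g i) y" if y: "y \<in> C" for y i j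
  proof -
    \<comment> \<open>This polynomial is linear in the matrix, and it vanishes on the curve exactly
      when the cross product of the matrix with \<open>g\<close> at \<open>i\<close> and
      \<open>j\<close> does. Divisibility by F survives the retraction because F and
      \<open>g\<close> have coefficients in \<open>L\<close>.\<close>
    define T where "T = (\<lambda>(N :: 3 \<Rightarrow> 3 \<Rightarrow> 'K) i j. (\<Sum>k\<in>UNIV. Const (N i k) * (Var k * g j)) + (\<Sum>k\<in>UNIV. Const (- N j k) * (Var k * g i)))"
    have evT: "mp_eval (T N i j) u = (\<Sum>k\<in>UNIV. N i k * u $ k) * mp_eval (g j) u - (\<Sum>k\<in>UNIV. N j k * u $ k) * mp_eval (g i) u" for N u
      by (simp add: T_def sum_distrib_right mult.assoc sum_negf)
    have Nu: "(\<Sum>k\<in>UNIV. N i k * u $ k) = (M0 *v u) $ i / M0 $ i0 $ j0" for i u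
      by (simp add: N_def matrix_vector_mult_def sum_divide_distrib)
    have fN: "form UNIV 1 (\<lambda>u. \<Sum>k\<in>UNIV. N i k * u $ k)" for i by (rule form_linear) auto
    have fT: "form UNIV (1 + int e) (mp_eval (T N i j))"
      unfolding evT[abs_def] by (intro formU(5) form_mult[OF is_subring_UNIV fN g(1)])
    have "van (mp_eval (T N i j))"
      unfolding van_def
    proof
      fix z assume z: "z \<in> C"
      obtain c where c: "tuple (\<lambda>j. mp_eval (g j)) z = c *s rp \<psi> z" using rep_mult[OF gr z] by metis
      have gz: "mp_eval (g j) z = c * rp \<psi> z $ j" for j using c by (metis tuple_nth vector_smult_component)
      show "mp_eval (T N i j) z = 0" unfolding evT Nu gz using M0(2)[OF z, of i j] by (simp add: mult.left_commute)
    qed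
    then obtain Q where Q: "form UNIV (1 + int e - int d) Q" "\<And>u. mp_eval (T N i j) u = mp_eval F u * Q u"
      by (rule van_multiple[OF fT]) (rule that)
    obtain q where q: "Q = mp_eval q" using Q(1) unfolding form_def by blast
    have TN: "T N i j = q * F"
      by (rule mp_eval_inj) (use Q(2) q in \<open>simp add: mult.commute\<close>)
    have \<pi>neg: "\<pi> (- x) = - \<pi> x" for x using \<pi>(1)[of x "- x"] \<pi>0 by (simp add: eq_neg_iff_add_eq_0 add.commute)
    have mc: "map_coeffs \<pi> (Const c * (Var k * g j)) = Const (\<pi> c) * (Var k * g j)" for c k j
      using map_coeffs_mult[of \<pi> L "Var k * g j" "Const c", OF \<pi>(1) \<pi>0 \<pi>(2) coeffs_in_mult[OF Lr coeffs_in_Var[OF Lr] g(2)]]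
      by (simp add: Const_def map_coeffs_single[of \<pi>, OF \<pi>0])
    have "map_coeffs \<pi> (T N i j) = T (\<lambda>i k. M $ i $ k) i j"
      unfolding T_def by (simp add: map_coeffs_add[of \<pi>, OF \<pi>(1) \<pi>0] map_coeffs_sum[of \<pi>, OF \<pi>(1) \<pi>0] mc M_def \<pi>neg)
    then have "T (\<lambda>i k. M $ i $ k) i j = map_coeffs \<pi> q * F"
      unfolding TN using map_coeffs_mult[of \<pi> L F q, OF \<pi>(1) \<pi>0 \<pi>(2) FL] by simp
    then have "mp_eval (T (\<lambda>i k. M $ i $ k) i j) y = 0" using y by (simp add: C_def)
    then show ?thesis unfolding evT by (simp add: matrix_vector_mult_def)
  qed
  have fM: "form UNIV 1 (\<lambda>y. (M *v y) $ i)" for i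
    unfolding matrix_vector_mult_def by (simp add: form_linear)
  have nz: "\<exists>y\<in>C. M *v y \<noteq> 0"
  proof (rule ccontr)
    assume "\<not> ?thesis"
    then have "van (\<lambda>y. (M *v y) $ i0)" by (simp add: van_def)
    then have "(M *v axis j0 1) $ i0 = 0" using nondegenerate[OF fM] d(1) by simp
    moreover have "(M *v axis j0 1) $ i0 = M $ i0 $ j0"
    proof -
      have "(M *v axis j0 1) $ i0 = (\<Sum>k\<in>UNIV. if k = j0 then M $ i0 $ k else 0)"
        unfolding matrix_vector_mult_def vec_lambda_beta by (rule sum.cong) (auto simp: axis_def)
      then show ?thesis by simp
    qed
    ultimately show False using ij0 \<pi>(4) by (simp add: M_def N_def)
  qed
  obtain k0 where k0: "mp_eval (g k0) x0 \<noteq> 0" using g(3) by (auto simp: vec_eq_iff)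
  then have nvk: "\<not> van (mp_eval (g k0))" using x0 by (auto simp: van_def)
  \<comment> \<open>The relation with the tuple \<open>g\<close> says nothing where \<open>g\<close>
    vanishes; cancelling the component \<open>g k0\<close> transfers it to a tuple that is nonzero
    at \<open>y\<close>.\<close>
  have cr: "(M *v y) $ i * rp \<psi> y $ j = (M *v y) $ j * rp \<psi> y $ i" if y: "y \<in> C" for y i j
  proof -
    obtain e' h where h: "rep e' h" "tuple h y \<noteq> 0" by (rule rep_ex[OF y])
    have hf: "\<And>j. form UNIV e' (h j)" using h(1) by (simp add: rep_def)
    have "(M *v y) $ i * h j y = (M *v y) $ j * h i y"
    proof (rule van_cancel[OF g(1) nvk form_mult[OF is_subring_UNIV fM hf] form_mult[OF is_subring_UNIV fM hf] _ y])
      fix z assume z: "z \<in> C"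
      have c: "mp_eval (g k0) z * h j z = mp_eval (g j) z * h k0 z" for j
        using rep_cross[OF gr h(1) z formU(9)[of k0] formU(9)[of j]] by simp
      have "mp_eval (g k0) z * ((M *v z) $ i * h j z) = (M *v z) $ i * mp_eval (g j) z * h k0 z"
        using c[of j] by (metis mult.assoc mult.left_commute)
      also have "\<dots> = (M *v z) $ j * (mp_eval (g i) z * h k0 z)" unfolding cross[OF z, of i j] by (simp only: mult.assoc)
      also have "\<dots> = mp_eval (g k0) z * ((M *v z) $ j * h i z)" using c[of i] by (metis mult.left_commute)
      finally show "mp_eval (g k0) z * ((M *v z) $ i * h j z) = mp_eval (g k0) z * ((M *v z) $ j * h i z)" .
    qed
    moreover obtain c where c: "tuple h y = c *s rp \<psi> y" "c \<noteq> 0" using rep_mult[OF h(1) y] h(2) by metis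
    moreover have "h j y = c * rp \<psi> y $ j" for j using c by (metis tuple_nth vector_smult_component)
    ultimately show ?thesis by (simp add: mult.left_commute)
  qed
  have lin1: "det M \<noteq> 0" using linear_unique(1)[OF nz] cr by blast
  have lin2: "par (M *v y) (rp \<psi> y)" if "y \<in> C" for y using linear_unique(2)[OF nz _ that] cr by blast
  have lin3: "\<exists>c. c \<noteq> 0 \<and> (\<forall>u. mp_eval F (M *v u) = c * mp_eval F u)" using linear_unique(3)[OF nz] cr by blast
  show ?thesis
  proof (rule that[of M])
    show "M $ i $ j \<in> L" for i j using \<pi>(3) by (simp add: M_def)
    show "det M \<noteq> 0" by (rule lin1)
    obtain c where c: "c \<noteq> 0" "\<And>u. mp_eval F (M *v u) = c * mp_eval F u" using lin3 by blast
    have "lin_subst F M = Const c * F" by (rule mp_eval_inj) (simp add: mp_eval_lin_subst c(2))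
    then show "\<exists>c. c \<noteq> 0 \<and> lin_subst F M = Const c * F" using c(1) by blast
    fix y assume "y \<noteq> 0" "mp_eval F y = 0"
    then have y: "y \<in> C" by (simp add: C_def)
    then show "\<psi> (pt y) = pt (M *v y)" using lin2[OF y] rp[OF fun1 y] pt_eq_iff by metis
  qed
qed


section \<open>Automorphisms of an algebraically closed field\<close>

definition poly_over :: "'a::comm_ring_1 set \<Rightarrow> 'a poly \<Rightarrow> bool" where
  "poly_over L p \<longleftrightarrow> (\<forall>i. coeff p i \<in> L)"

lemma poly_over_add: "is_subring L \<Longrightarrow> poly_over L p \<Longrightarrow> poly_over L q \<Longrightarrow> poly_over L (p + q)"
  by (simp add: poly_over_def is_subringD(3))

lemma poly_over_diff: "is_subring L \<Longrightarrow> poly_over L p \<Longrightarrow> poly_over L q \<Longrightarrow> poly_over L (p - q)"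
  by (simp add: poly_over_def is_subringD(6))

lemma poly_over_mult: "is_subring L \<Longrightarrow> poly_over L p \<Longrightarrow> poly_over L q \<Longrightarrow> poly_over L (p * q)"
  by (auto simp: poly_over_def coeff_mult intro!: is_subring_sum is_subringD(4))

lemma poly_over_monom: "is_subring L \<Longrightarrow> c \<in> L \<Longrightarrow> poly_over L (monom c n)"
  by (simp add: poly_over_def is_subringD(1))

lemma poly_over_0: "is_subring L \<Longrightarrow> poly_over L 0"
  by (simp add: poly_over_def is_subringD(1))

lemma poly_over_pCons: "poly_over L (pCons c p) \<longleftrightarrow> c \<in> L \<and> poly_over L p"
  by (auto simp: poly_over_def coeff_pCons split: nat.splits)

lemma poly_over_pderiv: "is_subring L \<Longrightarrow> poly_over L p \<Longrightarrow> poly_over L (pderiv p)"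
proof -
  assume L: "is_subring L" and p: "poly_over L p"
  have "of_nat n \<in> L" for n by (induction n) (auto intro: is_subringD[OF L])
  then show ?thesis using p by (auto simp: poly_over_def coeff_pderiv intro!: is_subringD(4)[OF L] is_subringD(3)[OF L] is_subringD(2)[OF L])
qed

lemma poly_over_prod: "is_subring L \<Longrightarrow> (\<And>i. i \<in> I \<Longrightarrow> poly_over L (f i)) \<Longrightarrow> poly_over L (prod f I)"
proof (induction I rule: infinite_finite_induct)
  case (insert i I)
  then show ?case by (simp add: poly_over_mult)
qed (auto simp: poly_over_def one_pCons coeff_pCons is_subringD(1,2) split: nat.splits)

lemma poly_over_eval: "is_subring L \<Longrightarrow> poly_over L p \<Longrightarrow> x \<in> L \<Longrightarrow> poly p x \<in> L"
  by (induction p) (auto simp: poly_over_pCons is_subringD(1) intro!: is_subringD(3) is_subringD(4))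

lemma poly_over_mono: "poly_over L p \<Longrightarrow> L \<subseteq> L' \<Longrightarrow> poly_over L' p"
  by (auto simp: poly_over_def)

definition algebraic_over :: "'a::field set \<Rightarrow> bool" where
  "algebraic_over E \<longleftrightarrow> (\<forall>x. \<exists>p. p \<noteq> 0 \<and> poly_over E p \<and> poly p x = 0)"

lemma algebraic_over_mono: "algebraic_over E \<Longrightarrow> E \<subseteq> E' \<Longrightarrow> algebraic_over E'"
  unfolding algebraic_over_def using poly_over_mono by blast

text \<open>After removal of factors \<open>x\<close>, an equation of \<open>x\<close> over
  \<open>E\<close> has a nonzero constant term, which is then a multiple of \<open>x\<close> inside
  \<open>D\<close>.\<close>

lemma algebraic_subring_is_subfield:
  assumes E: "algebraic_over E" "is_subfield E" and D: "is_subring D" "E \<subseteq> D"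
  shows "is_subfield D"
  unfolding is_subfield_def
proof (intro conjI ballI D(1))
  fix x assume x: "x \<in> D"
  show "inverse x \<in> D"
  proof (cases "x = 0")
    case True
    then show ?thesis using is_subringD(1)[OF D(1)] by simp
  next
    case False
    have "poly_over E p \<Longrightarrow> p \<noteq> 0 \<Longrightarrow> poly p x = 0 \<Longrightarrow> inverse x \<in> D" for p
    proof (induction p)
      case (pCons a p)
      show ?case
      proof (cases "a = 0")
        case True
        then show ?thesis using pCons False by (auto simp: poly_over_pCons)
      next
        case a: False
        have "a + x * poly p x = 0" using pCons by simp
        then have "- (x * poly p x) = a" by (simp add: neg_eq_iff_add_eq_0 add.commute)
        moreover have "x * (- poly p x * inverse a) = - (x * poly p x) * inverse a" by simp
        ultimately have "x * (- poly p x * inverse a) = 1" using a by simp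
        then have "inverse x = - poly p x * inverse a" by (rule inverse_unique)
        moreover have "inverse a \<in> D" using pCons is_subfieldD(2)[OF E(2)] D(2) by (auto simp: poly_over_pCons)
        moreover have "poly p x \<in> D"
          using poly_over_eval[OF D(1) poly_over_mono[OF _ D(2)] x] pCons by (simp add: poly_over_pCons)
        ultimately show ?thesis using is_subringD(4,5)[OF D(1)] by simp
      qed
    qed simp
    then show ?thesis using E(1) unfolding algebraic_over_def by blast
  qed
qed

text \<open>Automorphisms of the whole algebraically closed field: total functions that act on all
  points and all polynomials. Over the base field, their restrictions to the separable closure are
  the Galois group (\<open>restrict_gal_sep\<close>, \<open>gal_sep_extend\<close>).\<close>

definition aut_over :: "'a::field set \<Rightarrow> ('a \<Rightarrow> 'a) set" where
  "aut_over E = {\<sigma>. bij \<sigma> \<and> (\<forall>x y. \<sigma> (x + y) = \<sigma> x + \<sigma> y \<and> \<sigma> (x * y) = \<sigma> x * \<sigma> y) \<and> (\<forall>x\<in>E. \<sigma> x = x)}"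

lemma aut_overD:
  assumes "\<sigma> \<in> aut_over E"
  shows "bij \<sigma>" "\<sigma> (x + y) = \<sigma> x + \<sigma> y" "\<sigma> (x * y) = \<sigma> x * \<sigma> y" "x \<in> E \<Longrightarrow> \<sigma> x = x"
    "\<sigma> 0 = 0" "\<sigma> 1 = 1" "\<sigma> (- x) = - \<sigma> x" "\<sigma> (x - y) = \<sigma> x - \<sigma> y" "\<sigma> (inverse x) = inverse (\<sigma> x)"
    "\<sigma> x = 0 \<longleftrightarrow> x = 0" "\<sigma> (x ^ n) = \<sigma> x ^ n"
proof -
  show 1: "bij \<sigma>" and add: "\<And>x y. \<sigma> (x + y) = \<sigma> x + \<sigma> y" and mult: "\<And>x y. \<sigma> (x * y) = \<sigma> x * \<sigma> y"
    and "x \<in> E \<Longrightarrow> \<sigma> x = x"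
    using assms by (auto simp: aut_over_def)
  show 0: "\<sigma> 0 = 0" using add[of 0 0] by (metis add_cancel_right_right add_0)
  have inj: "\<sigma> x = \<sigma> y \<Longrightarrow> x = y" for x y using 1 by (simp add: bij_def inj_def)
  show nz: "\<sigma> x = 0 \<longleftrightarrow> x = 0" for x using inj[of x 0] 0 by auto
  have "\<sigma> 1 * \<sigma> 1 = \<sigma> 1" using mult[of 1 1] by simp
  then show one: "\<sigma> 1 = 1" using nz[of 1] by (metis mult_cancel_left1 one_neq_zero)
  show neg: "\<sigma> (- x) = - \<sigma> x" for x using add[of x "- x"] 0 by (simp add: eq_neg_iff_add_eq_0 add.commute)
  show "\<sigma> (x - y) = \<sigma> x - \<sigma> y" using add[of x "- y"] neg[of y] by simp
  show "\<sigma> (inverse x) = inverse (\<sigma> x)"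
  proof (cases "x = 0")
    case False
    then have "\<sigma> x * \<sigma> (inverse x) = 1" using mult[of x "inverse x"] one by simp
    then show ?thesis by (metis inverse_unique)
  qed (simp add: 0)
  show "\<sigma> (x ^ n) = \<sigma> x ^ n" by (induction n) (simp_all add: one mult)
qed

lemma aut_over_sum: "\<sigma> \<in> aut_over E \<Longrightarrow> \<sigma> (sum f I) = (\<Sum>i\<in>I. \<sigma> (f i))"
  by (induction I rule: infinite_finite_induct) (auto simp: aut_overD)

lemma aut_over_mono: "\<sigma> \<in> aut_over E' \<Longrightarrow> E \<subseteq> E' \<Longrightarrow> \<sigma> \<in> aut_over E"
  by (auto simp: aut_over_def)

lemma aut_over_id: "(\<lambda>x. x) \<in> aut_over E"
  by (simp add: aut_over_def bij_def)

lemma aut_over_comp: "\<sigma> \<in> aut_over E \<Longrightarrow> \<tau> \<in> aut_over E \<Longrightarrow> (\<lambda>x. \<sigma> (\<tau> x)) \<in> aut_over E"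
  using bij_comp[of \<tau> \<sigma>] by (simp add: aut_over_def comp_def)

lemma aut_over_inv:
  assumes "\<sigma> \<in> aut_over E"
  shows "inv_into UNIV \<sigma> \<in> aut_over E" "inv_into UNIV \<sigma> (\<sigma> x) = x" "\<sigma> (inv_into UNIV \<sigma> x) = x"
proof -
  note s = aut_overD[OF assms]
  show inv1: "inv_into UNIV \<sigma> (\<sigma> x) = x" for x using s(1) by (simp add: bij_def)
  show inv2: "\<sigma> (inv_into UNIV \<sigma> x) = x" for x using s(1) by (simp add: bij_def surj_f_inv_f)
  have "inv_into UNIV \<sigma> (x + y) = inv_into UNIV \<sigma> x + inv_into UNIV \<sigma> y" "inv_into UNIV \<sigma> (x * y) = inv_into UNIV \<sigma> x * inv_into UNIV \<sigma> y" for x y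
    using s(2,3)[of "inv_into UNIV \<sigma> x" "inv_into UNIV \<sigma> y"] by (metis inv1 inv2)+
  moreover have "inv_into UNIV \<sigma> x = x" if "x \<in> E" for x using s(4)[OF that] inv1[of x] by simp
  ultimately show "inv_into UNIV \<sigma> \<in> aut_over E" using s(1) by (simp add: aut_over_def bij_imp_bij_inv)
qed

lemma aut_over_poly:
  assumes "\<sigma> \<in> aut_over E" "poly_over E p"
  shows "\<sigma> (poly p x) = poly p (\<sigma> x)"
  using assms(2) by (induction p) (auto simp: poly_over_pCons aut_overD[OF assms(1)])

lemma aut_over_map_poly:
  assumes "\<sigma> \<in> aut_over E"
  shows "poly (map_poly \<sigma> p) (\<sigma> x) = \<sigma> (poly p x)"
  by (induction p) (auto simp: map_poly_pCons aut_overD[OF assms])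

section \<open>Extension of partial homomorphisms\<close>

definition poly_graph :: "('a::field \<times> 'a) set \<Rightarrow> 'a poly \<Rightarrow> 'a poly \<Rightarrow> bool" where
  "poly_graph R f g \<longleftrightarrow> (\<forall>i. (coeff f i, coeff g i) \<in> R)"

text \<open>A partial homomorphism over \<open>E\<close>, encoded by its graph so that unions of
  chains are immediate. The last clause yields single-valuedness by taking differences
  (\<open>R_fun\<close>).\<close>

definition hom_graph :: "'a::field set \<Rightarrow> ('a \<times> 'a) set \<Rightarrow> bool" where
  "hom_graph E R \<longleftrightarrow> (\<forall>c\<in>E. (c, c) \<in> R) \<and> (\<forall>a b c d. (a, b) \<in> R \<longrightarrow> (c, d) \<in> R \<longrightarrow> (a + c, b + d) \<in> R \<and> (a * c, b * d) \<in> R)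
     \<and> (\<forall>y. (0, y) \<in> R \<longrightarrow> y = 0)"

locale alg_extension =
  fixes E :: "'a::alg_closed_field set"
  assumes E: "is_subfield E" and alg: "algebraic_over E"
begin

lemma E_ring: "is_subring E" by (rule is_subfieldD(1)[OF E])

context
  fixes R assumes R: "hom_graph E R"
begin

lemma R_const: "c \<in> E \<Longrightarrow> (c, c) \<in> R" using R by (simp add: hom_graph_def)
lemma R_add: "(a, b) \<in> R \<Longrightarrow> (c, d) \<in> R \<Longrightarrow> (a + c, b + d) \<in> R" using R by (simp add: hom_graph_def)
lemma R_mult: "(a, b) \<in> R \<Longrightarrow> (c, d) \<in> R \<Longrightarrow> (a * c, b * d) \<in> R" using R by (simp add: hom_graph_def)
lemma R_0: "(0, y) \<in> R \<Longrightarrow> y = 0" using R by (simp add: hom_graph_def)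
lemma R_00: "(0, 0) \<in> R" and R_11: "(1, 1) \<in> R" using R_const is_subringD(1,2)[OF E_ring] by auto
lemma R_neg: "(a, b) \<in> R \<Longrightarrow> (- a, - b) \<in> R"
  using R_mult[OF R_const[OF is_subringD(5)[OF E_ring is_subringD(2)[OF E_ring]]], of a b] by simp
lemma R_diff: "(a, b) \<in> R \<Longrightarrow> (c, d) \<in> R \<Longrightarrow> (a - c, b - d) \<in> R" using R_add[OF _ R_neg, of a b c d] by simp
lemma R_fun: "(a, b) \<in> R \<Longrightarrow> (a, c) \<in> R \<Longrightarrow> b = c" using R_diff[of a b a c] R_0[of "b - c"] by simp
lemma R_sum: "(\<And>i. i \<in> I \<Longrightarrow> (f i, g i) \<in> R) \<Longrightarrow> (sum f I, sum g I) \<in> R"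
  by (induction I rule: infinite_finite_induct) (auto intro: R_00 R_add)

lemma Dom_subfield: "is_subfield (Domain R)"
proof (rule algebraic_subring_is_subfield[OF alg E])
  show "is_subring (Domain R)" unfolding is_subring_def using R_00 R_11 R_add R_mult R_neg by blast
  show "E \<subseteq> Domain R" using R_const by blast
qed

lemma R_inj: "(a, 0) \<in> R \<Longrightarrow> a = 0"
proof (rule ccontr)
  assume a: "(a, 0) \<in> R" "a \<noteq> 0"
  then obtain y where "(inverse a, y) \<in> R" using is_subfieldD(2)[OF Dom_subfield, of a] by blast
  then have "(1, 0) \<in> R" using R_mult[OF a(1)] a(2) by fastforce
  from R_fun[OF R_11 this] show False by simp
qed

lemma pg_add: "poly_graph R f g \<Longrightarrow> poly_graph R f' g' \<Longrightarrow> poly_graph R (f + f') (g + g')"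
  by (simp add: poly_graph_def R_add)
lemma pg_diff: "poly_graph R f g \<Longrightarrow> poly_graph R f' g' \<Longrightarrow> poly_graph R (f - f') (g - g')"
  by (simp add: poly_graph_def R_diff)
lemma pg_mult: "poly_graph R f g \<Longrightarrow> poly_graph R f' g' \<Longrightarrow> poly_graph R (f * f') (g * g')"
  by (auto simp: poly_graph_def coeff_mult intro!: R_sum R_mult)
lemma pg_monom: "(a, b) \<in> R \<Longrightarrow> poly_graph R (monom a n) (monom b n)"
  by (simp add: poly_graph_def R_00)
lemma pg_zero: "poly_graph R 0 g \<Longrightarrow> g = 0"
  using R_0 by (auto simp: poly_graph_def poly_eq_iff)

text \<open>The extended map sends \<open>poly f z\<close> to \<open>poly g z'\<close> for
  corresponding \<open>f\<close> and \<open>g\<close>. It is well defined because \<open>f\<close>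
  can be reduced by the minimal polynomial \<open>p\<close> while \<open>g\<close> is reduced by
  \<open>q\<close> in parallel.\<close>

lemma extend_step:
  assumes p: "p \<noteq> 0" "poly p z = 0" and pq: "poly_graph R p q"
    and min: "\<And>f. f \<noteq> 0 \<Longrightarrow> poly_over (Domain R) f \<Longrightarrow> poly f z = 0 \<Longrightarrow> degree p \<le> degree f"
    and z': "poly q z' = 0"
  shows "\<exists>R'. hom_graph E R' \<and> R \<subseteq> R' \<and> (z, z') \<in> R'"
proof -
  have welldef: "poly f z = 0 \<Longrightarrow> poly_graph R f g \<Longrightarrow> poly g z' = 0" for f g
  proof (induction "degree f" arbitrary: f g rule: less_induct)
    case less
    show ?case
    proof (cases "f = 0")
      case True
      have "g = 0" by (rule pg_zero) (use less.prems True in simp)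
      then show ?thesis by simp
    next
      case False
      have fD: "poly_over (Domain R) f" using less.prems(2) by (auto simp: poly_graph_def poly_over_def)
      have le: "degree p \<le> degree f" by (rule min[OF False fD less.prems(1)])
      define n where "n = degree f" define m where "m = degree p"
      \<comment> \<open>A pseudo-remainder step: leading coefficients are multiplied across instead
        of divided, so that it can be performed on both sides of the graph.\<close>
      define f1 where "f1 = monom (coeff p m) 0 * f - monom (coeff f n) (n - m) * p"
      define g1 where "g1 = monom (coeff q m) 0 * g - monom (coeff g n) (n - m) * q"
      have rel: "(coeff p m, coeff q m) \<in> R" "(coeff f n, coeff g n) \<in> R"
        using pq less.prems(2) by (auto simp: poly_graph_def)
      have pg: "poly_graph R f1 g1"
        unfolding f1_def g1_def by (intro pg_diff pg_mult pg_monom rel pq less.prems)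
      have f1z: "poly f1 z = 0" by (simp add: f1_def p less.prems)
      have "poly g1 z' = 0"
      proof (cases "f1 = 0")
        case True
        have "g1 = 0" by (rule pg_zero) (use pg True in simp)
        then show ?thesis by simp
      next
        case f1: False
        have "coeff f1 k = 0" if "k \<ge> n" for k
        proof (cases "k = n")
          case True
          then show ?thesis using le by (simp add: f1_def coeff_monom_mult n_def m_def)
        next
          case False
          then have "coeff f k = 0" "coeff p (k - (n - m)) = 0" using that le by (auto simp: n_def m_def intro!: coeff_eq_0)
          then show ?thesis by (simp add: f1_def coeff_monom_mult)
        qed
        then have "degree f1 < degree f" unfolding n_def[symmetric] using f1 by (intro degree_lessI) auto
        then show ?thesis by (rule less.hyps[OF _ f1z pg])
      qed
      then have "coeff q m * poly g z' = 0" by (simp add: g1_def z' poly_monom)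
      moreover have "coeff q m \<noteq> 0"
      proof
        assume "coeff q m = 0"
        then have "coeff p m = 0" using R_inj rel(1) by auto
        then show False using p(1) by (simp add: m_def)
      qed
      ultimately show ?thesis by simp
    qed
  qed
  define R' where "R' = {(poly f z, poly g z') | f g. poly_graph R f g}"
  have "hom_graph E R'"
    unfolding hom_graph_def
  proof (intro conjI ballI allI impI)
    show "(c, c) \<in> R'" if "c \<in> E" for c
    proof -
      have "poly_graph R (monom c 0) (monom c 0)" by (rule pg_monom[OF R_const[OF that]])
      moreover have "poly (monom c 0) z = c" "poly (monom c 0) z' = c" by (simp_all add: poly_monom)
      ultimately show ?thesis unfolding R'_def by (metis (mono_tags, lifting) CollectI)
    qed
    fix a b c d assume "(a, b) \<in> R'" "(c, d) \<in> R'"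
    then obtain f g f' g' where f: "poly_graph R f g" "a = poly f z" "b = poly g z'"
      "poly_graph R f' g'" "c = poly f' z" "d = poly g' z'" by (auto simp: R'_def)
    show "(a + c, b + d) \<in> R'"
      unfolding R'_def mem_Collect_eq by (rule exI[of _ "f + f'"], rule exI[of _ "g + g'"]) (simp add: f pg_add)
    show "(a * c, b * d) \<in> R'"
      unfolding R'_def mem_Collect_eq by (rule exI[of _ "f * f'"], rule exI[of _ "g * g'"]) (simp add: f pg_mult)
  next
    fix y assume "(0, y) \<in> R'"
    then show "y = 0" using welldef by (auto simp: R'_def)
  qed
  moreover have "(a, b) \<in> R'" if "(a, b) \<in> R" for a b
    unfolding R'_def mem_Collect_eq by (rule exI[of _ "monom a 0"], rule exI[of _ "monom b 0"]) (simp add: pg_monom[OF that] poly_monom)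
  moreover have "(z, z') \<in> R'"
    unfolding R'_def mem_Collect_eq by (rule exI[of _ "monom 1 1"], rule exI[of _ "monom 1 1"]) (simp add: pg_monom[OF R_11] poly_monom)
  ultimately show ?thesis by (intro exI[of _ R']) auto
qed

lemma minimal_poly:
  obtains p where "p \<noteq> 0" "poly_over (Domain R) p" "poly p z = 0"
    "\<And>f. f \<noteq> 0 \<Longrightarrow> poly_over (Domain R) f \<Longrightarrow> poly f z = 0 \<Longrightarrow> degree p \<le> degree f"
proof -
  have "E \<subseteq> Domain R" using R_const by blast
  then have "\<exists>p. p \<noteq> 0 \<and> poly_over (Domain R) p \<and> poly p z = 0"
    using algebraic_over_mono[OF alg] unfolding algebraic_over_def by blast
  from ex_has_least_nat[of "\<lambda>p. p \<noteq> 0 \<and> poly_over (Domain R) p \<and> poly p z = 0", OF this[THEN someI_ex], of degree]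
  show ?thesis using that by blast
qed

text \<open>The transported polynomial keeps the degree of \<open>p\<close>, because
  \<open>R_inj\<close> forbids its leading coefficient to vanish; so it has a root to which
  \<open>z\<close> can be sent.\<close>

lemma extend_domain: "\<exists>R' z'. hom_graph E R' \<and> R \<subseteq> R' \<and> (z, z') \<in> R'"
proof -
  obtain p where p: "p \<noteq> 0" "poly_over (Domain R) p" "poly p z = 0"
    "\<And>f. f \<noteq> 0 \<Longrightarrow> poly_over (Domain R) f \<Longrightarrow> poly f z = 0 \<Longrightarrow> degree p \<le> degree f"
    by (rule minimal_poly) (rule that)
  define h where "h = (\<lambda>x. SOME y. (x, y) \<in> R)"
  have h: "(coeff p i, h (coeff p i)) \<in> R" for i
    unfolding h_def by (rule someI_ex) (use p(2) in \<open>auto simp: poly_over_def\<close>)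
  define q where "q = (\<Sum>i\<le>degree p. monom (h (coeff p i)) i)"
  have cq: "coeff q i = (if i \<le> degree p then h (coeff p i) else 0)" for i by (simp add: q_def coeff_sum)
  have pq: "poly_graph R p q" unfolding poly_graph_def
  proof
    fix i show "(coeff p i, coeff q i) \<in> R"
      using h[of i] R_00 by (cases "i \<le> degree p") (auto simp: cq coeff_eq_0)
  qed
  have "degree p \<noteq> 0"
  proof
    assume "degree p = 0"
    then obtain c where "p = [:c:]" by (metis degree_eq_zeroE)
    then show False using p by simp
  qed
  moreover have "coeff q (degree p) \<noteq> 0"
  proof
    assume "coeff q (degree p) = 0"
    then have "(coeff p (degree p), 0) \<in> R" using h[of "degree p"] by (simp add: cq)
    then have "coeff p (degree p) = 0" by (rule R_inj)
    then show False using p(1) by simp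
  qed
  ultimately have "degree q > 0" using le_degree by fastforce
  then obtain z' where "poly q z' = 0" using alg_closed_imp_poly_has_root by blast
  then show ?thesis using extend_step[OF p(1,3) pq p(4)] by blast
qed

end

text \<open>A maximal extension is total by \<open>extend_domain\<close>. It is onto because it maps
  the finite set of zeros of each nonzero polynomial over \<open>E\<close> injectively into
  itself.\<close>

lemma extend_graph:
  assumes R0: "hom_graph E R0"
  obtains \<sigma> where "\<sigma> \<in> aut_over E" "\<And>x y. (x, y) \<in> R0 \<Longrightarrow> \<sigma> x = y"
proof -
  define \<A> where "\<A> = {R. hom_graph E R \<and> R0 \<subseteq> R}"
  have "\<exists>M\<in>\<A>. \<forall>N\<in>\<A>. M \<subseteq> N \<longrightarrow> N = M"
  proof (rule subset_Zorn_nonempty)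
    show "\<A> \<noteq> {}" using R0 by (auto simp: \<A>_def)
    fix \<C> assume c: "\<C> \<noteq> {}" "subset.chain \<A> \<C>"
    have sub: "\<And>R. R \<in> \<C> \<Longrightarrow> hom_graph E R \<and> R0 \<subseteq> R" using c(2) by (auto simp: subset.chain_def \<A>_def)
    have tot: "\<And>V W. V \<in> \<C> \<Longrightarrow> W \<in> \<C> \<Longrightarrow> V \<subseteq> W \<or> W \<subseteq> V" using c(2) by (auto simp: subset.chain_def)
    have "hom_graph E (\<Union>\<C>)"
      unfolding hom_graph_def
    proof (intro conjI ballI allI impI)
      show "(e, e) \<in> \<Union>\<C>" if e: "e \<in> E" for e
      proof -
        obtain R where "R \<in> \<C>" using c(1) by (auto simp: ex_in_conv[symmetric])
        then show ?thesis using R_const[OF conjunct1[OF sub] e] by blast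
      qed
      show "y = 0" if y: "(0, y) \<in> \<Union>\<C>" for y
      proof -
        obtain R where R: "R \<in> \<C>" "(0, y) \<in> R" using y by (elim UnionE)
        show ?thesis by (rule R_0[OF conjunct1[OF sub[OF R(1)]] R(2)])
      qed
      fix a b c d assume "(a, b) \<in> \<Union>\<C>" "(c, d) \<in> \<Union>\<C>"
      then obtain V W where VW: "V \<in> \<C>" "(a, b) \<in> V" "W \<in> \<C>" "(c, d) \<in> W" by (elim UnionE)
      obtain R where R: "R \<in> \<C>" "(a, b) \<in> R" "(c, d) \<in> R"
        using tot[OF VW(1,3)] VW by (elim disjE) (auto intro: that)
      have h: "hom_graph E R" using sub R(1) by blast
      show "(a + c, b + d) \<in> \<Union>\<C>" using R_add[OF h R(2,3)] R(1) by blast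
      show "(a * c, b * d) \<in> \<Union>\<C>" using R_mult[OF h R(2,3)] R(1) by blast
    qed
    then show "\<Union>\<C> \<in> \<A>" using c(1) sub by (auto simp: \<A>_def)
  qed
  then obtain M where MA: "M \<in> \<A>" and maxA: "\<forall>N\<in>\<A>. M \<subseteq> N \<longrightarrow> N = M" by (elim bexE)
  then have M: "hom_graph E M" "R0 \<subseteq> M" by (simp_all add: \<A>_def)
  have max: "N = M" if "hom_graph E N" "M \<subseteq> N" for N
    using maxA that M(2) unfolding \<A>_def by simp
  have tot: "\<exists>y. (x, y) \<in> M" for x
  proof -
    obtain R' z' where R': "hom_graph E R'" "M \<subseteq> R'" "(x, z') \<in> R'" using extend_domain[OF M(1), of x] by (elim exE conjE)
    then show ?thesis using max[OF R'(1,2)] by auto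
  qed
  define \<sigma> where "\<sigma> = (\<lambda>x. SOME y. (x, y) \<in> M)"
  have \<sigma>: "(x, \<sigma> x) \<in> M" for x unfolding \<sigma>_def using tot by (rule someI_ex)
  have eq: "\<sigma> x = y" if "(x, y) \<in> M" for x y using R_fun[OF M(1) \<sigma> that] .
  have add: "\<sigma> (x + y) = \<sigma> x + \<sigma> y" for x y by (rule eq[OF R_add[OF M(1) \<sigma> \<sigma>]])
  have mult: "\<sigma> (x * y) = \<sigma> x * \<sigma> y" for x y by (rule eq[OF R_mult[OF M(1) \<sigma> \<sigma>]])
  have fixE: "\<sigma> c = c" if "c \<in> E" for c by (rule eq[OF R_const[OF M(1) that]])
  have inj: "inj \<sigma>"
  proof (rule injI)
    fix x y assume "\<sigma> x = \<sigma> y"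
    then have "(x - y, 0) \<in> M" using R_diff[OF M(1) \<sigma>[of x] \<sigma>[of y]] by simp
    then show "x = y" using R_inj[OF M(1)] by fastforce
  qed
  have "surj \<sigma>"
    unfolding surj_def
  proof
    fix y
    obtain p where p: "p \<noteq> 0" "poly_over E p" "poly p y = 0" using alg unfolding algebraic_over_def by blast
    have hom: "\<sigma> (poly p x) = poly p (\<sigma> x)" if "poly_over E p" for p x
      using that by (induction p) (auto simp: poly_over_pCons add mult fixE is_subringD(1)[OF E_ring])
    have "\<sigma> ` {x. poly p x = 0} = {x. poly p x = 0}"
    proof (rule endo_inj_surj)
      show "finite {x. poly p x = 0}" using p(1) by (rule poly_roots_finite)
      show "\<sigma> ` {x. poly p x = 0} \<subseteq> {x. poly p x = 0}"
        using hom[OF p(2)] fixE[OF is_subringD(1)[OF E_ring]] by auto metis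
      show "inj_on \<sigma> {x. poly p x = 0}" using inj by (rule inj_on_subset) simp
    qed
    then show "\<exists>x. y = \<sigma> x" using p(3) by blast
  qed
  then have "\<sigma> \<in> aut_over E" using inj add mult fixE by (simp add: aut_over_def bij_def)
  then show ?thesis using that eq M(2) by blast
qed

section \<open>Minimal polynomials, conjugates and separable elements\<close>

lemma id_graph: "hom_graph E {(c, c) | c. c \<in> E}"
  unfolding hom_graph_def using is_subringD[OF E_ring] by auto

definition is_min_poly :: "'a poly \<Rightarrow> 'a \<Rightarrow> bool" where
  "is_min_poly m x \<longleftrightarrow> m \<noteq> 0 \<and> poly_over E m \<and> poly m x = 0 \<and>
     (\<forall>f. f \<noteq> 0 \<longrightarrow> poly_over E f \<longrightarrow> poly f x = 0 \<longrightarrow> degree m \<le> degree f)"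

lemma min_poly_ex:
  obtains m where "is_min_poly m x"
proof -
  have "Domain {(c, c) | c. c \<in> E} = E" by auto
  then show ?thesis using minimal_poly[OF id_graph, of x] that unfolding is_min_poly_def by metis
qed

lemma conjugate_ex:
  assumes m: "is_min_poly m x" and x': "poly m x' = 0"
  obtains \<sigma> where "\<sigma> \<in> aut_over E" "\<sigma> x = x'"
proof -
  let ?I = "{(c, c) | c. c \<in> E}"
  have D: "Domain ?I = E" by auto
  have "\<exists>R'. hom_graph E R' \<and> ?I \<subseteq> R' \<and> (x, x') \<in> R'"
  proof (rule extend_step[OF id_graph])
    show "m \<noteq> 0" "poly m x = 0" using m by (simp_all add: is_min_poly_def)
    show "poly_graph ?I m m" using m by (simp add: is_min_poly_def poly_graph_def poly_over_def)
    show "poly m x' = 0" by (rule x')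
    fix f assume "f \<noteq> 0" "poly_over (Domain ?I) f" "poly f x = 0"
    then show "degree m \<le> degree f" using m unfolding D is_min_poly_def by blast
  qed
  then obtain R' where "hom_graph E R'" "(x, x') \<in> R'" by blast
  then show ?thesis using extend_graph[of R'] that by metis
qed

lemma division_over:
  assumes m: "m \<noteq> 0" "poly_over E m" and f: "poly_over E f"
  shows "\<exists>q r. poly_over E q \<and> poly_over E r \<and> f = m * q + r \<and> (r = 0 \<or> degree r < degree m)"
  using f
proof (induction "degree f" arbitrary: f rule: less_induct)
  case less
  show ?case
  proof (cases "f = 0 \<or> degree f < degree m")
    case True
    then show ?thesis using less.prems by (intro exI[of _ 0] exI[of _ f]) (auto simp: poly_over_0[OF E_ring])
  next
    case False
    define n where "n = degree f"
    define t where "t = monom (coeff f n * inverse (lead_coeff m)) (n - degree m)"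
    have t: "poly_over E t" unfolding t_def
      by (rule poly_over_monom[OF E_ring], rule is_subringD(4)[OF E_ring])
        (use less.prems m is_subfieldD(2)[OF E] in \<open>auto simp: poly_over_def\<close>)
    define f1 where "f1 = f - t * m"
    have f1: "poly_over E f1" unfolding f1_def by (intro poly_over_diff poly_over_mult E_ring t m less.prems)
    show ?thesis
    proof (cases "f1 = 0")
      case True
      then show ?thesis using t poly_over_0[OF E_ring] by (intro exI[of _ t] exI[of _ 0]) (simp add: f1_def mult.commute)
    next
      case nz: False
      have "coeff f1 k = 0" if "k \<ge> n" for k
      proof (cases "k = n")
        case True
        then show ?thesis using False m(1) by (simp add: f1_def t_def coeff_monom_mult n_def)
      next
        case ne: False
        then have "coeff f k = 0" "coeff m (k - (n - degree m)) = 0" using that False by (auto simp: n_def intro!: coeff_eq_0)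
        then show ?thesis by (simp add: f1_def t_def coeff_monom_mult)
      qed
      then have "degree f1 < degree f" unfolding n_def[symmetric] using nz by (intro degree_lessI) auto
      from less.hyps[OF this f1] obtain q r where qr: "poly_over E q" "poly_over E r" "f1 = m * q + r" "r = 0 \<or> degree r < degree m"
        by blast
      have "f = m * (q + t) + r" using qr(3) by (simp add: f1_def algebra_simps)
      then show ?thesis using qr t poly_over_add[OF E_ring] by blast
    qed
  qed
qed

lemma min_poly_dvd:
  assumes m: "is_min_poly m x" and f: "poly_over E f" "poly f x = 0"
  obtains q where "poly_over E q" "f = m * q"
proof -
  have m': "m \<noteq> 0" "poly_over E m" "poly m x = 0" using m by (simp_all add: is_min_poly_def)
  obtain q r where qr: "poly_over E q" "poly_over E r" "f = m * q + r" "r = 0 \<or> degree r < degree m"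
    using division_over[OF m'(1,2) f(1)] by blast
  have "poly r x = 0" using f(2) m'(3) by (simp add: qr(3))
  then have "r = 0" using qr(2,4) m unfolding is_min_poly_def by (metis leD)
  then show ?thesis using that qr by simp
qed

definition separable :: "'a \<Rightarrow> bool" where
  "separable x \<longleftrightarrow> (\<exists>f. poly_over E f \<and> poly f x = 0 \<and> poly (pderiv f) x \<noteq> 0)"

text \<open>An automorphism from \<open>conjugate_ex\<close> carries the simplicity of the zero
  \<open>x\<close> to every other zero of \<open>m\<close>.\<close>

lemma separable_min_poly:
  assumes x: "separable x" and m: "is_min_poly m x" and z: "poly m z = 0"
  shows "poly (pderiv m) z \<noteq> 0"
proof -
  obtain f where f: "poly_over E f" "poly f x = 0" "poly (pderiv f) x \<noteq> 0" using x by (auto simp: separable_def)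
  obtain q where q: "f = m * q" using min_poly_dvd[OF m f(1,2)] by metis
  have mE: "poly_over E m" and mx: "poly m x = 0" using m by (simp_all add: is_min_poly_def)
  have "poly (pderiv m) x \<noteq> 0" using f(3) mx by (auto simp: q pderiv_mult)
  moreover obtain \<sigma> where s: "\<sigma> \<in> aut_over E" "\<sigma> x = z" by (rule conjugate_ex[OF m z])
  ultimately show ?thesis
    using aut_over_poly[OF s(1) poly_over_pderiv[OF E_ring mE], of x] aut_overD(10)[OF s(1)] s(2) by metis
qed

text \<open>The remainder \<open>r\<close> of \<open>f\<close> modulo the minimal polynomial takes
  the same value at all conjugates of \<open>x\<close>. By separability there are
  \<open>degree m\<close> of these, more than the degree of \<open>r\<close>, so \<open>r\<close> is
  constant and its value lies in \<open>E\<close>.\<close>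

lemma fixed_in_simple:
  assumes x: "separable x" and f: "poly_over E f" and a: "\<And>\<sigma>. \<sigma> \<in> aut_over E \<Longrightarrow> \<sigma> (poly f x) = poly f x"
  shows "poly f x \<in> E"
proof -
  obtain m where m: "is_min_poly m x" by (rule min_poly_ex)
  have m': "m \<noteq> 0" "poly_over E m" "poly m x = 0" using m by (simp_all add: is_min_poly_def)
  obtain q r where qr: "poly_over E q" "poly_over E r" "f = m * q + r" "r = 0 \<or> degree r < degree m"
    using division_over[OF m'(1,2) f] by blast
  have fr: "poly f x = poly r x" by (simp add: qr(3) m')
  define s where "s = r - [:poly r x:]"
  have deg: "degree m > 0"
  proof (rule ccontr)
    assume "\<not> ?thesis"
    then obtain c where "m = [:c:]" by (metis degree_eq_zeroE gr0I)
    then show False using m' by simp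
  qed
  have "s = 0"
  proof (rule ccontr)
    assume n: "s \<noteq> 0"
    have "{z. poly m z = 0} \<subseteq> {z. poly s z = 0}"
    proof
      fix z assume "z \<in> {z. poly m z = 0}"
      then obtain \<sigma> where \<sigma>: "\<sigma> \<in> aut_over E" "\<sigma> x = z" using conjugate_ex[OF m] by auto
      have "poly r z = poly r x" using aut_over_poly[OF \<sigma>(1) qr(2), of x] a[OF \<sigma>(1)] \<sigma>(2) fr by simp
      then show "z \<in> {z. poly s z = 0}" by (simp add: s_def)
    qed
    then have "card {z. poly m z = 0} \<le> card {z. poly s z = 0}" by (intro card_mono poly_roots_finite n)
    also have "\<dots> \<le> degree s" by (rule card_poly_roots_bound[OF n])
    also have "\<dots> < degree m" unfolding s_def
      by (rule degree_diff_less) (use qr(4) deg in auto)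
    also have "degree m = card {z. poly m z = 0}"
      by (rule card_roots_eq_degree[symmetric]) (use m' separable_min_poly[OF x m] in auto)
    finally show False by simp
  qed
  then have "r = [:poly r x:]" by (simp add: s_def)
  then have "coeff r 0 = coeff [:poly r x:] 0" by (rule arg_cong)
  then have "coeff r 0 = poly r x" by simp
  then show ?thesis using qr(2) fr unfolding poly_over_def by metis
qed

lemma simple_extension:
  defines "E1 \<equiv> \<lambda>x. {poly f x | f. poly_over E f}"
  shows "is_subfield (E1 x)" "E \<subseteq> E1 x" "x \<in> E1 x"
proof -
  show sub: "E \<subseteq> E1 x"
  proof
    fix c assume "c \<in> E"
    then have "poly_over E [:c:] \<and> c = poly [:c:] x" using is_subringD(1)[OF E_ring] by (simp add: poly_over_def coeff_pCons split: nat.splits)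
    then show "c \<in> E1 x" unfolding E1_def by blast
  qed
  have "poly_over E (monom 1 1) \<and> x = poly (monom 1 1) x"
    using poly_over_monom[OF E_ring is_subringD(2)[OF E_ring]] by (simp add: poly_monom)
  then show "x \<in> E1 x" unfolding E1_def by blast
  have "is_subring (E1 x)"
    unfolding is_subring_def
  proof (intro conjI ballI)
    show "0 \<in> E1 x" "1 \<in> E1 x" using sub is_subringD(1,2)[OF E_ring] by blast+
    fix a assume a': "a \<in> E1 x"
    then obtain f where f: "poly_over E f" "a = poly f x" by (auto simp: E1_def)
    have "poly_over E (0 - f) \<and> - a = poly (0 - f) x" using poly_over_diff[OF E_ring poly_over_0[OF E_ring] f(1)] f(2) by simp
    then show "- a \<in> E1 x" unfolding E1_def by blast
    fix b assume "b \<in> E1 x"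
    then obtain g where g: "poly_over E g" "b = poly g x" by (auto simp: E1_def)
    have "poly_over E (f + g) \<and> a + b = poly (f + g) x" "poly_over E (f * g) \<and> a * b = poly (f * g) x"
      using poly_over_add[OF E_ring f(1) g(1)] poly_over_mult[OF E_ring f(1) g(1)] f g by simp_all
    then show "a + b \<in> E1 x" "a * b \<in> E1 x" unfolding E1_def by blast+
  qed
  then show "is_subfield (E1 x)" using sub by (rule algebraic_subring_is_subfield[OF alg E])
qed

end

text \<open>Adjoining separable elements creates no new elements fixed by all automorphisms, although the perfect closure
  is fixed by them.\<close>

lemma fixed_in_separable_extension:
  assumes "finite T" "alg_extension E" "\<And>x. x \<in> T \<Longrightarrow> alg_extension.separable E x"
    and "\<And>D. is_subfield D \<Longrightarrow> E \<subseteq> D \<Longrightarrow> T \<subseteq> D \<Longrightarrow> a \<in> D"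
    and "\<And>\<sigma>. \<sigma> \<in> aut_over E \<Longrightarrow> \<sigma> a = a"
  shows "a \<in> E"
  using assms
proof (induction T arbitrary: E rule: finite_induct)
  case empty
  then show ?case by (simp add: alg_extension_def)
next
  case (insert x T)
  interpret alg_extension E by (rule insert.prems(1))
  define E1 where "E1 = {poly f x | f. poly_over E f}"
  have E1: "is_subfield E1" "E \<subseteq> E1" "x \<in> E1" using simple_extension[of x] by (simp_all add: E1_def)
  interpret E1: alg_extension E1 using E1 algebraic_over_mono[OF alg] by unfold_locales auto
  have "a \<in> E1"
  proof (rule insert.IH[OF E1.alg_extension_axioms])
    fix y assume "y \<in> T"
    then have "separable y" using insert.prems(2) by blast
    then show "E1.separable y" unfolding separable_def E1.separable_def using poly_over_mono[OF _ E1(2)] by blast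
  next
    fix D assume "is_subfield D" "E1 \<subseteq> D" "T \<subseteq> D"
    then show "a \<in> D" using insert.prems(3)[of D] E1 by auto
  next
    fix \<sigma> assume "\<sigma> \<in> aut_over E1"
    then show "\<sigma> a = a" using insert.prems(4) aut_over_mono[OF _ E1(2)] by blast
  qed
  then obtain f where f: "poly_over E f" "a = poly f x" by (auto simp: E1_def)
  show ?case unfolding f(2)
    by (rule fixed_in_simple[OF _ f(1)]) (use insert.prems(2,4) f(2) in auto)
qed

section \<open>Closure properties of separable elements\<close>

context alg_extension
begin

lemma finite_orbit: "finite {\<sigma> x | \<sigma>. \<sigma> \<in> aut_over E}"
proof -
  obtain p where p: "p \<noteq> 0" "poly_over E p" "poly p x = 0" using alg unfolding algebraic_over_def by blast
  have "poly p (\<sigma> x) = 0" if "\<sigma> \<in> aut_over E" for \<sigma>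
    using aut_over_poly[OF that p(2), of x] p(3) aut_overD(5)[OF that] by simp
  then have "{\<sigma> x | \<sigma>. \<sigma> \<in> aut_over E} \<subseteq> {z. poly p z = 0}" by auto
  then show ?thesis using poly_roots_finite[OF p(1)] finite_subset by blast
qed

text \<open>The product of \<open>[:- w, 1:]\<close> over the orbit of \<open>z\<close> has simple
  zeros. Its coefficients are invariant and lie in every field containing \<open>E\<close> and
  \<open>T\<close>, hence in \<open>E\<close> by
  \<open>fixed_in_separable_extension\<close>.\<close>

lemma separable_if_conjugates_generated:
  assumes T: "finite T" "\<And>x. x \<in> T \<Longrightarrow> separable x"
    and z: "\<And>\<sigma> D. \<sigma> \<in> aut_over E \<Longrightarrow> is_subfield D \<Longrightarrow> E \<subseteq> D \<Longrightarrow> T \<subseteq> D \<Longrightarrow> \<sigma> z \<in> D"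
  shows "separable z"
proof -
  define Ob where "Ob = {\<sigma> z | \<sigma>. \<sigma> \<in> aut_over E}"
  have fin: "finite Ob" unfolding Ob_def by (rule finite_orbit)
  define p where "p = (\<Prod>w\<in>Ob. [:- w, 1:])"
  have "poly_over E p"
    unfolding poly_over_def
  proof
    fix i
    show "coeff p i \<in> E"
    proof (rule fixed_in_separable_extension[OF T(1) alg_extension_axioms T(2)])
      fix D assume D: "is_subfield D" "E \<subseteq> D" "T \<subseteq> D"
      note Dr = is_subfieldD(1)[OF D(1)]
      have "w \<in> D" if "w \<in> Ob" for w using z[OF _ D] that by (auto simp: Ob_def)
      then have "poly_over D p" unfolding p_def
        by (intro poly_over_prod Dr) (auto simp: poly_over_pCons poly_over_0[OF Dr] is_subringD[OF Dr])
      then show "coeff p i \<in> D" by (simp add: poly_over_def)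
    next
      fix \<sigma> assume s: "\<sigma> \<in> aut_over E"
      have "\<sigma> ` Ob = Ob"
      proof (rule endo_inj_surj[OF fin])
        show "\<sigma> ` Ob \<subseteq> Ob" unfolding Ob_def using aut_over_comp[OF s] by auto
        show "inj_on \<sigma> Ob" using aut_overD(1)[OF s] by (meson bij_is_inj inj_on_subset subset_UNIV)
      qed
      have val: "poly p t = (\<Prod>w\<in>Ob. t - w)" for t by (simp add: p_def poly_prod)
      have "poly (map_poly \<sigma> p - p) t = 0" for t
      proof -
        define t' where "t' = inv_into UNIV \<sigma> t"
        have t: "t = \<sigma> t'" using aut_over_inv(3)[OF s] by (simp add: t'_def)
        have "\<sigma> (\<Prod>w\<in>I. f w) = (\<Prod>w\<in>I. \<sigma> (f w))" for I and f :: "'a \<Rightarrow> 'a"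
          by (induction I rule: infinite_finite_induct) (auto simp: aut_overD[OF s])
        then have "poly (map_poly \<sigma> p) t = (\<Prod>w\<in>Ob. \<sigma> t' - \<sigma> w)"
          unfolding t aut_over_map_poly[OF s] val by (simp add: aut_overD(8)[OF s])
        also have "\<dots> = (\<Prod>w\<in>\<sigma> ` Ob. t - w)"
          unfolding t by (rule prod.reindex[symmetric, unfolded comp_def])
            (meson aut_overD(1)[OF s] bij_is_inj inj_on_subset subset_UNIV)
        finally show ?thesis unfolding \<open>\<sigma> ` Ob = Ob\<close> val[symmetric] by simp
      qed
      then have "map_poly \<sigma> p = p" using poly_zero_fun by (metis eq_iff_diff_eq_0)
      then show "\<sigma> (coeff p i) = coeff p i" by (metis coeff_map_poly aut_overD(5)[OF s])
    qed
  qed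
  moreover have zO: "z \<in> Ob" unfolding Ob_def mem_Collect_eq by (rule exI[of _ "\<lambda>x. x"]) (simp add: aut_over_id)
  moreover have "poly p z = 0" using zO fin by (auto simp: p_def poly_prod prod_zero_iff)
  moreover have "poly (pderiv p) z \<noteq> 0"
  proof -
    define q where "q = (\<Prod>w\<in>Ob - {z}. [:- w, 1:])"
    have p: "p = [:- z, 1:] * q" unfolding p_def q_def by (rule prod.remove[OF fin zO])
    have "pderiv p = [:- z, 1:] * pderiv q + q * pderiv [:- z, 1:]" unfolding p by (rule pderiv_mult)
    then have "poly (pderiv p) z = poly q z" by (simp add: pderiv_pCons)
    also have "\<dots> \<noteq> 0" using fin by (auto simp: q_def poly_prod prod_zero_iff)
    finally show ?thesis .
  qed
  ultimately show ?thesis unfolding separable_def by blast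
qed

lemma separable_conj: "separable x \<Longrightarrow> \<sigma> \<in> aut_over E \<Longrightarrow> separable (\<sigma> x)"
  unfolding separable_def
  using aut_over_poly[of \<sigma> E _ x] aut_overD(5,10)[of \<sigma> E] poly_over_pderiv[OF E_ring] by metis

lemma separable_fixed:
  assumes "separable x" "\<And>\<sigma>. \<sigma> \<in> aut_over E \<Longrightarrow> \<sigma> x = x"
  shows "x \<in> E"
  by (rule fixed_in_separable_extension[of "{x}"]) (use assms alg_extension_axioms in auto)

lemma separable_E: "x \<in> E \<Longrightarrow> separable x"
  unfolding separable_def
  by (rule exI[of _ "[:- x, 1:]"])
    (auto simp: poly_over_pCons poly_over_0[OF E_ring] pderiv_pCons is_subringD[OF E_ring])

text \<open>The conjugates of a sum, product or inverse lie in the field generated by the conjugates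
  of \<open>x\<close> and \<open>y\<close>, which are finitely many separable elements.\<close>

lemma separable_subfield: "is_subfield {x. separable x}"
proof -
  have gen: "separable z" if xy: "separable x" "separable y"
    and z: "\<And>\<sigma> D. \<sigma> \<in> aut_over E \<Longrightarrow> is_subfield D \<Longrightarrow> \<sigma> x \<in> D \<Longrightarrow> \<sigma> y \<in> D \<Longrightarrow> \<sigma> z \<in> D" for x y z
  proof (rule separable_if_conjugates_generated[of "{\<sigma> x | \<sigma>. \<sigma> \<in> aut_over E} \<union> {\<sigma> y | \<sigma>. \<sigma> \<in> aut_over E}"])
    show "finite ({\<sigma> x | \<sigma>. \<sigma> \<in> aut_over E} \<union> {\<sigma> y | \<sigma>. \<sigma> \<in> aut_over E})" using finite_orbit by simp
    show "separable w" if "w \<in> {\<sigma> x | \<sigma>. \<sigma> \<in> aut_over E} \<union> {\<sigma> y | \<sigma>. \<sigma> \<in> aut_over E}" for w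
      using that xy separable_conj by auto
    fix \<sigma> D assume "\<sigma> \<in> aut_over E" "is_subfield D"
      "{\<sigma> x | \<sigma>. \<sigma> \<in> aut_over E} \<union> {\<sigma> y | \<sigma>. \<sigma> \<in> aut_over E} \<subseteq> D"
    then show "\<sigma> z \<in> D" using z by blast
  qed
  have "separable 0" "separable 1" using separable_E is_subringD(1,2)[OF E_ring] by blast+
  moreover have "separable (- x)" if "separable x" for x
    by (rule gen[OF that that]) (auto simp: aut_overD dest: is_subfieldD(1) intro: is_subringD(5))
  moreover have "separable (inverse x)" if "separable x" for x
    by (rule gen[OF that that]) (auto simp: aut_overD is_subfieldD(2))
  moreover have "separable (x + y)" if "separable x" "separable y" for x y
    by (rule gen[OF that]) (auto simp: aut_overD dest: is_subfieldD(1) intro: is_subringD(3))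
  moreover have "separable (x * y)" if "separable x" "separable y" for x y
    by (rule gen[OF that]) (auto simp: aut_overD dest: is_subfieldD(1) intro: is_subringD(4))
  ultimately show ?thesis by (simp add: is_subfield_def is_subring_def)
qed

end


section \<open>Hilbert 90\<close>

text \<open>The characters are tested only on a multiplicative set \<open>A\<close>, later the field
  fixed by a stabiliser. Comparing the relation at \<open>a * b\<close> with \<open>\<xi>0 b\<close>
  times the relation at \<open>a\<close> removes one character.\<close>

lemma dedekind_independence:
  fixes c :: "('a::field \<Rightarrow> 'a) \<Rightarrow> 'a"
  assumes "finite S" "1 \<in> A" "\<And>a b. a \<in> A \<Longrightarrow> b \<in> A \<Longrightarrow> a * b \<in> A"
    and "\<And>\<xi> a b. \<xi> \<in> S \<Longrightarrow> \<xi> (a * b) = \<xi> a * \<xi> b" "\<And>\<xi>. \<xi> \<in> S \<Longrightarrow> \<xi> 1 = 1"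
    and "\<And>\<xi> \<xi>'. \<xi> \<in> S \<Longrightarrow> \<xi>' \<in> S \<Longrightarrow> \<xi> \<noteq> \<xi>' \<Longrightarrow> \<exists>a\<in>A. \<xi> a \<noteq> \<xi>' a"
    and "\<And>a. a \<in> A \<Longrightarrow> (\<Sum>\<xi>\<in>S. c \<xi> * \<xi> a) = 0" "\<xi> \<in> S"
  shows "c \<xi> = 0"
  using assms
proof (induction S arbitrary: c \<xi> rule: finite_induct)
  case empty
  from empty.prems(7) show ?case by simp
next
  case (insert \<xi>0 S)
  have S: "c \<xi>1 = 0" if \<xi>1: "\<xi>1 \<in> S" for \<xi>1
  proof -
    have "\<xi>0 \<noteq> \<xi>1" using insert.hyps \<xi>1 by auto
    then obtain b where b: "b \<in> A" "\<xi>0 b \<noteq> \<xi>1 b" using insert.prems(5)[of \<xi>0 \<xi>1] \<xi>1 by auto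
    have "c \<xi>1 * (\<xi>1 b - \<xi>0 b) = 0"
    proof (rule insert.IH[of "\<lambda>\<xi>. c \<xi> * (\<xi> b - \<xi>0 b)" \<xi>1])
      fix a assume a: "a \<in> A"
      have 1: "c \<xi>0 * \<xi>0 a + (\<Sum>\<xi>\<in>S. c \<xi> * \<xi> a) = 0"
        using insert.prems(6)[OF a] insert.hyps by simp
      have 2: "c \<xi>0 * \<xi>0 a * \<xi>0 b + (\<Sum>\<xi>\<in>S. c \<xi> * \<xi> a * \<xi> b) = 0"
        using insert.prems(6)[OF insert.prems(2)[OF a b(1)]] insert.hyps insert.prems(3) by (simp add: mult.assoc)
      have "(\<Sum>\<xi>\<in>S. c \<xi> * (\<xi> b - \<xi>0 b) * \<xi> a) = (\<Sum>\<xi>\<in>S. c \<xi> * \<xi> a * \<xi> b) - (\<Sum>\<xi>\<in>S. c \<xi> * \<xi> a) * \<xi>0 b"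
        unfolding sum_distrib_right sum_subtractf[symmetric] by (rule sum.cong) (simp_all add: algebra_simps)
      also have "\<dots> = - (c \<xi>0 * \<xi>0 a * \<xi>0 b) + c \<xi>0 * \<xi>0 a * \<xi>0 b"
        using 1 2 by (simp add: add_eq_0_iff)
      finally show "(\<Sum>\<xi>\<in>S. c \<xi> * (\<xi> b - \<xi>0 b) * \<xi> a) = 0" by simp
    qed (use insert.prems \<xi>1 in auto)
    then show ?thesis using b(2) by simp
  qed
  have "c \<xi>0 * \<xi>0 1 + (\<Sum>\<xi>\<in>S. c \<xi> * \<xi> 1) = 0"
    using insert.prems(6)[OF insert.prems(1)] insert.hyps by simp
  then have c0: "c \<xi>0 = 0" using S insert.prems(4)[of \<xi>0] by simp
  show ?case
  proof (cases "\<xi> = \<xi>0")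
    case True
    then show ?thesis using c0 by simp
  next
    case False
    then show ?thesis using S[of \<xi>] insert.prems(7) by blast
  qed
qed

section \<open>Averaging over automorphisms modulo a stabiliser\<close>

context alg_extension
begin

text \<open>Representatives of the left cosets of the stabiliser of \<open>T\<close>. They take the
  role of the Galois group of a finite extension, also when that extension is not normal.\<close>

definition agree_reps :: "'a set \<Rightarrow> ('a \<Rightarrow> 'a) set \<Rightarrow> bool" where
  "agree_reps T S \<longleftrightarrow> finite S \<and> S \<subseteq> aut_over E \<and>
     (\<forall>\<sigma>\<in>aut_over E. \<exists>\<rho>\<in>S. \<forall>x\<in>T. \<rho> x = \<sigma> x) \<and>
     (\<forall>\<rho>\<in>S. \<forall>\<rho>'\<in>S. (\<forall>x\<in>T. \<rho> x = \<rho>' x) \<longrightarrow> \<rho> = \<rho>')"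

lemma agree_reps_ex:
  assumes "finite T"
  obtains S where "agree_reps T S" "(\<lambda>x. x) \<in> S"
proof -
  define f where "f = (\<lambda>\<sigma>. restrict \<sigma> T :: 'a \<Rightarrow> 'a)"
  have "f ` aut_over E \<subseteq> PiE T (\<lambda>x. {\<sigma> x | \<sigma>. \<sigma> \<in> aut_over E})" by (auto simp: f_def)
  then have fin: "finite (f ` aut_over E)" using finite_subset[OF _ finite_PiE[OF assms finite_orbit]] by simp
  \<comment> \<open>The choice function is adjusted so that the identity represents its own coset;
    this gives \<open>trace_nonzero\<close> a coefficient known to be nonzero.\<close>
  define g where "g = (\<lambda>h. if h = f (\<lambda>x. x) then (\<lambda>x. x) else inv_into (aut_over E) f h)"
  have g: "g h \<in> aut_over E" "f (g h) = h" if "h \<in> f ` aut_over E" for h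
    using that aut_over_id inv_into_into[OF that] f_inv_into_f[OF that] unfolding g_def by (metis, metis)
  define S where "S = g ` f ` aut_over E"
  have ff: "f \<sigma> = f \<tau> \<longleftrightarrow> (\<forall>x\<in>T. \<sigma> x = \<tau> x)" for \<sigma> \<tau>
    by (auto simp: f_def restrict_def fun_eq_iff)
  have "agree_reps T S"
    unfolding agree_reps_def
  proof (intro conjI ballI impI)
    show "finite S" using fin by (simp add: S_def)
    show "S \<subseteq> aut_over E" using g by (auto simp: S_def)
    show "\<exists>\<rho>\<in>S. \<forall>x\<in>T. \<rho> x = \<sigma> x" if "\<sigma> \<in> aut_over E" for \<sigma>
      using g(2)[of "f \<sigma>"] that ff[of "g (f \<sigma>)" \<sigma>] by (auto simp: S_def)
    fix \<rho> \<rho>' assume "\<rho> \<in> S" "\<rho>' \<in> S" and eq: "\<forall>x\<in>T. \<rho> x = \<rho>' x"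
    then obtain h h' where "h \<in> f ` aut_over E" "h' \<in> f ` aut_over E" "\<rho> = g h" "\<rho>' = g h'" by (auto simp: S_def)
    then show "\<rho> = \<rho>'" using g(2) ff[of \<rho> \<rho>'] eq by metis
  qed
  moreover have "(\<lambda>x. x) \<in> S"
  proof -
    have "g (f (\<lambda>x. x)) = (\<lambda>x. x)" by (simp add: g_def)
    then show ?thesis unfolding S_def using aut_over_id by (metis imageI)
  qed
  ultimately show ?thesis by (rule that)
qed

lemma agree_repsD:
  assumes "agree_reps T S"
  shows "finite S" "\<rho> \<in> S \<Longrightarrow> \<rho> \<in> aut_over E" "\<sigma> \<in> aut_over E \<Longrightarrow> \<exists>\<rho>\<in>S. \<forall>x\<in>T. \<rho> x = \<sigma> x"
    "\<rho> \<in> S \<Longrightarrow> \<rho>' \<in> S \<Longrightarrow> (\<And>x. x \<in> T \<Longrightarrow> \<rho> x = \<rho>' x) \<Longrightarrow> \<rho> = \<rho>'"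
  using assms unfolding agree_reps_def by blast+

text \<open>Left translation by \<open>\<tau>\<close> permutes the cosets, and \<open>W\<close>
  depends only on the coset.\<close>

lemma sum_agree_reps_translate:
  assumes S: "agree_reps T S" and \<tau>: "\<tau> \<in> aut_over E"
    and W: "\<And>\<sigma> \<sigma>'. \<sigma> \<in> aut_over E \<Longrightarrow> \<sigma>' \<in> aut_over E \<Longrightarrow> (\<And>x. x \<in> T \<Longrightarrow> \<sigma> x = \<sigma>' x) \<Longrightarrow> W \<sigma> = W \<sigma>'"
  shows "(\<Sum>\<rho>\<in>S. W (\<lambda>x. \<tau> (\<rho> x))) = (\<Sum>\<rho>\<in>S. W \<rho>)"
proof -
  define r where "r = (\<lambda>\<sigma>. SOME \<rho>. \<rho> \<in> S \<and> (\<forall>x\<in>T. \<rho> x = \<sigma> x))"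
  have r: "r \<sigma> \<in> S \<and> (\<forall>x\<in>T. r \<sigma> x = \<sigma> x)" if "\<sigma> \<in> aut_over E" for \<sigma>
  proof -
    have ex: "\<exists>\<rho>. \<rho> \<in> S \<and> (\<forall>x\<in>T. \<rho> x = \<sigma> x)" using agree_repsD(3)[OF S that] by blast
    show ?thesis unfolding r_def by (rule someI_ex[OF ex])
  qed
  define h where "h = (\<lambda>\<rho>. r (\<lambda>x. \<tau> (\<rho> x)))"
  have c: "(\<lambda>x. \<tau> (\<rho> x)) \<in> aut_over E" if "\<rho> \<in> S" for \<rho>
    by (rule aut_over_comp[OF \<tau> agree_repsD(2)[OF S that]])
  have hS: "h \<rho> \<in> S" and hx: "x \<in> T \<Longrightarrow> h \<rho> x = \<tau> (\<rho> x)" if "\<rho> \<in> S" for \<rho> x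
    using r[OF c[OF that]] by (auto simp: h_def)
  have inj: "inj_on h S"
  proof (rule inj_onI)
    fix \<rho> \<rho>' assume a: "\<rho> \<in> S" "\<rho>' \<in> S" "h \<rho> = h \<rho>'"
    show "\<rho> = \<rho>'"
    proof (rule agree_repsD(4)[OF S a(1,2)])
      fix x assume "x \<in> T"
      then have "\<tau> (\<rho> x) = \<tau> (\<rho>' x)" using hx a by metis
      then show "\<rho> x = \<rho>' x" using aut_overD(1)[OF \<tau>] by (simp add: bij_def inj_def)
    qed
  qed
  have "h ` S = S" by (rule endo_inj_surj[OF agree_repsD(1)[OF S] _ inj]) (use hS in auto)
  then have "(\<Sum>\<rho>\<in>S. W \<rho>) = (\<Sum>\<rho>\<in>S. W (h \<rho>))" using sum.reindex[OF inj, of W] by (simp add: comp_def)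
  also have "\<dots> = (\<Sum>\<rho>\<in>S. W (\<lambda>x. \<tau> (\<rho> x)))"
    by (rule sum.cong[OF refl], rule W) (use hS hx c agree_repsD(2)[OF S] in auto)
  finally show ?thesis by simp
qed

text \<open>On these elements an automorphism depends only on its coset modulo the stabiliser of
  \<open>T\<close> (\<open>fixed_sep_agree\<close>).\<close>

definition fixed_sep :: "'a set \<Rightarrow> 'a set" where
  "fixed_sep T = {a. separable a \<and> (\<forall>\<sigma>\<in>aut_over E. (\<forall>x\<in>T. \<sigma> x = x) \<longrightarrow> \<sigma> a = a)}"

lemma fixed_sep_agree:
  assumes "a \<in> fixed_sep T" "\<sigma> \<in> aut_over E" "\<sigma>' \<in> aut_over E" "\<And>x. x \<in> T \<Longrightarrow> \<sigma> x = \<sigma>' x"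
  shows "\<sigma> a = \<sigma>' a"
proof -
  let ?\<tau> = "\<lambda>x. inv_into UNIV \<sigma> (\<sigma>' x)"
  have \<tau>: "?\<tau> \<in> aut_over E" by (rule aut_over_comp[OF aut_over_inv(1)[OF assms(2)] assms(3)])
  have fT: "\<forall>x\<in>T. ?\<tau> x = x"
  proof
    fix x assume "x \<in> T"
    then show "?\<tau> x = x" using assms(4)[of x] aut_over_inv(2)[OF assms(2), of x] by simp
  qed
  have "\<forall>\<sigma>\<in>aut_over E. (\<forall>x\<in>T. \<sigma> x = x) \<longrightarrow> \<sigma> a = a" using assms(1) by (simp add: fixed_sep_def)
  from mp[OF bspec[OF this \<tau>] fT] have "?\<tau> a = a" .
  then have "\<sigma> (?\<tau> a) = \<sigma> a" by simp
  then show ?thesis unfolding aut_over_inv(3)[OF assms(2)] by simp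
qed

text \<open>Dedekind independence: distinct representatives already differ on some element of
  \<open>T\<close>, and \<open>T\<close> is contained in \<open>fixed_sep T\<close>.\<close>

lemma trace_nonzero:
  assumes S: "agree_reps T S" and T: "\<And>x. x \<in> T \<Longrightarrow> separable x" and w: "\<rho>0 \<in> S" "w \<rho>0 \<noteq> 0"
  obtains a where "a \<in> fixed_sep T" "(\<Sum>\<rho>\<in>S. w \<rho> * \<rho> a) \<noteq> 0"
proof (rule ccontr)
  note main = that
  assume n0: "\<not> thesis"
  have n: "(\<Sum>\<rho>\<in>S. w \<rho> * \<rho> a) = 0" if "a \<in> fixed_sep T" for a
    using n0 main[OF that] by blast
  note sub = is_subfieldD(1)[OF separable_subfield]
  have "w \<rho>0 = 0"
  proof (rule dedekind_independence[of S "fixed_sep T" w])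
    show "finite S" by (rule agree_repsD(1)[OF S])
    show "1 \<in> fixed_sep T" using is_subringD(2)[OF sub] by (auto simp: fixed_sep_def aut_overD(6))
    show "a * b \<in> fixed_sep T" if "a \<in> fixed_sep T" "b \<in> fixed_sep T" for a b
      using is_subringD(4)[OF sub, of a b] that by (auto simp: fixed_sep_def aut_overD(3))
    show "\<xi> (a * b) = \<xi> a * \<xi> b" "\<xi> 1 = 1" if "\<xi> \<in> S" for \<xi> a b
      by (rule aut_overD[OF agree_repsD(2)[OF S that]])+
    show "\<exists>a\<in>fixed_sep T. \<xi> a \<noteq> \<xi>' a" if ne: "\<xi> \<in> S" "\<xi>' \<in> S" "\<xi> \<noteq> \<xi>'" for \<xi> \<xi>'
    proof -
      obtain x where "x \<in> T" "\<xi> x \<noteq> \<xi>' x" using agree_repsD(4)[OF S ne(1,2)] ne(3) by blast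
      moreover from this have "x \<in> fixed_sep T" using T by (simp add: fixed_sep_def)
      ultimately show ?thesis by blast
    qed
    show "(\<Sum>\<xi>\<in>S. w \<xi> * \<xi> a) = 0" if "a \<in> fixed_sep T" for a by (rule n[OF that])
  qed (rule w(1))
  then show False using w(2) by simp
qed

text \<open>A Poincare series \<open>f\<close>, the sum of \<open>u \<rho> * \<rho> a\<close>,
  satisfies \<open>\<tau> f * u \<tau> = f\<close>, so its inverse has the required behaviour.
  Hypothesis \<open>loc\<close> expresses continuity and makes \<open>u\<close> a function on
  finitely many cosets.\<close>

theorem hilbert90:
  assumes T: "finite T" "\<And>x. x \<in> T \<Longrightarrow> separable x"
    and coc: "\<And>\<sigma> \<tau>. \<sigma> \<in> aut_over E \<Longrightarrow> \<tau> \<in> aut_over E \<Longrightarrow> u (\<lambda>x. \<sigma> (\<tau> x)) = u \<sigma> * \<sigma> (u \<tau>)"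
    and loc: "\<And>\<sigma>. \<sigma> \<in> aut_over E \<Longrightarrow> (\<And>x. x \<in> T \<Longrightarrow> \<sigma> x = x) \<Longrightarrow> u \<sigma> = 1"
    and u: "\<And>\<sigma>. \<sigma> \<in> aut_over E \<Longrightarrow> u \<sigma> \<noteq> 0 \<and> separable (u \<sigma>)"
  obtains b where "b \<noteq> 0" "separable b" "\<And>\<sigma>. \<sigma> \<in> aut_over E \<Longrightarrow> \<sigma> b = u \<sigma> * b"
proof -
  have uT: "u \<sigma> = u \<sigma>'" if a: "\<sigma> \<in> aut_over E" "\<sigma>' \<in> aut_over E" "\<And>x. x \<in> T \<Longrightarrow> \<sigma> x = \<sigma>' x" for \<sigma> \<sigma>'
  proof -
    let ?\<tau> = "\<lambda>x. inv_into UNIV \<sigma> (\<sigma>' x)"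
    have \<tau>: "?\<tau> \<in> aut_over E" by (rule aut_over_comp[OF aut_over_inv(1)[OF a(1)] a(2)])
    have "u ?\<tau> = 1" by (rule loc[OF \<tau>]) (use a(3) aut_over_inv(2)[OF a(1)] in metis)
    moreover have "(\<lambda>x. \<sigma> (?\<tau> x)) = \<sigma>'" using aut_over_inv(3)[OF a(1)] by auto
    ultimately show ?thesis using coc[OF a(1) \<tau>] aut_overD(6)[OF a(1)] by simp
  qed
  obtain S where S: "agree_reps T S" "(\<lambda>x. x) \<in> S" by (rule agree_reps_ex[OF T(1)])
  have "u (\<lambda>x. x) \<noteq> 0" using u aut_over_id by blast
  then obtain a where a: "a \<in> fixed_sep T" and f0: "(\<Sum>\<rho>\<in>S. u \<rho> * \<rho> a) \<noteq> 0"
    using trace_nonzero[OF S(1) T(2) S(2), of u] by blast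
  define f where "f = (\<Sum>\<rho>\<in>S. u \<rho> * \<rho> a)"
  have \<tau>f: "\<tau> f * u \<tau> = f" if \<tau>: "\<tau> \<in> aut_over E" for \<tau>
  proof -
    have "\<tau> f * u \<tau> = (\<Sum>\<rho>\<in>S. (u \<tau> * \<tau> (u \<rho>)) * \<tau> (\<rho> a))"
      unfolding f_def aut_over_sum[OF \<tau>] sum_distrib_right
      by (rule sum.cong) (simp_all add: aut_overD(3)[OF \<tau>] mult_ac)
    also have "\<dots> = (\<Sum>\<rho>\<in>S. u (\<lambda>x. \<tau> (\<rho> x)) * \<tau> (\<rho> a))"
      by (rule sum.cong) (simp_all add: coc[OF \<tau> agree_repsD(2)[OF S(1)]])
    also have "\<dots> = f" unfolding f_def
      by (rule sum_agree_reps_translate[OF S(1) \<tau>, of "\<lambda>\<sigma>. u \<sigma> * \<sigma> a"]) (use uT fixed_sep_agree[OF a] in metis)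
    finally show ?thesis .
  qed
  note sub = is_subfieldD(1)[OF separable_subfield]
  have sepf: "f \<in> {x. separable x}"
    unfolding f_def
  proof (rule is_subring_sum[OF sub], rule is_subringD(4)[OF sub])
    fix \<rho> assume \<rho>: "\<rho> \<in> S"
    show "u \<rho> \<in> {x. separable x}" using u agree_repsD(2)[OF S(1) \<rho>] by blast
    show "\<rho> a \<in> {x. separable x}" using a separable_conj agree_repsD(2)[OF S(1) \<rho>] by (simp add: fixed_sep_def)
  qed
  show ?thesis
  proof (rule that[of "inverse f"])
    show "inverse f \<noteq> 0" using f0 by (simp add: f_def)
    show "separable (inverse f)" using is_subfieldD(2)[OF separable_subfield sepf] by simp
    fix \<tau> assume \<tau>: "\<tau> \<in> aut_over E"
    have "\<tau> f \<noteq> 0" using f0 aut_overD(10)[OF \<tau>] by (simp add: f_def)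
    then have "inverse (\<tau> f) = u \<tau> * inverse (\<tau> f * u \<tau>)" using u[OF \<tau>] by (simp add: field_simps)
    then show "\<tau> (inverse f) = u \<tau> * inverse f" unfolding aut_overD(9)[OF \<tau>] \<tau>f[OF \<tau>] .
  qed
qed

end


section \<open>The separable closure\<close>

lemma poly_over_base_iff: "poly_over base_field p \<longleftrightarrow> (\<exists>q. p = map_poly to_ac q)"
proof
  assume p: "poly_over base_field p"
  have "p = map_poly to_ac (map_poly of_ac p)"
    by (rule poly_eqI) (use p in \<open>auto simp: coeff_map_poly poly_over_def base_field_def to_ac_of_ac\<close>)
  then show "\<exists>q. p = map_poly to_ac q" by blast
qed (auto simp: poly_over_def coeff_map_poly base_field_def)

interpretation base: alg_extension "base_field :: 'k::field alg_closure set"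
proof
  show "is_subfield (base_field :: 'k alg_closure set)"
    unfolding is_subfield_def is_subring_def base_field_def
    by (auto simp flip: to_ac_add to_ac_mult to_ac_minus to_ac_inverse to_ac_0 to_ac_1)
  show "algebraic_over (base_field :: 'k alg_closure set)"
    unfolding algebraic_over_def
  proof
    fix x :: "'k alg_closure"
    obtain p :: "'k poly" where p: "p \<noteq> 0" "poly (map_poly to_ac p) x = 0" using alg_closure_algebraic[of x] by metis
    have "coeff p (degree p) \<noteq> 0" by (rule leading_coeff_neq_0[OF p(1)])
    then have "coeff (map_poly to_ac p) (degree p) \<noteq> 0" by (simp only: coeff_map_poly[of to_ac, OF to_ac_0] to_ac_eq_0_iff not_False_eq_True)
    then have "map_poly to_ac p \<noteq> 0" by (metis coeff_0)
    then show "\<exists>p. p \<noteq> 0 \<and> poly_over base_field p \<and> poly p x = 0" using p(2) poly_over_base_iff by blast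
  qed
qed

lemma map_to_ac_mult: "map_poly to_ac (p * q) = map_poly to_ac p * map_poly to_ac q"
  by (rule poly_eqI) (simp add: coeff_map_poly coeff_mult to_ac_sum)

lemma map_to_ac_pderiv: "map_poly to_ac (pderiv p) = pderiv (map_poly to_ac p)"
  by (rule poly_eqI) (simp add: coeff_map_poly coeff_pderiv)

lemma map_to_ac_inj: "map_poly to_ac p = map_poly to_ac q \<longleftrightarrow> p = q"
  by (auto simp: poly_eq_iff coeff_map_poly)

lemma degree_map_to_ac: "degree (map_poly to_ac p) = degree p"
  by (cases "p = 0") (auto intro!: map_poly_degree_eq)

text \<open>If \<open>x\<close> were a multiple zero of \<open>p\<close>, its minimal polynomial
  would divide both \<open>p\<close> and the derivative. Conversely, a common divisor of the minimal
  polynomial and its derivative does not vanish at a separable \<open>x\<close>, so the cofactor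
  does, and minimality makes the divisor a unit.\<close>

lemma sep_closure_eq: "sep_closure = {x :: 'k::field alg_closure. base.separable x}"
proof (intro Set.set_eqI iffI)
  fix x :: "'k alg_closure"
  assume "x \<in> sep_closure"
  then obtain p :: "'k poly" where p: "coprime p (pderiv p)" "poly (map_poly to_ac p) x = 0"
    by (auto simp: sep_closure_def)
  have "poly (pderiv (map_poly to_ac p)) x \<noteq> 0"
  proof
    assume d: "poly (pderiv (map_poly to_ac p)) x = 0"
    obtain m where m: "base.is_min_poly m x" by (rule base.min_poly_ex)
    obtain m0 where m0: "m = map_poly to_ac m0" using m poly_over_base_iff unfolding base.is_min_poly_def by metis
    have dv: "m0 dvd f" if fx: "poly (map_poly to_ac f) x = 0" for f
    proof -
      have "poly_over base_field (map_poly to_ac f)" using poly_over_base_iff by blast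
      then obtain q where q: "poly_over base_field q" "map_poly to_ac f = m * q"
        by (rule base.min_poly_dvd[OF m _ fx]) (rule that)
      then obtain q0 where "q = map_poly to_ac q0" using poly_over_base_iff by metis
      then have "map_poly to_ac f = map_poly to_ac (m0 * q0)" using q(2) by (simp only: m0 map_to_ac_mult)
      then have "f = m0 * q0" unfolding map_to_ac_inj .
      then show ?thesis by simp
    qed
    have "is_unit m0" using coprime_common_divisor[OF p(1) dv[OF p(2)] dv] d by (simp add: map_to_ac_pderiv)
    moreover have "m0 \<noteq> 0" using m by (auto simp: base.is_min_poly_def m0)
    ultimately have "degree m0 = 0" "m0 \<noteq> 0" using is_unit_iff_degree[of m0] by auto
    then obtain c where "m0 = [:c:]" "c \<noteq> 0" by (metis degree_eq_zeroE pCons_eq_0_iff)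
    then have "m = [:to_ac c:]" "to_ac c \<noteq> 0" by (simp_all add: m0 map_poly_pCons)
    then show False using m by (auto simp: base.is_min_poly_def)
  qed
  then show "x \<in> {x. base.separable x}"
    unfolding base.separable_def mem_Collect_eq using p(2) poly_over_base_iff by blast
next
  fix x :: "'k alg_closure"
  assume "x \<in> {x. base.separable x}"
  then have x: "base.separable x" by simp
  obtain m where m: "base.is_min_poly m x" by (rule base.min_poly_ex)
  obtain m0 where m0: "m = map_poly to_ac m0" using m poly_over_base_iff unfolding base.is_min_poly_def by metis
  have mx: "poly m x = 0" "m0 \<noteq> 0" using m m0 by (auto simp: base.is_min_poly_def)
  have d: "poly (pderiv m) x \<noteq> 0" by (rule base.separable_min_poly[OF x m mx(1)])
  have "coprime m0 (pderiv m0)"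
  proof (rule coprimeI)
    fix c assume c: "c dvd m0" "c dvd pderiv m0"
    obtain e where e: "m0 = c * e" using c(1) by (elim dvdE)
    obtain e' where e': "pderiv m0 = c * e'" using c(2) by (elim dvdE)
    have "poly (map_poly to_ac c) x \<noteq> 0"
      using d unfolding m0 map_to_ac_pderiv[symmetric] e' map_to_ac_mult by auto
    then have ex: "poly (map_poly to_ac e) x = 0" using mx(1) unfolding m0 e map_to_ac_mult by simp
    have nz: "c \<noteq> 0" "e \<noteq> 0" using mx(2) e by auto
    have "map_poly to_ac e \<noteq> 0" using nz(2) by (auto simp: poly_eq_iff coeff_map_poly)
    then have "degree m \<le> degree (map_poly to_ac e)"
      using m ex poly_over_base_iff unfolding base.is_min_poly_def by blast
    then have "degree m0 \<le> degree e" by (simp add: m0 degree_map_to_ac)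
    then have "degree c = 0" unfolding e using degree_mult_eq[OF nz] by simp
    then show "is_unit c" using nz(1) by (simp add: is_unit_iff_degree)
  qed
  then show "x \<in> sep_closure" using mx(1) unfolding sep_closure_def m0 by blast
qed

lemma sep_subfield: "is_subfield sep_closure"
  unfolding sep_closure_eq by (rule base.separable_subfield)

lemma base_subset_sep: "base_field \<subseteq> sep_closure"
  unfolding sep_closure_eq using base.separable_E by blast

lemma sep_fixed_in_base:
  "x \<in> sep_closure \<Longrightarrow> (\<And>\<sigma>. \<sigma> \<in> aut_over base_field \<Longrightarrow> \<sigma> x = x) \<Longrightarrow> x \<in> base_field"
  unfolding sep_closure_eq using base.separable_fixed by blast

lemma sep_conj: "x \<in> sep_closure \<Longrightarrow> \<sigma> \<in> aut_over base_field \<Longrightarrow> \<sigma> x \<in> sep_closure"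
  unfolding sep_closure_eq using base.separable_conj by blast


section \<open>Galois action on points and morphisms\<close>

definition vact :: "('a \<Rightarrow> 'a) \<Rightarrow> 'a ^ 'm \<Rightarrow> 'a ^ 'm" where
  "vact \<sigma> x = (\<chi> i. \<sigma> (x $ i))"

definition pact :: "('a \<Rightarrow> 'a) \<Rightarrow> ('a ^ 'm) set \<Rightarrow> ('a ^ 'm) set" where
  "pact \<sigma> P = vact \<sigma> ` P"

lemma vact_nth [simp]: "vact \<sigma> x $ i = \<sigma> (x $ i)"
  by (simp add: vact_def)

lemma vact_scale: "\<sigma> \<in> aut_over E \<Longrightarrow> vact \<sigma> (c *s x) = \<sigma> c *s vact \<sigma> x"
  by (simp add: vec_eq_iff aut_overD(3))

lemma vact_eq_0: "\<sigma> \<in> aut_over E \<Longrightarrow> vact \<sigma> x = 0 \<longleftrightarrow> x = 0"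
  by (simp add: vec_eq_iff aut_overD(10))

lemma vact_inv:
  assumes "\<sigma> \<in> aut_over E"
  shows "vact \<sigma> (vact (inv_into UNIV \<sigma>) x) = x" "vact (inv_into UNIV \<sigma>) (vact \<sigma> x) = x"
  by (simp_all add: vec_eq_iff aut_over_inv(2,3)[OF assms])

lemma pact_pt:
  assumes s: "\<sigma> \<in> aut_over E"
  shows "pact \<sigma> (pt x) = pt (vact \<sigma> x)"
proof (intro Set.set_eqI iffI)
  fix y assume "y \<in> pact \<sigma> (pt x)"
  then obtain c where "c \<noteq> 0" "y = vact \<sigma> (c *s x)" by (auto simp: pact_def pt_def)
  then show "y \<in> pt (vact \<sigma> x)"
    using vact_scale[OF s] aut_overD(10)[OF s] by (auto simp: pt_def)
next
  fix y assume "y \<in> pt (vact \<sigma> x)"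
  then obtain c where c: "c \<noteq> 0" "y = c *s vact \<sigma> x" by (auto simp: pt_def)
  let ?c = "inv_into UNIV \<sigma> c"
  have "\<sigma> ?c = c" by (rule aut_over_inv(3)[OF s])
  moreover from this have "?c \<noteq> 0" using c(1) aut_overD(5)[OF s] by auto
  ultimately have "y = vact \<sigma> (?c *s x)" "?c *s x \<in> pt x"
    unfolding c(2) vact_scale[OF s] by (auto simp: pt_def)
  then show "y \<in> pact \<sigma> (pt x)" unfolding pact_def by blast
qed

lemma pact_inv:
  assumes "\<sigma> \<in> aut_over E"
  shows "pact \<sigma> (pact (inv_into UNIV \<sigma>) P) = P" "pact (inv_into UNIV \<sigma>) (pact \<sigma> P) = P"
  by (simp_all add: pact_def image_image vact_inv[OF assms])

lemma pact_comp: "pact (\<lambda>x. \<sigma> (\<tau> x)) P = pact \<sigma> (pact \<tau> P)"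
  by (simp add: pact_def image_image vact_def)

lemma mp_eval_map_coeffs:
  assumes s: "\<sigma> \<in> aut_over E"
  shows "mp_eval (map_coeffs \<sigma> p) (vact \<sigma> x) = \<sigma> (mp_eval p x)"
proof -
  have prod: "\<sigma> (prod f I) = (\<Prod>i\<in>I. \<sigma> (f i))" for f :: "'b \<Rightarrow> 'a" and I
    by (induction I rule: infinite_finite_induct) (auto simp: aut_overD[OF s])
  have mon: "monom_at m (vact \<sigma> x) = \<sigma> (monom_at m x)" for m
    by (simp add: monom_at_def prod aut_overD(11)[OF s])
  have keys: "Poly_Mapping.keys (map_coeffs \<sigma> p) \<subseteq> Poly_Mapping.keys p"
    by (auto simp: in_keys_iff lookup_map_coeffs aut_overD(5)[OF s])
  show ?thesis
    by (subst mp_eval_superset[OF finite_keys keys])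
      (simp add: lookup_map_coeffs[of \<sigma>, OF aut_overD(5)[OF s]] mon mp_eval_eq[of p] aut_over_sum[OF s] aut_overD(3)[OF s])
qed

lemma lookup_Const_mult: "Poly_Mapping.lookup (Const c * p) m = c * Poly_Mapping.lookup p m"
proof -
  have "Const c * p = map_coeffs (\<lambda>z. c * z) p"
    unfolding Const_def map_coeffs_def by (rule mult_map_scale_conv_mult[symmetric])
  then show ?thesis by (simp add: lookup_map_coeffs)
qed

lemma map_coeffs_fixed:
  assumes "\<And>m. h (Poly_Mapping.lookup p m) = Poly_Mapping.lookup p m" "h 0 = 0"
  shows "map_coeffs h p = p"
  by (rule poly_mapping_eqI) (simp add: lookup_map_coeffs assms)

lemma mp_eval_vact:
  assumes s: "\<sigma> \<in> aut_over E" and p: "coeffs_in E p"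
  shows "mp_eval p (vact \<sigma> x) = \<sigma> (mp_eval p x)"
proof -
  have "map_coeffs \<sigma> p = p"
    by (rule map_coeffs_fixed) (use p aut_overD(4,5)[OF s] in \<open>auto simp: coeffs_in_def\<close>)
  then show ?thesis using mp_eval_map_coeffs[OF s, of p x] by simp
qed

lemma homogeneous_map_coeffs: "homogeneous e p \<Longrightarrow> h 0 = 0 \<Longrightarrow> homogeneous e (map_coeffs h p)"
  by (auto simp: homogeneous_def in_keys_iff lookup_map_coeffs)

lemma pact_proj_zeros:
  assumes s: "\<sigma> \<in> aut_over E" and S: "\<And>f. f \<in> S \<Longrightarrow> coeffs_in E f" and P: "P \<in> proj_zeros S"
  shows "pact \<sigma> P \<in> proj_zeros S"
proof -
  obtain x where x: "P = pt x" "x \<noteq> 0" "\<forall>f\<in>S. mp_eval f x = 0" using P by (auto simp: proj_zeros_def)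
  have "vact \<sigma> x \<noteq> 0" "\<forall>f\<in>S. mp_eval f (vact \<sigma> x) = 0"
    using x vact_eq_0[OF s] mp_eval_vact[OF s S] aut_overD(5)[OF s] by auto
  then show ?thesis unfolding x(1) pact_pt[OF s] proj_zeros_def by blast
qed

section \<open>Morphisms of projective sets\<close>

definition pmat :: "'a::field ^ 'n ^ 'n \<Rightarrow> ('a ^ 'n) set \<Rightarrow> ('a ^ 'n::finite) set" where
  "pmat M P = (*v) M ` P"

lemma pmat_pt: "pmat M (pt x) = pt (M *v x)"
  by (auto simp: pmat_def pt_def vector_scalar_commute image_iff) (metis vector_scalar_commute)

lemma proj_morphism_cong:
  assumes "proj_morphism L V W \<phi>" "\<And>P. P \<in> V \<Longrightarrow> \<phi>' P = \<phi> P"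
  shows "proj_morphism L V W \<phi>'"
  unfolding proj_morphism_def
proof (intro conjI allI impI)
  show "\<phi>' \<in> V \<rightarrow> W" using assms by (auto simp: proj_morphism_def)
  fix x assume x: "x \<noteq> 0 \<and> pt x \<in> V"
  with assms(1) obtain g e where g: "\<forall>j. homogeneous e (g j) \<and> coeffs_in L (g j)" "(\<chi> j. mp_eval (g j) x) \<noteq> 0"
    "\<forall>y. y \<noteq> 0 \<and> pt y \<in> V \<and> (\<chi> j. mp_eval (g j) y) \<noteq> 0 \<longrightarrow> \<phi> (pt y) = pt (\<chi> j. mp_eval (g j) y)"
    unfolding proj_morphism_def by metis
  show "\<exists>g e. (\<forall>j. homogeneous e (g j) \<and> coeffs_in L (g j)) \<and> (\<chi> j. mp_eval (g j) x) \<noteq> 0 \<and>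
      (\<forall>y. y \<noteq> 0 \<and> pt y \<in> V \<and> (\<chi> j. mp_eval (g j) y) \<noteq> 0 \<longrightarrow> \<phi>' (pt y) = pt (\<chi> j. mp_eval (g j) y))"
    by (intro exI[of _ g] exI[of _ e]) (use g assms(2) in auto)
qed

lemma proj_morphism_rep:
  fixes \<phi> :: "('K::alg_closed_field ^ 'm::finite) set \<Rightarrow> ('K ^ 'n::finite) set"
  assumes "proj_morphism L V W \<phi>" "x \<noteq> 0" "pt x \<in> V"
  obtains g :: "'n \<Rightarrow> ('m, 'K) mpoly" and e where "\<And>j. homogeneous e (g j)" "\<And>j. coeffs_in L (g j)"
    "tuple (\<lambda>j. mp_eval (g j)) x \<noteq> 0"
    "\<And>y. y \<noteq> 0 \<Longrightarrow> pt y \<in> V \<Longrightarrow> tuple (\<lambda>j. mp_eval (g j)) y \<noteq> 0 \<Longrightarrow> \<phi> (pt y) = pt (tuple (\<lambda>j. mp_eval (g j)) y)"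
proof -
  from assms obtain g :: "'n \<Rightarrow> ('m, 'K) mpoly" and e where g: "\<forall>j. homogeneous e (g j) \<and> coeffs_in L (g j)" "(\<chi> j. mp_eval (g j) x) \<noteq> 0"
    "\<forall>y. y \<noteq> 0 \<and> pt y \<in> V \<and> (\<chi> j. mp_eval (g j) y) \<noteq> 0 \<longrightarrow> \<phi> (pt y) = pt (\<chi> j. mp_eval (g j) y)"
    unfolding proj_morphism_def by metis
  show ?thesis by (rule that[of e g]) (use g in \<open>auto simp: tuple_def\<close>)
qed

lemma proj_morphismI:
  fixes \<phi> :: "('K::alg_closed_field ^ 'm::finite) set \<Rightarrow> ('K ^ 'n::finite) set"
  assumes "\<And>P. P \<in> V \<Longrightarrow> \<phi> P \<in> W"
    and "\<And>x. x \<noteq> 0 \<Longrightarrow> pt x \<in> V \<Longrightarrow> \<exists>e g. (\<forall>j. form L (int e) (g j)) \<and> tuple g x \<noteq> 0 \<and>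
      (\<forall>y. y \<noteq> 0 \<longrightarrow> pt y \<in> V \<longrightarrow> tuple g y \<noteq> 0 \<longrightarrow> \<phi> (pt y) = pt (tuple g y))"
  shows "proj_morphism L V W \<phi>"
  unfolding proj_morphism_def
proof (intro conjI allI impI)
  show "\<phi> \<in> V \<rightarrow> W" using assms(1) by blast
  fix x :: "'K ^ 'm" assume "x \<noteq> 0 \<and> pt x \<in> V"
  then obtain e g where g: "\<forall>j. form L (int e) (g j)" "tuple g x \<noteq> 0"
    "\<forall>y. y \<noteq> 0 \<longrightarrow> pt y \<in> V \<longrightarrow> tuple g y \<noteq> 0 \<longrightarrow> \<phi> (pt y) = pt (tuple g y)" using assms(2) by metis
  have "\<forall>j. \<exists>p. homogeneous e p \<and> coeffs_in L p \<and> g j = mp_eval p" using g(1) formE by metis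
  then obtain p where p: "\<And>j. homogeneous e (p j) \<and> coeffs_in L (p j) \<and> g j = mp_eval (p j)" by metis
  have t: "(\<chi> j. mp_eval (p j) y) = tuple g y" for y using p by (simp add: tuple_def)
  show "\<exists>g e. (\<forall>j. homogeneous e (g j) \<and> coeffs_in L (g j)) \<and> (\<chi> j. mp_eval (g j) x) \<noteq> 0 \<and>
      (\<forall>y. y \<noteq> 0 \<and> pt y \<in> V \<and> (\<chi> j. mp_eval (g j) y) \<noteq> 0 \<longrightarrow> \<phi> (pt y) = pt (\<chi> j. mp_eval (g j) y))"
    by (intro exI[of _ p] exI[of _ e]) (use p g t in auto)
qed

lemma proj_morphism_comp:
  fixes \<phi> :: "('K::alg_closed_field ^ 'l::finite) set \<Rightarrow> ('K ^ 'm::finite) set"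
    and \<psi> :: "('K ^ 'm) set \<Rightarrow> ('K ^ 'n::finite) set"
  assumes L: "is_subring L" and \<phi>: "proj_morphism L V W \<phi>" and \<psi>: "proj_morphism L W U \<psi>"
  shows "proj_morphism L V U (\<lambda>P. \<psi> (\<phi> P))"
proof (rule proj_morphismI)
  have \<phi>W: "\<phi> P \<in> W" if "P \<in> V" for P using \<phi> that by (auto simp: proj_morphism_def)
  show "\<psi> (\<phi> P) \<in> U" if "P \<in> V" for P using \<phi>W[OF that] \<psi> by (auto simp: proj_morphism_def)
  fix x :: "'K ^ 'l" assume x: "x \<noteq> 0" "pt x \<in> V"
  obtain g :: "'m \<Rightarrow> ('l, 'K) mpoly" and e where g: "\<And>j. homogeneous e (g j)" "\<And>j. coeffs_in L (g j)"
    "tuple (\<lambda>j. mp_eval (g j)) x \<noteq> 0"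
    "\<And>y. y \<noteq> 0 \<Longrightarrow> pt y \<in> V \<Longrightarrow> tuple (\<lambda>j. mp_eval (g j)) y \<noteq> 0 \<Longrightarrow> \<phi> (pt y) = pt (tuple (\<lambda>j. mp_eval (g j)) y)"
    by (rule proj_morphism_rep[OF \<phi> x]) (rule that)
  let ?g = "tuple (\<lambda>j. mp_eval (g j))"
  have gx: "pt (?g x) \<in> W" using g(4)[OF x g(3)] \<phi>W[OF x(2)] by simp
  obtain h :: "'n \<Rightarrow> ('m, 'K) mpoly" and e' where h: "\<And>j. homogeneous e' (h j)" "\<And>j. coeffs_in L (h j)"
    "tuple (\<lambda>j. mp_eval (h j)) (?g x) \<noteq> 0"
    "\<And>y. y \<noteq> 0 \<Longrightarrow> pt y \<in> W \<Longrightarrow> tuple (\<lambda>j. mp_eval (h j)) y \<noteq> 0 \<Longrightarrow> \<psi> (pt y) = pt (tuple (\<lambda>j. mp_eval (h j)) y)"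
    by (rule proj_morphism_rep[OF \<psi> g(3) gx]) (rule that)
  obtain k where k: "mp_eval (g k) x \<noteq> 0" using g(3) by (auto simp: vec_eq_iff)
  \<comment> \<open>The additional factor \<open>mp_eval (g k) y\<close> makes the composite tuple
    vanish where the inner one does; constant forms \<open>h j\<close> would not do so by
    themselves.\<close>
  define f where "f = (\<lambda>j y. mp_eval (g k) y * mp_eval (h j) (?g y))"
  have ft: "tuple f y = mp_eval (g k) y *s tuple (\<lambda>j. mp_eval (h j)) (?g y)" for y
    by (simp add: vec_eq_iff f_def)
  have "form L (int (e + e' * e)) (f j)" for j
    unfolding f_def tuple_def
    using form_mult[OF L form_mp_eval[OF g(1,2)] form_comp[OF L form_mp_eval[OF h(1,2)] form_mp_eval[OF g(1,2)]]] by simp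
  moreover have "tuple f x \<noteq> 0" using k h(3) by (auto simp: ft vec_eq_iff)
  moreover have "\<psi> (\<phi> (pt y)) = pt (tuple f y)" if y: "y \<noteq> 0" "pt y \<in> V" "tuple f y \<noteq> 0" for y
  proof -
    have k0: "mp_eval (g k) y \<noteq> 0" and hy: "tuple (\<lambda>j. mp_eval (h j)) (?g y) \<noteq> 0"
      using y(3) unfolding ft by (auto simp: vec_eq_iff)
    have gy: "?g y \<noteq> 0" using k0 by (auto simp: vec_eq_iff)
    have 1: "\<phi> (pt y) = pt (?g y)" by (rule g(4)[OF y(1,2) gy])
    then have "pt (?g y) \<in> W" using \<phi>W[OF y(2)] by simp
    from h(4)[OF gy this hy] show ?thesis unfolding 1 ft using par_scale[OF k0] pt_eq_iff par_sym by metis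
  qed
  ultimately show "\<exists>e g. (\<forall>j. form L (int e) (g j)) \<and> tuple g x \<noteq> 0 \<and>
      (\<forall>y. y \<noteq> 0 \<longrightarrow> pt y \<in> V \<longrightarrow> tuple g y \<noteq> 0 \<longrightarrow> \<psi> (\<phi> (pt y)) = pt (tuple g y))" by blast
qed

lemma proj_morphism_conj:
  fixes \<phi> :: "('K::alg_closed_field ^ 'm::finite) set \<Rightarrow> ('K ^ 'n::finite) set"
  assumes s: "\<sigma> \<in> aut_over E" and L: "\<And>x. x \<in> L \<Longrightarrow> \<sigma> x \<in> L"
    and V: "\<And>P. P \<in> V \<Longrightarrow> pact (inv_into UNIV \<sigma>) P \<in> V" and W: "\<And>P. P \<in> W \<Longrightarrow> pact \<sigma> P \<in> W"
    and \<phi>: "proj_morphism L V W \<phi>"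
  shows "proj_morphism L V W (\<lambda>P. pact \<sigma> (\<phi> (pact (inv_into UNIV \<sigma>) P)))"
proof (rule proj_morphismI)
  let ?s = "inv_into UNIV \<sigma>"
  have si: "?s \<in> aut_over E" by (rule aut_over_inv(1)[OF s])
  show "pact \<sigma> (\<phi> (pact ?s P)) \<in> W" if "P \<in> V" for P using V[OF that] W \<phi> by (auto simp: proj_morphism_def)
  fix x :: "'K ^ 'm" assume x: "x \<noteq> 0" "pt x \<in> V"
  have x': "vact ?s x \<noteq> 0" "pt (vact ?s x) \<in> V" using vact_eq_0[OF si, of x] x V[OF x(2)] unfolding pact_pt[OF si] by auto
  obtain g :: "'n \<Rightarrow> ('m, 'K) mpoly" and e where g: "\<And>j. homogeneous e (g j)" "\<And>j. coeffs_in L (g j)"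
    "tuple (\<lambda>j. mp_eval (g j)) (vact ?s x) \<noteq> 0"
    "\<And>y. y \<noteq> 0 \<Longrightarrow> pt y \<in> V \<Longrightarrow> tuple (\<lambda>j. mp_eval (g j)) y \<noteq> 0 \<Longrightarrow> \<phi> (pt y) = pt (tuple (\<lambda>j. mp_eval (g j)) y)"
    by (rule proj_morphism_rep[OF \<phi> x']) (rule that)
  define f where "f = (\<lambda>j. mp_eval (map_coeffs \<sigma> (g j)))"
  have ft: "tuple f y = vact \<sigma> (tuple (\<lambda>j. mp_eval (g j)) (vact ?s y))" for y
    using mp_eval_map_coeffs[OF s, of "g _" "vact ?s y"] by (simp add: vec_eq_iff f_def vact_inv[OF s])
  have "form L (int e) (f j)" for j
    unfolding f_def
    by (rule form_mp_eval[OF homogeneous_map_coeffs[OF g(1)]])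
      (use g(2)[of j] L aut_overD(5)[OF s] in \<open>auto simp: coeffs_in_def lookup_map_coeffs\<close>)
  moreover have "tuple f x \<noteq> 0" unfolding ft using g(3) vact_eq_0[OF s] by blast
  moreover have "pact \<sigma> (\<phi> (pact ?s (pt y))) = pt (tuple f y)" if y: "y \<noteq> 0" "pt y \<in> V" "tuple f y \<noteq> 0" for y
  proof -
    have y': "vact ?s y \<noteq> 0" "pt (vact ?s y) \<in> V" using vact_eq_0[OF si, of y] y V[OF y(2)] unfolding pact_pt[OF si] by auto
    have "tuple (\<lambda>j. mp_eval (g j)) (vact ?s y) \<noteq> 0" using y(3) vact_eq_0[OF s] unfolding ft by blast
    from g(4)[OF y' this] show ?thesis unfolding pact_pt[OF si] ft by (simp add: pact_pt[OF s])
  qed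
  ultimately show "\<exists>e g. (\<forall>j. form L (int e) (g j)) \<and> tuple g x \<noteq> 0 \<and>
      (\<forall>y. y \<noteq> 0 \<longrightarrow> pt y \<in> V \<longrightarrow> tuple g y \<noteq> 0 \<longrightarrow> pact \<sigma> (\<phi> (pact ?s (pt y))) = pt (tuple g y))" by blast
qed

lemma proj_morphism_pmat:
  fixes M :: "'K::alg_closed_field ^ 'n::finite ^ 'n"
  assumes L: "is_subring L" and M: "\<And>i j. M $ i $ j \<in> L" and inj: "\<And>x. M *v x = 0 \<Longrightarrow> x = 0"
    and VW: "\<And>P. P \<in> V \<Longrightarrow> pmat M P \<in> W"
  shows "proj_morphism L V W (pmat M)"
proof (rule proj_morphismI[OF VW])
  fix x :: "'K ^ 'n" assume x: "x \<noteq> 0" "pt x \<in> V"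
  let ?g = "\<lambda>j y. (M *v y) $ j"
  have t: "tuple ?g y = M *v y" for y by (simp add: vec_eq_iff)
  have "form L (int 1) (?g j)" for j
    unfolding matrix_vector_mult_def by (simp add: form_linear[OF L M])
  moreover have "tuple ?g x \<noteq> 0" unfolding t using inj x(1) by blast
  ultimately show "\<exists>e g. (\<forall>j. form L (int e) (g j)) \<and> tuple g x \<noteq> 0 \<and>
      (\<forall>y. y \<noteq> 0 \<longrightarrow> pt y \<in> V \<longrightarrow> tuple g y \<noteq> 0 \<longrightarrow> pmat M (pt y) = pt (tuple g y))"
    using t pmat_pt by metis
qed

context alg_extension
begin

text \<open>Traces of the local equations of \<open>\<phi>\<close> are equations over \<open>E\<close>; Dedekind independence keeps them nonzero
  at a given point.\<close>

lemma proj_morphism_descent: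
  fixes \<phi> :: "('a ^ 'm::finite) set \<Rightarrow> ('a ^ 'n::finite) set"
  assumes \<phi>: "proj_morphism {x. separable x} V W \<phi>"
    and V: "\<And>\<sigma> P. \<sigma> \<in> aut_over E \<Longrightarrow> P \<in> V \<Longrightarrow> pact \<sigma> P \<in> V"
    and comm: "\<And>\<sigma> P. \<sigma> \<in> aut_over E \<Longrightarrow> P \<in> V \<Longrightarrow> \<phi> (pact \<sigma> P) = pact \<sigma> (\<phi> P)"
  shows "proj_morphism E V W \<phi>"
proof (rule proj_morphismI)
  show "\<phi> P \<in> W" if "P \<in> V" for P using \<phi> that by (auto simp: proj_morphism_def)
  fix x :: "'a ^ 'm" assume x: "x \<noteq> 0" "pt x \<in> V"
  obtain g :: "'n \<Rightarrow> ('m, 'a) mpoly" and e where g: "\<And>j. homogeneous e (g j)" "\<And>j. coeffs_in {x. separable x} (g j)"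
    "tuple (\<lambda>j. mp_eval (g j)) x \<noteq> 0"
    "\<And>y. y \<noteq> 0 \<Longrightarrow> pt y \<in> V \<Longrightarrow> tuple (\<lambda>j. mp_eval (g j)) y \<noteq> 0 \<Longrightarrow> \<phi> (pt y) = pt (tuple (\<lambda>j. mp_eval (g j)) y)"
    by (rule proj_morphism_rep[OF \<phi> x]) (rule that)
  define T where "T = (\<Union>j. Poly_Mapping.lookup (g j) ` Poly_Mapping.keys (g j))"
  have T: "finite T" "\<And>c. c \<in> T \<Longrightarrow> separable c" using g(2) by (auto simp: T_def coeffs_in_def)
  obtain S where S: "agree_reps T S" "(\<lambda>x. x) \<in> S" by (rule agree_reps_ex[OF T(1)])
  note Sa = agree_repsD(2)[OF S(1)]
  obtain k where k: "mp_eval (g k) x \<noteq> 0" using g(3) by (auto simp: vec_eq_iff)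
  have "map_coeffs (\<lambda>x. x) (g k) = g k" by (rule map_coeffs_fixed) auto
  then have k': "mp_eval (map_coeffs (\<lambda>x. x) (g k)) x \<noteq> 0" using k by simp
  obtain a where a: "a \<in> fixed_sep T" "(\<Sum>\<rho>\<in>S. mp_eval (map_coeffs \<rho> (g k)) x * \<rho> a) \<noteq> 0"
    by (rule trace_nonzero[OF S(1) _ S(2), of "\<lambda>\<rho>. mp_eval (map_coeffs \<rho> (g k)) x"]) (erule T(2), rule k', rule that)
  define G where "G = (\<lambda>j. \<Sum>\<rho>\<in>S. Const (\<rho> a) * map_coeffs \<rho> (g j))"
  have lkG: "Poly_Mapping.lookup (G j) m = (\<Sum>\<rho>\<in>S. \<rho> a * \<rho> (Poly_Mapping.lookup (g j) m))" for j m
    unfolding G_def lookup_sum lookup_Const_mult by (rule sum.cong) (auto simp: lookup_map_coeffs aut_overD(5)[OF Sa])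
  note sub = is_subfieldD(1)[OF separable_subfield]
  have GE: "coeffs_in E (G j)" for j
    unfolding coeffs_in_def
  proof
    fix m
    let ?c = "Poly_Mapping.lookup (g j) m"
    have sc: "separable ?c" using g(2) by (simp add: coeffs_in_def)
    have "separable (\<Sum>\<rho>\<in>S. \<rho> a * \<rho> ?c)"
    proof -
      have "(\<Sum>\<rho>\<in>S. \<rho> a * \<rho> ?c) \<in> {x. separable x}"
        by (intro is_subring_sum[OF sub] is_subringD(4)[OF sub])
          (use a(1) sc separable_conj Sa in \<open>auto simp: fixed_sep_def\<close>)
      then show ?thesis by simp
    qed
    moreover have "\<tau> (\<Sum>\<rho>\<in>S. \<rho> a * \<rho> ?c) = (\<Sum>\<rho>\<in>S. \<rho> a * \<rho> ?c)" if \<tau>: "\<tau> \<in> aut_over E" for \<tau>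
    proof -
      have "\<tau> (\<Sum>\<rho>\<in>S. \<rho> a * \<rho> ?c) = (\<Sum>\<rho>\<in>S. \<tau> (\<rho> a) * \<tau> (\<rho> ?c))"
        by (simp add: aut_over_sum[OF \<tau>] aut_overD(3)[OF \<tau>])
      also have "\<dots> = (\<Sum>\<rho>\<in>S. \<rho> a * \<rho> ?c)"
      proof (rule sum_agree_reps_translate[OF S(1) \<tau>, of "\<lambda>\<sigma>. \<sigma> a * \<sigma> ?c"])
        fix \<sigma> \<sigma>' assume s: "\<sigma> \<in> aut_over E" "\<sigma>' \<in> aut_over E" "\<And>x. x \<in> T \<Longrightarrow> \<sigma> x = \<sigma>' x"
        have "\<sigma> a = \<sigma>' a" by (rule fixed_sep_agree[OF a(1) s])
        moreover have "\<sigma> ?c = \<sigma>' ?c"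
        proof (cases "?c = 0")
          case True
          then show ?thesis using aut_overD(5)[OF s(1)] aut_overD(5)[OF s(2)] by simp
        next
          case False
          then have "m \<in> Poly_Mapping.keys (g j)" by (simp add: in_keys_iff)
          then have "?c \<in> T" unfolding T_def by blast
          then show ?thesis by (rule s(3))
        qed
        ultimately show "\<sigma> a * \<sigma> ?c = \<sigma>' a * \<sigma>' ?c" by simp
      qed
      finally show ?thesis .
    qed
    ultimately show "Poly_Mapping.lookup (G j) m \<in> E" unfolding lkG by (rule separable_fixed)
  qed
  have Gh: "homogeneous e (G j)" for j
    unfolding homogeneous_def
  proof
    fix m assume "m \<in> Poly_Mapping.keys (G j)"
    then have "(\<Sum>\<rho>\<in>S. \<rho> a * \<rho> (Poly_Mapping.lookup (g j) m)) \<noteq> 0" by (simp add: in_keys_iff lkG)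
    then have "Poly_Mapping.lookup (g j) m \<noteq> 0" using aut_overD(5)[OF Sa] by (metis (no_types, lifting) mult_zero_right sum.neutral)
    then show "(\<Sum>i\<in>UNIV. Poly_Mapping.lookup m i) = e" using g(1)[of j] by (auto simp: homogeneous_def in_keys_iff)
  qed
  let ?G = "tuple (\<lambda>j. mp_eval (G j))"
  have Gev: "mp_eval (G j) y = (\<Sum>\<rho>\<in>S. mp_eval (map_coeffs \<rho> (g j)) y * \<rho> a)" for j y
    by (simp add: G_def mult.commute)
  have "form E (int e) (mp_eval (G j))" for j by (rule form_mp_eval[OF Gh GE])
  moreover have "?G x \<noteq> 0" using a(2) Gev[of k x] by (metis tuple_nth zero_index)
  moreover have "\<phi> (pt y) = pt (?G y)" if y: "y \<noteq> 0" "pt y \<in> V" "?G y \<noteq> 0" for y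
  proof -
    let ?r = "\<lambda>\<rho>. tuple (\<lambda>j. mp_eval (map_coeffs \<rho> (g j))) y"
    \<comment> \<open>Each conjugate tuple represents \<open>\<phi>\<close> as well, because
      \<open>\<phi>\<close> commutes with the action. Hence the nonzero ones are all proportional at
      \<open>y\<close>, and a nonzero weighted sum of them represents the same point.\<close>
    have r: "pt (?r \<rho>) = \<phi> (pt y)" if \<rho>: "\<rho> \<in> S" and nz: "?r \<rho> \<noteq> 0" for \<rho>
    proof -
      let ?s = "inv_into UNIV \<rho>"
      note ra = Sa[OF \<rho>] and si = aut_over_inv(1)[OF Sa[OF \<rho>]]
      define y' where "y' = vact ?s y"
      have yy: "vact \<rho> y' = y" by (simp add: y'_def vact_inv[OF ra])
      have y': "y' \<noteq> 0" "pt y' \<in> V" using vact_eq_0[OF si, of y] y V[OF si y(2)] unfolding pact_pt[OF si] y'_def by auto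
      have eq: "?r \<rho> = vact \<rho> (tuple (\<lambda>j. mp_eval (g j)) y')"
        using mp_eval_map_coeffs[OF ra, of "g _" y'] by (simp add: vec_eq_iff yy)
      then have "tuple (\<lambda>j. mp_eval (g j)) y' \<noteq> 0" using nz vact_eq_0[OF ra] by metis
      then have "\<phi> (pt y') = pt (tuple (\<lambda>j. mp_eval (g j)) y')" by (rule g(4)[OF y'])
      then have "pt (?r \<rho>) = pact \<rho> (\<phi> (pt y'))" by (simp add: eq pact_pt[OF ra])
      also have "\<dots> = \<phi> (pt y)" using comm[OF ra y'(2)] by (simp add: pact_pt[OF ra] yy)
      finally show ?thesis .
    qed
    have Gsum: "?G y = (\<Sum>\<rho>\<in>S. \<rho> a *s ?r \<rho>)" by (simp add: vec_eq_iff Gev mult.commute)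
    have "\<exists>\<rho>0\<in>S. ?r \<rho>0 \<noteq> 0"
    proof (rule ccontr)
      assume "\<not> ?thesis"
      then have "(\<Sum>\<rho>\<in>S. \<rho> a *s ?r \<rho>) = 0" by (intro sum.neutral) simp
      then show False using y(3) Gsum by simp
    qed
    then obtain \<rho>0 where \<rho>0: "\<rho>0 \<in> S" "?r \<rho>0 \<noteq> 0" by blast
    define z where "z = ?r \<rho>0"
    have "\<exists>c. ?r \<rho> = c *s z" if "\<rho> \<in> S" for \<rho>
    proof (cases "?r \<rho> = 0")
      case True
      then show ?thesis by (intro exI[of _ 0]) simp
    next
      case False
      then have "par (?r \<rho>) z" using r[OF that] r[OF \<rho>0] unfolding z_def pt_eq_iff[symmetric] by simp
      then show ?thesis unfolding par_def by blast
    qed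
    then obtain c where c: "\<And>\<rho>. \<rho> \<in> S \<Longrightarrow> ?r \<rho> = c \<rho> *s z" by metis
    have "?G y = (\<Sum>\<rho>\<in>S. \<rho> a * c \<rho>) *s z"
      unfolding Gsum by (simp add: c vec_eq_iff sum_distrib_right mult.assoc)
    moreover from this have "(\<Sum>\<rho>\<in>S. \<rho> a * c \<rho>) \<noteq> 0" using y(3) by (metis vector_smult_lzero)
    ultimately have "par (?G y) z" unfolding par_def by blast
    then show ?thesis using r[OF \<rho>0] unfolding z_def pt_eq_iff[symmetric] by simp
  qed
  ultimately show "\<exists>e g. (\<forall>j. form E (int e) (g j)) \<and> tuple g x \<noteq> 0 \<and>
      (\<forall>y. y \<noteq> 0 \<longrightarrow> pt y \<in> V \<longrightarrow> tuple g y \<noteq> 0 \<longrightarrow> \<phi> (pt y) = pt (tuple g y))"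
    by (intro exI[of _ e] exI[of _ "\<lambda>j. mp_eval (G j)"]) blast
qed

end


section \<open>The projective linear group over a subfield\<close>

lemma det_in:
  fixes A :: "'a::field ^ 3 ^ 3"
  assumes L: "is_subring L" and A: "\<And>i j. A $ i $ j \<in> L"
  shows "det A \<in> L"
  unfolding det_3 by (intro is_subringD(3,4,6)[OF L] A)

lemma matrix_inv_in:
  fixes A :: "'a::field ^ 3 ^ 3"
  assumes L: "is_subfield L" and A: "\<And>i j. A $ i $ j \<in> L" "det A \<noteq> 0"
  obtains B :: "'a ^ 3 ^ 3" where "\<And>i j. B $ i $ j \<in> L" "A ** B = mat 1" "B ** A = mat 1"
proof -
  from A(2) obtain B where B: "A ** B = mat 1" "B ** A = mat 1"
    unfolding invertible_det_nz[symmetric] invertible_def by blast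
  note R = is_subfieldD(1)[OF L]
  have "B $ i $ j \<in> L" for i j
  proof -
    have "A *v column j B = (\<chi> i. if i = j then 1 else 0)"
      using B(1) by (simp add: vec_eq_iff matrix_vector_mult_def column_def matrix_matrix_mult_def mat_def)
    then have e: "column j B = (\<chi> k. det (\<chi> i l. if l = k then (\<chi> i. if i = j then 1 else 0) $ i else A $ i $ l) / det A)"
      by (rule iffD1[OF cramer[OF A(2)]])
    have "B $ i $ j = column j B $ i" by (simp add: column_def)
    also have "\<dots> = det (\<chi> k l. if l = i then if k = j then 1 else 0 else A $ k $ l) / det A"
      unfolding e vec_lambda_beta ..
    also have "\<dots> \<in> L"
      by (intro is_subfieldD(3)[OF L] det_in[OF R] A(1)) (simp add: A(1) is_subringD(1,2)[OF R])
    finally show ?thesis .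
  qed
  then show ?thesis using that B by blast
qed

lemma mat_mult_nth: "(mat c ** A) $ i $ j = c * A $ i $ (j :: 'n::finite)" for A :: "'a::comm_ring_1 ^ 'n ^ 'n"
  by (simp add: matrix_matrix_mult_def mat_def if_distrib[of "\<lambda>x. x * _"] cong: if_cong)

lemma mult_mat_nth: "(A ** mat c) $ i $ j = c * A $ i $ (j :: 'n::finite)" for A :: "'a::comm_ring_1 ^ 'n ^ 'n"
  by (simp add: matrix_matrix_mult_def mat_def if_distrib[of "\<lambda>x. _ * x"] mult.commute cong: if_cong)

lemma mat_central: "mat c ** A = A ** mat c" for A :: "'a::comm_ring_1 ^ 'n ^ 'n::finite"
  by (simp add: vec_eq_iff mat_mult_nth mult_mat_nth)

lemma mat_mult_mat: "mat c ** mat d = (mat (c * d) :: 'a::comm_ring_1 ^ 'n ^ 'n::finite)"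
  by (simp add: vec_eq_iff mat_mult_nth) (simp add: mat_def)

lemma det_mat_ne_0: "c \<noteq> 0 \<Longrightarrow> det (mat c :: 'a::field ^ 3 ^ 3) \<noteq> 0"
  by (simp add: det_3 mat_def)

context
  fixes L :: "'a::field set"
  assumes L: "is_subfield L"
begin

private lemmas R = is_subringD[OF is_subfieldD(1)[OF L]]

lemma GL3_group: "group (GL3 L)"
proof (rule groupI)
  show "x \<otimes>\<^bsub>GL3 L\<^esub> y \<in> carrier (GL3 L)" if "x \<in> carrier (GL3 L)" "y \<in> carrier (GL3 L)" for x y
  proof -
    have "(x ** y) $ i $ j \<in> L" for i j
      unfolding matrix_matrix_mult_def vec_lambda_beta
      by (rule is_subring_sum[OF is_subfieldD(1)[OF L]], rule R(4)) (use that in \<open>auto simp: GL3_def\<close>)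
    then show ?thesis using that by (auto simp: GL3_def det_mul)
  qed
  show "\<one>\<^bsub>GL3 L\<^esub> \<in> carrier (GL3 L)" 
    using R(1,2) det_mat_ne_0[of "1 :: 'a"] unfolding GL3_def by (simp add: mat_def)
  show "x \<otimes>\<^bsub>GL3 L\<^esub> y \<otimes>\<^bsub>GL3 L\<^esub> z = x \<otimes>\<^bsub>GL3 L\<^esub> (y \<otimes>\<^bsub>GL3 L\<^esub> z)" for x y z
    by (simp add: GL3_def matrix_mul_assoc)
  show "\<one>\<^bsub>GL3 L\<^esub> \<otimes>\<^bsub>GL3 L\<^esub> x = x" for x by (simp add: GL3_def)
  fix A assume "A \<in> carrier (GL3 L)"
  then have A: "\<And>i j. A $ i $ j \<in> L" "det A \<noteq> 0" by (auto simp: GL3_def)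
  obtain B :: "'a ^ 3 ^ 3" where B: "\<And>i j. B $ i $ j \<in> L" "A ** B = mat 1" "B ** A = mat 1"
    by (rule matrix_inv_in[OF L A]) (rule that)
  have "det B \<noteq> 0" using B(3) det_mul[of B A] by auto
  then show "\<exists>y\<in>carrier (GL3 L). y \<otimes>\<^bsub>GL3 L\<^esub> A = \<one>\<^bsub>GL3 L\<^esub>" using B by (auto simp: GL3_def)
qed

lemma scalars3_normal: "scalars3 L \<lhd> GL3 L"
proof -
  interpret GL: group "GL3 L" by (rule GL3_group)
  have c: "mat c \<in> carrier (GL3 L)" if "c \<in> L" "c \<noteq> 0" for c
    using that R(1) det_mat_ne_0[OF that(2)] by (auto simp: GL3_def mat_def)
  have sub: "subgroup (scalars3 L) (GL3 L)"
  proof (rule GL.subgroupI)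
    show "scalars3 L \<subseteq> carrier (GL3 L)" using c by (auto simp: scalars3_def)
    show "scalars3 L \<noteq> {}" using R(2) by (auto simp: scalars3_def)
    show "a \<otimes>\<^bsub>GL3 L\<^esub> b \<in> scalars3 L" if "a \<in> scalars3 L" "b \<in> scalars3 L" for a b
      using that R(4) by (auto simp: scalars3_def GL3_def mat_mult_mat intro: exI[of _ "_ * _"])
    fix a assume "a \<in> scalars3 L"
    then obtain c' where c': "a = mat c'" "c' \<in> L" "c' \<noteq> 0" by (auto simp: scalars3_def)
    have "inv\<^bsub>GL3 L\<^esub> a = mat (inverse c')"
      by (rule GL.inv_equality) (use c' c is_subfieldD(2)[OF L] in \<open>auto simp: GL3_def mat_mult_mat\<close>)
    then show "inv\<^bsub>GL3 L\<^esub> a \<in> scalars3 L" using c' is_subfieldD(2)[OF L] by (auto simp: scalars3_def)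
  qed
  show ?thesis
  proof (rule GL.normalI[OF sub], rule ballI)
    fix x
    show "scalars3 L #>\<^bsub>GL3 L\<^esub> x = x <#\<^bsub>GL3 L\<^esub> scalars3 L"
      unfolding r_coset_def l_coset_def by (auto simp: scalars3_def GL3_def mat_central)
  qed
qed

lemma PGL3_group: "group (PGL3 L)"
  unfolding PGL3_def by (rule normal.factorgroup_is_group[OF scalars3_normal])

lemma pgl_class_mult:
  assumes "A \<in> carrier (GL3 L)" "B \<in> carrier (GL3 L)"
  shows "pgl_class L A \<otimes>\<^bsub>PGL3 L\<^esub> pgl_class L B = pgl_class L (A ** B)"
  using normal.rcos_sum[OF scalars3_normal assms] unfolding PGL3_def pgl_class_def by (simp add: GL3_def)

lemma pgl_class_carrier: "A \<in> carrier (GL3 L) \<Longrightarrow> pgl_class L A \<in> carrier (PGL3 L)"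
  by (simp add: PGL3_def carrier_FactGroup pgl_class_def)

lemma PGL3_cases:
  assumes "g \<in> carrier (PGL3 L)"
  obtains A where "A \<in> carrier (GL3 L)" "g = pgl_class L A"
  using assms by (auto simp: PGL3_def carrier_FactGroup pgl_class_def)

lemma PGL3_one: "\<one>\<^bsub>PGL3 L\<^esub> = pgl_class L (mat 1)"
proof -
  have "mat 1 = \<one>\<^bsub>GL3 L\<^esub>" by (simp add: GL3_def)
  then show ?thesis
    using group.coset_mult_one[OF GL3_group] normal_imp_subgroup[OF scalars3_normal] subgroup.subset
    unfolding PGL3_def pgl_class_def by (metis one_FactGroup)
qed

lemma mem_pgl_class: "B \<in> pgl_class L A \<longleftrightarrow> (\<exists>c\<in>L. c \<noteq> 0 \<and> B = mat c ** A)"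
  by (auto simp: pgl_class_def r_coset_def scalars3_def GL3_def)

lemma pgl_class_self: "A \<in> pgl_class L A"
  unfolding mem_pgl_class by (rule bexI[OF _ R(2)]) simp

lemma pgl_class_eqD: "pgl_class L B = pgl_class L A \<Longrightarrow> \<exists>c\<in>L. c \<noteq> 0 \<and> B = mat c ** A"
  using pgl_class_self[of B] unfolding mem_pgl_class[symmetric] by simp

end

text \<open>The first entry is normalised to 1, so that a class in PGL_3 contains at most one such
  matrix (\<open>pgl_class_dg_eqD\<close>); relations between classes thereby become relations
  between the entries.\<close>

definition dg :: "'a::zero_neq_one \<Rightarrow> 'a \<Rightarrow> 'a ^ 3 ^ 3" where
  "dg u v = diag (vector [1, u, v])"

lemma dg_nth: "dg u v $ i $ j = (if i = j then if i = 1 then 1 else if i = 2 then u else v else 0)"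
  using exhaust_3[of i] by (auto simp: dg_def diag_def vector_3)

lemma dg_mult: "dg u v ** dg u' v' = dg (u * u') (v * v' :: 'a::comm_ring_1)"
  by (simp add: vec_eq_iff matrix_matrix_mult_def sum_3 dg_nth forall_3)

lemma dg_1: "dg 1 1 = mat 1"
  by (simp add: vec_eq_iff dg_nth mat_def)

lemma det_dg: "det (dg u v) = u * (v :: 'a::comm_ring_1)"
  by (simp add: det_3 dg_nth)

lemma dg_GL3:
  assumes "is_subfield L" "u \<in> L" "v \<in> L" "u \<noteq> 0" "v \<noteq> (0 :: 'a::field)"
  shows "dg u v \<in> carrier (GL3 L)"
  using assms is_subringD(1,2)[OF is_subfieldD(1)[OF assms(1)]] by (auto simp: GL3_def det_dg dg_nth)

lemma dg_mult_vec: "(dg u v *v y) $ i = (if i = 1 then 1 else if i = 2 then u else v) * (y $ i :: 'a::comm_ring_1)"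
  using exhaust_3[of i] by (auto simp: matrix_vector_mult_def sum_3 dg_nth)

lemma pgl_class_dg_eqD:
  assumes L: "is_subfield L" and "pgl_class L (dg u v) = pgl_class L (dg u' v')"
  shows "u = u' \<and> v = (v' :: 'a::field)"
proof -
  obtain c where c: "dg u v = mat c ** dg u' v'" using pgl_class_eqD[OF assms] by blast
  have e: "dg u v $ i $ i = c * dg u' v' $ i $ i" for i unfolding c mat_mult_nth ..
  show ?thesis using e[of 1] e[of 2] e[of 3] by (simp add: dg_nth)
qed

text \<open>The classes of \<open>dg u v\<close> with n-th roots of unity \<open>u\<close>,
  \<open>v\<close> in \<open>L\<close> are closed under products and inverses, so they contain the
  generated group.\<close>

lemma generate_dg:
  fixes \<zeta> :: "'a::field"
  assumes L: "is_subfield L" and z: "\<zeta> \<in> L" "\<zeta> ^ n = 1" "n > 0"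
    and g: "g \<in> generate (PGL3 L) {pgl_class L (dg (\<zeta> ^ a) (\<zeta> ^ b))}"
  obtains u v where "g = pgl_class L (dg u v)" "u \<in> L" "v \<in> L" "u ^ n = 1" "v ^ n = 1"
proof -
  interpret PGL: group "PGL3 L" by (rule PGL3_group[OF L])
  note R = is_subringD[OF is_subfieldD(1)[OF L]] is_subring_power[OF is_subfieldD(1)[OF L]]
  define U where "U = {u \<in> L. u ^ n = 1}"
  have U0: "u \<noteq> 0" if "u \<in> U" for u using that z(3) by (auto simp: U_def power_0_left)
  have U: "dg u v \<in> carrier (GL3 L)" if "u \<in> U" "v \<in> U" for u v
    by (rule dg_GL3[OF L _ _ U0[OF that(1)] U0[OF that(2)]]) (use that in \<open>auto simp: U_def\<close>)
  have Um: "u * v \<in> U" if "u \<in> U" "v \<in> U" for u v using that R(4) by (auto simp: U_def power_mult_distrib)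
  have Ui: "inverse u \<in> U" if "u \<in> U" for u using that is_subfieldD(2)[OF L] by (auto simp: U_def power_inverse)
  have U1: "1 \<in> U" using R(2) by (simp add: U_def)
  have Uz: "\<zeta> ^ k \<in> U" for k
    using R(7)[OF z(1)] z(2) by (simp add: U_def power_mult[symmetric] mult.commute[of k]) (simp add: power_mult)
  have "\<exists>u\<in>U. \<exists>v\<in>U. g = pgl_class L (dg u v)"
    using g
  proof (induction rule: generate.induct)
    case one
    show ?case using U1 by (intro bexI[of _ 1]) (simp_all add: PGL3_one[OF L] dg_1)
  next
    case (incl h)
    then show ?case using Uz by blast
  next
    case (inv h)
    let ?u = "\<zeta> ^ a" and ?v = "\<zeta> ^ b"
    have "inv\<^bsub>PGL3 L\<^esub> (pgl_class L (dg ?u ?v)) = pgl_class L (dg (inverse ?u) (inverse ?v))"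
      by (rule PGL.inv_equality)
        (use U0[OF Uz] in \<open>simp_all add: pgl_class_mult[OF L] pgl_class_carrier[OF L] U Uz Ui dg_mult PGL3_one[OF L] dg_1\<close>)
    then show ?case using inv Ui Uz by blast
  next
    case (eng g h)
    then obtain u v u' v' where h: "u \<in> U" "v \<in> U" "g = pgl_class L (dg u v)" "u' \<in> U" "v' \<in> U" "h = pgl_class L (dg u' v')" by blast
    have "g \<otimes>\<^bsub>PGL3 L\<^esub> h = pgl_class L (dg (u * u') (v * v'))"
      unfolding h(3,6) pgl_class_mult[OF L U[OF h(1,2)] U[OF h(4,5)]] dg_mult ..
    then show ?case using Um h by blast
  qed
  then show ?thesis using that by (auto simp: U_def)
qed


section \<open>The Galois group of the separable closure\<close>

lemma carrier_gal_sep: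
  "\<sigma> \<in> carrier gal_sep \<longleftrightarrow> \<sigma> \<in> Bij sep_closure \<and>
    (\<forall>x\<in>sep_closure. \<forall>y\<in>sep_closure. \<sigma> (x + y) = \<sigma> x + \<sigma> y \<and> \<sigma> (x * y) = \<sigma> x * \<sigma> y) \<and> (\<forall>x\<in>base_field. \<sigma> x = x)"
  by (simp add: galois_group_def)

text \<open>The graph of a Galois automorphism is a partial homomorphism, so
  \<open>extend_graph\<close> prolongs it to the algebraic closure.\<close>

lemma gal_sep_extend:
  fixes \<sigma> :: "'k::field alg_closure \<Rightarrow> 'k alg_closure"
  assumes "\<sigma> \<in> carrier gal_sep"
  obtains \<tau> where "\<tau> \<in> aut_over base_field" "\<sigma> = restrict \<tau> sep_closure"
proof -
  note \<sigma> = assms[unfolded carrier_gal_sep]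
  note R = is_subringD[OF is_subfieldD(1)[OF sep_subfield]]
  have 0: "\<sigma> 0 = 0" using \<sigma> R(1) base_subset_sep is_subringD(1)[OF is_subfieldD(1)[OF base.E]] by blast
  have "hom_graph base_field {(x, \<sigma> x) | x. x \<in> sep_closure}"
    unfolding hom_graph_def
  proof (intro conjI allI impI ballI)
    show "(c, c) \<in> {(x, \<sigma> x) | x. x \<in> sep_closure}" if "c \<in> base_field" for c
      using \<sigma> that base_subset_sep by fastforce
  next
    fix a b c d assume "(a, b) \<in> {(x, \<sigma> x) | x. x \<in> sep_closure}" "(c, d) \<in> {(x, \<sigma> x) | x. x \<in> sep_closure}"
    then show "(a + c, b + d) \<in> {(x, \<sigma> x) | x. x \<in> sep_closure}" "(a * c, b * d) \<in> {(x, \<sigma> x) | x. x \<in> sep_closure}"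
      using \<sigma> R(3,4) by auto
  next
    show "y = 0" if "(0, y) \<in> {(x, \<sigma> x) | x. x \<in> sep_closure}" for y using that 0 by auto
  qed
  then obtain \<tau> where \<tau>: "\<tau> \<in> aut_over base_field" "\<And>x y. (x, y) \<in> {(x, \<sigma> x) | x. x \<in> sep_closure} \<Longrightarrow> \<tau> x = y"
    by (rule base.extend_graph) (rule that)
  have "\<sigma> = restrict \<tau> sep_closure"
  proof
    fix x
    show "\<sigma> x = restrict \<tau> sep_closure x"
      using \<tau>(2)[of x "\<sigma> x"] \<sigma> by (cases "x \<in> sep_closure") (auto simp: Bij_def extensional_def)
  qed
  then show ?thesis using that \<tau>(1) by blast
qed

lemma bij_betw_sep:
  assumes "\<tau> \<in> aut_over base_field"
  shows "bij_betw \<tau> sep_closure sep_closure"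
proof (rule bij_betwI[of _ _ _ "inv_into UNIV \<tau>"])
  show "\<tau> \<in> sep_closure \<rightarrow> sep_closure" using sep_conj[OF _ assms] by blast
  show "inv_into UNIV \<tau> \<in> sep_closure \<rightarrow> sep_closure" using sep_conj[OF _ aut_over_inv(1)[OF assms]] by blast
qed (simp_all add: aut_over_inv[OF assms])

lemma restrict_gal_sep:
  assumes "\<tau> \<in> aut_over base_field"
  shows "restrict \<tau> sep_closure \<in> carrier gal_sep"
proof -
  note R = is_subringD[OF is_subfieldD(1)[OF sep_subfield]]
  have "restrict \<tau> sep_closure \<in> Bij sep_closure" using bij_betw_sep[OF assms] by (simp add: Bij_def)
  then show ?thesis
    unfolding carrier_gal_sep using R(3,4) base_subset_sep by (auto simp: aut_overD[OF assms])
qed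

lemma restrict_gal_sep_mult:
  assumes "\<sigma> \<in> aut_over base_field" "\<tau> \<in> aut_over base_field"
  shows "restrict \<sigma> sep_closure \<otimes>\<^bsub>gal_sep\<^esub> restrict \<tau> sep_closure = restrict (\<lambda>x. \<sigma> (\<tau> x)) sep_closure"
proof -
  have B: "restrict \<sigma> sep_closure \<in> Bij sep_closure" "restrict \<tau> sep_closure \<in> Bij sep_closure"
    using assms[THEN restrict_gal_sep] by (auto simp: carrier_gal_sep)
  have "restrict \<sigma> sep_closure \<otimes>\<^bsub>gal_sep\<^esub> restrict \<tau> sep_closure
      = compose sep_closure (restrict \<sigma> sep_closure) (restrict \<tau> sep_closure)"
    using B by (simp add: galois_group_def BijGroup_def)
  also have "\<dots> = restrict (\<lambda>x. \<sigma> (\<tau> x)) sep_closure"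
    using sep_conj[OF _ assms(2)] by (auto simp: compose_def fun_eq_iff)
  finally show ?thesis .
qed

lemma gal_sep_mult_closed:
  assumes "\<sigma> \<in> carrier gal_sep" "\<tau> \<in> carrier gal_sep"
  shows "\<sigma> \<otimes>\<^bsub>gal_sep\<^esub> \<tau> \<in> carrier gal_sep"
proof -
  obtain s where s: "s \<in> aut_over base_field" "\<sigma> = restrict s sep_closure" by (rule gal_sep_extend[OF assms(1)])
  obtain t where t: "t \<in> aut_over base_field" "\<tau> = restrict t sep_closure" by (rule gal_sep_extend[OF assms(2)])
  show ?thesis
    unfolding s(2) t(2) restrict_gal_sep_mult[OF s(1) t(1)] using restrict_gal_sep[OF aut_over_comp[OF s(1) t(1)]] .
qed

text \<open>A basic open set of the product topology restricts only finitely many coordinates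
  \<open>T\<close>; an automorphism fixing \<open>T\<close> satisfies these restrictions because the
  identity does.\<close>

lemma gal_sep_open_neighbourhood:
  assumes O: "openin gal_sep_top N" "restrict (\<lambda>x. x) sep_closure \<in> N"
  obtains T where "finite T" "T \<subseteq> sep_closure"
    "\<And>\<tau>. \<tau> \<in> aut_over base_field \<Longrightarrow> \<forall>x\<in>T. \<tau> x = x \<Longrightarrow> restrict \<tau> sep_closure \<in> N"
proof -
  let ?i = "restrict (\<lambda>x. x) sep_closure"
  obtain W where W: "openin (product_topology (\<lambda>_. discrete_topology sep_closure) sep_closure) W" "N = W \<inter> carrier gal_sep"
    using O(1) unfolding krull_topology_def openin_subtopology by blast
  have "?i \<in> W" using O(2) W(2) by blast
  with W(1) have "\<exists>U. finite {i \<in> sep_closure. U i \<noteq> topspace (discrete_topology sep_closure)}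
      \<and> (\<forall>i\<in>sep_closure. openin (discrete_topology sep_closure) (U i)) \<and> ?i \<in> Pi\<^sub>E sep_closure U \<and> Pi\<^sub>E sep_closure U \<subseteq> W"
    unfolding openin_product_topology_alt by (elim bspec)
  then obtain U where U: "finite {i \<in> sep_closure. U i \<noteq> topspace (discrete_topology sep_closure)}"
      "?i \<in> Pi\<^sub>E sep_closure U" "Pi\<^sub>E sep_closure U \<subseteq> W"
    by (elim exE conjE) (rule that)
  let ?T = "{i \<in> sep_closure. U i \<noteq> topspace (discrete_topology sep_closure)}"
  have "restrict \<tau> sep_closure \<in> N" if t: "\<tau> \<in> aut_over base_field" "\<forall>x\<in>?T. \<tau> x = x" for \<tau>
  proof -
    have "\<tau> x \<in> U x" if x: "x \<in> sep_closure" for x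
    proof (cases "U x = sep_closure")
      case True
      then show ?thesis using sep_conj[OF x t(1)] by simp
    next
      case False
      then have "\<tau> x = x" using t(2) x by simp
      moreover have "?i x \<in> U x" using U(2) x by (rule PiE_mem)
      ultimately show ?thesis using x by simp
    qed
    then have "restrict \<tau> sep_closure \<in> Pi\<^sub>E sep_closure U" by auto
    then show ?thesis using U(3) W(2) restrict_gal_sep[OF t(1)] by blast
  qed
  then show ?thesis using that[of ?T] U(1) by blast
qed

section \<open>Galois action on classes of matrices\<close>

definition mact :: "('a \<Rightarrow> 'a) \<Rightarrow> 'a ^ 3 ^ 3 \<Rightarrow> 'a ^ 3 ^ 3" where
  "mact \<sigma> A = (\<chi> i j. \<sigma> (A $ i $ j))"

lemma mact_nth [simp]: "mact \<sigma> A $ i $ j = \<sigma> (A $ i $ j)"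
  by (simp add: mact_def)

lemma mact_mult: "\<sigma> \<in> aut_over E \<Longrightarrow> mact \<sigma> (A ** B) = mact \<sigma> A ** mact \<sigma> B"
  by (simp add: vec_eq_iff matrix_matrix_mult_def aut_over_sum aut_overD(3))

lemma mact_mat: "\<sigma> \<in> aut_over E \<Longrightarrow> mact \<sigma> (mat c) = mat (\<sigma> c)"
  by (simp add: vec_eq_iff mat_def aut_overD(5))

lemma mact_dg: "\<sigma> \<in> aut_over E \<Longrightarrow> mact \<sigma> (dg u v) = dg (\<sigma> u) (\<sigma> v)"
  by (simp add: vec_eq_iff dg_nth aut_overD(5,6))

lemma mact_GL3:
  assumes "\<tau> \<in> aut_over base_field" "A \<in> carrier (GL3 sep_closure)"
  shows "mact \<tau> A \<in> carrier (GL3 sep_closure)"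
proof -
  have "det (mact \<tau> A) = \<tau> (det A)" by (simp add: det_3 aut_overD[OF assms(1)])
  then show ?thesis using assms(2) sep_conj[OF _ assms(1)] by (auto simp: GL3_def aut_overD(10)[OF assms(1)])
qed

lemma pgl_act_class:
  assumes t: "\<tau> \<in> aut_over base_field" and A: "A \<in> carrier (GL3 sep_closure)"
  shows "pgl_act (restrict \<tau> sep_closure) (pgl_class sep_closure A) = pgl_class sep_closure (mact \<tau> A)"
proof -
  note R = is_subringD[OF is_subfieldD(1)[OF sep_subfield]]
  have m: "(\<chi> i j. restrict \<tau> sep_closure ((mat c ** A) $ i $ j)) = mat (\<tau> c) ** mact \<tau> A" if c: "c \<in> sep_closure" for c
  proof -
    have "c * A $ i $ j \<in> sep_closure" for i j by (rule R(4)[OF c]) (use A in \<open>simp add: GL3_def\<close>)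
    then show ?thesis by (simp add: vec_eq_iff mat_mult_nth aut_overD(3)[OF t])
  qed
  show ?thesis
  proof (intro Set.set_eqI iffI)
    fix M assume "M \<in> pgl_act (restrict \<tau> sep_closure) (pgl_class sep_closure A)"
    then obtain N where N: "N \<in> pgl_class sep_closure A" "M = (\<chi> i j. restrict \<tau> sep_closure (N $ i $ j))"
      unfolding pgl_act_def by blast
    obtain c where c: "c \<in> sep_closure" "c \<noteq> 0" "N = mat c ** A"
      using N(1) unfolding mem_pgl_class[OF sep_subfield] by blast
    then have "M = mat (\<tau> c) ** mact \<tau> A" using N(2) m by simp
    then show "M \<in> pgl_class sep_closure (mact \<tau> A)"
      unfolding mem_pgl_class[OF sep_subfield] using c sep_conj[OF _ t] aut_overD(10)[OF t] by blast
  next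
    fix M assume "M \<in> pgl_class sep_closure (mact \<tau> A)"
    then obtain c where c: "c \<in> sep_closure" "c \<noteq> 0" "M = mat c ** mact \<tau> A"
      unfolding mem_pgl_class[OF sep_subfield] by blast
    let ?c = "inv_into UNIV \<tau> c"
    have c': "\<tau> ?c = c" "?c \<in> sep_closure" using aut_over_inv[OF t] sep_conj[OF c(1)] by auto
    then have "?c \<noteq> 0" using c(2) aut_overD(5)[OF t] by metis
    with c' have "mat ?c ** A \<in> pgl_class sep_closure A" unfolding mem_pgl_class[OF sep_subfield] by blast
    moreover have "M = (\<chi> i j. restrict \<tau> sep_closure ((mat ?c ** A) $ i $ j))" using m[OF c'(2)] c(3) c'(1) by simp
    ultimately show "M \<in> pgl_act (restrict \<tau> sep_closure) (pgl_class sep_closure A)"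
      unfolding pgl_act_def by blast
  qed
qed

lemma pgl_act_hom:
  assumes "\<sigma> \<in> carrier gal_sep"
  shows "pgl_act \<sigma> \<in> hom (PGL3 sep_closure) (PGL3 (sep_closure :: 'k::field alg_closure set))"
proof -
  obtain \<tau> where \<tau>: "\<tau> \<in> aut_over base_field" "\<sigma> = restrict \<tau> sep_closure" by (rule gal_sep_extend[OF assms])
  have L: "is_subfield (sep_closure :: 'k alg_closure set)" by (rule sep_subfield)
  show ?thesis
  proof (rule homI)
    fix g :: "('k alg_closure ^ 3 ^ 3) set" assume "g \<in> carrier (PGL3 sep_closure)"
    then show "pgl_act \<sigma> g \<in> carrier (PGL3 sep_closure)"
      by (rule PGL3_cases[OF L]) (simp add: \<tau>(2) pgl_act_class[OF \<tau>(1)] pgl_class_carrier[OF L] mact_GL3[OF \<tau>(1)])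
  next
    fix g h :: "('k alg_closure ^ 3 ^ 3) set" assume gh: "g \<in> carrier (PGL3 sep_closure)" "h \<in> carrier (PGL3 sep_closure)"
    obtain A where A: "A \<in> carrier (GL3 sep_closure)" "g = pgl_class sep_closure A" by (rule PGL3_cases[OF L gh(1)])
    obtain B where B: "B \<in> carrier (GL3 sep_closure)" "h = pgl_class sep_closure B" by (rule PGL3_cases[OF L gh(2)])
    have AB: "A ** B \<in> carrier (GL3 sep_closure)"
      using group.is_monoid[OF GL3_group[OF L]] monoid.m_closed A(1) B(1) by (fastforce simp: GL3_def)
    show "pgl_act \<sigma> (g \<otimes>\<^bsub>PGL3 sep_closure\<^esub> h) = pgl_act \<sigma> g \<otimes>\<^bsub>PGL3 sep_closure\<^esub> pgl_act \<sigma> h"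
      by (simp add: A B AB \<tau>(2) pgl_act_class[OF \<tau>(1)] pgl_class_mult[OF L] mact_GL3[OF \<tau>(1)] mact_mult[OF \<tau>(1)])
  qed
qed


section \<open>Triviality of the map on cohomology\<close>

text \<open>Hypothesis \<open>triv\<close> says that \<xi> is the coboundary of some
  \<open>a\<close> in \<open>B\<close>. Left multiplication by \<open>a\<close> then matches the
  elements relating a cocycle to \<xi> with those relating it to the trivial cocycle, so the two
  classes are equal.\<close>

lemma H1_incl_trivial:
  assumes B: "group B" and act: "\<And>\<sigma>. \<sigma> \<in> carrier G \<Longrightarrow> act \<sigma> \<in> hom B B"
    and T: "topspace T \<subseteq> carrier G" and G: "\<And>\<sigma> \<tau>. \<sigma> \<in> carrier G \<Longrightarrow> \<tau> \<in> carrier G \<Longrightarrow> \<sigma> \<otimes>\<^bsub>G\<^esub> \<tau> \<in> carrier G"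
    and incl: "cocycles G T act A \<subseteq> cocycles G T act B"
    and refl: "\<And>\<xi>. \<xi> \<in> cocycles G T act A \<Longrightarrow> (\<xi>, \<xi>) \<in> cohomologous G T act A"
    and triv: "\<And>\<xi>. \<xi> \<in> cocycles G T act A \<Longrightarrow> \<exists>a\<in>carrier B. \<forall>\<sigma>\<in>carrier G. \<xi> \<sigma> \<otimes>\<^bsub>B\<^esub> act \<sigma> a = a"
    and c: "c \<in> H1 G T act A"
  shows "H1_incl G T act B c = H1_trivial G T act B"
proof -
  interpret B: group B by (rule B)
  have act_hom: "group_hom B B (act \<sigma>)" if "\<sigma> \<in> carrier G" for \<sigma>
    using B act[OF that] by (simp add: group_hom_def group_hom_axioms_def)
  note ac = group_hom.hom_closed[OF act_hom] and am = group_hom.hom_mult[OF act_hom]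
    and a1 = group_hom.hom_one[OF act_hom] and ai = group_hom.hom_inv[OF act_hom]
  let ?t = "\<lambda>\<sigma>\<in>carrier G. \<one>\<^bsub>B\<^esub>"
  have t: "?t \<in> cocycles G T act B"
  proof -
    have "continuous_map T (discrete_topology (carrier B)) ?t"
      by (rule continuous_map_eq[of _ _ "\<lambda>_. \<one>\<^bsub>B\<^esub>"]) (use T in auto)
    then show ?thesis by (auto simp: cocycles_def G a1)
  qed
  have key: "(\<xi>, \<eta>) \<in> cohomologous G T act B \<longleftrightarrow> (?t, \<eta>) \<in> cohomologous G T act B"
    if \<xi>: "\<xi> \<in> cocycles G T act A" for \<xi> \<eta>
  proof -
    have \<xi>B: "\<xi> \<in> cocycles G T act B" using \<xi> incl by blast
    then have \<xi>c: "\<xi> \<sigma> \<in> carrier B" if "\<sigma> \<in> carrier G" for \<sigma> using that by (auto simp: cocycles_def)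
    obtain a where a: "a \<in> carrier B" "\<And>\<sigma>. \<sigma> \<in> carrier G \<Longrightarrow> \<xi> \<sigma> \<otimes>\<^bsub>B\<^esub> act \<sigma> a = a" using triv[OF \<xi>] by blast
    have eq: "inv\<^bsub>B\<^esub> (a \<otimes>\<^bsub>B\<^esub> x) \<otimes>\<^bsub>B\<^esub> \<xi> \<sigma> \<otimes>\<^bsub>B\<^esub> act \<sigma> (a \<otimes>\<^bsub>B\<^esub> x) = inv\<^bsub>B\<^esub> x \<otimes>\<^bsub>B\<^esub> ?t \<sigma> \<otimes>\<^bsub>B\<^esub> act \<sigma> x"
      if s: "\<sigma> \<in> carrier G" and x: "x \<in> carrier B" for \<sigma> x
    proof -
      note cs = a(1) x \<xi>c[OF s] ac[OF s a(1)] ac[OF s x]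
      have "inv\<^bsub>B\<^esub> (a \<otimes>\<^bsub>B\<^esub> x) \<otimes>\<^bsub>B\<^esub> \<xi> \<sigma> \<otimes>\<^bsub>B\<^esub> act \<sigma> (a \<otimes>\<^bsub>B\<^esub> x)
          = inv\<^bsub>B\<^esub> x \<otimes>\<^bsub>B\<^esub> (inv\<^bsub>B\<^esub> a \<otimes>\<^bsub>B\<^esub> (\<xi> \<sigma> \<otimes>\<^bsub>B\<^esub> act \<sigma> a)) \<otimes>\<^bsub>B\<^esub> act \<sigma> x"
        using cs by (simp add: am[OF s a(1) x] B.inv_mult_group B.m_assoc)
      also have "\<dots> = inv\<^bsub>B\<^esub> x \<otimes>\<^bsub>B\<^esub> ?t \<sigma> \<otimes>\<^bsub>B\<^esub> act \<sigma> x"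
        unfolding a(2)[OF s] using cs s by simp
      finally show ?thesis .
    qed
    show ?thesis
    proof
      assume h: "(\<xi>, \<eta>) \<in> cohomologous G T act B"
      then obtain y where y: "y \<in> carrier B" "\<forall>\<sigma>\<in>carrier G. \<eta> \<sigma> = inv\<^bsub>B\<^esub> y \<otimes>\<^bsub>B\<^esub> \<xi> \<sigma> \<otimes>\<^bsub>B\<^esub> act \<sigma> y"
        and \<eta>: "\<eta> \<in> cocycles G T act B" unfolding cohomologous_def by blast
      have ya: "inv\<^bsub>B\<^esub> a \<otimes>\<^bsub>B\<^esub> y \<in> carrier B" "a \<otimes>\<^bsub>B\<^esub> (inv\<^bsub>B\<^esub> a \<otimes>\<^bsub>B\<^esub> y) = y"
        using a(1) y(1) by (simp_all add: B.m_assoc[symmetric])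
      have "\<forall>\<sigma>\<in>carrier G. \<eta> \<sigma> = inv\<^bsub>B\<^esub> (inv\<^bsub>B\<^esub> a \<otimes>\<^bsub>B\<^esub> y) \<otimes>\<^bsub>B\<^esub> ?t \<sigma> \<otimes>\<^bsub>B\<^esub> act \<sigma> (inv\<^bsub>B\<^esub> a \<otimes>\<^bsub>B\<^esub> y)"
        using eq[OF _ ya(1)] y(2) unfolding ya(2) by metis
      then show "(?t, \<eta>) \<in> cohomologous G T act B" unfolding cohomologous_def using t \<eta> ya(1) by blast
    next
      assume h: "(?t, \<eta>) \<in> cohomologous G T act B"
      then obtain y where y: "y \<in> carrier B" "\<forall>\<sigma>\<in>carrier G. \<eta> \<sigma> = inv\<^bsub>B\<^esub> y \<otimes>\<^bsub>B\<^esub> ?t \<sigma> \<otimes>\<^bsub>B\<^esub> act \<sigma> y"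
        and \<eta>: "\<eta> \<in> cocycles G T act B" unfolding cohomologous_def by blast
      have "\<forall>\<sigma>\<in>carrier G. \<eta> \<sigma> = inv\<^bsub>B\<^esub> (a \<otimes>\<^bsub>B\<^esub> y) \<otimes>\<^bsub>B\<^esub> \<xi> \<sigma> \<otimes>\<^bsub>B\<^esub> act \<sigma> (a \<otimes>\<^bsub>B\<^esub> y)"
        using eq[OF _ y(1)] y(2) by metis
      moreover have "a \<otimes>\<^bsub>B\<^esub> y \<in> carrier B" using a(1) y(1) by simp
      ultimately show "(\<xi>, \<eta>) \<in> cohomologous G T act B" unfolding cohomologous_def using \<xi>B \<eta> by blast
    qed
  qed
  obtain \<xi>0 where \<xi>0: "\<xi>0 \<in> cocycles G T act A" "c = cohomologous G T act A `` {\<xi>0}"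
    using c unfolding H1_def by (rule quotientE)
  have "\<xi>0 \<in> c" using refl[OF \<xi>0(1)] \<xi>0(2) by blast
  moreover have "c \<subseteq> cocycles G T act A" unfolding \<xi>0(2) cohomologous_def by blast
  ultimately show ?thesis unfolding H1_incl_def H1_trivial_def using key by blast
qed

text \<open>Uniqueness of the representatives \<open>dg u v\<close> splits the cocycle into two with
  values in the multiplicative group. The witness uses the inverses of the elements from Hilbert 90
  because \<open>u \<tau> * \<tau> (inverse b1) = inverse b1\<close>.\<close>

lemma diagonal_cocycle_trivial:
  fixes F :: "(3, 'k::field alg_closure) mpoly" and \<zeta> :: "'k alg_closure"
  assumes z: "\<zeta> \<in> sep_closure" "\<zeta> ^ n = 1" "n > 0"
    and gen: "carrier A = generate (PGL3 sep_closure) {pgl_class sep_closure (dg (\<zeta> ^ a) (\<zeta> ^ b))}"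
    and A: "monoid.mult A = monoid.mult (PGL3 sep_closure)"
    and \<xi>: "\<xi> \<in> cocycles gal_sep gal_sep_top pgl_act A"
  shows "\<exists>a\<in>carrier (PGL3 sep_closure). \<forall>\<sigma>\<in>carrier gal_sep. \<xi> \<sigma> \<otimes>\<^bsub>PGL3 sep_closure\<^esub> pgl_act \<sigma> a = a"
proof -
  have L: "is_subfield (sep_closure :: 'k alg_closure set)" by (rule sep_subfield)
  let ?r = "\<lambda>\<tau>. restrict \<tau> sep_closure"
  have "\<exists>w. \<xi> (?r \<tau>) = pgl_class sep_closure (dg (fst w) (snd w)) \<and> fst w \<in> sep_closure \<and> snd w \<in> sep_closure
      \<and> fst w \<noteq> 0 \<and> snd w \<noteq> 0" if "\<tau> \<in> aut_over base_field" for \<tau>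
  proof -
    have "\<xi> (?r \<tau>) \<in> carrier A" using \<xi> restrict_gal_sep[OF that] by (auto simp: cocycles_def)
    then obtain u v where uv: "\<xi> (?r \<tau>) = pgl_class sep_closure (dg u v)" "u \<in> sep_closure" "v \<in> sep_closure" "u ^ n = 1" "v ^ n = 1"
      unfolding gen by (rule generate_dg[OF L z])
    moreover have "u \<noteq> 0" "v \<noteq> 0" using uv(4,5) z(3) by (auto simp: power_0_left)
    ultimately show ?thesis by (intro exI[of _ "(u, v)"]) simp
  qed
  then obtain w where w: "\<And>\<tau>. \<tau> \<in> aut_over base_field \<Longrightarrow> \<xi> (?r \<tau>) = pgl_class sep_closure (dg (fst (w \<tau>)) (snd (w \<tau>)))
      \<and> fst (w \<tau>) \<in> sep_closure \<and> snd (w \<tau>) \<in> sep_closure \<and> fst (w \<tau>) \<noteq> 0 \<and> snd (w \<tau>) \<noteq> 0" by metis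
  define u v where "u = (\<lambda>\<tau>. fst (w \<tau>))" and "v = (\<lambda>\<tau>. snd (w \<tau>))"
  have uv: "\<xi> (?r \<tau>) = pgl_class sep_closure (dg (u \<tau>) (v \<tau>))" "u \<tau> \<in> sep_closure" "v \<tau> \<in> sep_closure" "u \<tau> \<noteq> 0" "v \<tau> \<noteq> 0"
    if "\<tau> \<in> aut_over base_field" for \<tau> using w[OF that] by (simp_all add: u_def v_def)
  have GL: "dg (u \<tau>) (v \<tau>) \<in> carrier (GL3 sep_closure)" if "\<tau> \<in> aut_over base_field" for \<tau>
    by (rule dg_GL3[OF L uv(2-5)[OF that]])
  have coc: "u (\<lambda>x. \<sigma> (\<tau> x)) = u \<sigma> * \<sigma> (u \<tau>)" "v (\<lambda>x. \<sigma> (\<tau> x)) = v \<sigma> * \<sigma> (v \<tau>)"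
    if s: "\<sigma> \<in> aut_over base_field" and t: "\<tau> \<in> aut_over base_field" for \<sigma> \<tau>
  proof -
    have "\<xi> (?r \<sigma> \<otimes>\<^bsub>gal_sep\<^esub> ?r \<tau>) = \<xi> (?r \<sigma>) \<otimes>\<^bsub>PGL3 sep_closure\<^esub> pgl_act (?r \<sigma>) (\<xi> (?r \<tau>))"
      using \<xi> restrict_gal_sep[OF s] restrict_gal_sep[OF t] unfolding cocycles_def A by blast
    then have "pgl_class sep_closure (dg (u (\<lambda>x. \<sigma> (\<tau> x))) (v (\<lambda>x. \<sigma> (\<tau> x)))) =
        pgl_class sep_closure (dg (u \<sigma> * \<sigma> (u \<tau>)) (v \<sigma> * \<sigma> (v \<tau>)))"
      unfolding restrict_gal_sep_mult[OF s t] uv(1)[OF s] uv(1)[OF t] uv(1)[OF aut_over_comp[OF s t]]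
        pgl_act_class[OF s GL[OF t]] mact_dg[OF s] pgl_class_mult[OF L GL[OF s] mact_GL3[OF s GL[OF t], unfolded mact_dg[OF s]]] dg_mult .
    from pgl_class_dg_eqD[OF L this]
    show "u (\<lambda>x. \<sigma> (\<tau> x)) = u \<sigma> * \<sigma> (u \<tau>)" "v (\<lambda>x. \<sigma> (\<tau> x)) = v \<sigma> * \<sigma> (v \<tau>)" by auto
  qed
  note id = aut_over_id[of base_field]
  have id1: "u (\<lambda>x. x) = 1" "v (\<lambda>x. x) = 1" using coc[OF id id] uv(4,5)[OF id] by auto
  \<comment> \<open>The cocycle is continuous into a discrete space, so the set where it takes its
    value at the identity is open and contains all automorphisms that fix a suitable finite
    set.\<close>
  let ?N = "{\<sigma> \<in> topspace gal_sep_top. \<xi> \<sigma> \<in> {\<xi> (?r (\<lambda>x. x))}}"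
  have top: "topspace gal_sep_top = carrier (gal_sep :: ('k alg_closure \<Rightarrow> 'k alg_closure) monoid)"
  proof -
    have "\<sigma> \<in> sep_closure \<rightarrow>\<^sub>E sep_closure" if "\<sigma> \<in> carrier gal_sep" for \<sigma> :: "'k alg_closure \<Rightarrow> 'k alg_closure"
      using that by (rule gal_sep_extend) (use sep_conj in auto)
    then have "carrier gal_sep \<subseteq> sep_closure \<rightarrow>\<^sub>E (sep_closure :: 'k alg_closure set)" by blast
    then show ?thesis
      unfolding krull_topology_def topspace_subtopology topspace_product_topology topspace_discrete_topology
      by (rule Int_absorb1)
  qed
  have "\<xi> (?r (\<lambda>x. x)) \<in> carrier A" using \<xi> restrict_gal_sep[OF id] by (auto simp: cocycles_def)
  moreover have "continuous_map gal_sep_top (discrete_topology (carrier A)) \<xi>" using \<xi> by (simp add: cocycles_def)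
  ultimately have "openin gal_sep_top ?N" by (intro openin_continuous_map_preimage) auto
  moreover have "?r (\<lambda>x. x) \<in> ?N" using restrict_gal_sep[OF id] unfolding top by blast
  ultimately obtain T where T: "finite T" "T \<subseteq> sep_closure"
    "\<And>\<tau>. \<tau> \<in> aut_over base_field \<Longrightarrow> \<forall>x\<in>T. \<tau> x = x \<Longrightarrow> ?r \<tau> \<in> ?N"
    by (rule gal_sep_open_neighbourhood) (rule that)
  have loc: "u \<tau> = 1 \<and> v \<tau> = 1" if t: "\<tau> \<in> aut_over base_field" "\<forall>x\<in>T. \<tau> x = x" for \<tau>
  proof -
    have "\<xi> (?r \<tau>) = \<xi> (?r (\<lambda>x. x))" using T(3)[OF t] by blast
    then show ?thesis
      unfolding uv(1)[OF t(1)] uv(1)[OF id] using pgl_class_dg_eqD[OF L] id1 by metis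
  qed
  have Tsep: "x \<in> T \<Longrightarrow> base.separable x" for x using T(2) unfolding sep_closure_eq by blast
  obtain b1 where b1: "b1 \<noteq> 0" "base.separable b1" "\<And>\<sigma>. \<sigma> \<in> aut_over base_field \<Longrightarrow> \<sigma> b1 = u \<sigma> * b1"
    by (rule base.hilbert90[OF T(1) Tsep, of u]) (use coc(1) loc uv(2,4) in \<open>auto simp: sep_closure_eq\<close>)
  obtain b2 where b2: "b2 \<noteq> 0" "base.separable b2" "\<And>\<sigma>. \<sigma> \<in> aut_over base_field \<Longrightarrow> \<sigma> b2 = v \<sigma> * b2"
    by (rule base.hilbert90[OF T(1) Tsep, of v]) (use coc(2) loc uv(3,5) in \<open>auto simp: sep_closure_eq\<close>)
  have bs: "inverse b1 \<in> sep_closure" "inverse b2 \<in> sep_closure"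
    using is_subfieldD(2)[OF L] b1(2) b2(2) by (auto simp: sep_closure_eq)
  have bG: "dg (inverse b1) (inverse b2) \<in> carrier (GL3 sep_closure)"
    by (rule dg_GL3[OF L bs]) (use b1(1) b2(1) in auto)
  show ?thesis
  proof (intro bexI ballI)
    show "pgl_class sep_closure (dg (inverse b1) (inverse b2)) \<in> carrier (PGL3 sep_closure)"
      by (rule pgl_class_carrier[OF L bG])
    fix \<sigma> :: "'k alg_closure \<Rightarrow> 'k alg_closure" assume "\<sigma> \<in> carrier gal_sep"
    then obtain \<tau> where \<tau>: "\<tau> \<in> aut_over base_field" "\<sigma> = ?r \<tau>" by (rule gal_sep_extend)
    have "u \<tau> * \<tau> (inverse b1) = inverse b1" "v \<tau> * \<tau> (inverse b2) = inverse b2"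
      using uv(4,5)[OF \<tau>(1)] by (simp_all add: aut_overD(9)[OF \<tau>(1)] b1(3)[OF \<tau>(1)] b2(3)[OF \<tau>(1)] mult.assoc[symmetric])
    then show "\<xi> \<sigma> \<otimes>\<^bsub>PGL3 sep_closure\<^esub> pgl_act \<sigma> (pgl_class sep_closure (dg (inverse b1) (inverse b2))) =
        pgl_class sep_closure (dg (inverse b1) (inverse b2))"
      unfolding \<tau>(2) pgl_act_class[OF \<tau>(1) bG] uv(1)[OF \<tau>(1)] mact_dg[OF \<tau>(1)]
        pgl_class_mult[OF L GL[OF \<tau>(1)] mact_GL3[OF \<tau>(1) bG, unfolded mact_dg[OF \<tau>(1)]]] dg_mult by simp
  qed
qed

theorem Sigma_map_trivial:
  fixes F :: "(3, 'k::field alg_closure) mpoly" and \<zeta> :: "'k alg_closure"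
  assumes z: "\<zeta> \<in> sep_closure" "\<zeta> ^ n = 1" "n > 0"
    and gen: "carrier (plane_aut sep_closure F) = generate (PGL3 sep_closure) {pgl_class sep_closure (dg (\<zeta> ^ a) (\<zeta> ^ b))}"
    and c: "c \<in> H1 gal_sep gal_sep_top pgl_act (plane_aut sep_closure F)"
  shows "Sigma_map c = H1_trivial gal_sep gal_sep_top pgl_act (PGL3 sep_closure)"
  unfolding Sigma_map_def
proof (rule H1_incl_trivial[OF PGL3_group[OF sep_subfield] pgl_act_hom _ gal_sep_mult_closed _ _ _ c])
  have L: "is_subfield (sep_closure :: 'k alg_closure set)" by (rule sep_subfield)
  let ?A = "plane_aut sep_closure F" and ?B = "PGL3 (sep_closure :: 'k alg_closure set)"
  interpret PGL: group ?B by (rule PGL3_group[OF L])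
  have zz: "\<zeta> ^ k \<in> sep_closure" "\<zeta> ^ k \<noteq> 0" for k
    using is_subring_power[OF is_subfieldD(1)[OF L] z(1)] z(2,3) by (auto simp: power_0_left)
  have "subgroup (carrier ?A) ?B"
    unfolding gen by (rule PGL.generate_is_subgroup) (simp add: pgl_class_carrier[OF L dg_GL3[OF L zz(1) zz(1) zz(2) zz(2)]])
  then have AG: "group (?B\<lparr>carrier := carrier ?A\<rparr>)" and sub: "carrier ?A \<subseteq> carrier ?B"
    by (rule subgroup.subgroup_is_group[OF _ PGL3_group[OF L]], rule subgroup.subset)
  have A: "?B\<lparr>carrier := carrier ?A\<rparr> = ?A" by (simp add: plane_aut_def)
  interpret A: group ?A using AG unfolding A .
  have mult: "monoid.mult ?A = monoid.mult ?B" and one: "\<one>\<^bsub>?A\<^esub> = \<one>\<^bsub>?B\<^esub>" by (simp_all add: plane_aut_def)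
  show "topspace gal_sep_top \<subseteq> carrier (gal_sep :: ('k alg_closure \<Rightarrow> 'k alg_closure) monoid)" by (auto simp: krull_topology_def)
  show "cocycles gal_sep gal_sep_top pgl_act ?A \<subseteq> cocycles gal_sep gal_sep_top pgl_act ?B"
  proof
    fix \<xi> assume "\<xi> \<in> cocycles gal_sep gal_sep_top pgl_act ?A"
    then have \<xi>: "\<xi> \<in> carrier gal_sep \<rightarrow>\<^sub>E carrier ?A" "continuous_map gal_sep_top (discrete_topology (carrier ?A)) \<xi>"
      "\<forall>\<sigma>\<in>carrier gal_sep. \<forall>\<tau>\<in>carrier gal_sep. \<xi> (\<sigma> \<otimes>\<^bsub>gal_sep\<^esub> \<tau>) = \<xi> \<sigma> \<otimes>\<^bsub>?B\<^esub> pgl_act \<sigma> (\<xi> \<tau>)"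
      unfolding cocycles_def mult by blast+
    have "continuous_map (discrete_topology (carrier ?A)) (discrete_topology (carrier ?B)) (\<lambda>x. x)"
      using sub by auto
    from continuous_map_compose[OF \<xi>(2) this] have "continuous_map gal_sep_top (discrete_topology (carrier ?B)) \<xi>"
      by (simp add: comp_def)
    moreover have "\<xi> \<in> carrier gal_sep \<rightarrow>\<^sub>E carrier ?B" using \<xi>(1) sub by (auto simp: PiE_iff)
    ultimately show "\<xi> \<in> cocycles gal_sep gal_sep_top pgl_act ?B" using \<xi>(3) unfolding cocycles_def by blast
  qed
  show "(\<xi>, \<xi>) \<in> cohomologous gal_sep gal_sep_top pgl_act ?A" if \<xi>: "\<xi> \<in> cocycles gal_sep gal_sep_top pgl_act ?A" for \<xi>
  proof -
    have "\<xi> \<sigma> = inv\<^bsub>?A\<^esub> \<one>\<^bsub>?A\<^esub> \<otimes>\<^bsub>?A\<^esub> \<xi> \<sigma> \<otimes>\<^bsub>?A\<^esub> pgl_act \<sigma> \<one>\<^bsub>?A\<^esub>" if s: "\<sigma> \<in> carrier gal_sep" for \<sigma>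
    proof -
      have "pgl_act \<sigma> \<one>\<^bsub>?A\<^esub> = \<one>\<^bsub>?A\<^esub>" unfolding one by (rule hom_one[OF pgl_act_hom[OF s] PGL3_group[OF L] PGL3_group[OF L]])
      moreover have "\<xi> \<sigma> \<in> carrier ?A" using \<xi> s by (auto simp: cocycles_def)
      ultimately show ?thesis by simp
    qed
    then show ?thesis unfolding cohomologous_def using \<xi> A.one_closed by blast
  qed
  show "\<exists>a\<in>carrier ?B. \<forall>\<sigma>\<in>carrier gal_sep. \<xi> \<sigma> \<otimes>\<^bsub>?B\<^esub> pgl_act \<sigma> a = a"
    if "\<xi> \<in> cocycles gal_sep gal_sep_top pgl_act ?A" for \<xi>
    by (rule diagonal_cocycle_trivial[OF z gen mult that])
qed


section \<open>Roots in the separable closure\<close>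

lemma of_nat_alg_closure_eq_0: "of_nat m = (0 :: 'k::field alg_closure) \<longleftrightarrow> CHAR('k) dvd m"
proof -
  have "of_nat m = to_ac (of_nat m :: 'k)" by simp
  then show ?thesis by (simp only: to_ac_eq_0_iff of_nat_eq_0_iff_char_dvd)
qed

text \<open>Substituting X^d into an equation with simple zero \<open>x\<close> gives an equation
  for \<open>y\<close>, whose derivative acquires the nonzero factor
  \<open>d * y ^ (d - 1)\<close>.\<close>

lemma root_in_sep_closure:
  fixes x y :: "'k::field alg_closure"
  assumes x: "x \<in> sep_closure" "x \<noteq> 0" and y: "y ^ d = x" and d: "\<not> CHAR('k) dvd d"
  shows "y \<in> sep_closure"
proof -
  note R = is_subfieldD(1)[OF base.E]
  obtain f where f: "poly_over base_field f" "poly f x = 0" "poly (pderiv f) x \<noteq> 0"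
    using x(1) unfolding sep_closure_eq base.separable_def by blast
  define g where "g = pcompose f (monom 1 d)"
  have "poly_over base_field (pcompose h (monom 1 d))" if "poly_over base_field h" for h :: "'k alg_closure poly"
    using that
  proof (induction h)
    case 0
    then show ?case by simp
  next
    case (pCons a h)
    then have "poly_over base_field [:a:]" "poly_over base_field (pcompose h (monom 1 d))"
      using poly_over_0[OF R] by (auto simp: poly_over_pCons)
    then show ?case
      unfolding pcompose_pCons by (intro poly_over_add[OF R] poly_over_mult[OF R] poly_over_monom[OF R is_subringD(2)[OF R]])
  qed
  then have "poly_over base_field g" using f(1) by (simp add: g_def)
  moreover have "poly g y = 0" using f(2) y by (simp add: g_def poly_pcompose poly_monom)
  moreover have "poly (pderiv g) y \<noteq> 0"
  proof -
    have "y \<noteq> 0" using x(2) y d by (auto simp: power_0_left split: if_splits)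
    moreover have "of_nat d \<noteq> (0 :: 'k alg_closure)" using d by (simp add: of_nat_alg_closure_eq_0)
    ultimately show ?thesis
      using f(3) y by (simp add: g_def pderiv_pcompose poly_pcompose pderiv_monom poly_monom)
  qed
  ultimately show ?thesis unfolding sep_closure_eq base.separable_def by blast
qed

text \<open>Here \<open>e\<close> is the largest power of the characteristic dividing
  \<open>d\<close>; it is prime to \<open>n\<close>, so Bezout's identity inverts it modulo
  \<open>n\<close> by \<open>s\<close>. In characteristic 0 all of \<open>d\<close> is kept and
  \<open>e = 1\<close>.\<close>

lemma degree_decomposition:
  assumes n: "CHAR('k::field) = 0 \<or> coprime n CHAR('k)" "n > 0" and d: "d > 0"
  obtains d' e s q where "d = d' * e" "\<not> CHAR('k) dvd d'" "s * e = 1 + q * n"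
proof (cases "CHAR('k) = 0")
  case True
  then show ?thesis using that[of d 1 1 0] d by simp
next
  case False
  define p where "p = CHAR('k)"
  have p: "Factorial_Ring.prime p" "p > 0" using prime_CHAR_semidom[where 'a = 'k] False by (simp_all add: p_def zero_less_iff_neq_zero)
  define r where "r = multiplicity p d"
  have dd: "d = (d div p ^ r) * p ^ r" unfolding r_def using multiplicity_dvd[of p d] by simp
  have nd: "\<not> p dvd d div p ^ r"
    unfolding r_def by (rule multiplicity_decompose) (use d p(1) not_prime_unit in auto)
  have "coprime (p ^ r) n" using n False by (auto simp: p_def coprime_commute)
  moreover obtain s q where "p ^ r * s = n * q + gcd (p ^ r) n" using bezout_nat[of "p ^ r" n] p(2) by auto
  ultimately have "s * CHAR('k) ^ r = 1 + q * n" by (simp add: mult.commute p_def)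
  then show ?thesis by (rule that[OF dd[unfolded p_def] nd[unfolded p_def]])
qed

text \<open>Since the degree \<open>d\<close> may be divisible by the characteristic, a separable \<open>d\<close>-th root of \<open>\<gamma>\<close>
  is only available up to a power of \<open>\<gamma>\<^sup>n\<close>, which is rational.\<close>

lemma root_up_to_base:
  fixes \<gamma> :: "'k::field alg_closure"
  assumes \<gamma>: "\<gamma> \<in> sep_closure" "\<gamma> \<noteq> 0" "\<gamma> ^ n \<in> base_field"
    and n: "CHAR('k) = 0 \<or> coprime n CHAR('k)" "n > 0" and d: "d > 0"
  obtains t r where "t \<in> sep_closure" "t \<noteq> 0" "r \<in> base_field" "t ^ d = \<gamma> * r"
proof -
  obtain d' e s q where de: "d = d' * e" "\<not> CHAR('k) dvd d'" "s * e = 1 + q * n"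
    by (rule degree_decomposition[OF n d])
  have "d' > 0" using d de(1) by auto
  \<comment> \<open>The root is taken of \<open>\<gamma> ^ s\<close>, so that raising to the power
    \<open>e\<close> gives the exponent \<open>s * e = 1 + q * n\<close>.\<close>
  then obtain t where t: "t ^ d' = \<gamma> ^ s" using nth_root_exists[of d' "\<gamma> ^ s"] by blast
  have gs: "\<gamma> ^ s \<in> sep_closure" "\<gamma> ^ s \<noteq> 0"
    using is_subring_power[OF is_subfieldD(1)[OF sep_subfield] \<gamma>(1)] \<gamma>(2) by auto
  have "t ^ d = \<gamma> ^ (s * e)" unfolding de(1) power_mult t ..
  also have "\<dots> = \<gamma> * (\<gamma> ^ n) ^ q" unfolding de(3) by (simp add: power_mult[symmetric] mult.commute)
  finally have "t ^ d = \<gamma> * (\<gamma> ^ n) ^ q" .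
  moreover have "t \<in> sep_closure" by (rule root_in_sep_closure[OF gs t de(2)])
  moreover have "t \<noteq> 0" using t gs(2) \<open>d' > 0\<close> by (auto simp: power_0_left)
  moreover have "(\<gamma> ^ n) ^ q \<in> base_field" by (rule is_subring_power[OF is_subfieldD(1)[OF base.E] \<gamma>(3)])
  ultimately show ?thesis using that by blast
qed


section \<open>Diagonal substitutions and descent of isomorphisms\<close>

lemma lookup_lin_subst_diag:
  fixes F :: "('i::finite, 'a::alg_closed_field) mpoly"
  shows "Poly_Mapping.lookup (lin_subst F (diag w)) m = Poly_Mapping.lookup F m * monom_at m w"
proof -
  define P where "P = Poly_Mapping.mapp (\<lambda>m c. c * monom_at m w) F"
  have lk: "Poly_Mapping.lookup P m = Poly_Mapping.lookup F m * monom_at m w" for m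
    by (auto simp: P_def lookup_mapp when_def in_keys_iff)
  have keys: "Poly_Mapping.keys P \<subseteq> Poly_Mapping.keys F" by (auto simp: in_keys_iff lk)
  have "lin_subst F (diag w) = P"
  proof (rule mp_eval_inj)
    fix x :: "'a ^ 'i"
    have "(diag w *v x) $ i = w $ i * x $ i" for i
      by (simp add: matrix_vector_mult_def diag_def if_distrib[of "\<lambda>z. z * _"] cong: if_cong)
    then have "monom_at m (diag w *v x) = monom_at m w * monom_at m x" for m
      by (simp add: monom_at_def power_mult_distrib prod.distrib)
    then show "mp_eval (lin_subst F (diag w)) x = mp_eval P x"
      unfolding mp_eval_lin_subst mp_eval_superset[OF finite_keys keys] mp_eval_eq[of F] by (simp add: lk mult.assoc)
  qed
  then show ?thesis by (simp add: lk)
qed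

lemma lin_subst_mult:
  fixes F :: "('i::finite, 'a::alg_closed_field) mpoly"
  shows "lin_subst F (A ** B) = lin_subst (lin_subst F A) B"
  by (rule mp_eval_inj) (simp add: mp_eval_lin_subst matrix_vector_mul_assoc)

lemma mat_mult_vec: "mat c *v x = c *s (x :: 'a::comm_ring_1 ^ 'n::finite)"
  by (simp add: vec_eq_iff matrix_vector_mult_def mat_def if_distrib[of "\<lambda>z. z * _"] cong: if_cong)

lemma lin_subst_mat:
  fixes F :: "('i::finite, 'a::alg_closed_field) mpoly"
  assumes "homogeneous d F"
  shows "lin_subst F (mat c) = Const (c ^ d) * F"
proof (rule mp_eval_inj)
  fix x
  have "form UNIV (int d) (mp_eval F)" by (rule form_mp_eval[OF assms]) simp
  from form_scale[OF this] show "mp_eval (lin_subst F (mat c)) x = mp_eval (Const (c ^ d) * F) x"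
    by (simp add: mp_eval_lin_subst mat_mult_vec)
qed

lemma pmat_mult: "pmat A (pmat B P) = pmat (A ** B) P"
  by (simp add: pmat_def image_image matrix_vector_mul_assoc)

lemma pmat_1: "pmat (mat 1) P = P"
  by (simp add: pmat_def)

lemma pmat_scalar: "c \<noteq> 0 \<Longrightarrow> pmat (mat c ** A) (pt y) = pmat A (pt y)"
  unfolding pmat_pt matrix_vector_mul_assoc[symmetric] mat_mult_vec pt_eq_iff by (rule par_scale)

lemma pact_pmat:
  fixes A :: "'a::field ^ 3 ^ 3"
  assumes "\<sigma> \<in> aut_over E"
  shows "pact \<sigma> (pmat A P) = pmat (mact \<sigma> A) (pact \<sigma> P)"
proof -
  have "vact \<sigma> (A *v x) = mact \<sigma> A *v vact \<sigma> x" for x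
    by (simp add: vec_eq_iff matrix_vector_mult_def aut_over_sum[OF assms] aut_overD(3)[OF assms])
  then show ?thesis by (simp add: pact_def pmat_def image_image)
qed

lemma proj_zerosE:
  assumes "P \<in> proj_zeros S"
  obtains x where "P = pt x" "x \<noteq> 0" "\<forall>f\<in>S. mp_eval f x = 0"
  using assms by (auto simp: proj_zeros_def)

text \<open>Equivariance of the map implies that of its inverse, so
  \<open>proj_morphism_descent\<close> applies to both.\<close>

lemma isomorphic_over_descent:
  fixes S :: "('m::finite, 'k::field alg_closure) mpoly set" and T :: "('n::finite, 'k alg_closure) mpoly set"
  assumes S: "\<And>f. f \<in> S \<Longrightarrow> coeffs_in base_field f" and T: "\<And>f. f \<in> T \<Longrightarrow> coeffs_in base_field f"
    and bij: "bij_betw \<phi> (proj_zeros S) (proj_zeros T)"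
    and mor: "proj_morphism sep_closure (proj_zeros S) (proj_zeros T) \<phi>"
    and mor': "proj_morphism sep_closure (proj_zeros T) (proj_zeros S) (inv_into (proj_zeros S) \<phi>)"
    and comm: "\<And>\<sigma> P. \<sigma> \<in> aut_over base_field \<Longrightarrow> P \<in> proj_zeros S \<Longrightarrow> \<phi> (pact \<sigma> P) = pact \<sigma> (\<phi> P)"
  shows "isomorphic_over base_field S T"
  unfolding isomorphic_over_def
proof (intro exI[of _ \<phi>] conjI bij)
  show "proj_morphism base_field (proj_zeros S) (proj_zeros T) \<phi>"
    by (rule base.proj_morphism_descent[OF mor[unfolded sep_closure_eq] pact_proj_zeros[OF _ S] comm])
  show "proj_morphism base_field (proj_zeros T) (proj_zeros S) (inv_into (proj_zeros S) \<phi>)"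
  proof (rule base.proj_morphism_descent[OF mor'[unfolded sep_closure_eq] pact_proj_zeros[OF _ T]])
    fix \<sigma> :: "'k alg_closure \<Rightarrow> 'k alg_closure" and P assume \<sigma>: "\<sigma> \<in> aut_over base_field" and P: "P \<in> proj_zeros T"
    define Q where "Q = inv_into (proj_zeros S) \<phi> P"
    have Q: "Q \<in> proj_zeros S" "\<phi> Q = P"
      using P bij unfolding Q_def by (auto simp: bij_betw_def inv_into_into f_inv_into_f)
    have "pact \<sigma> P = \<phi> (pact \<sigma> Q)" using comm[OF \<sigma> Q(1)] Q(2) by simp
    moreover have "pact \<sigma> Q \<in> proj_zeros S" by (rule pact_proj_zeros[OF \<sigma> S Q(1)])
    ultimately show "inv_into (proj_zeros S) \<phi> (pact \<sigma> P) = pact \<sigma> (inv_into (proj_zeros S) \<phi> P)"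
      using bij_betw_inv_into_left[OF bij] Q_def by metis
  qed
qed

lemma linear_iso:
  fixes F :: "(3, 'K::alg_closed_field) mpoly" and A A' :: "'K ^ 3 ^ 3"
  assumes L: "is_subring L" and A: "\<And>i j. A $ i $ j \<in> L" "\<And>i j. A' $ i $ j \<in> L" and inv: "A ** A' = mat 1" "A' ** A = mat 1"
    and bij: "bij_betw \<phi> Z (proj_zeros {F})" and mor: "proj_morphism L Z (proj_zeros {F}) \<phi>"
    and mor': "proj_morphism L (proj_zeros {F}) Z (inv_into Z \<phi>)"
  shows "bij_betw (\<lambda>P. pmat A' (\<phi> P)) Z (proj_zeros {lin_subst F A})"
    "proj_morphism L Z (proj_zeros {lin_subst F A}) (\<lambda>P. pmat A' (\<phi> P))"
    "proj_morphism L (proj_zeros {lin_subst F A}) Z (inv_into Z (\<lambda>P. pmat A' (\<phi> P)))"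
proof -
  let ?W = "proj_zeros {F}" and ?V = "proj_zeros {lin_subst F A}"
  have i0: "x = 0" if "A *v x = 0" for x
    using that inv(2) by (metis matrix_vector_mul_assoc matrix_vector_mul_lid matrix_vector_mult_0_right)
  have i0': "x = 0" if "A' *v x = 0" for x
    using that inv(1) by (metis matrix_vector_mul_assoc matrix_vector_mul_lid matrix_vector_mult_0_right)
  have W: "pmat A' P \<in> ?V" if P: "P \<in> ?W" for P
  proof (rule proj_zerosE[OF P])
    fix x assume x: "P = pt x" "x \<noteq> 0" "\<forall>f\<in>{F}. mp_eval f x = 0"
    have "A *v (A' *v x) = x" by (simp add: matrix_vector_mul_assoc inv)
    then have "mp_eval (lin_subst F A) (A' *v x) = 0" using x(3) by (simp add: mp_eval_lin_subst)
    moreover have "A' *v x \<noteq> 0" using i0' x(2) by blast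
    ultimately show ?thesis unfolding x(1) pmat_pt proj_zeros_def by blast
  qed
  have V: "pmat A P \<in> ?W" if P: "P \<in> ?V" for P
  proof (rule proj_zerosE[OF P])
    fix x assume x: "P = pt x" "x \<noteq> 0" "\<forall>f\<in>{lin_subst F A}. mp_eval f x = 0"
    then have "mp_eval F (A *v x) = 0" by (simp add: mp_eval_lin_subst)
    moreover have "A *v x \<noteq> 0" using i0 x(2) by blast
    ultimately show ?thesis unfolding x(1) pmat_pt proj_zeros_def by blast
  qed
  have AA: "pmat A (pmat A' P) = P" "pmat A' (pmat A P) = P" for P by (simp_all add: pmat_mult inv pmat_1)
  have bW: "bij_betw (pmat A') ?W ?V"
    by (rule bij_betw_byWitness[of _ "pmat A"]) (use W V AA in auto)
  from bij_betw_trans[OF bij this] show b: "bij_betw (\<lambda>P. pmat A' (\<phi> P)) Z ?V" by (simp add: comp_def)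
  show "proj_morphism L Z ?V (\<lambda>P. pmat A' (\<phi> P))"
    by (rule proj_morphism_comp[OF L mor proj_morphism_pmat[OF L A(2) i0' W]])
  have "proj_morphism L ?V Z (\<lambda>P. inv_into Z \<phi> (pmat A P))"
    by (rule proj_morphism_comp[OF L proj_morphism_pmat[OF L A(1) i0 V] mor'])
  then show "proj_morphism L ?V Z (inv_into Z (\<lambda>P. pmat A' (\<phi> P)))"
  proof (rule proj_morphism_cong)
    fix P assume P: "P \<in> ?V"
    have "inv_into Z \<phi> (pmat A P) \<in> Z" "\<phi> (inv_into Z \<phi> (pmat A P)) = pmat A P"
      using V[OF P] bij by (auto simp: bij_betw_def inv_into_into f_inv_into_f)
    then show "inv_into Z (\<lambda>P. pmat A' (\<phi> P)) P = inv_into Z \<phi> (pmat A P)"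
      using bij_betw_inv_into_left[OF b] AA(2) by metis
  qed
qed


section \<open>Twists of plane curves with diagonal automorphisms\<close>

text \<open>By primality the product of the coordinates does not vanish on the curve. At such a
  point the entries of \<open>dg u v\<close> can be read off from the image
  (\<open>pt_dg_eqD\<close>).\<close>

lemma generic_point:
  fixes F :: "(3, 'K::alg_closed_field) mpoly"
  assumes sm: "smooth_plane_curve k F"
  obtains y :: "'K ^ 3" where "y \<noteq> 0" "mp_eval F y = 0" "\<And>i. y $ i \<noteq> 0"
proof -
  obtain d where d: "d \<ge> 4" "homogeneous d F" using sm by (auto simp: smooth_plane_curve_def)
  interpret plane_curve "mp_eval F" d "\<lambda>i. mp_eval (mp_deriv i F)"
    by (rule smooth_plane_curve_locale[OF sm d(2,1)])
  have f: "form UNIV 1 (\<lambda>x :: 'K ^ 3. x $ i)" for i by (rule formU(9))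
  have nv: "\<not> van (\<lambda>x. x $ i)" for i
  proof
    assume "van (\<lambda>x. x $ i)"
    from nondegenerate[OF f this] have "axis i (1 :: 'K) $ i = 0" using d(1) by simp
    then show False by (simp add: axis_def)
  qed
  have "\<not> van (\<lambda>x. x $ 1 * (x $ 2 * x $ 3))"
  proof
    assume "van (\<lambda>x. x $ 1 * (x $ 2 * x $ 3))"
    then have z: "\<And>x. x \<in> C \<Longrightarrow> x $ 1 * (x $ 2 * x $ 3) = 0" by (simp add: van_def)
    have "van (\<lambda>x. x $ 2 * x $ 3)" by (rule van_prime[OF f form_mult[OF is_subring_UNIV f f] z nv])
    then have z': "\<And>x. x \<in> C \<Longrightarrow> x $ 2 * x $ 3 = 0" by (simp add: van_def)
    have "van (\<lambda>x. x $ 3)" by (rule van_prime[OF f f z' nv])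
    then show False using nv by blast
  qed
  then obtain y :: "'K ^ 3" where y: "y \<in> C" "y $ 1 * (y $ 2 * y $ 3) \<noteq> 0" by (auto simp: van_def)
  then have "y $ i \<noteq> 0" for i using exhaust_3[of i] by auto
  moreover have "y \<noteq> 0" "mp_eval F y = 0" using y(1) by (simp_all add: C_def)
  ultimately show ?thesis by (intro that)
qed

lemma pt_dg_eqD:
  fixes y :: "'a::field ^ 3"
  assumes y: "\<And>i. y $ i \<noteq> 0" and eq: "pt (dg u v *v y) = pt (dg u' v' *v y)"
  shows "u = u' \<and> v = v'"
proof -
  obtain c where c: "dg u v *v y = c *s (dg u' v' *v y)" using eq unfolding pt_eq_iff par_def by blast
  have e: "(dg u v *v y) $ i = c * (dg u' v' *v y) $ i" for i unfolding c by simp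
  show ?thesis using e[of 1] e[of 2] e[of 3] y by (simp add: dg_mult_vec)
qed

lemma monom_at_vector_3:
  "monom_at m (vector [x, y, z]) = x ^ Poly_Mapping.lookup m 1 * (y ^ Poly_Mapping.lookup m 2 * z ^ Poly_Mapping.lookup m (3 :: 3))"
  unfolding monom_at_def UNIV_3 by (simp add: vector_3)

text \<open>The matrix of the automorphism is diagonal up to a scalar because its class lies in the
  given cyclic group. That the substitution multiplies F by a constant is recorded as well: it will
  force all monomials of F to carry the same character.\<close>

lemma galois_twist_automorphism:
  fixes F :: "(3, 'k::field alg_closure) mpoly" and \<zeta> :: "'k alg_closure" and S :: "('m::finite, 'k alg_closure) mpoly set"
  assumes sm: "smooth_plane_curve base_field F"
    and z: "\<zeta> \<in> sep_closure" "\<zeta> ^ n = 1" "n > 0"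
    and gen: "carrier (plane_aut sep_closure F) = generate (PGL3 sep_closure) {pgl_class sep_closure (dg (\<zeta> ^ a) (\<zeta> ^ b))}"
    and S: "\<And>f. f \<in> S \<Longrightarrow> coeffs_in base_field f"
    and bij: "bij_betw \<phi> (proj_zeros S) (proj_zeros {F})"
    and mor: "proj_morphism sep_closure (proj_zeros S) (proj_zeros {F}) \<phi>"
    and mor': "proj_morphism sep_closure (proj_zeros {F}) (proj_zeros S) (inv_into (proj_zeros S) \<phi>)"
    and \<sigma>: "\<sigma> \<in> aut_over base_field"
  obtains u v where "u \<in> sep_closure" "v \<in> sep_closure" "u ^ n = 1" "v ^ n = 1"
    "\<exists>c. lin_subst F (dg u v) = Const c * F"
    "\<And>Q. Q \<in> proj_zeros S \<Longrightarrow> \<phi> (pact \<sigma> Q) = pmat (dg u v) (pact \<sigma> (\<phi> Q))"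
proof -
  let ?Z = "proj_zeros S" and ?W = "proj_zeros {F}"
  let ?s = "inv_into UNIV \<sigma>" and ?\<phi>i = "inv_into (proj_zeros S) \<phi>"
  have L: "is_subfield (sep_closure :: 'k alg_closure set)" by (rule sep_subfield)
  note R = is_subfieldD(1)[OF L]
  have FB: "coeffs_in base_field f" if "f \<in> {F}" for f
    using that sm by (auto simp: smooth_plane_curve_def smooth_curve_def)
  have FL: "coeffs_in sep_closure F" using FB base_subset_sep by (auto simp: coeffs_in_def)
  obtain d where d: "homogeneous d F" using sm by (auto simp: smooth_plane_curve_def)
  have si: "?s \<in> aut_over base_field" by (rule aut_over_inv(1)[OF \<sigma>])
  have Zs: "pact \<tau> P \<in> ?Z" if "\<tau> \<in> aut_over base_field" "P \<in> ?Z" for \<tau> P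
    by (rule pact_proj_zeros[OF that(1) _ that(2)]) (rule S)
  have Ws: "pact \<tau> P \<in> ?W" if "\<tau> \<in> aut_over base_field" "P \<in> ?W" for \<tau> P
    by (rule pact_proj_zeros[OF that(1) _ that(2)]) (rule FB)
  have \<phi>W: "\<phi> Q \<in> ?W" "?\<phi>i (\<phi> Q) = Q" if "Q \<in> ?Z" for Q
    using that bij bij_betw_inv_into_left[OF bij] by (auto simp: bij_betw_def)
  have \<phi>Z: "?\<phi>i P \<in> ?Z" "\<phi> (?\<phi>i P) = P" if "P \<in> ?W" for P
    using that bij by (auto simp: bij_betw_def inv_into_into f_inv_into_f)
  \<comment> \<open>This is \<phi> composed with the inverse of its conjugate by \<sigma>;
    \<open>\<theta>'\<close> is the inverse map.\<close>
  define \<theta> where "\<theta> = (\<lambda>P. \<phi> (pact \<sigma> (?\<phi>i (pact ?s P))))"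
  define \<theta>' where "\<theta>' = (\<lambda>P. pact \<sigma> (\<phi> (pact ?s (?\<phi>i P))))"
  have tW: "\<theta> P \<in> ?W" "\<theta>' P \<in> ?W" if P: "P \<in> ?W" for P
    unfolding \<theta>_def \<theta>'_def
    using \<phi>W(1)[OF Zs[OF \<sigma> \<phi>Z(1)[OF Ws[OF si P]]]] Ws[OF \<sigma> \<phi>W(1)[OF Zs[OF si \<phi>Z(1)[OF P]]]] by blast+
  have tt: "\<theta>' (\<theta> P) = P" if P: "P \<in> ?W" for P
    unfolding \<theta>_def \<theta>'_def \<phi>W(2)[OF Zs[OF \<sigma> \<phi>Z(1)[OF Ws[OF si P]]]] pact_inv(2)[OF \<sigma>] \<phi>Z(2)[OF Ws[OF si P]] pact_inv(1)[OF \<sigma>] ..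
  have tt': "\<theta> (\<theta>' P) = P" if P: "P \<in> ?W" for P
    unfolding \<theta>_def \<theta>'_def pact_inv(2)[OF \<sigma>] \<phi>W(2)[OF Zs[OF si \<phi>Z(1)[OF P]]] pact_inv(1)[OF \<sigma>] \<phi>Z(2)[OF P] ..
  have tb: "bij_betw \<theta> ?W ?W" by (rule bij_betw_byWitness[of _ \<theta>']) (use tW tt tt' in auto)
  have tm: "proj_morphism sep_closure ?W ?W \<theta>"
    unfolding \<theta>_def
    by (rule proj_morphism_comp[OF R proj_morphism_conj[OF \<sigma> sep_conj[OF _ \<sigma>] Ws[OF si] Zs[OF \<sigma>] mor'] mor])
  have "proj_morphism sep_closure ?W ?W \<theta>'"
    unfolding \<theta>'_def
    by (rule proj_morphism_comp[OF R mor' proj_morphism_conj[OF \<sigma> sep_conj[OF _ \<sigma>] Zs[OF si] Ws[OF \<sigma>] mor]])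
  then have tm': "proj_morphism sep_closure ?W ?W (inv_into ?W \<theta>)"
  proof (rule proj_morphism_cong)
    fix P assume P: "P \<in> ?W"
    show "inv_into ?W \<theta> P = \<theta>' P" using bij_betw_inv_into_left[OF tb tW(2)[OF P]] tt'[OF P] by simp
  qed
  obtain M :: "'k alg_closure ^ 3 ^ 3" where M: "\<And>i j. M $ i $ j \<in> sep_closure" "det M \<noteq> 0" "\<exists>c. c \<noteq> 0 \<and> lin_subst F M = Const c * F"
    "\<And>y. y \<noteq> 0 \<Longrightarrow> mp_eval F y = 0 \<Longrightarrow> \<theta> (pt y) = pt (M *v y)"
    by (rule automorphism_linear[OF sm L FL tb tm tm']) (rule that)
  have MG: "M \<in> carrier (GL3 sep_closure)" using M(1,2) by (simp add: GL3_def)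
  have "pgl_class sep_closure M \<in> carrier (plane_aut sep_closure F)"
    using pgl_class_carrier[OF L MG] pgl_class_self[OF L, of M] M(3) by (auto simp: plane_aut_def)
  then obtain u v where uv: "pgl_class sep_closure M = pgl_class sep_closure (dg u v)" "u \<in> sep_closure" "v \<in> sep_closure" "u ^ n = 1" "v ^ n = 1"
    unfolding gen by (rule generate_dg[OF L z])
  obtain s where s: "s \<noteq> 0" "M = mat s ** dg u v" using pgl_class_eqD[OF L uv(1)] by blast
  show ?thesis
  proof (rule that[OF uv(2-5)])
    obtain c where c: "lin_subst F M = Const c * F" using M(3) by blast
    have "dg u v = mat (inverse s) ** M" unfolding s(2) using s(1) by (simp add: matrix_mul_assoc mat_mult_mat)
    then have "lin_subst F (dg u v) = lin_subst (Const (inverse s ^ d) * F) M"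
      by (simp only: lin_subst_mult lin_subst_mat[OF d])
    also have "\<dots> = Const (inverse s ^ d) * lin_subst F M" by (rule mp_eval_inj) (simp add: mp_eval_lin_subst)
    also have "\<dots> = Const (inverse s ^ d * c) * F" unfolding c by (rule mp_eval_inj) simp
    finally show "\<exists>c. lin_subst F (dg u v) = Const c * F" by blast
  next
    fix Q assume Q: "Q \<in> ?Z"
    have P: "pact \<sigma> (\<phi> Q) \<in> ?W" by (rule Ws[OF \<sigma> \<phi>W(1)[OF Q]])
    then obtain y where y: "pact \<sigma> (\<phi> Q) = pt y" "y \<noteq> 0" "\<forall>f\<in>{F}. mp_eval f y = 0" by (rule proj_zerosE)
    have "\<phi> (pact \<sigma> Q) = \<theta> (pact \<sigma> (\<phi> Q))" unfolding \<theta>_def pact_inv(2)[OF \<sigma>] \<phi>W(2)[OF Q] ..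
    also have "\<dots> = pmat M (pt y)" using M(4) y by (simp add: pmat_pt)
    also have "\<dots> = pmat (dg u v) (pact \<sigma> (\<phi> Q))" unfolding s(2) pmat_scalar[OF s(1)] y(1) ..
    finally show "\<phi> (pact \<sigma> Q) = pmat (dg u v) (pact \<sigma> (\<phi> Q))" .
  qed
qed

theorem diagonal_twist:
  fixes F :: "(3, 'k::field alg_closure) mpoly" and \<zeta> :: "'k alg_closure" and S :: "('m::finite, 'k alg_closure) mpoly set"
  assumes sm: "smooth_plane_curve base_field F"
    and n: "CHAR('k) = 0 \<or> coprime n CHAR('k)" "n > 0"
    and z: "\<zeta> \<in> sep_closure" "\<zeta> ^ n = 1"
    and gen: "carrier (plane_aut sep_closure F) = generate (PGL3 sep_closure) {pgl_class sep_closure (dg (\<zeta> ^ a) (\<zeta> ^ b))}"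
    and tw: "is_twist base_field sep_closure S {F}"
  shows "\<exists>D\<in>carrier (PGL3 sep_closure). \<exists>A\<in>D. is_diagonal A \<and> coeffs_in base_field (lin_subst F A) \<and>
    isomorphic_over base_field S {lin_subst F A}"
proof -
  let ?\<Gamma> = "aut_over base_field :: ('k alg_closure \<Rightarrow> 'k alg_closure) set"
  let ?Z = "proj_zeros S" and ?W = "proj_zeros {F}"
  have L: "is_subfield (sep_closure :: 'k alg_closure set)" by (rule sep_subfield)
  note R = is_subfieldD(1)[OF L]
  have S: "\<And>f. f \<in> S \<Longrightarrow> coeffs_in base_field f" using tw by (auto simp: is_twist_def smooth_curve_def)
  have FB: "coeffs_in base_field F" using sm by (auto simp: smooth_plane_curve_def smooth_curve_def)
  obtain \<phi> where bij: "bij_betw \<phi> ?Z ?W" and mor: "proj_morphism sep_closure ?Z ?W \<phi>"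
    and mor': "proj_morphism sep_closure ?W ?Z (inv_into ?Z \<phi>)"
    using tw by (auto simp: is_twist_def isomorphic_over_def)
  obtain d where d: "d \<ge> 4" "homogeneous d F" using sm by (auto simp: smooth_plane_curve_def)
  interpret plane_curve "mp_eval F" d "\<lambda>i. mp_eval (mp_deriv i F)"
    by (rule smooth_plane_curve_locale[OF sm d(2,1)])
  have "\<exists>w. fst w \<in> sep_closure \<and> snd w \<in> sep_closure \<and> fst w ^ n = 1 \<and> snd w ^ n = 1 \<and>
      (\<exists>c. lin_subst F (dg (fst w) (snd w)) = Const c * F) \<and>
      (\<forall>Q\<in>?Z. \<phi> (pact \<sigma> Q) = pmat (dg (fst w) (snd w)) (pact \<sigma> (\<phi> Q)))" if \<sigma>: "\<sigma> \<in> ?\<Gamma>" for \<sigma>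
  proof -
    obtain u v where "u \<in> sep_closure" "v \<in> sep_closure" "u ^ n = 1" "v ^ n = 1"
      "\<exists>c. lin_subst F (dg u v) = Const c * F"
      "\<And>Q. Q \<in> ?Z \<Longrightarrow> \<phi> (pact \<sigma> Q) = pmat (dg u v) (pact \<sigma> (\<phi> Q))"
      by (rule galois_twist_automorphism[OF sm z n(2) gen S bij mor mor' \<sigma>]) (assumption, rule that)
    then show ?thesis by (intro exI[of _ "(u, v)"]) simp
  qed
  then obtain w where w: "\<And>\<sigma>. \<sigma> \<in> ?\<Gamma> \<Longrightarrow> fst (w \<sigma>) \<in> sep_closure \<and> snd (w \<sigma>) \<in> sep_closure \<and> fst (w \<sigma>) ^ n = 1 \<and> snd (w \<sigma>) ^ n = 1 \<and>
      (\<exists>c. lin_subst F (dg (fst (w \<sigma>)) (snd (w \<sigma>))) = Const c * F) \<and>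
      (\<forall>Q\<in>?Z. \<phi> (pact \<sigma> Q) = pmat (dg (fst (w \<sigma>)) (snd (w \<sigma>))) (pact \<sigma> (\<phi> Q)))" by metis
  define u v where "u = (\<lambda>\<sigma>. fst (w \<sigma>))" and "v = (\<lambda>\<sigma>. snd (w \<sigma>))"
  have uv: "u \<sigma> \<in> sep_closure" "v \<sigma> \<in> sep_closure" "u \<sigma> ^ n = 1" "v \<sigma> ^ n = 1"
    and uvF: "\<exists>c. lin_subst F (dg (u \<sigma>) (v \<sigma>)) = Const c * F"
    and K: "\<And>Q. Q \<in> ?Z \<Longrightarrow> \<phi> (pact \<sigma> Q) = pmat (dg (u \<sigma>) (v \<sigma>)) (pact \<sigma> (\<phi> Q))"
    if "\<sigma> \<in> ?\<Gamma>" for \<sigma> using w[OF that] by (simp_all add: u_def v_def)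
  have uv0: "u \<sigma> \<noteq> 0" "v \<sigma> \<noteq> 0" if "\<sigma> \<in> ?\<Gamma>" for \<sigma> using uv(3,4)[OF that] n(2) by (auto simp: power_0_left)

  have Zs: "pact \<tau> P \<in> ?Z" if "\<tau> \<in> ?\<Gamma>" "P \<in> ?Z" for \<tau> P
    by (rule pact_proj_zeros[OF that(1) _ that(2)]) (rule S)
  \<comment> \<open>The image of a point with nonzero coordinates determines \<open>u\<close> and
    \<open>v\<close>, so the cocycle relations and continuity can be read off at its single preimage
    \<open>Q0\<close>.\<close>
  obtain y0 :: "'k alg_closure ^ 3" where y0: "y0 \<noteq> 0" "mp_eval F y0 = 0" "\<And>i. y0 $ i \<noteq> 0"
    by (rule generic_point[OF sm]) (rule that)
  define Q0 where "Q0 = inv_into ?Z \<phi> (pt y0)"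
  have "pt y0 \<in> ?W" using y0(1,2) by (auto simp: proj_zeros_def)
  then have Q0: "Q0 \<in> ?Z" "\<phi> Q0 = pt y0"
    using bij unfolding Q0_def by (auto simp: bij_betw_def inv_into_into f_inv_into_f)

  have coc: "u (\<lambda>x. \<sigma> (\<tau> x)) = u \<sigma> * \<sigma> (u \<tau>) \<and> v (\<lambda>x. \<sigma> (\<tau> x)) = v \<sigma> * \<sigma> (v \<tau>)"
    if s: "\<sigma> \<in> ?\<Gamma>" and t: "\<tau> \<in> ?\<Gamma>" for \<sigma> \<tau>
  proof -
    let ?st = "\<lambda>x. \<sigma> (\<tau> x)"
    note st = aut_over_comp[OF s t]
    define y where "y = vact ?st y0"
    have y: "y $ i \<noteq> 0" for i using y0(3) by (simp add: y_def aut_overD(10)[OF s] aut_overD(10)[OF t])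
    have py: "pact \<sigma> (pact \<tau> (\<phi> Q0)) = pt y"
      unfolding pact_comp[symmetric] Q0(2) pact_pt[OF st] y_def ..
    have "pt (dg (u ?st) (v ?st) *v y) = \<phi> (pact \<sigma> (pact \<tau> Q0))"
      using K[OF st Q0(1)] unfolding pact_comp py pmat_pt by simp
    also have "\<dots> = pmat (dg (u \<sigma>) (v \<sigma>)) (pact \<sigma> (pmat (dg (u \<tau>) (v \<tau>)) (pact \<tau> (\<phi> Q0))))"
      unfolding K[OF s Zs[OF t Q0(1)]] K[OF t Q0(1)] ..
    also have "\<dots> = pt (dg (u \<sigma> * \<sigma> (u \<tau>)) (v \<sigma> * \<sigma> (v \<tau>)) *v y)"
      unfolding pact_pmat[OF s] py mact_dg[OF s] pmat_pt matrix_vector_mul_assoc dg_mult ..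
    finally show ?thesis by (rule pt_dg_eqD[OF y])
  qed

  obtain T where T: "finite T" "\<And>x. x \<in> T \<Longrightarrow> x \<in> sep_closure"
    "\<And>\<sigma>. \<sigma> \<in> ?\<Gamma> \<Longrightarrow> \<forall>x\<in>T. \<sigma> x = x \<Longrightarrow> u \<sigma> = 1 \<and> v \<sigma> = 1"
  proof -
    obtain x where x: "Q0 = pt x" "x \<noteq> 0" using Q0(1) by (rule proj_zerosE) (rule that)
    have xZ: "pt x \<in> ?Z" using Q0(1) x(1) by simp
    obtain g :: "3 \<Rightarrow> ('m, 'k alg_closure) mpoly" and e where g: "\<And>j. homogeneous e (g j)" "\<And>j. coeffs_in sep_closure (g j)"
      "tuple (\<lambda>j. mp_eval (g j)) x \<noteq> 0"
      "\<And>y. y \<noteq> 0 \<Longrightarrow> pt y \<in> ?Z \<Longrightarrow> tuple (\<lambda>j. mp_eval (g j)) y \<noteq> 0 \<Longrightarrow> \<phi> (pt y) = pt (tuple (\<lambda>j. mp_eval (g j)) y)"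
      by (rule proj_morphism_rep[OF mor x(2) xZ]) (rule that)
    let ?g = "tuple (\<lambda>j. mp_eval (g j))"
    \<comment> \<open>Continuity: an automorphism fixing the coefficients of one local description
      of \<phi> near \<open>Q0\<close> commutes with \<phi> at \<open>Q0\<close>, which forces its
      \<open>u\<close> and \<open>v\<close> to be 1.\<close>
    define T where "T = (\<Union>j. Poly_Mapping.lookup (g j) ` Poly_Mapping.keys (g j))"
    have "u \<sigma> = 1 \<and> v \<sigma> = 1" if s: "\<sigma> \<in> ?\<Gamma>" and fixed: "\<forall>x\<in>T. \<sigma> x = x" for \<sigma>
    proof -
      have "map_coeffs \<sigma> (g j) = g j" for j
      proof (rule map_coeffs_fixed)
        show "\<sigma> (Poly_Mapping.lookup (g j) m) = Poly_Mapping.lookup (g j) m" for m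
        proof (cases "m \<in> Poly_Mapping.keys (g j)")
          case True
          then have "Poly_Mapping.lookup (g j) m \<in> T" unfolding T_def by blast
          then show ?thesis using fixed by blast
        next
          case False
          then show ?thesis using aut_overD(5)[OF s] by (simp add: in_keys_iff)
        qed
      qed (rule aut_overD(5)[OF s])
      then have gs: "?g (vact \<sigma> x) = vact \<sigma> (?g x)"
        using mp_eval_map_coeffs[OF s, of "g _" x] by (simp add: vec_eq_iff)
      have y1: "pact \<sigma> (\<phi> Q0) = pt (vact \<sigma> (?g x))"
        unfolding x(1) g(4)[OF x(2) xZ g(3)] pact_pt[OF s] ..
      have "pt (vact \<sigma> x) \<in> ?Z" using Zs[OF s xZ] unfolding pact_pt[OF s] .
      moreover have "vact \<sigma> x \<noteq> 0" "vact \<sigma> (?g x) \<noteq> 0" using x(2) g(3) vact_eq_0[OF s] by blast+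
      ultimately have "\<phi> (pact \<sigma> Q0) = pt (vact \<sigma> (?g x))"
        using g(4)[of "vact \<sigma> x"] unfolding x(1) pact_pt[OF s] gs by blast
      then have "pmat (dg (u \<sigma>) (v \<sigma>)) (pact \<sigma> (\<phi> Q0)) = pact \<sigma> (\<phi> Q0)" unfolding K[OF s Q0(1)] y1 .
      then have "pt (dg (u \<sigma>) (v \<sigma>) *v vact \<sigma> y0) = pt (dg 1 1 *v vact \<sigma> y0)"
        unfolding Q0(2) pact_pt[OF s] pmat_pt dg_1 by simp
      then show ?thesis by (rule pt_dg_eqD[rotated]) (use y0(3) in \<open>simp add: aut_overD(10)[OF s]\<close>)
    qed
    moreover have "x \<in> sep_closure" if "x \<in> T" for x using that g(2) by (auto simp: T_def coeffs_in_def)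
    moreover have "finite T" by (simp add: T_def)
    ultimately show thesis using that[of T] by blast
  qed
  have Tsep: "x \<in> T \<Longrightarrow> base.separable x" for x using T(2) unfolding sep_closure_eq by blast
  obtain b1 where b1: "b1 \<noteq> 0" "base.separable b1" "\<And>\<sigma>. \<sigma> \<in> ?\<Gamma> \<Longrightarrow> \<sigma> b1 = u \<sigma> * b1"
    by (rule base.hilbert90[OF T(1) Tsep, of u]) (use coc T(3) uv(1) uv0(1) in \<open>auto simp: sep_closure_eq\<close>)
  obtain b2 where b2: "b2 \<noteq> 0" "base.separable b2" "\<And>\<sigma>. \<sigma> \<in> ?\<Gamma> \<Longrightarrow> \<sigma> b2 = v \<sigma> * b2"
    by (rule base.hilbert90[OF T(1) Tsep, of v]) (use coc T(3) uv(2) uv0(2) in \<open>auto simp: sep_closure_eq\<close>)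
  have bs: "b1 \<in> sep_closure" "b2 \<in> sep_closure" using b1(2) b2(2) by (simp_all add: sep_closure_eq)

  \<comment> \<open>\<open>\<beta> m\<close> is the value of the monomial \<open>m\<close> at (1,
    b1, b2), and \<open>\<chi>' \<sigma> m\<close> is the factor by which \<sigma> changes it. The
    factor is the same for all monomials of F, so their quotients
    \<open>\<beta> m0 / \<beta> m\<close> are rational.\<close>
  define \<beta> where "\<beta> = (\<lambda>m :: 3 \<Rightarrow>\<^sub>0 nat. b1 ^ Poly_Mapping.lookup m 2 * b2 ^ Poly_Mapping.lookup m 3)"
  define \<chi>' where "\<chi>' = (\<lambda>\<sigma> (m :: 3 \<Rightarrow>\<^sub>0 nat). u \<sigma> ^ Poly_Mapping.lookup m 2 * v \<sigma> ^ Poly_Mapping.lookup m 3)"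
  have \<beta>: "\<beta> m \<in> sep_closure" "\<beta> m \<noteq> 0" for m
    using is_subringD(4)[OF R is_subring_power[OF R bs(1)] is_subring_power[OF R bs(2)]] b1(1) b2(1) by (auto simp: \<beta>_def)
  have \<sigma>\<beta>: "\<sigma> (\<beta> m) = \<chi>' \<sigma> m * \<beta> m" if s: "\<sigma> \<in> ?\<Gamma>" for \<sigma> m
    by (simp add: \<beta>_def \<chi>'_def aut_overD(3,11)[OF s] b1(3)[OF s] b2(3)[OF s] power_mult_distrib mult_ac)
  have \<chi>0: "\<chi>' \<sigma> m \<noteq> 0" if s: "\<sigma> \<in> ?\<Gamma>" for \<sigma> m using uv0[OF s] by (simp add: \<chi>'_def)
  have \<chi>n: "\<chi>' \<sigma> m ^ n = 1" if s: "\<sigma> \<in> ?\<Gamma>" for \<sigma> m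
  proof -
    have "\<chi>' \<sigma> m ^ n = (u \<sigma> ^ n) ^ Poly_Mapping.lookup m 2 * (v \<sigma> ^ n) ^ Poly_Mapping.lookup m 3"
      by (simp add: \<chi>'_def power_mult_distrib power_mult[symmetric] mult.commute)
    then show ?thesis using uv(3,4)[OF s] by simp
  qed
  have \<chi>eq: "\<chi>' \<sigma> m = \<chi>' \<sigma> m'" if s: "\<sigma> \<in> ?\<Gamma>" and m: "m \<in> Poly_Mapping.keys F" "m' \<in> Poly_Mapping.keys F" for \<sigma> m m'
  proof -
    obtain c where c: "lin_subst F (dg (u \<sigma>) (v \<sigma>)) = Const c * F" using uvF[OF s] by blast
    have "\<chi>' \<sigma> m = c" if "m \<in> Poly_Mapping.keys F" for m
    proof -
      have "Poly_Mapping.lookup F m * \<chi>' \<sigma> m = c * Poly_Mapping.lookup F m"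
        using arg_cong[OF c, of "\<lambda>p. Poly_Mapping.lookup p m"]
        unfolding dg_def lookup_lin_subst_diag lookup_Const_mult monom_at_vector_3 \<chi>'_def power_one mult_1_left .
      then show ?thesis using that by (simp add: in_keys_iff)
    qed
    then show ?thesis using m by simp
  qed
  obtain m0 where m0: "m0 \<in> Poly_Mapping.keys F"
  proof -
    obtain P where "mp_eval F P \<noteq> 0" using good_point by blast
    then have "Poly_Mapping.keys F \<noteq> {}" by (auto simp: mp_eval_eq)
    then show ?thesis using that by blast
  qed
  \<comment> \<open>The factors are n-th roots of unity, hence the n-th power is invariant, as
    \<open>root_up_to_base\<close> requires.\<close>
  have \<gamma>n: "\<beta> m0 ^ n \<in> base_field"
    by (rule sep_fixed_in_base[OF is_subring_power[OF R \<beta>(1)]])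
      (simp add: aut_overD(11)[of _ base_field] \<sigma>\<beta> power_mult_distrib \<chi>n)
  obtain t r where t: "t \<in> sep_closure" "t \<noteq> 0" "r \<in> base_field" "t ^ d = \<beta> m0 * r"
    by (rule root_up_to_base[OF \<beta> \<gamma>n n, of d]) (use d(1) in \<open>auto intro: that\<close>)

  \<comment> \<open>Substituting \<open>A\<close> multiplies the coefficient at \<open>m\<close> by
    \<open>t ^ d / \<beta> m\<close>, that is, by the rational element
    \<open>r * \<beta> m0 / \<beta> m\<close>.\<close>
  define A where "A = diag (vector [t, t * inverse b1, t * inverse b2] :: 'k alg_closure ^ 3)"
  define A' where "A' = mat (inverse t) ** dg b1 b2"
  have A: "A = mat t ** dg (inverse b1) (inverse b2)"
    by (simp add: vec_eq_iff mat_mult_nth) (simp add: A_def diag_def dg_nth forall_3 vector_3)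
  have ib: "inverse b1 \<in> sep_closure" "inverse b2 \<in> sep_closure" "inverse t \<in> sep_closure"
    using is_subfieldD(2)[OF L] bs t(1) by blast+
  note R' = is_subringD[OF R]
  have AL: "A $ i $ j \<in> sep_closure" "A' $ i $ j \<in> sep_closure" for i j
  proof -
    have dL: "dg x y $ i $ j \<in> sep_closure" if "x \<in> sep_closure" "y \<in> sep_closure" for x y :: "'k alg_closure"
      using that R'(1,2) by (simp add: dg_nth)
    show "A $ i $ j \<in> sep_closure" unfolding A mat_mult_nth by (rule R'(4)[OF t(1) dL[OF ib(1,2)]])
    show "A' $ i $ j \<in> sep_closure" unfolding A'_def mat_mult_nth by (rule R'(4)[OF ib(3) dL[OF bs]])
  qed
  have inv: "A ** A' = mat 1" "A' ** A = mat 1"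
  proof -
    let ?E = "dg (inverse b1) (inverse b2)"
    have "A ** A' = mat t ** (?E ** mat (inverse t)) ** dg b1 b2"
      unfolding A A'_def by (simp only: matrix_mul_assoc)
    also have "\<dots> = (mat t ** mat (inverse t)) ** (?E ** dg b1 b2)"
      unfolding mat_central[of _ ?E, symmetric] by (simp only: matrix_mul_assoc)
    also have "\<dots> = mat 1" using t(2) b1(1) b2(1) by (simp add: mat_mult_mat dg_mult dg_1)
    finally show "A ** A' = mat 1" .
    then show "A' ** A = mat 1" by (rule matrix_left_right_inverse1)
  qed
  have coeffs: "coeffs_in base_field (lin_subst F A)"
    unfolding coeffs_in_def
  proof
    fix m
    note BR = is_subringD[OF is_subfieldD(1)[OF base.E]]
    show "Poly_Mapping.lookup (lin_subst F A) m \<in> base_field"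
    proof (cases "m \<in> Poly_Mapping.keys F")
      case False
      then show ?thesis using BR(1) by (simp add: A_def lookup_lin_subst_diag in_keys_iff)
    next
      case True
      have "(\<Sum>i\<in>UNIV. Poly_Mapping.lookup m i) = d" using d(2) True by (auto simp: homogeneous_def)
      then have dm: "Poly_Mapping.lookup m 1 + (Poly_Mapping.lookup m 2 + Poly_Mapping.lookup m 3) = d"
        by (simp add: sum_3 add.assoc)
      have "monom_at m (vector [t, t * inverse b1, t * inverse b2]) = t ^ d * inverse (\<beta> m)"
        unfolding monom_at_vector_3 dm[symmetric] by (simp add: \<beta>_def power_mult_distrib power_add power_inverse mult_ac)
      also have "\<dots> = r * (\<beta> m0 * inverse (\<beta> m))" unfolding t(4) by (simp add: mult_ac)
      finally have lk: "Poly_Mapping.lookup (lin_subst F A) m = Poly_Mapping.lookup F m * (r * (\<beta> m0 * inverse (\<beta> m)))"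
        by (simp add: A_def lookup_lin_subst_diag)
      have q: "\<beta> m0 * inverse (\<beta> m) \<in> base_field"
      proof (rule sep_fixed_in_base)
        show "\<beta> m0 * inverse (\<beta> m) \<in> sep_closure" by (intro R'(4) is_subfieldD(2)[OF L] \<beta>)
        fix \<sigma> assume s: "\<sigma> \<in> ?\<Gamma>"
        show "\<sigma> (\<beta> m0 * inverse (\<beta> m)) = \<beta> m0 * inverse (\<beta> m)"
          using \<chi>0[OF s, of m] by (simp add: aut_overD(3,9)[OF s] \<sigma>\<beta>[OF s] \<chi>eq[OF s m0 True])
      qed
      have "Poly_Mapping.lookup F m \<in> base_field" using FB by (simp add: coeffs_in_def)
      then show ?thesis unfolding lk by (rule BR(4)[OF _ BR(4)[OF t(3) q]])
    qed
  qed
  note iso = linear_iso[OF R AL inv bij mor mor']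
  have "isomorphic_over base_field S {lin_subst F A}"
  proof (rule isomorphic_over_descent[OF S _ iso])
    show "coeffs_in base_field f" if "f \<in> {lin_subst F A}" for f using that coeffs by simp
    fix \<sigma> :: "'k alg_closure \<Rightarrow> 'k alg_closure" and Q assume s: "\<sigma> \<in> ?\<Gamma>" and Q: "Q \<in> ?Z"
    have "pact \<sigma> (\<phi> Q) \<in> ?W"
      by (rule pact_proj_zeros[OF s]) (use FB Q bij in \<open>auto simp: bij_betw_def\<close>)
    then obtain y where y: "pact \<sigma> (\<phi> Q) = pt y" by (rule proj_zerosE)
    let ?D = "dg (u \<sigma> * b1) (v \<sigma> * b2)"
    \<comment> \<open>The entries \<open>u \<sigma>\<close> and \<open>v \<sigma>\<close> are
      absorbed through \<open>\<sigma> b1 = u \<sigma> * b1\<close> and its analogue for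
      \<open>b2\<close>; the scalar \<open>t\<close>, which \<sigma> may move, does not affect
      points.\<close>
    have "pmat A' (\<phi> (pact \<sigma> Q)) = pmat (mat (inverse t) ** ?D) (pt y)"
      unfolding K[OF s Q] y pmat_mult A'_def matrix_mul_assoc[symmetric] dg_mult by (simp add: mult.commute)
    also have "\<dots> = pmat (mat (inverse (\<sigma> t)) ** ?D) (pt y)"
      using t(2) aut_overD(10)[OF s] by (simp add: pmat_scalar)
    also have "mat (inverse (\<sigma> t)) ** ?D = mact \<sigma> A'"
      unfolding A'_def mact_mult[OF s] mact_mat[OF s] mact_dg[OF s] aut_overD(9)[OF s] b1(3)[OF s] b2(3)[OF s] ..
    finally show "pmat A' (\<phi> (pact \<sigma> Q)) = pact \<sigma> (pmat A' (\<phi> Q))" unfolding pact_pmat[OF s] y .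
  qed assumption
  moreover have "is_diagonal A" by (simp add: A_def diag_def is_diagonal_def)
  moreover have "det A \<noteq> 0" using inv(1) det_mul[of A A'] by auto
  then have "A \<in> carrier (GL3 sep_closure)" using AL(1) by (simp add: GL3_def)
  ultimately show ?thesis
    using coeffs pgl_class_carrier[OF L] pgl_class_self[OF L, of A] by blast
qed

theorem mainTheorem13:
  fixes F :: "(3, 'k::field alg_closure) mpoly"
    and \<zeta> :: "'k alg_closure" and n a b :: nat
  assumes "smooth_plane_curve base_field F"
    and "n > 1"
    and "CHAR('k) = 0 \<or> coprime n CHAR('k)"
    and "\<zeta> \<in> sep_closure" and "\<zeta> ^ n = 1" and "\<forall>m. 0 < m \<and> m < n \<longrightarrow> \<zeta> ^ m \<noteq> 1"
    and "Coset.order (plane_aut sep_closure F) = n"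
    and "carrier (plane_aut sep_closure F) =
           generate (PGL3 sep_closure) {pgl_class sep_closure (diag (vector [1, \<zeta> ^ a, \<zeta> ^ b]))}"
  shows "(\<forall>S :: ('m::finite, 'k alg_closure) mpoly set.
            is_twist base_field sep_closure S {F} \<longrightarrow>
            (\<exists>D \<in> carrier (PGL3 sep_closure). \<exists>A\<in>D. is_diagonal A \<and>
               coeffs_in base_field (lin_subst F A) \<and>
               isomorphic_over base_field S {lin_subst F A}))
       \<and> (\<forall>c \<in> H1 gal_sep gal_sep_top pgl_act (plane_aut sep_closure F).
            Sigma_map c = H1_trivial gal_sep gal_sep_top pgl_act (PGL3 sep_closure))"
proof -
  have n: "n > 0" using assms(2) by simp
  note gen = assms(8)[folded dg_def]
  show ?thesis
    using diagonal_twist[OF assms(1,3) n assms(4,5) gen] Sigma_map_trivial[OF assms(4,5) n gen] by blast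
qed

end
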